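(* Let $\mathcal{S}$ be a regular category. (i) The class of Dugger--Isaksen weak equivalences has the 2-out-of-3 property and is closed under retracts in $\mathbf{Kan}(\mathcal{S})$. (ii) An internal Kan fibration of internal Kan complexes in $\mathcal{S}$ is an internal trivial Kan fibration if and only if it is also a Dugger--Isaksen weak equivalence. (iii) $\mathbf{Kan}(\mathcal{S})$ is a category of fibrant objects in the sense of Brown, where the fibrations are the internal Kan fibrations and the weak equivalences are the Dugger--Isaksen weak equivalences.
   Context: Notation: $\mathbf{s}\mathcal{S}$ is the category of simplicial objects in $\mathcal{S}$. For a finite simplicial set $Z$ and $X$ in $\mathbf{s}\mathcal{S}$, the weighted limit $\{Z,X\}$ is the object of $\mathcal{S}$ (it exists, being a finite limit) equipped with bijections $\mathrm{Hom}_{\mathbf{sSet}}(Z,\mathrm{Hom}_{\mathcal{S}}(T,X))\cong \mathrm{Hom}_{\mathcal{S}}(T,\{Z,X\})$ natural in $T$, where $\mathrm{Hom}_{\mathcal{S}}(T,X)$ is the simplicial set $n\mapsto \mathrm{Hom}_{\mathcal{S}}(T,X_n)$. It is contravariant in $Z$ and covariant in $X$, and $\{\Delta^n,X\}\cong X_n$. A morphism $p:X\to Y$ in $\mathbf{s}\mathcal{S}$ is an internal Kan fibration (resp. internal trivial Kan fibration) if for every horn inclusion $i:\Lambda^n_k\hookrightarrow\Delta^n$ (resp. every boundary inclusion $i:\partial\Delta^n\hookrightarrow\Delta^n$), written $i:Z\to W$, the comparison morphism $\{W,X\}\to\{Z,X\}\times_{\{Z,Y\}}\{W,Y\}$ is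 a regular epimorphism in $\mathcal{S}$. An internal Kan complex is an object $X$ of $\mathbf{s}\mathcal{S}$ such that $X\to 1$ is an internal Kan fibration; $\mathbf{Kan}(\mathcal{S})$ is the full subcategory of $\mathbf{s}\mathcal{S}$ spanned by the internal Kan complexes. Let $D^{n+1}$ be the simplicial set defined as the pushout of the inclusion $\partial\Delta^n\times\Delta^1\hookrightarrow\Delta^n\times\Delta^1$ along the projection $\partial\Delta^n\times\Delta^1\to\partial\Delta^n$, with $q:\Delta^n\times\Delta^1\to D^{n+1}$ the canonical map, and let $j_0,j_1:\Delta^n\to D^{n+1}$ be the composites with $q$ of the two maps $\Delta^n\to\Delta^n\times\Delta^1$ induced by the two vertex inclusions $\Delta^0\to\Delta^1$. A Dugger--Isaksen weak equivalence is a morphism $f:X\to Y$ in $\mathbf{Kan}(\mathcal{S})$ such that for all $n\ge 0$ the morphism $$\{\Delta^n,X\}\times_{\{\Delta^n,Y\}}\{D^{n+1},Y\}\longrightarrow\{\partial\Delta^n,X\}\times_{\{\partial\Delta^n,Y\}}\{\Delta^n,Y\}$$ is a regular epimorphism in $\mathcal{S}$, where the domain is the pullback of $\{\Delta^n,f\}$ and $\{j_1,Y\}$, the codomain is the pullback of $\{\partial\Delta^n,f\}$ and the restriction $\{\Delta^n,Y\}\to\{\partial\Delta^n,Y\}$, and the morphism is induced by the restriction $\{\Delta^n,X\}\to\{\partial\Delta^n,X\}$ and by $\{j_0,Y\}:\{D^{n+1},Y\}\to\{\Delta^n,Y\}$. A category of fibrant objects (Brown) is a category with finite products and two distinguished classes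 of morphisms, weak equivalences and fibrations (a trivial fibration being a morphism in both classes), such that: isomorphisms are weak equivalences and weak equivalences satisfy 2-out-of-3; isomorphisms are fibrations and fibrations are closed under composition; pullbacks of fibrations along arbitrary morphisms exist and are fibrations, and pullbacks of trivial fibrations are trivial fibrations; for every object $B$ the diagonal $B\to B\times B$ factors as a weak equivalence followed by a fibration; and for every object $B$ the morphism $B\to 1$ is a fibration. *)

theory Defs
  imports Main "HOL-Library.FuncSet"
begin

section \<open>Categories, limits and regular categories\<close>

record ('o, 'm) cat =
  Obj :: "'o set"
  Arr :: "'m set"
  Dom :: "'m \<Rightarrow> 'o"
  Cod :: "'m \<Rightarrow> 'o"
  Ident :: "'o \<Rightarrow> 'm"
  Comp :: "'m \<Rightarrow> 'm \<Rightarrow> 'm" (infixr "\<cdot>\<index>" 65)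

definition hom :: "('o, 'm) cat \<Rightarrow> 'o \<Rightarrow> 'o \<Rightarrow> 'm set" where
  "hom C a b = {f \<in> Arr C. Dom C f = a \<and> Cod C f = b}"

locale category =
  fixes C :: "('o, 'm) cat" (structure)
  assumes Dom_in: "f \<in> Arr C \<Longrightarrow> Dom C f \<in> Obj C"
    and Cod_in: "f \<in> Arr C \<Longrightarrow> Cod C f \<in> Obj C"
    and Ident_in: "a \<in> Obj C \<Longrightarrow> Ident C a \<in> hom C a a"
    and Comp_in: "f \<in> hom C a b \<Longrightarrow> g \<in> hom C b c \<Longrightarrow> g \<cdot> f \<in> hom C a c"
    and Ident_right: "f \<in> hom C a b \<Longrightarrow> f \<cdot> Ident C a = f"
    and Ident_left: "f \<in> hom C a b \<Longrightarrow> Ident C b \<cdot> f = f"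
    and assoc: "f \<in> hom C a b \<Longrightarrow> g \<in> hom C b c \<Longrightarrow> h \<in> hom C c d \<Longrightarrow>
      (h \<cdot> g) \<cdot> f = h \<cdot> (g \<cdot> f)"

definition full_subcategory :: "('o, 'm) cat \<Rightarrow> ('o \<Rightarrow> bool) \<Rightarrow> ('o, 'm) cat" where
  "full_subcategory C P = C\<lparr>Obj := {a \<in> Obj C. P a},
     Arr := {f \<in> Arr C. P (Dom C f) \<and> P (Cod C f)}\<rparr>"

definition is_iso :: "('o, 'm) cat \<Rightarrow> 'm \<Rightarrow> bool" where
  "is_iso C f \<longleftrightarrow> f \<in> Arr C \<and> (\<exists>g \<in> hom C (Cod C f) (Dom C f).
     g \<cdot>\<^bsub>C\<^esub> f = Ident C (Dom C f) \<and> f \<cdot>\<^bsub>C\<^esub> g = Ident C (Cod C f))"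

definition is_retract_of :: "('o, 'm) cat \<Rightarrow> 'm \<Rightarrow> 'm \<Rightarrow> bool" where
  "is_retract_of C f g \<longleftrightarrow> f \<in> Arr C \<and> g \<in> Arr C \<and>
     (\<exists>s \<in> hom C (Dom C f) (Dom C g). \<exists>r \<in> hom C (Dom C g) (Dom C f).
      \<exists>s' \<in> hom C (Cod C f) (Cod C g). \<exists>r' \<in> hom C (Cod C g) (Cod C f).
        r \<cdot>\<^bsub>C\<^esub> s = Ident C (Dom C f) \<and> r' \<cdot>\<^bsub>C\<^esub> s' = Ident C (Cod C f) \<and>
        g \<cdot>\<^bsub>C\<^esub> s = s' \<cdot>\<^bsub>C\<^esub> f \<and> f \<cdot>\<^bsub>C\<^esub> r = r' \<cdot>\<^bsub>C\<^esub> g)"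

definition is_functor ::
  "('i, 'j) cat \<Rightarrow> ('o, 'm) cat \<Rightarrow> ('i \<Rightarrow> 'o) \<Rightarrow> ('j \<Rightarrow> 'm) \<Rightarrow> bool" where
  "is_functor J C Fo Fm \<longleftrightarrow>
     (\<forall>i \<in> Obj J. Fo i \<in> Obj C) \<and>
     (\<forall>u \<in> Arr J. Fm u \<in> hom C (Fo (Dom J u)) (Fo (Cod J u))) \<and>
     (\<forall>i \<in> Obj J. Fm (Ident J i) = Ident C (Fo i)) \<and>
     (\<forall>u \<in> Arr J. \<forall>v \<in> Arr J. Cod J u = Dom J v \<longrightarrow> Fm (v \<cdot>\<^bsub>J\<^esub> u) = Fm v \<cdot>\<^bsub>C\<^esub> Fm u)"

definition is_cone ::
  "('i, 'j) cat \<Rightarrow> ('o, 'm) cat \<Rightarrow> ('i \<Rightarrow> 'o) \<Rightarrow> ('j \<Rightarrow> 'm) \<Rightarrow> 'o \<Rightarrow> ('i \<Rightarrow> 'm) \<Rightarrow> bool" where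
  "is_cone J C Fo Fm L \<pi> \<longleftrightarrow> L \<in> Obj C \<and> (\<forall>i \<in> Obj J. \<pi> i \<in> hom C L (Fo i)) \<and>
     (\<forall>u \<in> Arr J. Fm u \<cdot>\<^bsub>C\<^esub> \<pi> (Dom J u) = \<pi> (Cod J u))"

definition is_limit ::
  "('i, 'j) cat \<Rightarrow> ('o, 'm) cat \<Rightarrow> ('i \<Rightarrow> 'o) \<Rightarrow> ('j \<Rightarrow> 'm) \<Rightarrow> 'o \<Rightarrow> ('i \<Rightarrow> 'm) \<Rightarrow> bool" where
  "is_limit J C Fo Fm L \<pi> \<longleftrightarrow> is_cone J C Fo Fm L \<pi> \<and>
     (\<forall>T \<tau>. is_cone J C Fo Fm T \<tau> \<longrightarrow>
        (\<exists>!t. t \<in> hom C T L \<and> (\<forall>i \<in> Obj J. \<pi> i \<cdot>\<^bsub>C\<^esub> t = \<tau> i)))"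

text \<open>Every finite category is isomorphic to one whose objects and arrows are natural numbers,
  so indexing diagrams by such categories loses no generality.\<close>

definition has_finite_limits :: "('o, 'm) cat \<Rightarrow> bool" where
  "has_finite_limits C \<longleftrightarrow>
     (\<forall>(J :: (nat, nat) cat) Fo Fm.
        category J \<and> finite (Obj J) \<and> finite (Arr J) \<and> is_functor J C Fo Fm \<longrightarrow>
        (\<exists>L \<pi>. is_limit J C Fo Fm L \<pi>))"

definition is_terminal :: "('o, 'm) cat \<Rightarrow> 'o \<Rightarrow> bool" where
  "is_terminal C T \<longleftrightarrow> T \<in> Obj C \<and> (\<forall>a \<in> Obj C. \<exists>!f. f \<in> hom C a T)"

definition is_product :: "('o, 'm) cat \<Rightarrow> 'i set \<Rightarrow> ('i \<Rightarrow> 'o) \<Rightarrow> 'o \<Rightarrow> ('i \<Rightarrow> 'm) \<Rightarrow> bool" where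
  "is_product C I A P \<pi> \<longleftrightarrow> P \<in> Obj C \<and> (\<forall>i \<in> I. \<pi> i \<in> hom C P (A i)) \<and>
     (\<forall>T \<in> Obj C. \<forall>\<tau>. (\<forall>i \<in> I. \<tau> i \<in> hom C T (A i)) \<longrightarrow>
        (\<exists>!t. t \<in> hom C T P \<and> (\<forall>i \<in> I. \<pi> i \<cdot>\<^bsub>C\<^esub> t = \<tau> i)))"

definition has_finite_products :: "('o, 'm) cat \<Rightarrow> bool" where
  "has_finite_products C \<longleftrightarrow>
     (\<forall>(n :: nat) A. (\<forall>i < n. A i \<in> Obj C) \<longrightarrow> (\<exists>P \<pi>. is_product C {..<n} A P \<pi>))"

text \<open>The pullback of \<open>f\<close> and \<open>g\<close> has projections \<open>p\<close> to the domain of \<open>f\<close> and \<open>q\<close> to the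
  domain of \<open>g\<close>.\<close>

definition is_pullback :: "('o, 'm) cat \<Rightarrow> 'm \<Rightarrow> 'm \<Rightarrow> 'm \<Rightarrow> 'm \<Rightarrow> bool" where
  "is_pullback C f g p q \<longleftrightarrow>
     f \<in> Arr C \<and> g \<in> Arr C \<and> Cod C f = Cod C g \<and>
     p \<in> hom C (Dom C p) (Dom C f) \<and> q \<in> hom C (Dom C p) (Dom C g) \<and>
     f \<cdot>\<^bsub>C\<^esub> p = g \<cdot>\<^bsub>C\<^esub> q \<and>
     (\<forall>T \<in> Obj C. \<forall>u \<in> hom C T (Dom C f). \<forall>v \<in> hom C T (Dom C g). f \<cdot>\<^bsub>C\<^esub> u = g \<cdot>\<^bsub>C\<^esub> v \<longrightarrow>
        (\<exists>!t. t \<in> hom C T (Dom C p) \<and> p \<cdot>\<^bsub>C\<^esub> t = u \<and> q \<cdot>\<^bsub>C\<^esub> t = v))"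

definition is_coequalizer :: "('o, 'm) cat \<Rightarrow> 'm \<Rightarrow> 'm \<Rightarrow> 'm \<Rightarrow> bool" where
  "is_coequalizer C u v e \<longleftrightarrow>
     u \<in> Arr C \<and> v \<in> hom C (Dom C u) (Cod C u) \<and> e \<in> hom C (Cod C u) (Cod C e) \<and>
     e \<cdot>\<^bsub>C\<^esub> u = e \<cdot>\<^bsub>C\<^esub> v \<and>
     (\<forall>b \<in> Obj C. \<forall>h \<in> hom C (Cod C u) b. h \<cdot>\<^bsub>C\<^esub> u = h \<cdot>\<^bsub>C\<^esub> v \<longrightarrow>
        (\<exists>!t. t \<in> hom C (Cod C e) b \<and> t \<cdot>\<^bsub>C\<^esub> e = h))"

definition regular_epi :: "('o, 'm) cat \<Rightarrow> 'm \<Rightarrow> bool" where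
  "regular_epi C e \<longleftrightarrow> (\<exists>u v. is_coequalizer C u v e)"

locale regular_category = category C for C :: "('o, 'm) cat" (structure) +
  assumes finite_limits: "has_finite_limits C"
    and kernel_pair_coequalizer:
      "is_pullback C f f p q \<Longrightarrow> \<exists>e. is_coequalizer C p q e"
    and regular_epi_pullback_stable:
      "regular_epi C e \<Longrightarrow> is_pullback C e g p q \<Longrightarrow> regular_epi C q"

text \<open>A chosen pullback, its projections, and the morphism into it induced by \<open>u\<close> and \<open>v\<close>.\<close>

definition pb_proj :: "('o, 'm) cat \<Rightarrow> 'm \<Rightarrow> 'm \<Rightarrow> 'm \<times> 'm" where
  "pb_proj C f g = (SOME (p, q). is_pullback C f g p q)"

definition pb_fst :: "('o, 'm) cat \<Rightarrow> 'm \<Rightarrow> 'm \<Rightarrow> 'm" where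
  "pb_fst C f g = fst (pb_proj C f g)"

definition pb_snd :: "('o, 'm) cat \<Rightarrow> 'm \<Rightarrow> 'm \<Rightarrow> 'm" where
  "pb_snd C f g = snd (pb_proj C f g)"

definition pb_pair :: "('o, 'm) cat \<Rightarrow> 'm \<Rightarrow> 'm \<Rightarrow> 'm \<Rightarrow> 'm \<Rightarrow> 'm" where
  "pb_pair C f g u v = (THE t. t \<in> hom C (Dom C u) (Dom C (pb_fst C f g)) \<and>
     pb_fst C f g \<cdot>\<^bsub>C\<^esub> t = u \<and> pb_snd C f g \<cdot>\<^bsub>C\<^esub> t = v)"


section \<open>Categories of fibrant objects\<close>

definition two_out_of_three :: "('o, 'm) cat \<Rightarrow> 'm set \<Rightarrow> bool" where
  "two_out_of_three C W \<longleftrightarrow> (\<forall>f \<in> Arr C. \<forall>g \<in> Arr C. Cod C f = Dom C g \<longrightarrow>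
     (f \<in> W \<and> g \<in> W \<longrightarrow> g \<cdot>\<^bsub>C\<^esub> f \<in> W) \<and>
     (f \<in> W \<and> g \<cdot>\<^bsub>C\<^esub> f \<in> W \<longrightarrow> g \<in> W) \<and>
     (g \<in> W \<and> g \<cdot>\<^bsub>C\<^esub> f \<in> W \<longrightarrow> f \<in> W))"

definition retract_closed :: "('o, 'm) cat \<Rightarrow> 'm set \<Rightarrow> bool" where
  "retract_closed C W \<longleftrightarrow> (\<forall>f g. is_retract_of C f g \<and> g \<in> W \<longrightarrow> f \<in> W)"

locale category_of_fibrant_objects = category C for C :: "('o, 'm) cat" (structure) +
  fixes W :: "'m set" and F :: "'m set"
  assumes finite_products: "has_finite_products C"
    and W_sub: "W \<subseteq> Arr C"
    and F_sub: "F \<subseteq> Arr C"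
    and iso_W: "is_iso C f \<Longrightarrow> f \<in> W"
    and W_two_out_of_three: "two_out_of_three C W"
    and iso_F: "is_iso C f \<Longrightarrow> f \<in> F"
    and F_comp: "f \<in> F \<Longrightarrow> g \<in> F \<Longrightarrow> Cod C f = Dom C g \<Longrightarrow> g \<cdot> f \<in> F"
    and F_pullback_exists: "f \<in> F \<Longrightarrow> g \<in> Arr C \<Longrightarrow> Cod C g = Cod C f \<Longrightarrow>
      \<exists>p q. is_pullback C f g p q"
    and F_pullback: "f \<in> F \<Longrightarrow> is_pullback C f g p q \<Longrightarrow> q \<in> F"
    and FW_pullback: "f \<in> F \<inter> W \<Longrightarrow> is_pullback C f g p q \<Longrightarrow> q \<in> F \<inter> W"
    and diagonal_factors: "B \<in> Obj C \<Longrightarrow> is_product C {0, 1 :: nat} (\<lambda>_. B) P \<pi> \<Longrightarrow>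
      d \<in> hom C B P \<Longrightarrow> \<pi> 0 \<cdot> d = Ident C B \<Longrightarrow> \<pi> 1 \<cdot> d = Ident C B \<Longrightarrow>
      \<exists>w \<in> W. \<exists>p \<in> F. Cod C w = Dom C p \<and> d = p \<cdot> w"
    and to_terminal_F: "B \<in> Obj C \<Longrightarrow> is_terminal C T \<Longrightarrow> t \<in> hom C B T \<Longrightarrow> t \<in> F"


section \<open>Simplicial sets\<close>

text \<open>A morphism \<open>[m] \<rightarrow> [n]\<close> of the simplex category is a monotone function, with the value
  \<open>undefined\<close> outside \<open>[m] = {..m}\<close>; composites are formed with \<open>compose {..m}\<close>.\<close>

definition delta_hom :: "nat \<Rightarrow> nat \<Rightarrow> (nat \<Rightarrow> nat) set" where
  "delta_hom m n = {\<theta> \<in> {..m} \<rightarrow>\<^sub>E {..n}. mono_on {..m} \<theta>}"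

text \<open>\<open>sset_op Z m n \<theta>\<close> is the operation from \<open>n\<close>-simplices to \<open>m\<close>-simplices given by
  \<open>\<theta> : [m] \<rightarrow> [n]\<close>.\<close>

record 'z sset =
  simplices :: "nat \<Rightarrow> 'z set"
  sset_op :: "nat \<Rightarrow> nat \<Rightarrow> (nat \<Rightarrow> nat) \<Rightarrow> 'z \<Rightarrow> 'z"

definition sset_maps :: "'z sset \<Rightarrow> 'w sset \<Rightarrow> (nat \<Rightarrow> 'z \<Rightarrow> 'w) set" where
  "sset_maps Z W = {\<phi>. (\<forall>n. \<phi> n \<in> simplices Z n \<rightarrow>\<^sub>E simplices W n) \<and>
     (\<forall>m n. \<forall>\<theta> \<in> delta_hom m n. \<forall>z \<in> simplices Z n.
        \<phi> m (sset_op Z m n \<theta> z) = sset_op W m n \<theta> (\<phi> n z))}"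

definition std_simplex :: "nat \<Rightarrow> (nat \<Rightarrow> nat) sset" where
  "std_simplex n = \<lparr>simplices = (\<lambda>m. delta_hom m n),
     sset_op = (\<lambda>l m \<theta> \<alpha>. compose {..l} \<alpha> \<theta>)\<rparr>"

definition boundary :: "nat \<Rightarrow> (nat \<Rightarrow> nat) sset" where
  "boundary n = (std_simplex n)\<lparr>simplices := (\<lambda>m. {\<alpha> \<in> delta_hom m n. \<alpha> ` {..m} \<noteq> {..n}})\<rparr>"

definition horn :: "nat \<Rightarrow> nat \<Rightarrow> (nat \<Rightarrow> nat) sset" where
  "horn n k = (std_simplex n)\<lparr>simplices :=
     (\<lambda>m. {\<alpha> \<in> delta_hom m n. \<exists>i \<in> {..n} - {k}. i \<notin> \<alpha> ` {..m}})\<rparr>"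

definition sset_incl :: "'z sset \<Rightarrow> nat \<Rightarrow> 'z \<Rightarrow> 'z" where
  "sset_incl Z = (\<lambda>n. \<lambda>z \<in> simplices Z n. z)"

definition sset_prod :: "'z sset \<Rightarrow> 'w sset \<Rightarrow> ('z \<times> 'w) sset" where
  "sset_prod Z W = \<lparr>simplices = (\<lambda>n. simplices Z n \<times> simplices W n),
     sset_op = (\<lambda>m n \<theta>. map_prod (sset_op Z m n \<theta>) (sset_op W m n \<theta>))\<rparr>"

text \<open>The pushout of \<open>u : A \<rightarrow> B\<close> along \<open>v : A \<rightarrow> B'\<close> is computed in each dimension as the quotient
  of the disjoint union by the equivalence relation generated by \<open>u a \<sim> v a\<close>.\<close>

definition pushout_rel ::
  "'a sset \<Rightarrow> (nat \<Rightarrow> 'a \<Rightarrow> 'b) \<Rightarrow> (nat \<Rightarrow> 'a \<Rightarrow> 'c) \<Rightarrow> nat \<Rightarrow> ('b + 'c) rel" where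
  "pushout_rel A u v n =
     (let R = {(Inl (u n a), Inr (v n a)) | a. a \<in> simplices A n} in (R \<union> R\<inverse>)\<^sup>*)"

definition sset_pushout ::
  "'a sset \<Rightarrow> 'b sset \<Rightarrow> 'c sset \<Rightarrow> (nat \<Rightarrow> 'a \<Rightarrow> 'b) \<Rightarrow> (nat \<Rightarrow> 'a \<Rightarrow> 'c) \<Rightarrow> ('b + 'c) set sset" where
  "sset_pushout A B B' u v =
     \<lparr>simplices = (\<lambda>n. (simplices B n <+> simplices B' n) // pushout_rel A u v n),
      sset_op = (\<lambda>m n \<theta> c.
        pushout_rel A u v m `` (map_sum (sset_op B m n \<theta>) (sset_op B' m n \<theta>) ` c))\<rparr>"

type_synonym disk_simplex = "((nat \<Rightarrow> nat) \<times> (nat \<Rightarrow> nat) + (nat \<Rightarrow> nat)) set"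

definition boundary_cylinder_proj ::
  "nat \<Rightarrow> nat \<Rightarrow> (nat \<Rightarrow> nat) \<times> (nat \<Rightarrow> nat) \<Rightarrow> (nat \<Rightarrow> nat)" where
  "boundary_cylinder_proj n =
     (\<lambda>m. \<lambda>x \<in> simplices (sset_prod (boundary n) (std_simplex 1)) m. fst x)"

text \<open>\<open>disk n\<close> is the simplicial set $D^{n+1}$.\<close>

definition disk :: "nat \<Rightarrow> disk_simplex sset" where
  "disk n = sset_pushout (sset_prod (boundary n) (std_simplex 1))
     (sset_prod (std_simplex n) (std_simplex 1)) (boundary n)
     (sset_incl (sset_prod (boundary n) (std_simplex 1))) (boundary_cylinder_proj n)"

definition disk_quot :: "nat \<Rightarrow> nat \<Rightarrow> (nat \<Rightarrow> nat) \<times> (nat \<Rightarrow> nat) \<Rightarrow> disk_simplex" where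
  "disk_quot n = (\<lambda>m. \<lambda>x \<in> simplices (sset_prod (std_simplex n) (std_simplex 1)) m.
     pushout_rel (sset_prod (boundary n) (std_simplex 1))
       (sset_incl (sset_prod (boundary n) (std_simplex 1))) (boundary_cylinder_proj n) m `` {Inl x})"

text \<open>For \<open>e \<in> {0, 1}\<close>, \<open>disk_end n e\<close> is $j_e$; the constant function with value \<open>e\<close> is the
  degenerate simplex at the vertex \<open>e\<close> of $\Delta^1$.\<close>

definition disk_end :: "nat \<Rightarrow> nat \<Rightarrow> nat \<Rightarrow> (nat \<Rightarrow> nat) \<Rightarrow> disk_simplex" where
  "disk_end n e = (\<lambda>m. \<lambda>\<alpha> \<in> simplices (std_simplex n) m. disk_quot n m (\<alpha>, \<lambda>i \<in> {..m}. e))"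


section \<open>Simplicial objects\<close>

record ('o, 'm) sobj =
  level :: "nat \<Rightarrow> 'o"
  sobj_op :: "nat \<Rightarrow> nat \<Rightarrow> (nat \<Rightarrow> nat) \<Rightarrow> 'm"

text \<open>The clause for \<open>\<theta> \<notin> delta_hom m n\<close> only makes equality of simplicial objects
  coincide with equality of functors.\<close>

definition simplicial_object :: "('o, 'm) cat \<Rightarrow> ('o, 'm) sobj \<Rightarrow> bool" where
  "simplicial_object C X \<longleftrightarrow>
     (\<forall>n. level X n \<in> Obj C) \<and>
     (\<forall>m n. \<forall>\<theta> \<in> delta_hom m n. sobj_op X m n \<theta> \<in> hom C (level X n) (level X m)) \<and>
     (\<forall>m n \<theta>. \<theta> \<notin> delta_hom m n \<longrightarrow> sobj_op X m n \<theta> = undefined) \<and>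
     (\<forall>n. sobj_op X n n (\<lambda>i \<in> {..n}. i) = Ident C (level X n)) \<and>
     (\<forall>l m n. \<forall>\<eta> \<in> delta_hom l m. \<forall>\<theta> \<in> delta_hom m n.
        sobj_op X l n (compose {..l} \<theta> \<eta>) = sobj_op X l m \<eta> \<cdot>\<^bsub>C\<^esub> sobj_op X m n \<theta>)"

record ('o, 'm) smor =
  sdom :: "('o, 'm) sobj"
  scod :: "('o, 'm) sobj"
  component :: "nat \<Rightarrow> 'm"

definition simplicial_morphism :: "('o, 'm) cat \<Rightarrow> ('o, 'm) smor \<Rightarrow> bool" where
  "simplicial_morphism C f \<longleftrightarrow> simplicial_object C (sdom f) \<and> simplicial_object C (scod f) \<and>
     (\<forall>n. component f n \<in> hom C (level (sdom f) n) (level (scod f) n)) \<and>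
     (\<forall>m n. \<forall>\<theta> \<in> delta_hom m n.
        component f m \<cdot>\<^bsub>C\<^esub> sobj_op (sdom f) m n \<theta> = sobj_op (scod f) m n \<theta> \<cdot>\<^bsub>C\<^esub> component f n)"

definition simplicial_objects :: "('o, 'm) cat \<Rightarrow> (('o, 'm) sobj, ('o, 'm) smor) cat" where
  "simplicial_objects C = \<lparr>Obj = {X. simplicial_object C X}, Arr = {f. simplicial_morphism C f},
     Dom = sdom, Cod = scod,
     Ident = (\<lambda>X. \<lparr>sdom = X, scod = X, component = (\<lambda>n. Ident C (level X n))\<rparr>),
     Comp = (\<lambda>g f. \<lparr>sdom = sdom f, scod = scod g,
       component = (\<lambda>n. component g n \<cdot>\<^bsub>C\<^esub> component f n)\<rparr>)\<rparr>"


section \<open>Weighted limits\<close>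

definition hom_sset :: "('o, 'm) cat \<Rightarrow> 'o \<Rightarrow> ('o, 'm) sobj \<Rightarrow> 'm sset" where
  "hom_sset C T X = \<lparr>simplices = (\<lambda>n. hom C T (level X n)),
     sset_op = (\<lambda>m n \<theta> f. sobj_op X m n \<theta> \<cdot>\<^bsub>C\<^esub> f)\<rparr>"

text \<open>\<open>(L, \<beta>)\<close> is a weighted limit when the \<open>\<beta> T\<close> are bijections from simplicial maps
  \<open>Z \<rightarrow> Hom(T, X)\<close> to morphisms \<open>T \<rightarrow> L\<close>, natural in \<open>T\<close>.\<close>

definition is_weighted_limit ::
  "('o, 'm) cat \<Rightarrow> 'z sset \<Rightarrow> ('o, 'm) sobj \<Rightarrow> 'o \<Rightarrow> ('o \<Rightarrow> (nat \<Rightarrow> 'z \<Rightarrow> 'm) \<Rightarrow> 'm) \<Rightarrow> bool" where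
  "is_weighted_limit C Z X L \<beta> \<longleftrightarrow> L \<in> Obj C \<and>
     (\<forall>T \<in> Obj C. bij_betw (\<beta> T) (sset_maps Z (hom_sset C T X)) (hom C T L)) \<and>
     (\<forall>T \<in> Obj C. \<forall>T' \<in> Obj C. \<forall>t \<in> hom C T' T. \<forall>\<phi> \<in> sset_maps Z (hom_sset C T X).
        \<beta> T' (\<lambda>n. \<lambda>z \<in> simplices Z n. \<phi> n z \<cdot>\<^bsub>C\<^esub> t) = \<beta> T \<phi> \<cdot>\<^bsub>C\<^esub> t)"

definition wlim_data ::
  "('o, 'm) cat \<Rightarrow> 'z sset \<Rightarrow> ('o, 'm) sobj \<Rightarrow> 'o \<times> ('o \<Rightarrow> (nat \<Rightarrow> 'z \<Rightarrow> 'm) \<Rightarrow> 'm)" where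
  "wlim_data C Z X = (SOME (L, \<beta>). is_weighted_limit C Z X L \<beta>)"

definition wlim :: "('o, 'm) cat \<Rightarrow> 'z sset \<Rightarrow> ('o, 'm) sobj \<Rightarrow> 'o" where
  "wlim C Z X = fst (wlim_data C Z X)"

definition wlim_bij ::
  "('o, 'm) cat \<Rightarrow> 'z sset \<Rightarrow> ('o, 'm) sobj \<Rightarrow> 'o \<Rightarrow> (nat \<Rightarrow> 'z \<Rightarrow> 'm) \<Rightarrow> 'm" where
  "wlim_bij C Z X = snd (wlim_data C Z X)"

text \<open>The universal simplicial map from \<open>Z\<close> to \<open>Hom({Z, X}, X)\<close>, corresponding to the identity.
  By the Yoneda lemma, the functorial actions \<open>{i, X}\<close> and \<open>{Z, f}\<close> are obtained by transporting
  its composites with \<open>i\<close> and \<open>f\<close>.\<close>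

definition wlim_univ :: "('o, 'm) cat \<Rightarrow> 'z sset \<Rightarrow> ('o, 'm) sobj \<Rightarrow> nat \<Rightarrow> 'z \<Rightarrow> 'm" where
  "wlim_univ C Z X = inv_into (sset_maps Z (hom_sset C (wlim C Z X) X))
     (wlim_bij C Z X (wlim C Z X)) (Ident C (wlim C Z X))"

definition wlim_restrict ::
  "('o, 'm) cat \<Rightarrow> 'z sset \<Rightarrow> 'w sset \<Rightarrow> (nat \<Rightarrow> 'z \<Rightarrow> 'w) \<Rightarrow> ('o, 'm) sobj \<Rightarrow> 'm" where
  "wlim_restrict C Z W i X = wlim_bij C Z X (wlim C W X)
     (\<lambda>n. \<lambda>z \<in> simplices Z n. wlim_univ C W X n (i n z))"

definition wlim_map :: "('o, 'm) cat \<Rightarrow> 'z sset \<Rightarrow> ('o, 'm) smor \<Rightarrow> 'm" where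
  "wlim_map C Z f = wlim_bij C Z (scod f) (wlim C Z (sdom f))
     (\<lambda>n. \<lambda>z \<in> simplices Z n. component f n \<cdot>\<^bsub>C\<^esub> wlim_univ C Z (sdom f) n z)"


section \<open>Internal Kan complexes and Dugger--Isaksen weak equivalences\<close>

definition comparison ::
  "('o, 'm) cat \<Rightarrow> 'z sset \<Rightarrow> 'w sset \<Rightarrow> (nat \<Rightarrow> 'z \<Rightarrow> 'w) \<Rightarrow> ('o, 'm) smor \<Rightarrow> 'm" where
  "comparison C Z W i p = pb_pair C (wlim_map C Z p) (wlim_restrict C Z W i (scod p))
     (wlim_restrict C Z W i (sdom p)) (wlim_map C W p)"

definition internal_Kan_fibration :: "('o, 'm) cat \<Rightarrow> ('o, 'm) smor \<Rightarrow> bool" where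
  "internal_Kan_fibration C p \<longleftrightarrow> p \<in> Arr (simplicial_objects C) \<and>
     (\<forall>n k. 1 \<le> n \<and> k \<le> n \<longrightarrow>
        regular_epi C (comparison C (horn n k) (std_simplex n) (sset_incl (horn n k)) p))"

definition internal_trivial_Kan_fibration :: "('o, 'm) cat \<Rightarrow> ('o, 'm) smor \<Rightarrow> bool" where
  "internal_trivial_Kan_fibration C p \<longleftrightarrow> p \<in> Arr (simplicial_objects C) \<and>
     (\<forall>n. regular_epi C (comparison C (boundary n) (std_simplex n) (sset_incl (boundary n)) p))"

definition internal_Kan_complex :: "('o, 'm) cat \<Rightarrow> ('o, 'm) sobj \<Rightarrow> bool" where
  "internal_Kan_complex C X \<longleftrightarrow> X \<in> Obj (simplicial_objects C) \<and>
     (\<exists>T t. is_terminal (simplicial_objects C) T \<and> t \<in> hom (simplicial_objects C) X T \<and>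
        internal_Kan_fibration C t)"

definition Kan :: "('o, 'm) cat \<Rightarrow> (('o, 'm) sobj, ('o, 'm) smor) cat" where
  "Kan C = full_subcategory (simplicial_objects C) (internal_Kan_complex C)"

definition DI_comparison :: "('o, 'm) cat \<Rightarrow> nat \<Rightarrow> ('o, 'm) smor \<Rightarrow> 'm" where
  "DI_comparison C n f =
     (let X = sdom f; Y = scod f;
          f_simp = wlim_map C (std_simplex n) f;
          f_bd = wlim_map C (boundary n) f;
          res = wlim_restrict C (boundary n) (std_simplex n) (sset_incl (boundary n));
          j = (\<lambda>e. wlim_restrict C (std_simplex n) (disk n) (disk_end n e) Y)
      in pb_pair C f_bd (res Y)
           (res X \<cdot>\<^bsub>C\<^esub> pb_fst C f_simp (j 1)) (j 0 \<cdot>\<^bsub>C\<^esub> pb_snd C f_simp (j 1)))"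

definition DI_weak_equivalence :: "('o, 'm) cat \<Rightarrow> ('o, 'm) smor \<Rightarrow> bool" where
  "DI_weak_equivalence C f \<longleftrightarrow> f \<in> Arr (Kan C) \<and> (\<forall>n. regular_epi C (DI_comparison C n f))"

end

theory Submission
  imports Defs "HOL-Library.Product_Order"
begin

text \<open>In a regular category the regular epimorphisms are exactly the morphisms through which every
  generalized element lifts after passing to a regular epimorphism. Internal Kan fibrations, trivial
  fibrations and Dugger--Isaksen equivalences therefore become lifting properties of the simplicial
  sets \<open>Hom(T, X)\<close> in which solutions are only required to exist after refining the stage \<open>T\<close>,
  and the theorem becomes simplicial homotopy theory in which finitely many fillers are chosen.

  The only combinatorial input is that \<open>K \<times> \<Delta>\<^sup>1 \<union> L \<times> {e} \<rightarrow> L \<times> \<Delta>\<^sup>1\<close> is a finite composite of pushouts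
  of horn inclusions. Horn inclusions are retracts of such maps, which gives the pushout product of a
  horn inclusion with \<open>\<partial>\<Delta>\<^sup>1 \<rightarrow> \<Delta>\<^sup>1\<close>, hence the path object \<open>X\<close> to the power \<open>\<Delta>\<^sup>1\<close>; the same maps provide homotopy
  extension and the filling of squares of homotopies. A Dugger--Isaksen equivalence lifts every finite
  relative cell complex up to relative homotopy, by induction on the cells, and two-out-of-three
  follows by filling squares.\<close>

section \<open>Regular epimorphisms\<close>

context category
begin

text \<open>The obstacle is that fillers cannot be chosen once and for all: each solution costs a
  cover of the stage, and covers are composed only finitely often. So there is no small object
  argument; the weights are finite, inductions run over their cells, and everything already
  constructed is transported along each new cover. A map from \<open>disk n\<close> is a homotopy
  that is stationary on the boundary. A Dugger--Isaksen equivalence therefore solves a lifting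
  problem strictly on the boundary and up to such a homotopy inside. These homotopies are directed,
  and the target being Kan is what allows them to be concatenated: a square of homotopies can be
  completed when the side at either end of one direction is missing. The path object is not shown to
  be Kan by hand. Its pair of endpoints is a fibration over a product of Kan complexes, and
  fibrations reflect being Kan. The morphism of constant paths is an equivalence because it is a
  section of an evaluation that lifts against all boundaries. Hence the third claim rests on
  two-out-of-three, and the stability of trivial fibrations rests on the second claim.\<close>

lemma homD:
  assumes "f \<in> hom C a b"
  shows "f \<in> Arr C" "Dom C f = a" "Cod C f = b" "a \<in> Obj C" "b \<in> Obj C"
  using assms Dom_in Cod_in by (auto simp: hom_def)

lemma ident_simps [simp]:
  assumes "a \<in> Obj C"
  shows "Ident C a \<in> Arr C" "Dom C (Ident C a) = a" "Cod C (Ident C a) = a"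
  using homD[OF Ident_in[OF assms]] by auto

lemma comp_simps [simp]:
  assumes "f \<in> Arr C" "g \<in> Arr C" "Dom C g = Cod C f"
  shows "g \<cdot> f \<in> Arr C" "Dom C (g \<cdot> f) = Dom C f" "Cod C (g \<cdot> f) = Cod C g"
  using homD[OF Comp_in[of f "Dom C f" "Cod C f" g "Cod C g"]] assms by (auto simp: hom_def)

lemma comp_assoc:
  "f \<in> Arr C \<Longrightarrow> g \<in> Arr C \<Longrightarrow> h \<in> Arr C \<Longrightarrow> Dom C g = Cod C f \<Longrightarrow> Dom C h = Cod C g \<Longrightarrow>
    (h \<cdot> g) \<cdot> f = h \<cdot> g \<cdot> f"
  by (rule assoc) (auto simp: hom_def)

lemma comp_square:
  assumes "f \<cdot> p = g \<cdot> q" "f \<in> Arr C" "p \<in> Arr C" "g \<in> Arr C" "q \<in> Arr C" "s \<in> Arr C"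
    "Dom C f = Cod C p" "Dom C g = Cod C q" "Dom C p = Cod C s" "Dom C q = Cod C s"
  shows "f \<cdot> p \<cdot> s = g \<cdot> q \<cdot> s"
proof -
  have "f \<cdot> p \<cdot> s = (f \<cdot> p) \<cdot> s" using assms(2-) by (simp add: comp_assoc)
  also have "\<dots> = g \<cdot> q \<cdot> s" unfolding assms(1) using assms(2-) by (simp add: comp_assoc)
  finally show ?thesis .
qed

lemma ident_comp [simp]: "f \<in> Arr C \<Longrightarrow> Cod C f = a \<Longrightarrow> Ident C a \<cdot> f = f"
  using Ident_left by (auto simp: hom_def)

lemma comp_ident [simp]: "f \<in> Arr C \<Longrightarrow> Dom C f = a \<Longrightarrow> f \<cdot> Ident C a = f"
  using Ident_right by (auto simp: hom_def)

definition monic :: "'m \<Rightarrow> bool" where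
  "monic m \<longleftrightarrow> m \<in> Arr C \<and> (\<forall>u \<in> Arr C. \<forall>v \<in> Arr C. Dom C u = Dom C v \<longrightarrow> Cod C u = Dom C m \<longrightarrow>
     Cod C v = Dom C m \<longrightarrow> m \<cdot> u = m \<cdot> v \<longrightarrow> u = v)"

lemma monicD:
  "monic m \<Longrightarrow> m \<cdot> u = m \<cdot> v \<Longrightarrow> u \<in> Arr C \<Longrightarrow> v \<in> Arr C \<Longrightarrow> Dom C u = Dom C v \<Longrightarrow>
    Cod C u = Dom C m \<Longrightarrow> Cod C v = Dom C m \<Longrightarrow> u = v"
  by (auto simp: monic_def)

text \<open>An auxiliary notion: in a regular category it coincides with being a regular
  epimorphism, but closure under composition and cancellation of a right factor are easier to prove
  for it.\<close>

definition extremal_epi :: "'m \<Rightarrow> bool" where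
  "extremal_epi e \<longleftrightarrow> e \<in> Arr C \<and> (\<forall>m h. monic m \<longrightarrow> h \<in> Arr C \<longrightarrow> Cod C h = Dom C m \<longrightarrow> e = m \<cdot> h \<longrightarrow> is_iso C m)"

lemma extremal_epiD:
  "extremal_epi e \<Longrightarrow> monic m \<Longrightarrow> h \<in> Arr C \<Longrightarrow> Cod C h = Dom C m \<Longrightarrow> e = m \<cdot> h \<Longrightarrow> is_iso C m"
  by (simp add: extremal_epi_def)

lemma coequalizerD:
  assumes "is_coequalizer C u v e"
  shows "u \<in> Arr C" "v \<in> Arr C" "Dom C v = Dom C u" "Cod C v = Cod C u" "e \<in> Arr C"
    "Dom C e = Cod C u" "e \<cdot> u = e \<cdot> v"
    "\<And>h. h \<in> Arr C \<Longrightarrow> Dom C h = Cod C u \<Longrightarrow> h \<cdot> u = h \<cdot> v \<Longrightarrow>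
      \<exists>t. t \<in> Arr C \<and> Dom C t = Cod C e \<and> Cod C t = Cod C h \<and> t \<cdot> e = h"
    "\<And>s t. s \<in> Arr C \<Longrightarrow> t \<in> Arr C \<Longrightarrow> Dom C s = Cod C e \<Longrightarrow> Dom C t = Cod C e \<Longrightarrow> s \<cdot> e = t \<cdot> e \<Longrightarrow> s = t"
proof -
  show a: "u \<in> Arr C" "v \<in> Arr C" "Dom C v = Dom C u" "Cod C v = Cod C u" "e \<in> Arr C"
    "Dom C e = Cod C u" "e \<cdot> u = e \<cdot> v"
    using assms by (auto simp: is_coequalizer_def hom_def)
  show "\<exists>t. t \<in> Arr C \<and> Dom C t = Cod C e \<and> Cod C t = Cod C h \<and> t \<cdot> e = h"
    if "h \<in> Arr C" "Dom C h = Cod C u" "h \<cdot> u = h \<cdot> v" for h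
  proof -
    have "\<exists>!t. t \<in> hom C (Cod C e) (Cod C h) \<and> t \<cdot> e = h"
      using assms that Cod_in[of h] by (auto simp: is_coequalizer_def hom_def)
    then show ?thesis by (auto simp: hom_def)
  qed
  show "s = t" if "s \<in> Arr C" "t \<in> Arr C" "Dom C s = Cod C e" "Dom C t = Cod C e" "s \<cdot> e = t \<cdot> e" for s t
  proof -
    \<comment> \<open>Equality of the codomains is not assumed; it is read off from the equal
      composites. Then \<open>s\<close> and \<open>t\<close> are both the unique factorization of
      \<open>s \<cdot> e\<close>.\<close>
    have "Cod C (s \<cdot> e) = Cod C s" "Cod C (t \<cdot> e) = Cod C t" using that(1-4) a by simp_all
    then have eq: "Cod C s = Cod C t" using that(5) by metis
    have "(s \<cdot> e) \<cdot> u = (s \<cdot> e) \<cdot> v" using that a by (simp add: comp_assoc)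
    moreover have "s \<cdot> e \<in> hom C (Cod C u) (Cod C s)" using that a eq by (auto simp: hom_def)
    ultimately have "\<exists>!r. r \<in> hom C (Cod C e) (Cod C s) \<and> r \<cdot> e = s \<cdot> e"
      using assms that Cod_in[of s] by (auto simp: is_coequalizer_def)
    then show ?thesis using that eq by (auto simp: hom_def)
  qed
qed

lemma regular_epi_arr: "regular_epi C e \<Longrightarrow> e \<in> Arr C"
  by (auto simp: regular_epi_def dest: coequalizerD)

lemma regular_epi_cancel:
  "regular_epi C e \<Longrightarrow> s \<cdot> e = t \<cdot> e \<Longrightarrow> s \<in> Arr C \<Longrightarrow> t \<in> Arr C \<Longrightarrow> Dom C s = Cod C e \<Longrightarrow> Dom C t = Cod C e \<Longrightarrow> s = t"
  by (metis regular_epi_def coequalizerD(9))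

text \<open>If \<open>e = m \<cdot> h\<close> with \<open>m\<close> monic, then \<open>h\<close>
  coequalizes the same pair as \<open>e\<close>, so it factors through \<open>e\<close>, and the
  factorization is a two-sided inverse of \<open>m\<close>.\<close>

lemma regular_epi_extremal:
  assumes "regular_epi C e" shows "extremal_epi e"
proof -
  obtain u v where c: "is_coequalizer C u v e" using assms regular_epi_def by metis
  note c' = coequalizerD[OF c]
  have "is_iso C m" if m: "monic m" and h: "h \<in> Arr C" "Cod C h = Dom C m" and e: "e = m \<cdot> h" for m h
  proof -
    have ma: "m \<in> Arr C" using m monic_def by auto
    have dh: "Dom C h = Cod C u" "Cod C e = Cod C m" using c'(6) e ma h by auto
    have "m \<cdot> (h \<cdot> u) = m \<cdot> (h \<cdot> v)"
      using c'(1-7) ma h dh comp_assoc[of u h m] comp_assoc[of v h m] unfolding e by simp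
    then have "h \<cdot> u = h \<cdot> v"
      by (rule monicD[OF m]) (use c'(1-7) h dh in auto)
    then obtain t where t: "t \<in> Arr C" "Dom C t = Cod C e" "Cod C t = Cod C h" "t \<cdot> e = h"
      using c'(8) h dh by blast
    have "(m \<cdot> t) \<cdot> e = Ident C (Cod C m) \<cdot> e"
      using t e ma h c'(5) dh by (simp add: comp_assoc)
    then have mt: "m \<cdot> t = Ident C (Cod C m)"
      by (rule c'(9)[rotated 4]) (use t ma h dh Cod_in in auto)
    have "m \<cdot> (t \<cdot> m) = m \<cdot> Ident C (Dom C m)"
      using mt t ma h dh comp_assoc[of m t m] by auto
    then have tm: "t \<cdot> m = Ident C (Dom C m)"
      by (rule monicD[OF m]) (use t ma h dh Dom_in in auto)
    show ?thesis unfolding is_iso_def using ma mt tm t h dh by (auto simp: hom_def intro!: exI[of _ t])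
  qed
  then show ?thesis using c'(5) by (auto simp: extremal_epi_def)
qed

section \<open>Pullbacks, isomorphisms and chosen pullbacks\<close>

lemma pullbackD:
  assumes "is_pullback C f g p q"
  shows "f \<in> Arr C" "g \<in> Arr C" "p \<in> Arr C" "q \<in> Arr C" "Cod C g = Cod C f" "Dom C q = Dom C p"
    "Cod C p = Dom C f" "Cod C q = Dom C g" "f \<cdot> p = g \<cdot> q"
  using assms by (auto simp: is_pullback_def hom_def)

lemma pullback_lift:
  assumes "is_pullback C f g p q" "u \<in> Arr C" "v \<in> Arr C" "Dom C v = Dom C u"
    "Cod C u = Dom C f" "Cod C v = Dom C g" "f \<cdot> u = g \<cdot> v"
  obtains t where "t \<in> Arr C" "Dom C t = Dom C u" "Cod C t = Dom C p" "p \<cdot> t = u" "q \<cdot> t = v"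
proof -
  have "\<exists>!t. t \<in> hom C (Dom C u) (Dom C p) \<and> p \<cdot> t = u \<and> q \<cdot> t = v"
    using assms Dom_in[of u] unfolding is_pullback_def hom_def by auto
  then show ?thesis using that by (auto simp: hom_def)
qed

lemma pullback_unique:
  assumes "is_pullback C f g p q" "s \<in> Arr C" "t \<in> Arr C" "Dom C s = Dom C t"
    "Cod C s = Dom C p" "Cod C t = Dom C p" "p \<cdot> s = p \<cdot> t" "q \<cdot> s = q \<cdot> t"
  shows "s = t"
proof -
  note pb = pullbackD[OF assms(1)]
  have "f \<cdot> (p \<cdot> s) = g \<cdot> (q \<cdot> s)" by (rule comp_square) (use pb assms in auto)
  moreover have "p \<cdot> s \<in> hom C (Dom C t) (Dom C f)" "q \<cdot> s \<in> hom C (Dom C t) (Dom C g)"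
    using pb assms by (auto simp: hom_def)
  ultimately have "\<exists>!r. r \<in> hom C (Dom C t) (Dom C p) \<and> p \<cdot> r = p \<cdot> s \<and> q \<cdot> r = q \<cdot> s"
    using assms(1) Dom_in[OF assms(3)] unfolding is_pullback_def by blast
  then show ?thesis using assms by (auto simp: hom_def)
qed

lemma pullbackI:
  assumes "f \<in> Arr C" "g \<in> Arr C" "p \<in> Arr C" "q \<in> Arr C" "Cod C g = Cod C f" "Dom C q = Dom C p"
    "Cod C p = Dom C f" "Cod C q = Dom C g" "f \<cdot> p = g \<cdot> q"
    "\<And>u v. u \<in> Arr C \<Longrightarrow> v \<in> Arr C \<Longrightarrow> Dom C v = Dom C u \<Longrightarrow> Cod C u = Dom C f \<Longrightarrow>
      Cod C v = Dom C g \<Longrightarrow> f \<cdot> u = g \<cdot> v \<Longrightarrow>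
      \<exists>t. t \<in> Arr C \<and> Dom C t = Dom C u \<and> Cod C t = Dom C p \<and> p \<cdot> t = u \<and> q \<cdot> t = v"
    "\<And>s t. s \<in> Arr C \<Longrightarrow> t \<in> Arr C \<Longrightarrow> Dom C s = Dom C t \<Longrightarrow> Cod C s = Dom C p \<Longrightarrow>
      Cod C t = Dom C p \<Longrightarrow> p \<cdot> s = p \<cdot> t \<Longrightarrow> q \<cdot> s = q \<cdot> t \<Longrightarrow> s = t"
  shows "is_pullback C f g p q"
  unfolding is_pullback_def
proof (intro conjI ballI impI)
  fix T u v assume h: "T \<in> Obj C" "u \<in> hom C T (Dom C f)" "v \<in> hom C T (Dom C g)" "f \<cdot> u = g \<cdot> v"
  obtain t where t: "t \<in> Arr C \<and> Dom C t = Dom C u \<and> Cod C t = Dom C p \<and> p \<cdot> t = u \<and> q \<cdot> t = v"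
    using assms(10)[of u v] h by (auto simp: hom_def)
  show "\<exists>!t. t \<in> hom C T (Dom C p) \<and> p \<cdot> t = u \<and> q \<cdot> t = v"
    using t h assms(11) by (intro ex1I[of _ t]) (auto simp: hom_def)
qed (use assms in \<open>auto simp: hom_def\<close>)

lemma pullback_monic:
  assumes "is_pullback C m d p q" "monic m" shows "monic q"
  unfolding monic_def
proof (intro conjI ballI impI)
  note pb = pullbackD[OF assms(1)]
  show "q \<in> Arr C" by (fact pb)
  fix u v assume h: "u \<in> Arr C" "v \<in> Arr C" "Dom C u = Dom C v" "Cod C u = Dom C q" "Cod C v = Dom C q" "q \<cdot> u = q \<cdot> v"
  have "m \<cdot> (p \<cdot> u) = d \<cdot> (q \<cdot> u)" "m \<cdot> (p \<cdot> v) = d \<cdot> (q \<cdot> v)"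
    by (rule comp_square; use pb h in auto)+
  then have "m \<cdot> (p \<cdot> u) = m \<cdot> (p \<cdot> v)" using h by simp
  then have "p \<cdot> u = p \<cdot> v" by (rule monicD[OF assms(2)]) (use pb h in auto)
  then show "u = v" by (rule pullback_unique[OF assms(1), rotated 5]) (use h pb in auto)
qed

lemma iso_inverse:
  assumes "is_iso C f"
  obtains g where "f \<in> Arr C" "g \<in> Arr C" "Dom C g = Cod C f" "Cod C g = Dom C f" "g \<cdot> f = Ident C (Dom C f)" "f \<cdot> g = Ident C (Cod C f)"
  using assms by (auto simp: is_iso_def hom_def)

text \<open>An isomorphism is a coequalizer of the identity of its domain with itself.\<close>

lemma iso_regular_epi:
  assumes "is_iso C f" shows "regular_epi C f"
proof -
  obtain g where g: "f \<in> Arr C" "g \<in> Arr C" "Dom C g = Cod C f" "Cod C g = Dom C f" "g \<cdot> f = Ident C (Dom C f)" "f \<cdot> g = Ident C (Cod C f)"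
    using iso_inverse[OF assms] by metis
  have "is_coequalizer C (Ident C (Dom C f)) (Ident C (Dom C f)) f"
    unfolding is_coequalizer_def
  proof (intro conjI ballI impI)
    fix b h assume b: "b \<in> Obj C" "h \<in> hom C (Cod C (Ident C (Dom C f))) b"
    have h: "h \<in> Arr C" "Dom C h = Dom C f" "Cod C h = b" using b g Dom_in by (auto simp: hom_def)
    show "\<exists>!t. t \<in> hom C (Cod C f) b \<and> t \<cdot> f = h"
    proof (intro ex1I[of _ "h \<cdot> g"] conjI)
      show "h \<cdot> g \<in> hom C (Cod C f) b" "(h \<cdot> g) \<cdot> f = h"
        using g h by (auto simp: hom_def comp_assoc)
      fix t assume t: "t \<in> hom C (Cod C f) b \<and> t \<cdot> f = h"
      then have "t \<cdot> (f \<cdot> g) = h \<cdot> g" using g comp_assoc[of g f t] by (auto simp: hom_def)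
      then show "t = h \<cdot> g" using t g by (simp add: hom_def)
    qed
  qed (use g Dom_in in \<open>auto simp: hom_def\<close>)
  then show ?thesis using regular_epi_def by metis
qed

lemma ident_iso: "a \<in> Obj C \<Longrightarrow> is_iso C (Ident C a)"
  unfolding is_iso_def by (auto intro!: bexI[of _ "Ident C a"] simp: hom_def)

lemma pb_ex:
  assumes "\<exists>p q. is_pullback C f g p q"
  shows "is_pullback C f g (pb_fst C f g) (pb_snd C f g)"
proof -
  have "\<exists>x. (case x of (p, q) \<Rightarrow> is_pullback C f g p q)" using assms by auto
  then show ?thesis unfolding pb_fst_def pb_snd_def pb_proj_def
    by (metis (mono_tags, lifting) case_prod_beta someI_ex)
qed

lemma pb_pair:
  assumes "\<exists>p q. is_pullback C f g p q" "u \<in> Arr C" "v \<in> Arr C" "Dom C v = Dom C u"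
    "Cod C u = Dom C f" "Cod C v = Dom C g" "f \<cdot> u = g \<cdot> v"
  shows "pb_pair C f g u v \<in> Arr C" "Dom C (pb_pair C f g u v) = Dom C u"
    "Cod C (pb_pair C f g u v) = Dom C (pb_fst C f g)"
    "pb_fst C f g \<cdot> pb_pair C f g u v = u" "pb_snd C f g \<cdot> pb_pair C f g u v = v"
proof -
  note pb = pb_ex[OF assms(1)]
  obtain t where t: "t \<in> Arr C" "Dom C t = Dom C u" "Cod C t = Dom C (pb_fst C f g)"
    "pb_fst C f g \<cdot> t = u" "pb_snd C f g \<cdot> t = v"
    by (rule pullback_lift[OF pb assms(2-)]) blast
  have "pb_pair C f g u v = t"
    unfolding pb_pair_def
    by (rule the_equality) (use t pullback_unique[OF pb] in \<open>auto simp: hom_def\<close>)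
  then show "pb_pair C f g u v \<in> Arr C" "Dom C (pb_pair C f g u v) = Dom C u"
    "Cod C (pb_pair C f g u v) = Dom C (pb_fst C f g)"
    "pb_fst C f g \<cdot> pb_pair C f g u v = u" "pb_snd C f g \<cdot> pb_pair C f g u v = v"
    using t by auto
qed

end

text \<open>Coded by numbers because \<open>has_finite_limits\<close> quantifies over such
  categories: each object is its own identity arrow, \<open>3\<close> goes from \<open>0\<close> to
  \<open>2\<close> and \<open>4\<close> from \<open>1\<close> to \<open>2\<close>. In every
  composite at least one factor is an identity, and \<open>Comp\<close> returns the other.\<close>

definition cospan :: "(nat, nat) cat" where
  "cospan = \<lparr>Obj = {0, 1, 2}, Arr = {0, 1, 2, 3, 4}, Dom = (\<lambda>u. if u = 3 then 0 else if u = 4 then 1 else u),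
     Cod = (\<lambda>u. if u = 3 \<or> u = 4 then 2 else u), Ident = (\<lambda>i. i), Comp = (\<lambda>v u. if u = 3 \<or> u = 4 then u else v)\<rparr>"

lemma category_cospan: "category cospan"
  by standard (auto simp: cospan_def hom_def split: if_splits)

section \<open>Terminal object, pullbacks and image factorizations\<close>

context regular_category
begin

lemma terminal_ex: "\<exists>T. is_terminal C T"
proof -
  define J :: "(nat, nat) cat" where "J = \<lparr>Obj = {}, Arr = {}, Dom = id, Cod = id, Ident = id, Comp = (\<lambda>v u. u)\<rparr>"
  have "category J" by standard (auto simp: J_def hom_def)
  moreover have "is_functor J C (\<lambda>_. undefined) (\<lambda>_. undefined)" by (auto simp: J_def is_functor_def)
  moreover have "finite (Obj J)" "finite (Arr J)" by (simp_all add: J_def)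
  ultimately obtain L \<pi> where L: "is_limit J C (\<lambda>_. undefined) (\<lambda>_. undefined) L \<pi>"
    using finite_limits unfolding has_finite_limits_def by blast
  have "is_terminal C L"
    unfolding is_terminal_def using L by (auto simp: is_limit_def is_cone_def J_def)
  then show ?thesis by blast
qed

lemma pullback_exists:
  assumes "f \<in> Arr C" "g \<in> Arr C" "Cod C g = Cod C f"
  shows "\<exists>p q. is_pullback C f g p q"
proof -
  define Fo where "Fo i = (if i = 0 then Dom C f else if i = 1 then Dom C g else Cod C f)" for i :: nat
  define Fm where "Fm u = (if u = 3 then f else if u = 4 then g else Ident C (Fo u))" for u :: nat
  have F: "is_functor cospan C Fo Fm"
    unfolding is_functor_def using assms Dom_in Cod_in
    by (auto simp: cospan_def Fo_def Fm_def hom_def split: if_splits)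
  have "finite (Obj cospan)" "finite (Arr cospan)" by (auto simp: cospan_def)
  then obtain L \<pi> where L: "is_limit cospan C Fo Fm L \<pi>"
    using finite_limits category_cospan F unfolding has_finite_limits_def by blast
  have cone: "is_cone cospan C Fo Fm L \<pi>" using L by (simp add: is_limit_def)
  have pi: "L \<in> Obj C" "\<pi> 0 \<in> hom C L (Dom C f)" "\<pi> 1 \<in> hom C L (Dom C g)" "\<pi> 2 \<in> hom C L (Cod C f)"
    "f \<cdot> \<pi> 0 = \<pi> 2" "g \<cdot> \<pi> 1 = \<pi> 2"
    using cone by (auto simp: is_cone_def cospan_def Fo_def Fm_def)
  have cn: "is_cone cospan C Fo Fm T (\<lambda>i. if i = 0 then u else if i = 1 then v else f \<cdot> u)"
    if "u \<in> Arr C" "v \<in> Arr C" "Dom C v = T" "Dom C u = T" "Cod C u = Dom C f" "Cod C v = Dom C g" "f \<cdot> u = g \<cdot> v" for T u v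
    using that assms Dom_in by (auto simp: is_cone_def cospan_def Fo_def Fm_def hom_def)
  have ex: "\<exists>!t. t \<in> hom C T L \<and> \<pi> 0 \<cdot> t = u \<and> \<pi> 1 \<cdot> t = v \<and> \<pi> 2 \<cdot> t = f \<cdot> u"
    if h: "u \<in> Arr C" "v \<in> Arr C" "Dom C v = T" "Dom C u = T" "Cod C u = Dom C f" "Cod C v = Dom C g" "f \<cdot> u = g \<cdot> v" for T u v
  proof -
    have "\<exists>!t. t \<in> hom C T L \<and> (\<forall>i \<in> Obj cospan. \<pi> i \<cdot> t = (\<lambda>i. if i = 0 then u else if i = 1 then v else f \<cdot> u) i)"
      using L cn[OF h] unfolding is_limit_def by blast
    moreover have "(\<forall>i \<in> Obj cospan. \<pi> i \<cdot> t = (\<lambda>i. if i = 0 then u else if i = 1 then v else f \<cdot> u) i) \<longleftrightarrow> 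
      \<pi> 0 \<cdot> t = u \<and> \<pi> 1 \<cdot> t = v \<and> \<pi> 2 \<cdot> t = f \<cdot> u" for t
      by (auto simp: cospan_def)
    ultimately show ?thesis by simp
  qed
  have "is_pullback C f g (\<pi> 0) (\<pi> 1)"
    unfolding is_pullback_def
  proof (intro conjI ballI impI)
    fix T u v assume h: "T \<in> Obj C" "u \<in> hom C T (Dom C f)" "v \<in> hom C T (Dom C g)" "f \<cdot> u = g \<cdot> v"
    have *: "\<pi> 2 \<cdot> t = f \<cdot> u" if "t \<in> hom C T L" "\<pi> 0 \<cdot> t = u" for t
      using that pi(5)[symmetric] comp_assoc[of t "\<pi> 0" f] pi assms by (auto simp: hom_def)
    show "\<exists>!t. t \<in> hom C T (Dom C (\<pi> 0)) \<and> \<pi> 0 \<cdot> t = u \<and> \<pi> 1 \<cdot> t = v"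
    proof -
      have "\<exists>!t. t \<in> hom C T L \<and> \<pi> 0 \<cdot> t = u \<and> \<pi> 1 \<cdot> t = v \<and> \<pi> 2 \<cdot> t = f \<cdot> u"
        using h by (intro ex) (auto simp: hom_def)
      moreover have "Dom C (\<pi> 0) = L" using pi(2) by (simp add: hom_def)
      ultimately show ?thesis using * by (metis (no_types, lifting))
    qed
  qed (use pi assms in \<open>auto simp: hom_def\<close>)
  then show ?thesis by blast
qed

text \<open>Let \<open>m\<close> identify \<open>u\<close> and \<open>v\<close>. After pulling
  \<open>e\<close> back along \<open>u\<close> and then along \<open>v \<cdot> t1\<close>, both lift
  through \<open>e\<close>. The lifts have the same image under \<open>f\<close>, so they form an
  element of the kernel pair and \<open>e\<close> identifies them. The two regular epimorphisms
  introduced on the way are cancelled at the end.\<close>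

lemma coequalizer_kernel_pair_monic:
  assumes pb: "is_pullback C f f p q" and co: "is_coequalizer C p q e"
    and m: "m \<in> Arr C" "Dom C m = Cod C e" "f = m \<cdot> e"
  shows "monic m"
  unfolding monic_def
proof (intro conjI ballI impI)
  note pb' = pullbackD[OF pb] and co' = coequalizerD[OF co]
  have re: "regular_epi C e" using co regular_epi_def by metis
  have ea: "Dom C e = Dom C f" "Cod C m = Cod C f" using m pb' co'(1-7) by auto
  show "m \<in> Arr C" by fact
  fix u v assume h: "u \<in> Arr C" "v \<in> Arr C" "Dom C u = Dom C v" "Cod C u = Dom C m" "Cod C v = Dom C m" "m \<cdot> u = m \<cdot> v"
  obtain a1 t1 where 1: "is_pullback C e u a1 t1" using pullback_exists[of e u] co'(1-7) h m by auto
  note p1 = pullbackD[OF 1]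
  have r1: "regular_epi C t1" by (rule regular_epi_pullback_stable[OF re 1])
  obtain a2 t2 where 2: "is_pullback C e (v \<cdot> t1) a2 t2" using pullback_exists[of e "v \<cdot> t1"] co'(1-7) h m p1 by auto
  note p2 = pullbackD[OF 2]
  have r2: "regular_epi C t2" by (rule regular_epi_pullback_stable[OF re 2])
  have T: "Cod C t1 = Dom C u" "Cod C t2 = Dom C t1" "Cod C a1 = Dom C e" "Cod C a2 = Dom C e" using p1 p2 h by auto
  have "f \<cdot> (a1 \<cdot> t2) = m \<cdot> (e \<cdot> a1) \<cdot> t2"
    unfolding m(3) using m(1,2) p1(3,4,6) p2(3,4) p2(6) co'(5) T by (simp add: comp_assoc)
  also have "\<dots> = (m \<cdot> u) \<cdot> t1 \<cdot> t2"
    unfolding p1(9) using p1(4) p2(4) h(1,4) m(1,2) T by (simp add: comp_assoc)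
  also have "\<dots> = m \<cdot> (v \<cdot> t1) \<cdot> t2"
    unfolding h(6) using p1(4) p2(4) h(2,3,5) m(1,2) T by (simp add: comp_assoc)
  also have "\<dots> = f \<cdot> a2"
    unfolding m(3) p2(9)[symmetric] using m(1,2) p2(3) co'(5) T by (simp add: comp_assoc)
  finally have fa: "f \<cdot> (a1 \<cdot> t2) = f \<cdot> a2" .
  obtain t where t: "t \<in> Arr C" "Dom C t = Dom C (a1 \<cdot> t2)" "Cod C t = Dom C p" "p \<cdot> t = a1 \<cdot> t2" "q \<cdot> t = a2"
    by (rule pullback_lift[OF pb _ _ _ _ _ fa]) (use p1 p2 ea T in auto)
  have P: "Cod C t = Dom C p" "Dom C e = Cod C p" "Cod C q = Cod C p" "Dom C q = Dom C p" using t pb' co'(6) by auto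
  have "e \<cdot> a1 \<cdot> t2 = e \<cdot> p \<cdot> t" using t by simp
  also have "\<dots> = e \<cdot> q \<cdot> t" by (rule comp_square[OF co'(7)]) (use t(1) P pb'(3,4) co'(5) in auto)
  also have "\<dots> = (v \<cdot> t1) \<cdot> t2" using t p2(9) by simp
  finally have "(e \<cdot> a1) \<cdot> t2 = (v \<cdot> t1) \<cdot> t2"
    using p1(3,4,6) p2(3,4,6) co'(5) T by (simp add: comp_assoc)
  then have "(u \<cdot> t1) \<cdot> t2 = (v \<cdot> t1) \<cdot> t2" unfolding p1(9) .
  then have "u \<cdot> t1 = v \<cdot> t1" by (rule regular_epi_cancel[OF r2]) (use p1 p2 h in auto)
  then show "u = v" by (rule regular_epi_cancel[OF r1]) (use p1 p2 h in auto)
qed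

text \<open>The coequalizer \<open>e\<close> of the kernel pair factors \<open>f\<close> as
  \<open>m \<cdot> e\<close> with \<open>m\<close> monic. Extremality makes \<open>m\<close>
  invertible, and then \<open>f\<close> is a coequalizer of the same pair.\<close>

lemma extremal_regular_epi:
  assumes "extremal_epi f" shows "regular_epi C f"
proof -
  have f: "f \<in> Arr C" using assms by (simp add: extremal_epi_def)
  obtain p q where pb: "is_pullback C f f p q" using pullback_exists f by blast
  obtain e where co: "is_coequalizer C p q e" using kernel_pair_coequalizer[OF pb] by blast
  note pb' = pullbackD[OF pb] and co' = coequalizerD[OF co]
  obtain m where m: "m \<in> Arr C" "Dom C m = Cod C e" "f = m \<cdot> e"
    using co'(8)[OF f] pb' by metis
  have mm: "monic m" by (rule coequalizer_kernel_pair_monic[OF pb co m])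
  have "is_iso C m" using assms mm m co'(1-7) by (auto simp: extremal_epi_def)
  then obtain g where g: "g \<in> Arr C" "Dom C g = Cod C m" "Cod C g = Dom C m" "g \<cdot> m = Ident C (Dom C m)" "m \<cdot> g = Ident C (Cod C m)"
    using iso_inverse by metis
  have T: "Cod C f = Cod C m" "Dom C f = Dom C e" using m co'(1-7) by auto
  have "is_coequalizer C p q f"
    unfolding is_coequalizer_def
  proof (intro conjI ballI impI)
    fix b h assume "b \<in> Obj C" "h \<in> hom C (Cod C p) b" "h \<cdot> p = h \<cdot> q"
    then have h: "h \<in> Arr C" "Dom C h = Cod C p" "Cod C h = b" "h \<cdot> p = h \<cdot> q" by (auto simp: hom_def)
    obtain t where t: "t \<in> Arr C" "Dom C t = Cod C e" "Cod C t = b" "t \<cdot> e = h"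
      using co'(8) h by metis
    show "\<exists>!t. t \<in> hom C (Cod C f) b \<and> t \<cdot> f = h"
    proof (intro ex1I[of _ "t \<cdot> g"] conjI)
      have "(t \<cdot> g) \<cdot> f = t \<cdot> ((g \<cdot> m) \<cdot> e)"
        unfolding m(3) using m(1,2) t g co'(1-7) T comp_assoc[of "m \<cdot> e" g t] comp_assoc[of e m g] by auto
      then show "(t \<cdot> g) \<cdot> f = h" using t g m co'(1-7) by simp
      show "t \<cdot> g \<in> hom C (Cod C f) b" using t g m T by (auto simp: hom_def)
      fix s assume "s \<in> hom C (Cod C f) b \<and> s \<cdot> f = h"
      then have s: "s \<in> Arr C" "Dom C s = Cod C f" "Cod C s = b" "s \<cdot> f = h" by (auto simp: hom_def)
      have "(s \<cdot> m) \<cdot> e = t \<cdot> e" using s t m co'(1-7) T by (simp add: comp_assoc)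
      then have "s \<cdot> m = t" by (rule co'(9)[rotated 4]) (use s t m T in auto)
      then have "t \<cdot> g = s \<cdot> (m \<cdot> g)" using s m g T by (auto simp: comp_assoc)
      then show "s = t \<cdot> g" using g s T by simp
    qed
  qed (use pb' f m in \<open>auto simp: hom_def\<close>)
  then show ?thesis using regular_epi_def by metis
qed

text \<open>A monic \<open>m\<close> through which \<open>d \<cdot> e\<close> factors is pulled back
  along \<open>d\<close>. The pullback is invertible because \<open>e\<close> is extremal, so
  \<open>d\<close> itself factors through \<open>m\<close>, and extremality of \<open>d\<close>
  finishes.\<close>

lemma regular_epi_comp:
  assumes "regular_epi C e" "regular_epi C d" "Dom C d = Cod C e"
  shows "regular_epi C (d \<cdot> e)"
proof (rule extremal_regular_epi, unfold extremal_epi_def, intro conjI allI impI)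
  have e: "e \<in> Arr C" "d \<in> Arr C" using assms regular_epi_arr by auto
  then show "d \<cdot> e \<in> Arr C" using assms by simp
  fix m h assume m: "monic m" and h: "h \<in> Arr C" "Cod C h = Dom C m" "d \<cdot> e = m \<cdot> h"
  have ma: "m \<in> Arr C" using m monic_def by auto
  have T: "Cod C m = Cod C d" "Dom C h = Dom C e"
    using comp_simps[of e d] comp_simps[of h m] e h ma assms(3) by simp_all
  obtain p m' where pb: "is_pullback C m d p m'" using pullback_exists[of m d] ma e T by auto
  note pb' = pullbackD[OF pb]
  obtain t where t: "t \<in> Arr C" "Dom C t = Dom C h" "Cod C t = Dom C p" "p \<cdot> t = h" "m' \<cdot> t = e"
    by (rule pullback_lift[OF pb, of h e]) (use h e T assms in auto)
  have "is_iso C m'"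
    by (rule extremal_epiD[OF regular_epi_extremal[OF assms(1)] pullback_monic[OF pb m] t(1)]) (use t pb' in auto)
  then obtain g where g: "g \<in> Arr C" "Dom C g = Cod C m'" "Cod C g = Dom C m'" "m' \<cdot> g = Ident C (Cod C m')"
    using iso_inverse by metis
  have "m \<cdot> (p \<cdot> g) = d \<cdot> (m' \<cdot> g)" by (rule comp_square) (use pb' g ma in auto)
  then have "d = m \<cdot> (p \<cdot> g)" using g pb' by simp
  then show "is_iso C m"
    by (rule extremal_epiD[OF regular_epi_extremal[OF assms(2)] m, rotated -1]) (use pb' g in auto)
qed

text \<open>A monic through which \<open>f\<close> factors is also one through which
  \<open>f \<cdot> g\<close> factors, so extremality passes from the composite to
  \<open>f\<close>.\<close>

lemma regular_epi_right_factor: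
  assumes "regular_epi C (f \<cdot> g)" "f \<in> Arr C" "g \<in> Arr C" "Dom C f = Cod C g"
  shows "regular_epi C f"
proof (rule extremal_regular_epi, unfold extremal_epi_def, intro conjI allI impI)
  show "f \<in> Arr C" by fact
  fix m h assume m: "monic m" and h: "h \<in> Arr C" "Cod C h = Dom C m" "f = m \<cdot> h"
  have "m \<in> Arr C" using m monic_def by auto
  then have "f \<cdot> g = m \<cdot> (h \<cdot> g)" using h assms(2-) comp_simps[of h m] comp_assoc[of g h m] by simp
  moreover have "h \<cdot> g \<in> Arr C" "Cod C (h \<cdot> g) = Dom C m" using h assms \<open>m \<in> Arr C\<close> by auto
  ultimately show "is_iso C m" using regular_epi_extremal[OF assms(1)] m unfolding extremal_epi_def by blast
qed

text \<open>The one-element covering families of the regular topology. "Locally" means after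
  refining the stage \<open>T\<close> along such a morphism.\<close>

definition cover :: "'m \<Rightarrow> 'o \<Rightarrow> 'o \<Rightarrow> bool" where
  "cover c T' T \<longleftrightarrow> c \<in> hom C T' T \<and> regular_epi C c"

lemma coverD:
  assumes "cover c T' T"
  shows "c \<in> hom C T' T" "c \<in> Arr C" "Dom C c = T'" "Cod C c = T" "T' \<in> Obj C" "T \<in> Obj C" "regular_epi C c"
  using assms homD[of c T' T] by (auto simp: cover_def)

lemma cover_ident: "T \<in> Obj C \<Longrightarrow> cover (Ident C T) T T"
  using iso_regular_epi ident_iso Ident_in by (auto simp: cover_def)

text \<open>Successive refinements of the stage collapse into one; this is what lets solutions found
  one after the other count as a single local solution.\<close>

lemma cover_comp: "cover c T' T \<Longrightarrow> cover d T'' T' \<Longrightarrow> cover (c \<cdot> d) T'' T"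
  using regular_epi_comp[of d c] Comp_in[of d T'' T' c T] by (simp add: cover_def hom_def)

text \<open>One direction is pullback stability. For the other, take the generalized element
  \<open>Ident C B\<close>: a local lift of it exhibits a cover that factors through
  \<open>f\<close>.\<close>

lemma regular_epi_iff_local:
  assumes f: "f \<in> hom C A B"
  shows "regular_epi C f \<longleftrightarrow>
    (\<forall>T b. b \<in> hom C T B \<longrightarrow> (\<exists>T' c a. cover c T' T \<and> a \<in> hom C T' A \<and> f \<cdot> a = b \<cdot> c))"
proof
  assume r: "regular_epi C f"
  show "\<forall>T b. b \<in> hom C T B \<longrightarrow> (\<exists>T' c a. cover c T' T \<and> a \<in> hom C T' A \<and> f \<cdot> a = b \<cdot> c)"
  proof (intro allI impI)
    fix T b assume b: "b \<in> hom C T B"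
    obtain p q where pb: "is_pullback C f b p q" using pullback_exists[of f b] f b by (auto simp: hom_def)
    note pb' = pullbackD[OF pb]
    have "cover q (Dom C q) T" using regular_epi_pullback_stable[OF r pb] pb' b by (auto simp: cover_def hom_def)
    then show "\<exists>T' c a. cover c T' T \<and> a \<in> hom C T' A \<and> f \<cdot> a = b \<cdot> c"
      using pb' f by (intro exI[of _ "Dom C q"] exI[of _ q] exI[of _ p]) (auto simp: hom_def)
  qed
next
  assume *: "\<forall>T b. b \<in> hom C T B \<longrightarrow> (\<exists>T' c a. cover c T' T \<and> a \<in> hom C T' A \<and> f \<cdot> a = b \<cdot> c)"
  have B: "B \<in> Obj C" using homD f by metis
  obtain T' c a where c: "cover c T' B" "a \<in> hom C T' A" "f \<cdot> a = Ident C B \<cdot> c"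
    using *[rule_format, OF Ident_in[OF B]] by auto
  have "f \<cdot> a = c" using c coverD[OF c(1)] by simp
  then show "regular_epi C f"
    using regular_epi_right_factor[of f a] c f coverD(7)[OF c(1)] by (simp add: hom_def)
qed

end

section \<open>Complexes of chains and their nerves\<close>

text \<open>All finite simplicial sets of the development, the disks excepted, are subobjects of nerves of
  posets. Such a subobject is encoded by the set \<open>K\<close> of finite nonempty chains that are images of its
  simplices; attaching a cell or filling a horn then amounts to adding one or two chains to \<open>K\<close>.\<close>

definition nerve :: "'p::order set set \<Rightarrow> (nat \<Rightarrow> 'p) sset" where
  "nerve K = \<lparr>simplices = (\<lambda>m. {\<alpha> \<in> extensional {..m}. mono_on {..m} \<alpha> \<and> \<alpha> ` {..m} \<in> K}),
     sset_op = (\<lambda>l m \<theta> \<alpha>. compose {..l} \<alpha> \<theta>)\<rparr>"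

definition is_chain :: "'p::order set \<Rightarrow> bool" where
  "is_chain \<sigma> \<longleftrightarrow> (\<forall>x \<in> \<sigma>. \<forall>y \<in> \<sigma>. x \<le> y \<or> y \<le> x)"

definition down_closed :: "'p set set \<Rightarrow> bool" where
  "down_closed K \<longleftrightarrow> (\<forall>\<sigma> \<in> K. \<forall>\<tau> \<subseteq> \<sigma>. \<tau> \<noteq> {} \<longrightarrow> \<tau> \<in> K)"

definition complex :: "'p::order set set \<Rightarrow> bool" where
  "complex K \<longleftrightarrow> finite K \<and> down_closed K \<and> (\<forall>\<sigma> \<in> K. finite \<sigma> \<and> \<sigma> \<noteq> {} \<and> is_chain \<sigma>)"

definition faces :: "'p set \<Rightarrow> 'p set set" where
  "faces A = {\<sigma>. \<sigma> \<subseteq> A \<and> \<sigma> \<noteq> {}}"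

definition bd :: "'p set \<Rightarrow> 'p set set" where
  "bd A = faces A - {A}"

definition horn_faces :: "'p set \<Rightarrow> 'p \<Rightarrow> 'p set set" where
  "horn_faces A v = faces A - {A, A - {v}}"

text \<open>Chains of the product poset with both projections among the given cells. By
  \<open>nerve_cprod\<close> this encodes the product of simplicial sets without any enumeration of
  shuffles.\<close>

definition cprod :: "'p::order set set \<Rightarrow> 'q::order set set \<Rightarrow> ('p \<times> 'q) set set" (infixl "\<otimes>" 75) where
  "K \<otimes> M = {\<sigma>. fst ` \<sigma> \<in> K \<and> snd ` \<sigma> \<in> M \<and> is_chain \<sigma>}"

definition vmap :: "('p \<Rightarrow> 'q) \<Rightarrow> nat \<Rightarrow> (nat \<Rightarrow> 'p) \<Rightarrow> nat \<Rightarrow> 'q" where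
  "vmap u = (\<lambda>m \<alpha>. compose {..m} u \<alpha>)"

text \<open>Monotonicity is asked on cells only, because the enumeration of a chain by an initial
  segment of the numbers behaves well only on that chain.\<close>

definition cmap :: "('p::order \<Rightarrow> 'q::order) \<Rightarrow> 'p set set \<Rightarrow> 'q set set \<Rightarrow> bool" where
  "cmap u K L \<longleftrightarrow> (\<forall>\<sigma> \<in> K. mono_on \<sigma> u \<and> u ` \<sigma> \<in> L)"

definition sset_ok :: "'z sset \<Rightarrow> bool" where
  "sset_ok Z \<longleftrightarrow> (\<forall>l m. \<forall>\<theta> \<in> delta_hom l m. \<forall>z \<in> simplices Z m. sset_op Z l m \<theta> z \<in> simplices Z l)"

definition sset_mor :: "'z sset \<Rightarrow> 'w sset \<Rightarrow> (nat \<Rightarrow> 'z \<Rightarrow> 'w) \<Rightarrow> bool" where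
  "sset_mor Z W i \<longleftrightarrow> (\<forall>m. \<forall>z \<in> simplices Z m. i m z \<in> simplices W m) \<and>
     (\<forall>l m. \<forall>\<theta> \<in> delta_hom l m. \<forall>z \<in> simplices Z m. i l (sset_op Z l m \<theta> z) = sset_op W l m \<theta> (i m z))"

section \<open>Nerves of complexes and the standard simplicial sets among them\<close>

lemma nerve_simps [simp]:
  "\<alpha> \<in> simplices (nerve K) m \<longleftrightarrow> \<alpha> \<in> extensional {..m} \<and> mono_on {..m} \<alpha> \<and> \<alpha> ` {..m} \<in> K"
  "sset_op (nerve K) l m \<theta> \<alpha> = compose {..l} \<alpha> \<theta>"
  by (simp_all add: nerve_def)

lemma compose_image: "compose A g f ` A = g ` f ` A"
  by (auto simp: compose_def)

lemma delta_homD: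
  assumes "\<theta> \<in> delta_hom l m"
  shows "\<And>i. i \<le> l \<Longrightarrow> \<theta> i \<le> m" "mono_on {..l} \<theta>" "\<theta> ` {..l} \<subseteq> {..m}" "\<theta> \<in> extensional {..l}"
  using assms by (auto simp: delta_hom_def PiE_def)

lemma delta_hom_iff: "\<theta> \<in> delta_hom l m \<longleftrightarrow> \<theta> \<in> extensional {..l} \<and> mono_on {..l} \<theta> \<and> \<theta> ` {..l} \<subseteq> {..m}"
  by (auto simp: delta_hom_def PiE_def)

lemma std_simplex_nerve: "std_simplex n = nerve (faces {..n})"
  unfolding std_simplex_def nerve_def faces_def by (auto simp: fun_eq_iff delta_hom_def PiE_def)

lemma boundary_nerve: "boundary n = nerve (bd {..n})"
  unfolding boundary_def std_simplex_def nerve_def bd_def faces_def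
  by (auto simp: fun_eq_iff delta_hom_def PiE_def)

lemma horn_nerve: "horn n k = nerve (horn_faces {..n} k)"
proof -
  have "(\<exists>i \<in> {..n} - {k}. i \<notin> \<sigma>) \<longleftrightarrow> \<sigma> \<noteq> {..n} \<and> \<sigma> \<noteq> {..n} - {k}" if "\<sigma> \<subseteq> {..n}" for \<sigma> :: "nat set"
    using that by auto
  then show ?thesis
    unfolding horn_def std_simplex_def nerve_def horn_faces_def faces_def
    by (auto simp: fun_eq_iff delta_hom_iff)
qed

lemma mono_on_compose:
  assumes "mono_on {..m} \<alpha>" "\<theta> \<in> delta_hom l m"
  shows "mono_on {..l} (compose {..l} \<alpha> \<theta>)"
  using assms delta_homD[OF assms(2)] by (auto simp: mono_on_def compose_def)

lemma down_closedD: "down_closed K \<Longrightarrow> \<sigma> \<in> K \<Longrightarrow> \<tau> \<subseteq> \<sigma> \<Longrightarrow> \<tau> \<noteq> {} \<Longrightarrow> \<tau> \<in> K"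
  by (auto simp: down_closed_def)

lemma nerve_ok:
  assumes "down_closed K" shows "sset_ok (nerve K)"
proof -
  have img: "compose {..l} \<alpha> \<theta> ` {..l} \<in> K" if "\<alpha> ` {..m} \<in> K" "\<theta> \<in> delta_hom l m" for l m \<alpha> \<theta>
    by (rule down_closedD[OF assms that(1)]) (use delta_homD[OF that(2)] in \<open>auto simp: compose_image\<close>)
  have "compose {..l} \<alpha> \<theta> \<in> simplices (nerve K) l" if "\<alpha> \<in> simplices (nerve K) m" "\<theta> \<in> delta_hom l m" for l m \<alpha> \<theta>
    using that mono_on_compose[OF _ that(2), of \<alpha>] img[OF _ that(2), of \<alpha>] by simp
  then show ?thesis by (simp only: sset_ok_def nerve_simps(2)) blast
qed

lemma complexD:
  assumes "complex K"
  shows "finite K" "down_closed K" "\<And>\<sigma>. \<sigma> \<in> K \<Longrightarrow> finite \<sigma>" "{} \<notin> K" "\<And>\<sigma>. \<sigma> \<in> K \<Longrightarrow> is_chain \<sigma>"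
  using assms by (auto simp: complex_def)

lemma is_chain_subset: "is_chain \<sigma> \<Longrightarrow> \<tau> \<subseteq> \<sigma> \<Longrightarrow> is_chain \<tau>"
  by (auto simp: is_chain_def)

lemma faces_complex: "finite A \<Longrightarrow> is_chain A \<Longrightarrow> complex (faces A)"
  unfolding complex_def down_closed_def faces_def
  by (auto intro: is_chain_subset finite_subset)

lemma complex_subset:
  assumes "complex L" "K \<subseteq> L" "down_closed K" shows "complex K"
  using assms finite_subset[OF assms(2)] unfolding complex_def by blast

lemma bd_complex: "finite A \<Longrightarrow> is_chain A \<Longrightarrow> complex (bd A)"
  by (rule complex_subset[OF faces_complex]) (auto simp: bd_def down_closed_def faces_def)

lemma horn_faces_complex: "finite A \<Longrightarrow> is_chain A \<Longrightarrow> complex (horn_faces A v)"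
  by (rule complex_subset[OF faces_complex]) (unfold horn_faces_def down_closed_def faces_def, blast+)

lemma down_closedI:
  "(\<And>\<sigma> \<tau>. \<sigma> \<in> K \<Longrightarrow> \<tau> \<subseteq> \<sigma> \<Longrightarrow> \<tau> \<noteq> {} \<Longrightarrow> \<tau> \<in> K) \<Longrightarrow> down_closed K"
  by (simp add: down_closed_def)

lemma complex_Un:
  assumes "complex K" "complex L" shows "complex (K \<union> L)"
proof -
  have "down_closed (K \<union> L)"
  proof (rule down_closedI)
    fix \<sigma> \<tau> assume "\<sigma> \<in> K \<union> L" "\<tau> \<subseteq> \<sigma>" "\<tau> \<noteq> {}"
    then show "\<tau> \<in> K \<union> L"
      using down_closedD[of K \<sigma> \<tau>] down_closedD[of L \<sigma> \<tau>] complexD(2)[OF assms(1)] complexD(2)[OF assms(2)] by simp metis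
  qed
  then show ?thesis using assms by (simp add: complex_def ball_Un)
qed

lemma complex_remove:
  assumes "complex L" "\<And>\<tau>. \<tau> \<in> L \<Longrightarrow> \<not> \<sigma> \<subset> \<tau>" shows "complex (L - {\<sigma>})"
proof (rule complex_subset[OF assms(1)])
  show "down_closed (L - {\<sigma>})"
  proof (rule down_closedI)
    fix \<rho> \<tau> assume h: "\<rho> \<in> L - {\<sigma>}" "\<tau> \<subseteq> \<rho>" "\<tau> \<noteq> {}"
    then have "\<tau> \<in> L" using down_closedD[OF complexD(2)[OF assms(1)], of \<rho> \<tau>] by simp
    moreover have "\<tau> \<noteq> \<sigma>" using h assms(2)[of \<rho>] by auto
    ultimately show "\<tau> \<in> L - {\<sigma>}" by simp
  qed
qed simp

lemma complex_empty [simp]: "complex {}"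
  by (simp add: complex_def down_closed_def)

lemma is_chain_atMost [simp]: "is_chain {..n::nat}"
  by (auto simp: is_chain_def)

lemma complex_faces_sub: "complex K \<Longrightarrow> \<sigma> \<in> K \<Longrightarrow> faces \<sigma> \<subseteq> K"
  using down_closedD[OF complexD(2), of K \<sigma>] by (auto simp: faces_def)

lemma down_closed_cprod:
  assumes "down_closed K" "down_closed M" shows "down_closed (K \<otimes> M)"
  unfolding down_closed_def
proof (intro ballI allI impI)
  fix \<sigma> \<tau> assume h: "\<sigma> \<in> K \<otimes> M" "\<tau> \<subseteq> \<sigma>" "\<tau> \<noteq> {}"
  have "fst ` \<tau> \<in> K"
    by (rule down_closedD[OF assms(1), of "fst ` \<sigma>"]) (use h in \<open>auto simp: cprod_def\<close>)
  moreover have "snd ` \<tau> \<in> M"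
    by (rule down_closedD[OF assms(2), of "snd ` \<sigma>"]) (use h in \<open>auto simp: cprod_def\<close>)
  ultimately show "\<tau> \<in> K \<otimes> M" using h is_chain_subset by (auto simp: cprod_def)
qed

lemma complex_cprod:
  assumes "complex K" "complex M" shows "complex (K \<otimes> M)"
proof -
  have sub: "\<sigma> \<subseteq> \<Union>K \<times> \<Union>M" if "\<sigma> \<in> K \<otimes> M" for \<sigma>
  proof
    fix x assume "x \<in> \<sigma>"
    then have "fst x \<in> fst ` \<sigma>" "snd x \<in> snd ` \<sigma>" by auto
    then show "x \<in> \<Union>K \<times> \<Union>M" using that by (cases x) (auto simp: cprod_def)
  qed
  have fin: "finite (\<Union>K \<times> \<Union>M)" using assms by (auto simp: complex_def)
  have "finite (K \<otimes> M)" by (rule finite_subset[of _ "Pow (\<Union>K \<times> \<Union>M)"]) (use sub fin in auto)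
  moreover have "\<forall>\<sigma> \<in> K \<otimes> M. finite \<sigma>" using sub fin finite_subset by blast
  moreover have "\<forall>\<sigma> \<in> K \<otimes> M. \<sigma> \<noteq> {} \<and> is_chain \<sigma>" using assms by (auto simp: cprod_def complex_def)
  ultimately show ?thesis
    using down_closed_cprod[of K M] assms by (auto simp: complex_def)
qed

text \<open>Monotonicity into the product order is monotonicity of both components, and the chain
  condition in \<open>\<otimes>\<close> holds automatically for the image of a monotone map.\<close>

lemma nerve_cprod:
  "\<alpha> \<in> simplices (nerve (K \<otimes> M)) m \<longleftrightarrow> \<alpha> \<in> extensional {..m} \<and>
    vmap fst m \<alpha> \<in> simplices (nerve K) m \<and> vmap snd m \<alpha> \<in> simplices (nerve M) m"
proof -
  have "mono_on {..m} \<alpha> \<longleftrightarrow> mono_on {..m} (compose {..m} fst \<alpha>) \<and> mono_on {..m} (compose {..m} snd \<alpha>)"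
    by (auto simp: mono_on_def compose_def less_eq_prod_def)
  moreover have "is_chain (\<alpha> ` {..m})" if "mono_on {..m} \<alpha>"
    using that by (auto simp: is_chain_def mono_on_def) (metis nle_le)
  ultimately show ?thesis
    by (auto simp: vmap_def cprod_def compose_image image_image)
qed

section \<open>Enumeration of chains and induction over cells\<close>

lemma chain_enum:
  fixes \<sigma> :: "'p::order set"
  assumes "finite \<sigma>" "is_chain \<sigma>" "\<sigma> \<noteq> {}"
  obtains n r s where "card \<sigma> = Suc n" "mono_on \<sigma> r" "r ` \<sigma> = {..n}" "mono_on {..n} s" "s ` {..n} = \<sigma>"
    "\<And>x. x \<in> \<sigma> \<Longrightarrow> s (r x) = x" "\<And>i. i \<le> n \<Longrightarrow> r (s i) = (i::nat)"
proof -
  obtain n where n: "card \<sigma> = Suc n" using assms by (metis card_gt_0_iff gr0_implies_Suc)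
  \<comment> \<open>The rank: the number of strictly smaller elements. On a chain it is strictly
    monotone, hence injective, and counting shows that its image is \<open>{..n}\<close>.\<close>
  define r where "r x = card {y \<in> \<sigma>. y < x}" for x
  have strict: "r x < r y" if "x \<in> \<sigma>" "y \<in> \<sigma>" "x < y" for x y
    unfolding r_def by (rule psubset_card_mono) (use assms that in auto)
  have mono: "r x \<le> r y" if "x \<in> \<sigma>" "y \<in> \<sigma>" "x \<le> y" for x y
    using strict[of x y] that by (cases "x = y") (auto simp: order_le_less)
  have cmp: "x < y \<or> x = y \<or> y < x" if "x \<in> \<sigma>" "y \<in> \<sigma>" for x y
    using assms(2) that by (auto simp: is_chain_def order_le_less)
  have inj: "inj_on r \<sigma>"
    by (rule inj_onI) (metis cmp strict less_irrefl)
  have "r x < card \<sigma>" if "x \<in> \<sigma>" for x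
    unfolding r_def by (rule psubset_card_mono) (use assms that in auto)
  then have "r ` \<sigma> \<subseteq> {..n}" using n by (auto simp: less_Suc_eq_le)
  then have img: "r ` \<sigma> = {..n}"
    by (intro card_subset_eq) (use n card_image[OF inj] in auto)
  define s where "s = inv_into \<sigma> r"
  have sr: "s (r x) = x" if "x \<in> \<sigma>" for x using that inj by (simp add: s_def)
  have rs: "r (s i) = i" and ss: "s i \<in> \<sigma>" if "i \<le> n" for i
    using that img by (auto simp: s_def f_inv_into_f inv_into_into)
  have "mono_on {..n} s"
  proof (rule mono_onI)
    fix i j assume h: "i \<in> {..n}" "j \<in> {..n}" "i \<le> j"
    show "s i \<le> s j"
      using cmp[of "s i" "s j"] strict[of "s j" "s i"] h rs ss by (auto simp: order_le_less)
  qed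
  moreover have "s ` {..n} = \<sigma>" using sr ss img by (force simp: image_iff)
  ultimately show thesis
    using that[of n r s] n mono img sr rs by (auto simp: mono_on_def)
qed

text \<open>A cell of maximal cardinality is a proper face of no other, so the complex is the union
  of the remaining cells and a simplex, meeting exactly in the boundary of that simplex.\<close>

lemma complex_step:
  assumes "complex L" "\<sigma> \<in> L" "\<And>\<tau>. \<tau> \<in> L \<Longrightarrow> card \<tau> \<le> card \<sigma>"
  shows "complex (L - {\<sigma>})" "bd \<sigma> \<subseteq> L - {\<sigma>}" "(L - {\<sigma>}) \<inter> faces \<sigma> = bd \<sigma>" "(L - {\<sigma>}) \<union> faces \<sigma> = L"
proof -
  have "\<not> \<sigma> \<subset> \<tau>" if "\<tau> \<in> L" for \<tau>
    using assms(3)[OF that] psubset_card_mono[of \<tau> \<sigma>] complexD(3)[OF assms(1) that] by auto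
  then show "complex (L - {\<sigma>})" by (rule complex_remove[OF assms(1)])
  show "bd \<sigma> \<subseteq> L - {\<sigma>}" "(L - {\<sigma>}) \<inter> faces \<sigma> = bd \<sigma>"
    using complex_faces_sub[OF assms(1,2)] by (auto simp: bd_def)
  show "(L - {\<sigma>}) \<union> faces \<sigma> = L"
    using complex_faces_sub[OF assms(1,2)] assms(2) complexD(4)[OF assms(1)] by (auto simp: faces_def)
qed

lemma ex_max_card:
  assumes "finite A" "A \<noteq> {}" obtains \<sigma> where "\<sigma> \<in> A" "\<And>\<tau>. \<tau> \<in> A \<Longrightarrow> card \<tau> \<le> card \<sigma>"
proof -
  have "Max (card ` A) \<in> card ` A" using assms by simp
  then obtain \<sigma> where "\<sigma> \<in> A" "card \<sigma> = Max (card ` A)" by auto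
  then show thesis using that assms(1) by simp
qed

text \<open>Cells are attached in the reverse of the order in which they can be removed: among the
  cells outside \<open>K\<close> one of maximal cardinality goes last, so its whole boundary is
  present when it is attached.\<close>

lemma cell_induct [consumes 3, case_names base step]:
  assumes "complex L" "complex K" "K \<subseteq> L"
    and base: "P K"
    and step: "\<And>\<sigma> M. complex M \<Longrightarrow> K \<subseteq> M \<Longrightarrow> M \<subseteq> L \<Longrightarrow> \<sigma> \<in> L \<Longrightarrow> \<sigma> \<notin> M \<Longrightarrow> M \<inter> faces \<sigma> = bd \<sigma> \<Longrightarrow>
      complex (M \<union> faces \<sigma>) \<Longrightarrow> P M \<Longrightarrow> P (M \<union> faces \<sigma>)"
  shows "P L"
proof -
  have "P M" if "complex M" "K \<subseteq> M" "M \<subseteq> L" for M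
    using that
  proof (induction "card (M - K)" arbitrary: M rule: less_induct)
    case less
    have fin: "finite (M - K)" using less.prems complexD(1) by auto
    show ?case
    proof (cases "M - K = {}")
      case True then show ?thesis using base less.prems by (metis Diff_eq_empty_iff subset_antisym)
    next
      case False
      obtain \<sigma> where s: "\<sigma> \<in> M - K" "\<And>\<tau>. \<tau> \<in> M - K \<Longrightarrow> card \<tau> \<le> card \<sigma>" using ex_max_card[OF fin False] by metis
      \<comment> \<open>A cell properly containing \<open>\<sigma>\<close> cannot lie in
        \<open>K\<close>, since \<open>K\<close> would then contain \<open>\<sigma>\<close>; and
        outside \<open>K\<close> it would exceed the maximal cardinality.\<close>
      have nK: "\<not> \<sigma> \<subset> \<tau>" if "\<tau> \<in> M" for \<tau>
      proof
        assume a: "\<sigma> \<subset> \<tau>"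
        have "\<sigma> \<noteq> {}" using s(1) complexD(4)[OF less.prems(1)] by auto
        then have "\<tau> \<notin> K" using down_closedD[OF complexD(2)[OF assms(2)], of \<tau> \<sigma>] a s(1) by auto
        then show False using s(2)[of \<tau>] that psubset_card_mono[OF _ a] complexD(3)[OF less.prems(1) that] by auto
      qed
      let ?M = "M - {\<sigma>}"
      have c: "complex ?M" by (rule complex_remove[OF less.prems(1) nK])
      have "card (?M - K) < card (M - K)" using s fin by (intro psubset_card_mono) auto
      then have "P ?M" using less.hyps[of ?M] c less.prems s(1) by auto
      moreover have i: "?M \<inter> faces \<sigma> = bd \<sigma>"
        using complex_faces_sub[OF less.prems(1), of \<sigma>] s(1) by (auto simp: bd_def)
      moreover have u: "?M \<union> faces \<sigma> = M"
        using complex_faces_sub[OF less.prems(1), of \<sigma>] s(1) complexD(4)[OF less.prems(1)] by (auto simp: faces_def)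
      moreover have "K \<subseteq> ?M" "?M \<subseteq> L" "\<sigma> \<in> L" "\<sigma> \<notin> ?M" using s(1) less.prems(2,3) by auto
      ultimately show ?thesis using step[of ?M \<sigma>] c less.prems(1) by simp
    qed
  qed
  then show ?thesis using assms by auto
qed

section \<open>Simplicial maps into generalized elements\<close>

context category
begin

text \<open>Unlike the elements of \<open>sset_maps\<close>, the maps below are not extensional, so that restriction to a
  subcomplex is the identity on functions; equality is replaced by \<open>agree\<close>.\<close>

definition smap :: "'z sset \<Rightarrow> 'o \<Rightarrow> ('o, 'm) sobj \<Rightarrow> (nat \<Rightarrow> 'z \<Rightarrow> 'm) \<Rightarrow> bool" where
  "smap Z T X \<phi> \<longleftrightarrow> (\<forall>m. \<forall>z \<in> simplices Z m. \<phi> m z \<in> hom C T (level X m)) \<and>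
     (\<forall>l m. \<forall>\<theta> \<in> delta_hom l m. \<forall>z \<in> simplices Z m. \<phi> l (sset_op Z l m \<theta> z) = sobj_op X l m \<theta> \<cdot> \<phi> m z)"

definition stage :: "(nat \<Rightarrow> 'z \<Rightarrow> 'm) \<Rightarrow> 'm \<Rightarrow> nat \<Rightarrow> 'z \<Rightarrow> 'm" (infixl "\<star>" 70) where
  "\<phi> \<star> c = (\<lambda>m z. \<phi> m z \<cdot> c)"

definition push :: "('o, 'm) smor \<Rightarrow> (nat \<Rightarrow> 'z \<Rightarrow> 'm) \<Rightarrow> nat \<Rightarrow> 'z \<Rightarrow> 'm" (infixr "\<odot>" 75) where
  "f \<odot> \<phi> = (\<lambda>m z. component f m \<cdot> \<phi> m z)"

end

definition pull :: "(nat \<Rightarrow> 'z \<Rightarrow> 'w) \<Rightarrow> (nat \<Rightarrow> 'w \<Rightarrow> 'm) \<Rightarrow> nat \<Rightarrow> 'z \<Rightarrow> 'm" where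
  "pull i \<phi> = (\<lambda>m z. \<phi> m (i m z))"

definition agree :: "'z sset \<Rightarrow> (nat \<Rightarrow> 'z \<Rightarrow> 'm) \<Rightarrow> (nat \<Rightarrow> 'z \<Rightarrow> 'm) \<Rightarrow> bool" where
  "agree Z \<phi> \<psi> \<longleftrightarrow> (\<forall>m. \<forall>z \<in> simplices Z m. \<phi> m z = \<psi> m z)"

section \<open>Calculus of simplicial maps up to agreement\<close>

lemma agree_refl [simp]: "agree Z \<phi> \<phi>" by (simp add: agree_def)
lemma agree_sym: "agree Z \<phi> \<psi> \<Longrightarrow> agree Z \<psi> \<phi>" by (simp add: agree_def)
lemma agree_trans [trans]: "agree Z \<phi> \<psi> \<Longrightarrow> agree Z \<psi> \<chi> \<Longrightarrow> agree Z \<phi> \<chi>" by (simp add: agree_def)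

lemma agree_mono: "agree (nerve L) \<phi> \<psi> \<Longrightarrow> K \<subseteq> L \<Longrightarrow> agree (nerve K) \<phi> \<psi>"
  by (auto simp: agree_def)

lemma agree_Un: "agree (nerve K) \<phi> \<psi> \<Longrightarrow> agree (nerve L) \<phi> \<psi> \<Longrightarrow> agree (nerve (K \<union> L)) \<phi> \<psi>"
  by (auto simp: agree_def)

lemma agree_pull: "agree W \<phi> \<psi> \<Longrightarrow> sset_mor Z W i \<Longrightarrow> agree Z (pull i \<phi>) (pull i \<psi>)"
  by (auto simp: agree_def sset_mor_def pull_def)

lemma pull_vmap_comp [simp]: "pull (vmap u) (pull (vmap v) \<phi>) = pull (vmap (v \<circ> u)) \<phi>"
proof -
  have "compose {..m} v (compose {..m} u \<alpha>) = compose {..m} (v \<circ> u) \<alpha>" for m :: nat and \<alpha>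
    by (auto simp: compose_def fun_eq_iff)
  then show ?thesis by (simp add: pull_def vmap_def)
qed

lemma agree_pull_cong:
  assumes "\<And>\<sigma> x. \<sigma> \<in> K \<Longrightarrow> x \<in> \<sigma> \<Longrightarrow> u x = v x"
  shows "agree (nerve K) (pull (vmap u) \<phi>) (pull (vmap v) \<phi>)"
proof -
  have "compose {..m} u \<alpha> = compose {..m} v \<alpha>" if "\<alpha> ` {..m} \<in> K" for m :: nat and \<alpha>
    using assms[OF that] by (auto simp: compose_def fun_eq_iff)
  then show ?thesis by (auto simp: agree_def pull_def vmap_def)
qed

lemma agree_pull_ident:
  assumes "\<And>\<sigma> x. \<sigma> \<in> K \<Longrightarrow> x \<in> \<sigma> \<Longrightarrow> u x = x"
  shows "agree (nerve K) (pull (vmap u) \<phi>) \<phi>"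
proof -
  have "compose {..m} u \<alpha> = \<alpha>" if "\<alpha> ` {..m} \<in> K" "\<alpha> \<in> extensional {..m}" for m :: nat and \<alpha>
    using assms[OF that(1)] that(2) by (auto simp: compose_def fun_eq_iff extensional_def)
  then show ?thesis by (auto simp: agree_def pull_def vmap_def)
qed

lemma sset_mor_vmap:
  assumes "cmap u K L" shows "sset_mor (nerve K) (nerve L) (vmap u)"
  unfolding sset_mor_def
proof (intro conjI allI ballI)
  fix m \<alpha> assume "\<alpha> \<in> simplices (nerve K) m"
  then have a: "mono_on {..m} \<alpha>" "\<alpha> ` {..m} \<in> K" by auto
  then have "mono_on (\<alpha> ` {..m}) u" "u ` \<alpha> ` {..m} \<in> L" using assms by (auto simp: cmap_def)
  then show "vmap u m \<alpha> \<in> simplices (nerve L) m"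
    using a by (auto simp: vmap_def compose_image mono_on_def) (simp add: compose_def)
next
  fix l m \<theta> \<alpha> assume t: "\<theta> \<in> delta_hom l m"
  show "vmap u l (sset_op (nerve K) l m \<theta> \<alpha>) = sset_op (nerve L) l m \<theta> (vmap u m \<alpha>)"
    using delta_homD(1)[OF t] by (auto simp: vmap_def compose_def fun_eq_iff)
qed

lemma sset_mor_incl: "K \<subseteq> L \<Longrightarrow> sset_mor (nerve K) (nerve L) (\<lambda>m \<alpha>. \<alpha>)"
  by (auto simp: sset_mor_def)

lemma pull_incl [simp]: "pull (\<lambda>m \<alpha>. \<alpha>) \<phi> = \<phi>"
  by (simp add: pull_def)

lemma agree_pull_vmap: "agree (nerve L) \<phi> \<psi> \<Longrightarrow> cmap u K L \<Longrightarrow> agree (nerve K) (pull (vmap u) \<phi>) (pull (vmap u) \<psi>)"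
  using agree_pull sset_mor_vmap by blast

text \<open>Passes from maps considered up to \<open>agree\<close> to the extensional functions of
  which \<open>sset_maps\<close> consists.\<close>

definition ext_map :: "'z sset \<Rightarrow> (nat \<Rightarrow> 'z \<Rightarrow> 'm) \<Rightarrow> nat \<Rightarrow> 'z \<Rightarrow> 'm" where
  "ext_map Z \<phi> = (\<lambda>m. \<lambda>z \<in> simplices Z m. \<phi> m z)"

lemma agree_ext_map [simp]: "agree Z (ext_map Z \<phi>) \<phi>"
  by (simp add: agree_def ext_map_def)

lemma ext_map_eqI: "agree Z \<phi> \<psi> \<Longrightarrow> ext_map Z \<phi> = ext_map Z \<psi>"
  by (auto simp: agree_def ext_map_def fun_eq_iff)

context category
begin

lemma smapD:
  assumes "smap Z T X \<phi>"
  shows "z \<in> simplices Z m \<Longrightarrow> \<phi> m z \<in> hom C T (level X m)"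
    "\<theta> \<in> delta_hom l m \<Longrightarrow> z \<in> simplices Z m \<Longrightarrow> \<phi> l (sset_op Z l m \<theta> z) = sobj_op X l m \<theta> \<cdot> \<phi> m z"
  using assms by (auto simp: smap_def)

lemma sobjD:
  assumes "simplicial_object C X"
  shows "level X n \<in> Obj C" "\<theta> \<in> delta_hom m n \<Longrightarrow> sobj_op X m n \<theta> \<in> hom C (level X n) (level X m)"
    "\<theta> \<notin> delta_hom m n \<Longrightarrow> sobj_op X m n \<theta> = undefined"
    "sobj_op X n n (\<lambda>i \<in> {..n}. i) = Ident C (level X n)"
    "\<eta> \<in> delta_hom l m \<Longrightarrow> \<theta> \<in> delta_hom m n \<Longrightarrow>
      sobj_op X l n (compose {..l} \<theta> \<eta>) = sobj_op X l m \<eta> \<cdot> sobj_op X m n \<theta>"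
  using assms unfolding simplicial_object_def by metis+

lemma smorD:
  assumes "simplicial_morphism C f"
  shows "simplicial_object C (sdom f)" "simplicial_object C (scod f)"
    "component f n \<in> hom C (level (sdom f) n) (level (scod f) n)"
    "\<theta> \<in> delta_hom m n \<Longrightarrow> component f m \<cdot> sobj_op (sdom f) m n \<theta> = sobj_op (scod f) m n \<theta> \<cdot> component f n"
  using assms unfolding simplicial_morphism_def by metis+

lemma smap_cong:
  assumes "smap Z T X \<phi>" "agree Z \<phi> \<psi>" "sset_ok Z" shows "smap Z T X \<psi>"
  using assms unfolding smap_def agree_def sset_ok_def by metis

lemma smap_pull: "smap W T X \<phi> \<Longrightarrow> sset_mor Z W i \<Longrightarrow> smap Z T X (pull i \<phi>)"
  by (auto simp: smap_def sset_mor_def pull_def)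

lemma smap_stage:
  assumes X: "simplicial_object C X" and "smap Z T X \<phi>" "c \<in> hom C T' T"
  shows "smap Z T' X (\<phi> \<star> c)"
  unfolding smap_def stage_def
proof (intro conjI allI ballI)
  show "\<phi> m z \<cdot> c \<in> hom C T' (level X m)" if "z \<in> simplices Z m" for m z
    using Comp_in assms(3) smapD(1)[OF assms(2) that] by blast
  fix l m \<theta> z assume h: "\<theta> \<in> delta_hom l m" "z \<in> simplices Z m"
  show "\<phi> l (sset_op Z l m \<theta> z) \<cdot> c = sobj_op X l m \<theta> \<cdot> \<phi> m z \<cdot> c"
    unfolding smapD(2)[OF assms(2) h]
    by (rule assoc[OF assms(3) smapD(1)[OF assms(2) h(2)] sobjD(2)[OF X h(1)]])
qed

lemma smap_push:
  assumes f: "simplicial_morphism C f" and p: "smap Z T (sdom f) \<phi>"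
  shows "smap Z T (scod f) (f \<odot> \<phi>)"
  unfolding smap_def push_def
proof (intro conjI allI ballI)
  show "component f m \<cdot> \<phi> m z \<in> hom C T (level (scod f) m)" if "z \<in> simplices Z m" for m z
    using Comp_in smorD(3)[OF f] smapD(1)[OF p that] by blast
  fix l m \<theta> z assume h: "\<theta> \<in> delta_hom l m" "z \<in> simplices Z m"
  note X = sobjD(2)[OF smorD(1)[OF f] h(1)] and Y = sobjD(2)[OF smorD(2)[OF f] h(1)] and z = smapD(1)[OF p h(2)]
  have "component f l \<cdot> \<phi> l (sset_op Z l m \<theta> z) = (component f l \<cdot> sobj_op (sdom f) l m \<theta>) \<cdot> \<phi> m z"
    unfolding smapD(2)[OF p h] by (rule assoc[OF z X smorD(3)[OF f], symmetric])
  also have "\<dots> = sobj_op (scod f) l m \<theta> \<cdot> component f m \<cdot> \<phi> m z"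
    unfolding smorD(4)[OF f h(1)] by (rule assoc[OF z smorD(3)[OF f] Y])
  finally show "component f l \<cdot> \<phi> l (sset_op Z l m \<theta> z) = sobj_op (scod f) l m \<theta> \<cdot> component f m \<cdot> \<phi> m z" .
qed

lemma stage_stage:
  assumes "smap Z T X \<phi>" "c \<in> hom C T' T" "d \<in> hom C T'' T'"
  shows "agree Z (\<phi> \<star> c \<star> d) (\<phi> \<star> (c \<cdot> d))"
  using assoc[OF assms(3,2) smapD(1)[OF assms(1)]] by (auto simp: agree_def stage_def)

lemma push_stage:
  assumes "simplicial_morphism C f" "smap Z T (sdom f) \<phi>" "c \<in> hom C T' T"
  shows "agree Z ((f \<odot> \<phi>) \<star> c) (f \<odot> (\<phi> \<star> c))"
  using assoc[OF assms(3) smapD(1)[OF assms(2)] smorD(3)[OF assms(1)]] by (auto simp: agree_def stage_def push_def)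

lemma stage_ident:
  assumes "smap Z T X \<phi>" shows "agree Z (\<phi> \<star> Ident C T) \<phi>"
  using Ident_right[OF smapD(1)[OF assms]] by (auto simp: agree_def stage_def)

lemma agree_stage: "agree Z \<phi> \<psi> \<Longrightarrow> agree Z (\<phi> \<star> c) (\<psi> \<star> c)"
  by (simp add: agree_def stage_def)

lemma agree_push: "agree Z \<phi> \<psi> \<Longrightarrow> agree Z (f \<odot> \<phi>) (f \<odot> \<psi>)"
  by (simp add: agree_def push_def)

lemma pull_stage [simp]: "pull i (\<phi> \<star> c) = pull i \<phi> \<star> c"
  by (simp add: pull_def stage_def)

lemma pull_push [simp]: "pull i (f \<odot> \<phi>) = f \<odot> pull i \<phi>"
  by (simp add: pull_def push_def)

lemma smap_mono: "smap (nerve L) T X \<phi> \<Longrightarrow> K \<subseteq> L \<Longrightarrow> smap (nerve K) T X \<phi>"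
  by (auto simp: smap_def)

lemma smap_pull_vmap: "smap (nerve L) T X \<phi> \<Longrightarrow> cmap u K L \<Longrightarrow> smap (nerve K) T X (pull (vmap u) \<phi>)"
  using smap_pull sset_mor_vmap by blast

definition glue :: "'p set set \<Rightarrow> (nat \<Rightarrow> (nat \<Rightarrow> 'p) \<Rightarrow> 'm) \<Rightarrow> (nat \<Rightarrow> (nat \<Rightarrow> 'p) \<Rightarrow> 'm) \<Rightarrow> nat \<Rightarrow> (nat \<Rightarrow> 'p) \<Rightarrow> 'm" where
  "glue K \<phi> \<psi> = (\<lambda>m \<alpha>. if \<alpha> ` {..m} \<in> K then \<phi> m \<alpha> else \<psi> m \<alpha>)"

lemma glue_agree:
  "agree (nerve K) (glue K \<phi> \<psi>) \<phi>"
  "agree (nerve (K \<inter> L)) \<phi> \<psi> \<Longrightarrow> agree (nerve L) (glue K \<phi> \<psi>) \<psi>"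
  by (auto simp: agree_def glue_def)

text \<open>The image of a simplex is a single cell, so each simplex of the union lies in one of the
  two nerves, together with everything that the operators produce from it.\<close>

lemma smap_Un:
  assumes "down_closed K" "down_closed L" "smap (nerve K) T X \<phi>" "smap (nerve L) T X \<phi>"
  shows "smap (nerve (K \<union> L)) T X \<phi>"
  using assms unfolding smap_def by auto

lemma smap_glue:
  assumes "down_closed K" "down_closed L" "smap (nerve K) T X \<phi>" "smap (nerve L) T X \<psi>"
    "agree (nerve (K \<inter> L)) \<phi> \<psi>"
  shows "smap (nerve (K \<union> L)) T X (glue K \<phi> \<psi>)"
proof (rule smap_Un[OF assms(1,2)])
  show "smap (nerve K) T X (glue K \<phi> \<psi>)"
    by (rule smap_cong[OF assms(3) agree_sym[OF glue_agree(1)] nerve_ok[OF assms(1)]])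
  show "smap (nerve L) T X (glue K \<phi> \<psi>)"
    by (rule smap_cong[OF assms(4) agree_sym[OF glue_agree(2)[OF assms(5)]] nerve_ok[OF assms(2)]])
qed

lemma smap_ext_map:
  assumes "sset_ok Z"
  shows "smap Z T X \<phi> \<Longrightarrow> ext_map Z \<phi> \<in> sset_maps Z (hom_sset C T X)"
    "\<phi> \<in> sset_maps Z (hom_sset C T X) \<Longrightarrow> smap Z T X \<phi> \<and> ext_map Z \<phi> = \<phi>"
proof -
  show "ext_map Z \<phi> \<in> sset_maps Z (hom_sset C T X)" if "smap Z T X \<phi>"
    using that assms unfolding sset_maps_def smap_def hom_sset_def ext_map_def sset_ok_def by auto
  show "smap Z T X \<phi> \<and> ext_map Z \<phi> = \<phi>" if "\<phi> \<in> sset_maps Z (hom_sset C T X)"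
    using that unfolding sset_maps_def smap_def hom_sset_def ext_map_def
    by (auto simp: fun_eq_iff PiE_def extensional_def)
qed

end

section \<open>Weighted limits\<close>

context category
begin

text \<open>The weighted limit by its universal element: by the Yoneda lemma the natural bijections
  amount to one universal simplicial map \<open>\<upsilon>\<close> at the stage
  \<open>L\<close>.\<close>

definition wlim_cone :: "'z sset \<Rightarrow> ('o, 'm) sobj \<Rightarrow> 'o \<Rightarrow> (nat \<Rightarrow> 'z \<Rightarrow> 'm) \<Rightarrow> bool" where
  "wlim_cone Z X L \<upsilon> \<longleftrightarrow> L \<in> Obj C \<and> smap Z L X \<upsilon> \<and>
     (\<forall>T \<in> Obj C. \<forall>\<phi>. smap Z T X \<phi> \<longrightarrow> (\<exists>!t. t \<in> hom C T L \<and> agree Z (\<upsilon> \<star> t) \<phi>))"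

definition has_wlim :: "'z sset \<Rightarrow> ('o, 'm) sobj \<Rightarrow> bool" where
  "has_wlim Z X \<longleftrightarrow> sset_ok Z \<and> simplicial_object C X \<and> (\<exists>L \<upsilon>. wlim_cone Z X L \<upsilon>)"

definition wmor :: "'z sset \<Rightarrow> ('o, 'm) sobj \<Rightarrow> 'o \<Rightarrow> (nat \<Rightarrow> 'z \<Rightarrow> 'm) \<Rightarrow> 'm" where
  "wmor Z X T \<phi> = wlim_bij C Z X T (ext_map Z \<phi>)"

lemma wlim_coneD:
  assumes "wlim_cone Z X L \<upsilon>"
  shows "L \<in> Obj C" "smap Z L X \<upsilon>"
    "T \<in> Obj C \<Longrightarrow> smap Z T X \<phi> \<Longrightarrow> \<exists>!t. t \<in> hom C T L \<and> agree Z (\<upsilon> \<star> t) \<phi>"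
  using assms by (simp_all add: wlim_cone_def)

lemma wlim_cone_lift:
  assumes "wlim_cone Z X L \<upsilon>" "T \<in> Obj C" "smap Z T X \<phi>"
  obtains t where "t \<in> hom C T L" "agree Z (\<upsilon> \<star> t) \<phi>"
  using wlim_coneD(3)[OF assms] by blast

lemma wlim_cone_unique:
  assumes "wlim_cone Z X L \<upsilon>" "simplicial_object C X" "t \<in> hom C T L" "t' \<in> hom C T L" "agree Z (\<upsilon> \<star> t) (\<upsilon> \<star> t')"
  shows "t = t'"
proof -
  have "\<exists>!s. s \<in> hom C T L \<and> agree Z (\<upsilon> \<star> s) (\<upsilon> \<star> t')"
    by (rule wlim_coneD(3)[OF assms(1)])
      (use homD(4)[OF assms(3)] smap_stage[OF assms(2) wlim_coneD(2)[OF assms(1)] assms(4)] in auto)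
  then show ?thesis using assms(3-5) by auto
qed

text \<open>From the universal map to natural bijections: \<open>B\<close> inverts composition with
  \<open>\<upsilon>\<close>, and naturality is the uniqueness of the classifying morphism.\<close>

lemma wlim_cone_weighted:
  assumes ok: "sset_ok Z" and X: "simplicial_object C X" and c: "wlim_cone Z X L \<upsilon>"
  shows "\<exists>\<beta>. is_weighted_limit C Z X L \<beta>"
proof -
  define B where "B T \<phi> = (THE t. t \<in> hom C T L \<and> agree Z (\<upsilon> \<star> t) \<phi>)" for T \<phi>
  have B: "B T \<phi> \<in> hom C T L \<and> agree Z (\<upsilon> \<star> B T \<phi>) \<phi>" if "T \<in> Obj C" "smap Z T X \<phi>" for T \<phi>
    unfolding B_def by (rule theI') (rule wlim_coneD(3)[OF c that])
  have Bu: "B T \<phi> = t" if "t \<in> hom C T L" "agree Z (\<upsilon> \<star> t) \<phi>" for T \<phi> t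
  proof -
    have "smap Z T X \<phi>" using smap_cong[OF smap_stage[OF X wlim_coneD(2)[OF c] that(1)] that(2) ok] .
    then have "\<exists>!t. t \<in> hom C T L \<and> agree Z (\<upsilon> \<star> t) \<phi>" using wlim_coneD(3)[OF c] homD(4)[OF that(1)] by blast
    then show ?thesis unfolding B_def using that by (intro the1_equality) auto
  qed
  have "is_weighted_limit C Z X L B"
    unfolding is_weighted_limit_def
  proof (intro conjI ballI)
    show "L \<in> Obj C" by (rule wlim_coneD(1)[OF c])
    fix T assume T: "T \<in> Obj C"
    show "bij_betw (B T) (sset_maps Z (hom_sset C T X)) (hom C T L)"
      unfolding bij_betw_def
    proof
      show "inj_on (B T) (sset_maps Z (hom_sset C T X))"
      proof (rule inj_onI)
        fix \<phi> \<psi> assume h: "\<phi> \<in> sset_maps Z (hom_sset C T X)" "\<psi> \<in> sset_maps Z (hom_sset C T X)" "B T \<phi> = B T \<psi>"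
        note p = smap_ext_map(2)[OF ok h(1)] smap_ext_map(2)[OF ok h(2)]
        have "agree Z (\<upsilon> \<star> B T \<phi>) \<phi>" "agree Z (\<upsilon> \<star> B T \<psi>) \<psi>" using B[OF T] p by auto
        then have "agree Z \<phi> \<psi>" unfolding h(3) using agree_sym agree_trans by blast
        then have "ext_map Z \<phi> = ext_map Z \<psi>" by (rule ext_map_eqI)
        then show "\<phi> = \<psi>" using p by simp
      qed
      show "B T ` sset_maps Z (hom_sset C T X) = hom C T L"
      proof
        show "B T ` sset_maps Z (hom_sset C T X) \<subseteq> hom C T L" using B[OF T] smap_ext_map(2)[OF ok] by blast
        show "hom C T L \<subseteq> B T ` sset_maps Z (hom_sset C T X)"
        proof
          fix t assume t: "t \<in> hom C T L"
          have "B T (ext_map Z (\<upsilon> \<star> t)) = t" by (rule Bu[OF t]) (simp add: agree_sym)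
          then show "t \<in> B T ` sset_maps Z (hom_sset C T X)"
            using smap_ext_map(1)[OF ok smap_stage[OF X wlim_coneD(2)[OF c] t]] by (metis image_eqI)
        qed
      qed
    qed
  next
    fix T T' t \<phi> assume h: "T \<in> Obj C" "T' \<in> Obj C" "t \<in> hom C T' T" "\<phi> \<in> sset_maps Z (hom_sset C T X)"
    have s: "smap Z T X \<phi>" using smap_ext_map(2)[OF ok h(4)] by simp
    note b = B[OF h(1) s]
    have "B T' (ext_map Z (\<phi> \<star> t)) = B T \<phi> \<cdot> t"
    proof (rule Bu)
      show "B T \<phi> \<cdot> t \<in> hom C T' L" using b h(3) Comp_in by blast
      have "agree Z (\<upsilon> \<star> (B T \<phi> \<cdot> t)) (\<upsilon> \<star> B T \<phi> \<star> t)"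
        using stage_stage[OF wlim_coneD(2)[OF c] _ h(3)] b agree_sym by blast
      also have "agree Z (\<upsilon> \<star> B T \<phi> \<star> t) (\<phi> \<star> t)" using b agree_stage by blast
      also have "agree Z (\<phi> \<star> t) (ext_map Z (\<phi> \<star> t))" by (simp add: agree_sym)
      finally show "agree Z (\<upsilon> \<star> (B T \<phi> \<cdot> t)) (ext_map Z (\<phi> \<star> t))" .
    qed
    then show "B T' (\<lambda>n. \<lambda>z \<in> simplices Z n. \<phi> n z \<cdot> t) = B T \<phi> \<cdot> t"
      by (simp add: ext_map_def stage_def)
  qed
  then show ?thesis by blast
qed

text \<open>The converse passage. It applies to any weighted limit, hence to the one that
  \<open>wlim_data\<close> happens to choose, and shows that \<open>wlim_univ\<close> is a universal
  map for it.\<close>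

lemma weighted_wlim_cone:
  assumes ok: "sset_ok Z" and X: "simplicial_object C X" and w: "is_weighted_limit C Z X L \<beta>"
    and u: "\<upsilon> = inv_into (sset_maps Z (hom_sset C L X)) (\<beta> L) (Ident C L)"
  shows "wlim_cone Z X L \<upsilon>"
    "T \<in> Obj C \<Longrightarrow> smap Z T X \<phi> \<Longrightarrow> \<beta> T (ext_map Z \<phi>) \<in> hom C T L \<and> agree Z (\<upsilon> \<star> \<beta> T (ext_map Z \<phi>)) \<phi>"
proof -
  have L: "L \<in> Obj C" and bij: "\<And>T. T \<in> Obj C \<Longrightarrow> bij_betw (\<beta> T) (sset_maps Z (hom_sset C T X)) (hom C T L)"
    and nat: "\<And>T T' t \<phi>. T \<in> Obj C \<Longrightarrow> T' \<in> Obj C \<Longrightarrow> t \<in> hom C T' T \<Longrightarrow> \<phi> \<in> sset_maps Z (hom_sset C T X) \<Longrightarrow>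
        \<beta> T' (ext_map Z (\<phi> \<star> t)) = \<beta> T \<phi> \<cdot> t"
    using w by (auto simp: is_weighted_limit_def ext_map_def stage_def)
  have img: "Ident C L \<in> \<beta> L ` sset_maps Z (hom_sset C L X)"
    using bij[OF L] Ident_in[OF L] by (simp add: bij_betw_def)
  have um: "\<upsilon> \<in> sset_maps Z (hom_sset C L X)" unfolding u by (rule inv_into_into[OF img])
  have bu: "\<beta> L \<upsilon> = Ident C L" unfolding u by (rule f_inv_into_f[OF img])
  have us: "smap Z L X \<upsilon>" using smap_ext_map(2)[OF ok um] by simp
  \<comment> \<open>Naturality at the universal map, which corresponds to the identity of
    \<open>L\<close>.\<close>
  have inv: "\<beta> T (ext_map Z (\<upsilon> \<star> t)) = t" if "t \<in> hom C T L" for T t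
    using nat[OF L homD(4)[OF that] that um] bu Ident_left[OF that] by simp
  have ev: "\<beta> T (ext_map Z \<phi>) \<in> hom C T L \<and> agree Z (\<upsilon> \<star> \<beta> T (ext_map Z \<phi>)) \<phi>"
    if T: "T \<in> Obj C" and p: "smap Z T X \<phi>" for T \<phi>
  proof
    have pm: "ext_map Z \<phi> \<in> sset_maps Z (hom_sset C T X)" by (rule smap_ext_map(1)[OF ok p])
    let ?t = "\<beta> T (ext_map Z \<phi>)"
    show t: "?t \<in> hom C T L" using bij_betw_apply[OF bij[OF T] pm] .
    have tm: "ext_map Z (\<upsilon> \<star> ?t) \<in> sset_maps Z (hom_sset C T X)"
      by (rule smap_ext_map(1)[OF ok smap_stage[OF X us t]])
    have "ext_map Z (\<upsilon> \<star> ?t) = ext_map Z \<phi>"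
      using inv[OF t] bij_betw_imp_inj_on[OF bij[OF T]] tm pm by (simp add: inj_on_def)
    then show "agree Z (\<upsilon> \<star> ?t) \<phi>" using agree_ext_map agree_sym agree_trans by metis
  qed
  then show "T \<in> Obj C \<Longrightarrow> smap Z T X \<phi> \<Longrightarrow> \<beta> T (ext_map Z \<phi>) \<in> hom C T L \<and> agree Z (\<upsilon> \<star> \<beta> T (ext_map Z \<phi>)) \<phi>"
    by blast
  show "wlim_cone Z X L \<upsilon>"
    unfolding wlim_cone_def
  proof (intro conjI ballI allI impI)
    fix T \<phi> assume h: "T \<in> Obj C" "smap Z T X \<phi>"
    show "\<exists>!t. t \<in> hom C T L \<and> agree Z (\<upsilon> \<star> t) \<phi>"
    proof (rule ex1I[of _ "\<beta> T (ext_map Z \<phi>)"])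
      fix t assume t: "t \<in> hom C T L \<and> agree Z (\<upsilon> \<star> t) \<phi>"
      then have "ext_map Z (\<upsilon> \<star> t) = ext_map Z \<phi>" using ext_map_eqI by blast
      then show "t = \<beta> T (ext_map Z \<phi>)" using inv[of t T] t by simp
    qed (rule ev[OF h])
  qed (fact L us)+
qed

text \<open>Makes the choice in \<open>wlim_data\<close> harmless: as soon as some universal map
  exists, the chosen limit has one, and \<open>wmor\<close> classifies maps by morphisms into
  it.\<close>

lemma has_wlimD:
  assumes "has_wlim Z X"
  shows "sset_ok Z" "simplicial_object C X" "wlim_cone Z X (wlim C Z X) (wlim_univ C Z X)"
    "smap Z T X \<phi> \<Longrightarrow> T \<in> Obj C \<Longrightarrow> wmor Z X T \<phi> \<in> hom C T (wlim C Z X)"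
    "smap Z T X \<phi> \<Longrightarrow> T \<in> Obj C \<Longrightarrow> agree Z (wlim_univ C Z X \<star> wmor Z X T \<phi>) \<phi>"
proof -
  show a: "sset_ok Z" "simplicial_object C X" using assms by (auto simp: has_wlim_def)
  obtain L \<upsilon> where "wlim_cone Z X L \<upsilon>" using assms by (auto simp: has_wlim_def)
  then obtain \<beta> where "is_weighted_limit C Z X L \<beta>" using wlim_cone_weighted[OF a] by blast
  then have "\<exists>x. case x of (L, \<beta>) \<Rightarrow> is_weighted_limit C Z X L \<beta>" by auto
  then have "case wlim_data C Z X of (L, \<beta>) \<Rightarrow> is_weighted_limit C Z X L \<beta>"
    unfolding wlim_data_def by (rule someI_ex)
  then have w: "is_weighted_limit C Z X (wlim C Z X) (wlim_bij C Z X)"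
    by (simp add: wlim_def wlim_bij_def case_prod_beta)
  note c = weighted_wlim_cone[OF a w wlim_univ_def]
  show "wlim_cone Z X (wlim C Z X) (wlim_univ C Z X)" by (rule c(1))
  show "smap Z T X \<phi> \<Longrightarrow> T \<in> Obj C \<Longrightarrow> wmor Z X T \<phi> \<in> hom C T (wlim C Z X)"
    "smap Z T X \<phi> \<Longrightarrow> T \<in> Obj C \<Longrightarrow> agree Z (wlim_univ C Z X \<star> wmor Z X T \<phi>) \<phi>"
    using c(2) unfolding wmor_def by blast+
qed

lemma wlim_restrict:
  assumes "has_wlim Z X" "has_wlim W X" "sset_mor Z W i"
  shows "wlim_restrict C Z W i X \<in> hom C (wlim C W X) (wlim C Z X)"
    "agree Z (wlim_univ C Z X \<star> wlim_restrict C Z W i X) (pull i (wlim_univ C W X))"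
proof -
  note W = has_wlimD(3)[OF assms(2)]
  have "wlim_restrict C Z W i X = wmor Z X (wlim C W X) (pull i (wlim_univ C W X))"
    by (simp add: wlim_restrict_def wmor_def ext_map_def pull_def)
  moreover have "smap Z (wlim C W X) X (pull i (wlim_univ C W X))"
    by (rule smap_pull[OF wlim_coneD(2)[OF W] assms(3)])
  ultimately show "wlim_restrict C Z W i X \<in> hom C (wlim C W X) (wlim C Z X)"
    "agree Z (wlim_univ C Z X \<star> wlim_restrict C Z W i X) (pull i (wlim_univ C W X))"
    using has_wlimD(4,5)[OF assms(1)] wlim_coneD(1)[OF W] by auto
qed

lemma wlim_map:
  assumes "simplicial_morphism C f" "has_wlim Z (sdom f)" "has_wlim Z (scod f)"
  shows "wlim_map C Z f \<in> hom C (wlim C Z (sdom f)) (wlim C Z (scod f))"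
    "agree Z (wlim_univ C Z (scod f) \<star> wlim_map C Z f) (f \<odot> wlim_univ C Z (sdom f))"
proof -
  note W = has_wlimD(3)[OF assms(2)]
  have "wlim_map C Z f = wmor Z (scod f) (wlim C Z (sdom f)) (f \<odot> wlim_univ C Z (sdom f))"
    by (simp add: wlim_map_def wmor_def ext_map_def push_def)
  moreover have "smap Z (wlim C Z (sdom f)) (scod f) (f \<odot> wlim_univ C Z (sdom f))"
    by (rule smap_push[OF assms(1) wlim_coneD(2)[OF W]])
  ultimately show "wlim_map C Z f \<in> hom C (wlim C Z (sdom f)) (wlim C Z (scod f))"
    "agree Z (wlim_univ C Z (scod f) \<star> wlim_map C Z f) (f \<odot> wlim_univ C Z (sdom f))"
    using has_wlimD(4,5)[OF assms(3)] wlim_coneD(1)[OF W] by auto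
qed

end

context regular_category
begin

text \<open>Weighted limits turn a pushout of weights into a pullback. The pushout is described
  through \<open>comm\<close>, joint surjectivity and \<open>lift\<close>, so that one argument
  serves for nerves, where it is a union, and for the disk, where it is a quotient.\<close>

lemma wlim_cone_pushout:
  assumes X: "simplicial_object C X"
    and c0: "wlim_cone Z0 X L0 \<upsilon>0" and c1: "wlim_cone Z1 X L1 \<upsilon>1" and c2: "wlim_cone Z2 X L2 \<upsilon>2"
    and m: "sset_mor Z0 Z1 i1" "sset_mor Z0 Z2 i2" "sset_mor Z1 Z j1" "sset_mor Z2 Z j2"
    and comm: "\<And>\<phi> :: nat \<Rightarrow> 'z \<Rightarrow> 'm. agree Z0 (pull i1 (pull j1 \<phi>)) (pull i2 (pull j2 \<phi>))"
    and surj: "\<And>n z. z \<in> simplices Z n \<Longrightarrow> z \<in> j1 n ` simplices Z1 n \<or> z \<in> j2 n ` simplices Z2 n"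
    and lift: "\<And>T \<phi>1 \<phi>2. T \<in> Obj C \<Longrightarrow> smap Z1 T X \<phi>1 \<Longrightarrow> smap Z2 T X \<phi>2 \<Longrightarrow> agree Z0 (pull i1 \<phi>1) (pull i2 \<phi>2) \<Longrightarrow>
      \<exists>\<phi>. smap Z T X \<phi> \<and> agree Z1 (pull j1 \<phi>) \<phi>1 \<and> agree Z2 (pull j2 \<phi>) \<phi>2"
  shows "\<exists>L \<upsilon>. wlim_cone (Z :: 'z sset) X L \<upsilon>"
proof -
  note u0 = wlim_coneD(1,2)[OF c0] and u1 = wlim_coneD(1,2)[OF c1] and u2 = wlim_coneD(1,2)[OF c2]
  obtain r1 where r1: "r1 \<in> hom C L1 L0" "agree Z0 (\<upsilon>0 \<star> r1) (pull i1 \<upsilon>1)"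
    using wlim_cone_lift[OF c0 u1(1) smap_pull[OF u1(2) m(1)]] .
  obtain r2 where r2: "r2 \<in> hom C L2 L0" "agree Z0 (\<upsilon>0 \<star> r2) (pull i2 \<upsilon>2)"
    using wlim_cone_lift[OF c0 u2(1) smap_pull[OF u2(2) m(2)]] .
  obtain p q where pb: "is_pullback C r1 r2 p q" using pullback_exists[of r1 r2] r1 r2 by (auto simp: hom_def)
  define L where "L = Dom C p"
  have p: "p \<in> hom C L L1" and q: "q \<in> hom C L L2" and LO: "L \<in> Obj C" and comm': "r1 \<cdot> p = r2 \<cdot> q"
    using pullbackD[OF pb] r1(1) r2(1) Dom_in[of p] by (auto simp: L_def hom_def)
  have e1: "agree Z0 (pull i1 (\<upsilon>1 \<star> s)) (\<upsilon>0 \<star> (r1 \<cdot> s))" if s: "s \<in> hom C T L1" for s T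
  proof -
    have "agree Z0 (pull i1 \<upsilon>1 \<star> s) (\<upsilon>0 \<star> r1 \<star> s)" using agree_stage[OF agree_sym[OF r1(2)]] .
    also have "agree Z0 (\<upsilon>0 \<star> r1 \<star> s) (\<upsilon>0 \<star> (r1 \<cdot> s))" by (rule stage_stage[OF u0(2) r1(1) s])
    finally show ?thesis by simp
  qed
  have e2: "agree Z0 (pull i2 (\<upsilon>2 \<star> s)) (\<upsilon>0 \<star> (r2 \<cdot> s))" if s: "s \<in> hom C T L2" for s T
  proof -
    have "agree Z0 (pull i2 \<upsilon>2 \<star> s) (\<upsilon>0 \<star> r2 \<star> s)" using agree_stage[OF agree_sym[OF r2(2)]] .
    also have "agree Z0 (\<upsilon>0 \<star> r2 \<star> s) (\<upsilon>0 \<star> (r2 \<cdot> s))" by (rule stage_stage[OF u0(2) r2(1) s])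
    finally show ?thesis by simp
  qed
  have "agree Z0 (pull i1 (\<upsilon>1 \<star> p)) (pull i2 (\<upsilon>2 \<star> q))"
    using agree_trans[OF e1[OF p]] agree_sym[OF e2[OF q]] unfolding comm' by blast
  then obtain \<upsilon> where v: "smap Z L X \<upsilon>" "agree Z1 (pull j1 \<upsilon>) (\<upsilon>1 \<star> p)" "agree Z2 (pull j2 \<upsilon>) (\<upsilon>2 \<star> q)"
    using lift[OF LO smap_stage[OF X u1(2) p] smap_stage[OF X u2(2) q]] by blast
  have v1: "agree Z1 (pull j1 (\<upsilon> \<star> t)) (\<upsilon>1 \<star> (p \<cdot> t))" if t: "t \<in> hom C T L" for t T
    using agree_trans[OF agree_stage[OF v(2)] stage_stage[OF u1(2) p t]] by simp
  have v2: "agree Z2 (pull j2 (\<upsilon> \<star> t)) (\<upsilon>2 \<star> (q \<cdot> t))" if t: "t \<in> hom C T L" for t T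
    using agree_trans[OF agree_stage[OF v(3)] stage_stage[OF u2(2) q t]] by simp
  \<comment> \<open>Maps on \<open>Z\<close> are determined by their restrictions because
    \<open>j1\<close> and \<open>j2\<close> are jointly surjective.\<close>
  have joint: "agree Z \<phi> \<psi>" if "agree Z1 (pull j1 \<phi>) (pull j1 \<psi>)" "agree Z2 (pull j2 \<phi>) (pull j2 \<psi>)" for \<phi> \<psi> :: "nat \<Rightarrow> 'z \<Rightarrow> 'm"
    unfolding agree_def
  proof (intro allI ballI)
    fix n z assume "z \<in> simplices Z n"
    from surj[OF this] show "\<phi> n z = \<psi> n z" using that by (auto simp: agree_def pull_def)
  qed
  have "wlim_cone Z X L \<upsilon>"
    unfolding wlim_cone_def
  proof (intro conjI ballI allI impI)
    fix T \<phi> assume h: "T \<in> Obj C" "smap Z T X \<phi>"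
    obtain t1 where t1: "t1 \<in> hom C T L1" "agree Z1 (\<upsilon>1 \<star> t1) (pull j1 \<phi>)"
      using wlim_cone_lift[OF c1 h(1) smap_pull[OF h(2) m(3)]] .
    obtain t2 where t2: "t2 \<in> hom C T L2" "agree Z2 (\<upsilon>2 \<star> t2) (pull j2 \<phi>)"
      using wlim_cone_lift[OF c2 h(1) smap_pull[OF h(2) m(4)]] .
    have "agree Z0 (\<upsilon>0 \<star> (r1 \<cdot> t1)) (pull i1 (pull j1 \<phi>))"
      using agree_trans[OF agree_sym[OF e1[OF t1(1)]] agree_pull[OF t1(2) m(1)]] .
    also have "agree Z0 (pull i1 (pull j1 \<phi>)) (pull i2 (pull j2 \<phi>))" by (rule comm)
    also have "agree Z0 (pull i2 (pull j2 \<phi>)) (\<upsilon>0 \<star> (r2 \<cdot> t2))"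
      using agree_sym[OF agree_trans[OF agree_sym[OF e2[OF t2(1)]] agree_pull[OF t2(2) m(2)]]] .
    finally have "r1 \<cdot> t1 = r2 \<cdot> t2"
      by (rule wlim_cone_unique[OF c0 X Comp_in[OF t1(1) r1(1)] Comp_in[OF t2(1) r2(1)]])
    then obtain t where t: "t \<in> hom C T L" "p \<cdot> t = t1" "q \<cdot> t = t2"
      using pullback_lift[OF pb, of t1 t2] t1(1) t2(1) r1(1) r2(1) by (auto simp: hom_def L_def)
    have "agree Z (\<upsilon> \<star> t) \<phi>"
    proof (rule joint)
      show "agree Z1 (pull j1 (\<upsilon> \<star> t)) (pull j1 \<phi>)" using agree_trans[OF v1[OF t(1)]] t1(2) t(2) by simp
      show "agree Z2 (pull j2 (\<upsilon> \<star> t)) (pull j2 \<phi>)" using agree_trans[OF v2[OF t(1)]] t2(2) t(3) by simp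
    qed
    moreover have "s = t" if s: "s \<in> hom C T L" "agree Z (\<upsilon> \<star> s) \<phi>" for s
    proof -
      have "agree Z1 (\<upsilon>1 \<star> (p \<cdot> s)) (\<upsilon>1 \<star> t1)"
        using agree_trans[OF agree_sym[OF v1[OF s(1)]] agree_trans[OF agree_pull[OF s(2) m(3)] agree_sym[OF t1(2)]]] .
      then have 1: "p \<cdot> s = p \<cdot> t" unfolding t(2) by (rule wlim_cone_unique[OF c1 X Comp_in[OF s(1) p] t1(1)])
      have "agree Z2 (\<upsilon>2 \<star> (q \<cdot> s)) (\<upsilon>2 \<star> t2)"
        using agree_trans[OF agree_sym[OF v2[OF s(1)]] agree_trans[OF agree_pull[OF s(2) m(4)] agree_sym[OF t2(2)]]] .
      then have 2: "q \<cdot> s = q \<cdot> t" unfolding t(3) by (rule wlim_cone_unique[OF c2 X Comp_in[OF s(1) q] t2(1)])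
      show ?thesis by (rule pullback_unique[OF pb _ _ _ _ _ 1 2]) (use s t in \<open>auto simp: hom_def L_def\<close>)
    qed
    ultimately show "\<exists>!t. t \<in> hom C T L \<and> agree Z (\<upsilon> \<star> t) \<phi>" using t(1) by blast
  qed (fact LO v(1))+
  then show ?thesis by blast
qed

text \<open>By the Yoneda lemma the limit weighted by a simplex is a level of \<open>X\<close>. The
  enumeration of the chain makes the nerve of \<open>faces \<sigma>\<close> a copy of the
  \<open>n\<close>-simplex, and the universal map consists of the operators of
  \<open>X\<close>.\<close>

lemma wlim_cone_faces:
  assumes X: "simplicial_object C X" and s: "finite \<sigma>" "is_chain \<sigma>" "\<sigma> \<noteq> {}"
  shows "\<exists>L \<upsilon>. wlim_cone (nerve (faces \<sigma>)) X L \<upsilon>"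
proof -
  obtain n r s where rs: "mono_on \<sigma> r" "r ` \<sigma> = {..n}" "mono_on {..n} s" "s ` {..n} = \<sigma>"
    "\<And>x. x \<in> \<sigma> \<Longrightarrow> s (r x) = x" "\<And>i. i \<le> n \<Longrightarrow> r (s i) = (i::nat)"
    using chain_enum[OF s] by metis
  let ?Z = "nerve (faces \<sigma>)"
  let ?L = "level X n"
  have ok: "sset_ok ?Z" using nerve_ok faces_complex[OF s(1,2)] complexD(2) by blast
  define u where "u = (\<lambda>m \<alpha>. sobj_op X m n (vmap r m \<alpha>))"
  have cr: "cmap r (faces \<sigma>) (faces {..n})"
  proof -
    have "r x \<le> n" if "x \<in> \<sigma>" for x using rs(2) that by auto
    then show ?thesis using rs(1) by (auto simp: cmap_def faces_def mono_on_def)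
  qed
  have d: "vmap r m \<alpha> \<in> delta_hom m n" if "\<alpha> \<in> simplices ?Z m" for m \<alpha>
  proof -
    have "vmap r m \<alpha> \<in> simplices (nerve (faces {..n})) m"
      using sset_mor_vmap[OF cr] that unfolding sset_mor_def by blast
    then show ?thesis by (simp add: delta_hom_iff faces_def)
  qed
  have us: "smap ?Z ?L X u"
    unfolding smap_def
  proof (intro conjI allI ballI)
    show "u m \<alpha> \<in> hom C ?L (level X m)" if "\<alpha> \<in> simplices ?Z m" for m \<alpha>
      unfolding u_def by (rule sobjD(2)[OF X d[OF that]])
    fix l m \<theta> \<alpha> assume h: "\<theta> \<in> delta_hom l m" "\<alpha> \<in> simplices ?Z m"
    have "vmap r l (sset_op ?Z l m \<theta> \<alpha>) = compose {..l} (vmap r m \<alpha>) \<theta>"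
      using sset_mor_vmap[OF cr] h unfolding sset_mor_def by (auto simp del: nerve_simps(1)) 
    then show "u l (sset_op ?Z l m \<theta> \<alpha>) = sobj_op X l m \<theta> \<cdot> u m \<alpha>"
      unfolding u_def using sobjD(5)[OF X h(1) d[OF h(2)]] by simp
  qed
  \<comment> \<open>The fundamental simplex. Every simplex \<open>\<alpha>\<close> arises from it by
    the operator \<open>vmap r m \<alpha>\<close>, which is the content of \<open>se\<close>; hence
    a map is determined by its value at \<open>e\<close>.\<close>
  define e where "e = restrict s {..n}"
  have e: "e \<in> simplices ?Z n" using rs(3,4) s by (auto simp: e_def mono_on_def faces_def)
  have re: "vmap r n e = (\<lambda>i \<in> {..n}. i)" using rs(6) by (auto simp: vmap_def compose_def e_def fun_eq_iff)
  have se: "compose {..m} e (vmap r m \<alpha>) = \<alpha>" if "\<alpha> \<in> simplices ?Z m" for m \<alpha>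
  proof
    fix i
    have "\<alpha> i \<in> \<sigma>" if "i \<le> m" using \<open>\<alpha> \<in> simplices ?Z m\<close> that by (auto simp: faces_def)
    moreover have "\<alpha> i = undefined" if "\<not> i \<le> m" using \<open>\<alpha> \<in> simplices ?Z m\<close> that by (auto simp: extensional_def)
    ultimately show "compose {..m} e (vmap r m \<alpha>) i = \<alpha> i"
      using rs(2,5) by (auto simp: compose_def e_def vmap_def)
  qed
  have ue: "u n e = Ident C ?L" unfolding u_def re by (rule sobjD(4)[OF X])
  have "wlim_cone ?Z X ?L u"
    unfolding wlim_cone_def
  proof (intro conjI ballI allI impI)
    show "?L \<in> Obj C" by (rule sobjD(1)[OF X])
    show "smap ?Z ?L X u" by (rule us)
    fix T \<phi> assume h: "T \<in> Obj C" "smap ?Z T X \<phi>"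
    show "\<exists>!t. t \<in> hom C T ?L \<and> agree ?Z (u \<star> t) \<phi>"
    proof (rule ex1I[of _ "\<phi> n e"])
      have "u m \<alpha> \<cdot> \<phi> n e = \<phi> m \<alpha>" if "\<alpha> \<in> simplices ?Z m" for m \<alpha>
        using smapD(2)[OF h(2) d[OF that] e] se[OF that] by (simp add: u_def)
      then show "\<phi> n e \<in> hom C T ?L \<and> agree ?Z (u \<star> \<phi> n e) \<phi>"
        using smapD(1)[OF h(2) e] unfolding agree_def stage_def by blast
      fix t assume t: "t \<in> hom C T ?L \<and> agree ?Z (u \<star> t) \<phi>"
      then have "u n e \<cdot> t = \<phi> n e" using e unfolding agree_def stage_def by blast
      then show "t = \<phi> n e" unfolding ue using t Ident_left by metis
    qed
  qed
  then show ?thesis by blast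
qed

text \<open>Induction on the number of cells: a nonempty complex is the pushout of the remaining
  cells and a maximal simplex along the boundary of the latter, and the empty complex yields the
  terminal object.\<close>

lemma wlim_cone_nerve:
  assumes X: "simplicial_object C X" and "complex K"
  shows "\<exists>L \<upsilon>. wlim_cone (nerve K) X L \<upsilon>"
  using assms(2)
proof (induction "card K" arbitrary: K rule: less_induct)
  case less
  note cK = less.prems
  show ?case
  proof (cases "K = {}")
    case True
    obtain T where T: "is_terminal C T" using terminal_ex by blast
    have e: "simplices (nerve K) m = {}" for m using True by auto
    have "wlim_cone (nerve K) X T (\<lambda>m \<alpha>. undefined)"
      using T unfolding wlim_cone_def is_terminal_def smap_def agree_def e by auto
    then show ?thesis by blast
  next
    case False
    obtain \<sigma> where s: "\<sigma> \<in> K" "\<And>\<tau>. \<tau> \<in> K \<Longrightarrow> card \<tau> \<le> card \<sigma>" using ex_max_card[OF complexD(1)[OF cK] False] by blast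
    note st = complex_step[OF cK s]
    have sg: "finite \<sigma>" "is_chain \<sigma>" "\<sigma> \<noteq> {}" using complexD[OF cK] s(1) by auto
    have lt: "card (K - {\<sigma>}) < card K" using s(1) complexD(1)[OF cK] by (metis card_Diff1_less)
    \<comment> \<open>The boundary need not be smaller than the rest of the complex, but it is
      contained in it and therefore has fewer cells than \<open>K\<close>.\<close>
    have "card (bd \<sigma>) \<le> card (K - {\<sigma>})" by (rule card_mono) (use st complexD(1)[OF cK] in auto)
    then have c0: "\<exists>L \<upsilon>. wlim_cone (nerve (bd \<sigma>)) X L \<upsilon>"
      using less.hyps[of "bd \<sigma>"] lt bd_complex[OF sg(1,2)] by simp
    have c1: "\<exists>L \<upsilon>. wlim_cone (nerve (K - {\<sigma>})) X L \<upsilon>" using less.hyps[OF lt st(1)] .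
    have c2: "\<exists>L \<upsilon>. wlim_cone (nerve (faces \<sigma>)) X L \<upsilon>" by (rule wlim_cone_faces[OF X sg])
    obtain L0 v0 L1 v1 L2 v2 where c: "wlim_cone (nerve (bd \<sigma>)) X L0 v0" "wlim_cone (nerve (K - {\<sigma>})) X L1 v1"
      "wlim_cone (nerve (faces \<sigma>)) X L2 v2" using c0 c1 c2 by blast
    have sub: "faces \<sigma> \<subseteq> K" using st(4) by blast
    have dc: "down_closed (K - {\<sigma>})" "down_closed (faces \<sigma>)" using st(1) faces_complex[OF sg(1,2)] complexD(2) by blast+
    show ?thesis
    proof (rule wlim_cone_pushout[OF X c])
      show "sset_mor (nerve (bd \<sigma>)) (nerve (K - {\<sigma>})) (\<lambda>m \<alpha>. \<alpha>)" "sset_mor (nerve (bd \<sigma>)) (nerve (faces \<sigma>)) (\<lambda>m \<alpha>. \<alpha>)"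
        "sset_mor (nerve (K - {\<sigma>})) (nerve K) (\<lambda>m \<alpha>. \<alpha>)" "sset_mor (nerve (faces \<sigma>)) (nerve K) (\<lambda>m \<alpha>. \<alpha>)"
        using st(2) sub by (auto intro!: sset_mor_incl simp: bd_def)
      fix n \<alpha> assume "\<alpha> \<in> simplices (nerve K) n"
      then show "\<alpha> \<in> (\<lambda>\<alpha>. \<alpha>) ` simplices (nerve (K - {\<sigma>})) n \<or> \<alpha> \<in> (\<lambda>\<alpha>. \<alpha>) ` simplices (nerve (faces \<sigma>)) n"
        using sg(3) by (auto simp: faces_def)
    next
      fix T f g assume h: "T \<in> Obj C" "smap (nerve (K - {\<sigma>})) T X f" "smap (nerve (faces \<sigma>)) T X g"
        "agree (nerve (bd \<sigma>)) (pull (\<lambda>m \<alpha>. \<alpha>) f) (pull (\<lambda>m \<alpha>. \<alpha>) g)"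
      then have ag: "agree (nerve ((K - {\<sigma>}) \<inter> faces \<sigma>)) f g" by (simp only: st(3) pull_incl)
      show "\<exists>\<phi>. smap (nerve K) T X \<phi> \<and> agree (nerve (K - {\<sigma>})) (pull (\<lambda>m \<alpha>. \<alpha>) \<phi>) f \<and>
          agree (nerve (faces \<sigma>)) (pull (\<lambda>m \<alpha>. \<alpha>) \<phi>) g"
      proof (intro exI conjI)
        show "smap (nerve K) T X (glue (K - {\<sigma>}) f g)" using smap_glue[OF dc h(2,3) ag] by (simp only: st(4))
      qed (simp_all add: glue_agree(1) glue_agree(2)[OF ag])
    qed simp
  qed
qed

lemma has_wlim_nerve: "complex K \<Longrightarrow> simplicial_object C X \<Longrightarrow> has_wlim (nerve K) X"
  unfolding has_wlim_def using wlim_cone_nerve nerve_ok complexD(2) by blast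

end

section \<open>The disk\<close>

abbreviation II :: "nat set set" where
  "II \<equiv> faces {..1}"

abbreviation at :: "nat \<Rightarrow> 'p \<Rightarrow> 'p \<times> nat" where
  "at e \<equiv> (\<lambda>x. (x, e))"

lemma cprod_mono: "K \<subseteq> K' \<Longrightarrow> M \<subseteq> M' \<Longrightarrow> K \<otimes> M \<subseteq> K' \<otimes> M'"
  by (auto simp: cprod_def)

lemma cmap_fst: "cmap fst (K \<otimes> M) K"
  by (auto simp: cmap_def cprod_def mono_on_def less_eq_prod_def)

lemma cmap_snd: "cmap snd (K \<otimes> M) M"
  by (auto simp: cmap_def cprod_def mono_on_def less_eq_prod_def)

lemma cmap_subset: "cmap u K L \<Longrightarrow> K' \<subseteq> K \<Longrightarrow> L \<subseteq> L' \<Longrightarrow> cmap u K' L'"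
  by (auto simp: cmap_def)

lemma cmap_at:
  assumes "complex K" "{e} \<in> M" shows "cmap (at e) K (K \<otimes> M)"
  unfolding cmap_def
proof (intro ballI conjI)
  fix \<sigma> assume s: "\<sigma> \<in> K"
  have "\<sigma> \<noteq> {}" using complexD(4)[OF assms(1)] s by auto
  then have "snd ` at e ` \<sigma> = {e}" by (auto simp: image_image)
  moreover have "is_chain (at e ` \<sigma>)" using complexD(5)[OF assms(1) s] by (auto simp: is_chain_def)
  ultimately show "at e ` \<sigma> \<in> K \<otimes> M" using s assms(2) by (simp add: cprod_def image_image)
qed (auto simp: mono_on_def)

lemma II_simps [simp]: "{0} \<in> II" "{Suc 0} \<in> II" "complex II"
  using faces_complex[of "{..1::nat}"] by (auto simp: faces_def)

section \<open>The disk as a quotient, computed on representatives\<close>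

definition disk_rel :: "nat \<Rightarrow> nat \<Rightarrow> ((nat \<Rightarrow> nat) \<times> (nat \<Rightarrow> nat) + (nat \<Rightarrow> nat)) rel" where
  "disk_rel n m = (let r = {(Inl (a, b), Inr a) | a b. a \<in> simplices (boundary n) m \<and> b \<in> simplices (std_simplex 1) m} in (r \<union> r\<inverse>)\<^sup>*)"

lemma pushout_rel_disk:
  "pushout_rel (sset_prod (boundary n) (std_simplex 1)) (sset_incl (sset_prod (boundary n) (std_simplex 1)))
    (boundary_cylinder_proj n) m = disk_rel n m"
proof -
  have eq: "{(Inl (sset_incl (sset_prod (boundary n) (std_simplex 1)) m a), Inr (boundary_cylinder_proj n m a)) | a.
      a \<in> simplices (sset_prod (boundary n) (std_simplex 1)) m} =
    {(Inl (a, b), Inr a) | a b. a \<in> simplices (boundary n) m \<and> b \<in> simplices (std_simplex 1) m}"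
    by (auto simp: sset_incl_def boundary_cylinder_proj_def sset_prod_def)
  show ?thesis unfolding pushout_rel_def disk_rel_def Let_def eq ..
qed

definition disk_gens :: "nat \<Rightarrow> nat \<Rightarrow> ((nat \<Rightarrow> nat) \<times> (nat \<Rightarrow> nat) + (nat \<Rightarrow> nat)) set" where
  "disk_gens n m = (simplices (std_simplex n) m \<times> simplices (std_simplex 1) m) <+> simplices (boundary n) m"

definition disk_gop where
  "disk_gop l \<theta> = map_sum (map_prod (\<lambda>\<alpha>. compose {..l} \<alpha> \<theta>) (\<lambda>\<alpha>. compose {..l} \<alpha> \<theta>)) (\<lambda>\<alpha>. compose {..l::nat} \<alpha> \<theta>)"

lemma nerve_op_eta: "sset_op (nerve K) l m \<theta> = (\<lambda>\<alpha>. compose {..l} \<alpha> \<theta>)"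
  by (simp add: nerve_def)

lemma disk_simplices: "c \<in> simplices (disk n) m \<longleftrightarrow> (\<exists>x \<in> disk_gens n m. c = disk_rel n m `` {x})"
  unfolding disk_def sset_pushout_def pushout_rel_disk by (simp add: quotient_def disk_gens_def sset_prod_def)

lemma disk_rel_refl [simp]: "(x, x) \<in> disk_rel n m"
  by (simp add: disk_rel_def Let_def)

lemma disk_rel_trans: "(x, y) \<in> disk_rel n m \<Longrightarrow> (y, z) \<in> disk_rel n m \<Longrightarrow> (x, z) \<in> disk_rel n m"
  unfolding disk_rel_def Let_def by (rule rtrancl_trans)

lemma disk_rel_sym: "(x, y) \<in> disk_rel n m \<Longrightarrow> (y, x) \<in> disk_rel n m"
  unfolding disk_rel_def Let_def by (meson symD sym_Un_converse sym_rtrancl)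

lemma disk_rel_invariant:
  assumes "(x, y) \<in> disk_rel n m"
    "\<And>a b. a \<in> simplices (boundary n) m \<Longrightarrow> b \<in> simplices (std_simplex 1) m \<Longrightarrow> F (Inl (a, b)) = F (Inr a)"
  shows "F x = F y"
  using assms(1) unfolding disk_rel_def Let_def
  by (induction rule: rtrancl_induct) (use assms(2) in auto)

lemma disk_rel_class_eq:
  assumes "(x, y) \<in> disk_rel n m" shows "disk_rel n m `` {x} = disk_rel n m `` {y}"
  using assms disk_rel_trans disk_rel_sym by blast

lemma disk_rel_op:
  assumes t: "\<theta> \<in> delta_hom l m" and "(x, y) \<in> disk_rel n m"
  shows "(disk_gop l \<theta> x, disk_gop l \<theta> y) \<in> disk_rel n l"
proof -
  have ok: "compose {..l} a \<theta> \<in> simplices (boundary n) l" "compose {..l} b \<theta> \<in> simplices (std_simplex 1) l"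
    if "a \<in> simplices (boundary n) m" "b \<in> simplices (std_simplex 1) m" for a b
  proof -
    have "sset_ok (boundary n)" "sset_ok (std_simplex 1)"
      unfolding boundary_nerve std_simplex_nerve using bd_complex[of "{..n}"] faces_complex[of "{..1::nat}"]
      by (auto intro!: nerve_ok complexD(2))
    then show "compose {..l} a \<theta> \<in> simplices (boundary n) l" "compose {..l} b \<theta> \<in> simplices (std_simplex 1) l"
      using that t unfolding sset_ok_def boundary_nerve std_simplex_nerve nerve_simps(2) by blast+
  qed
  show ?thesis
    using assms(2) unfolding disk_rel_def Let_def
  proof (induction rule: rtrancl_induct)
    case base show ?case by simp
  next
    case (step y z)
    have "(disk_gop l \<theta> y, disk_gop l \<theta> z) \<in> (let r = {(Inl (a, b), Inr a) | a b. a \<in> simplices (boundary n) l \<and> b \<in> simplices (std_simplex 1) l} in (r \<union> r\<inverse>))"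
      using step(2) ok by (fastforce simp: disk_gop_def Let_def)
    then show ?case using step(3) unfolding Let_def by (rule rtrancl_into_rtrancl[rotated])
  qed
qed

lemma disk_op:
  assumes "\<theta> \<in> delta_hom l m"
  shows "sset_op (disk n) l m \<theta> (disk_rel n m `` {x}) = disk_rel n l `` {disk_gop l \<theta> x}"
proof -
  have "sset_op (disk n) l m \<theta> (disk_rel n m `` {x}) = disk_rel n l `` (disk_gop l \<theta> ` disk_rel n m `` {x})"
    unfolding disk_def sset_pushout_def pushout_rel_disk
    by (simp add: disk_gop_def sset_prod_def std_simplex_nerve boundary_nerve nerve_op_eta)
  also have "\<dots> = disk_rel n l `` {disk_gop l \<theta> x}"
    using disk_rel_op[OF assms] disk_rel_trans disk_rel_refl by blast
  finally show ?thesis .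
qed

lemma disk_gens_op:
  assumes t: "\<theta> \<in> delta_hom l m" and "x \<in> disk_gens n m" shows "disk_gop l \<theta> x \<in> disk_gens n l"
proof -
  have "sset_ok (boundary n)" "sset_ok (std_simplex 1)" "sset_ok (std_simplex n)"
    unfolding boundary_nerve std_simplex_nerve using bd_complex[of "{..n}"] faces_complex[of "{..n}"] faces_complex[of "{..1::nat}"]
    by (auto intro!: nerve_ok complexD(2))
  then show ?thesis
    using assms unfolding sset_ok_def boundary_nerve std_simplex_nerve nerve_simps(2) disk_gens_def disk_gop_def
    by (auto simp del: nerve_simps(1))
qed

lemma disk_ok: "sset_ok (disk n)"
  unfolding sset_ok_def
proof (intro allI ballI)
  fix l m \<theta> c assume t: "\<theta> \<in> delta_hom l m" and "c \<in> simplices (disk n) m"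
  then obtain x where x: "x \<in> disk_gens n m" "c = disk_rel n m `` {x}" using disk_simplices by blast
  show "sset_op (disk n) l m \<theta> c \<in> simplices (disk n) l"
    unfolding x(2) disk_op[OF t] disk_simplices using disk_gens_op[OF t x(1)] by blast
qed

text \<open>With \<open>disk_bd\<close> one of the two coprojections of the pushout;
  \<open>disk_in\<close> is the canonical map from the cylinder, read on the nerve of the product
  poset, where a simplex is a function into pairs instead of a pair of functions.\<close>

definition disk_in :: "nat \<Rightarrow> nat \<Rightarrow> (nat \<Rightarrow> nat \<times> nat) \<Rightarrow> disk_simplex" where
  "disk_in n m \<alpha> = disk_rel n m `` {Inl (vmap fst m \<alpha>, vmap snd m \<alpha>)}"

definition disk_bd :: "nat \<Rightarrow> nat \<Rightarrow> (nat \<Rightarrow> nat) \<Rightarrow> disk_simplex" where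
  "disk_bd n m \<alpha> = disk_rel n m `` {Inr \<alpha>}"

lemma nerve_cprod_faces:
  assumes "\<alpha> \<in> simplices (nerve (faces {..n} \<otimes> II)) m"
  shows "vmap fst m \<alpha> \<in> simplices (std_simplex n) m" "vmap snd m \<alpha> \<in> simplices (std_simplex 1) m"
  using assms unfolding nerve_cprod std_simplex_nerve by blast+

lemma sset_mor_disk_in: "sset_mor (nerve (faces {..n} \<otimes> II)) (disk n) (disk_in n)"
  unfolding sset_mor_def
proof (intro conjI allI ballI)
  show "disk_in n m \<alpha> \<in> simplices (disk n) m" if "\<alpha> \<in> simplices (nerve (faces {..n} \<otimes> II)) m" for m \<alpha>
    unfolding disk_simplices disk_in_def disk_gens_def using nerve_cprod_faces[OF that] by blast
  fix l m \<theta> \<alpha> assume h: "\<theta> \<in> delta_hom l m" "\<alpha> \<in> simplices (nerve (faces {..n} \<otimes> II)) m"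
  have "vmap fst l (compose {..l} \<alpha> \<theta>) = compose {..l} (vmap fst m \<alpha>) \<theta>" "vmap snd l (compose {..l} \<alpha> \<theta>) = compose {..l} (vmap snd m \<alpha>) \<theta>"
    using delta_homD(1)[OF h(1)] by (auto simp: vmap_def compose_def fun_eq_iff)
  then show "disk_in n l (sset_op (nerve (faces {..n} \<otimes> II)) l m \<theta> \<alpha>) = sset_op (disk n) l m \<theta> (disk_in n m \<alpha>)"
    unfolding disk_in_def disk_op[OF h(1)] by (simp add: disk_gop_def)
qed

lemma sset_mor_disk_bd: "sset_mor (nerve (bd {..n})) (disk n) (disk_bd n)"
  unfolding sset_mor_def disk_bd_def
proof (intro conjI allI ballI)
  show "disk_rel n m `` {Inr \<alpha>} \<in> simplices (disk n) m" if "\<alpha> \<in> simplices (nerve (bd {..n})) m" for m \<alpha>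
    unfolding disk_simplices disk_gens_def boundary_nerve using that by blast
  fix l m \<theta> \<alpha> assume h: "\<theta> \<in> delta_hom l m"
  show "disk_rel n l `` {Inr (sset_op (nerve (bd {..n})) l m \<theta> \<alpha>)} = sset_op (disk n) l m \<theta> (disk_rel n m `` {Inr \<alpha>})"
    unfolding disk_op[OF h] by (simp add: disk_gop_def)
qed

lemma disk_in_boundary:
  assumes "\<alpha> \<in> simplices (nerve (bd {..n} \<otimes> II)) m"
  shows "disk_in n m \<alpha> = disk_bd n m (vmap fst m \<alpha>)"
  unfolding disk_in_def disk_bd_def
proof (rule disk_rel_class_eq)
  have "vmap fst m \<alpha> \<in> simplices (boundary n) m" "vmap snd m \<alpha> \<in> simplices (std_simplex 1) m"
    using assms unfolding nerve_cprod boundary_nerve std_simplex_nerve by blast+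
  then show "(Inl (vmap fst m \<alpha>, vmap snd m \<alpha>), Inr (vmap fst m \<alpha>)) \<in> disk_rel n m"
    unfolding disk_rel_def Let_def by blast
qed

lemma pair_nerve:
  assumes "a \<in> simplices (nerve K) m" "b \<in> simplices (nerve M) m"
  shows "(\<lambda>i \<in> {..m}. (a i, b i)) \<in> simplices (nerve (K \<otimes> M)) m"
    "vmap fst m (\<lambda>i \<in> {..m}. (a i, b i)) = a" "vmap snd m (\<lambda>i \<in> {..m}. (a i, b i)) = b"
proof -
  show e: "vmap fst m (\<lambda>i \<in> {..m}. (a i, b i)) = a" "vmap snd m (\<lambda>i \<in> {..m}. (a i, b i)) = b"
    using assms by (auto simp: vmap_def compose_def fun_eq_iff extensional_def)
  show "(\<lambda>i \<in> {..m}. (a i, b i)) \<in> simplices (nerve (K \<otimes> M)) m"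
    unfolding nerve_cprod e using assms by auto
qed

lemma disk_surj:
  assumes "c \<in> simplices (disk n) m"
  shows "c \<in> disk_in n m ` simplices (nerve (faces {..n} \<otimes> II)) m \<or> c \<in> disk_bd n m ` simplices (nerve (bd {..n})) m"
proof -
  obtain x where x: "x \<in> disk_gens n m" "c = disk_rel n m `` {x}" using assms disk_simplices by blast
  show ?thesis
  proof (cases x)
    case (Inl ab)
    obtain a b where "ab = (a, b)" by force
    then have ab: "x = Inl (a, b)" "a \<in> simplices (nerve (faces {..n})) m" "b \<in> simplices (nerve II) m"
      using x(1) Inl unfolding disk_gens_def std_simplex_nerve by auto
    have "c = disk_in n m (\<lambda>i \<in> {..m}. (a i, b i))"
      unfolding disk_in_def pair_nerve(2,3)[OF ab(2,3)] x(2) ab(1) ..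
    then show ?thesis using pair_nerve(1)[OF ab(2,3)] by blast
  next
    case (Inr a)
    then show ?thesis using x unfolding disk_gens_def boundary_nerve disk_bd_def by auto
  qed
qed

context category
begin

text \<open>The universal property of the pushout: a map on the cylinder that depends on the
  boundary only through the projection descends to the disk.\<close>

lemma disk_lift:
  assumes h1: "smap (nerve (faces {..n} \<otimes> II)) T X h" and h2: "smap (nerve (bd {..n})) T X b"
    and ag: "agree (nerve (bd {..n} \<otimes> II)) h (pull (vmap fst) b)"
  shows "\<exists>\<phi>. smap (disk n) T X \<phi> \<and> agree (nerve (faces {..n} \<otimes> II)) (pull (disk_in n) \<phi>) h \<and>
    agree (nerve (bd {..n})) (pull (disk_bd n) \<phi>) b"
proof -
  define F where "F m x = (case x of Inl p \<Rightarrow> h m (\<lambda>i \<in> {..m}. (fst p i, snd p i)) | Inr a \<Rightarrow> b m a)"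
    for m :: nat and x :: "(nat \<Rightarrow> nat) \<times> (nat \<Rightarrow> nat) + (nat \<Rightarrow> nat)"
  \<comment> \<open>The value at a class is computed on a representative picked by
    \<open>SOME\<close>; since \<open>F\<close> respects the generators of the relation, the choice
    is immaterial, as \<open>val\<close> shows.\<close>
  define \<phi> where "\<phi> m c = F m (SOME x. x \<in> c)" for m c
  have inv: "F m (Inl (a, c)) = F m (Inr a)" if "a \<in> simplices (boundary n) m" "c \<in> simplices (std_simplex 1) m" for m a c
  proof -
    note p = pair_nerve[OF that[unfolded boundary_nerve std_simplex_nerve]]
    have "h m (\<lambda>i \<in> {..m}. (a i, c i)) = pull (vmap fst) b m (\<lambda>i \<in> {..m}. (a i, c i))"
      using ag p(1) unfolding agree_def by blast
    then show ?thesis by (simp add: F_def pull_def p(2))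
  qed
  have val: "\<phi> m (disk_rel n m `` {x}) = F m x" for m x
  proof -
    have "(x, SOME y. y \<in> disk_rel n m `` {x}) \<in> disk_rel n m"
      using someI[of "\<lambda>y. y \<in> disk_rel n m `` {x}" x] by auto
    then have "F m x = F m (SOME y. y \<in> disk_rel n m `` {x})" by (rule disk_rel_invariant) (rule inv)
    then show ?thesis by (simp add: \<phi>_def)
  qed
  have a1: "agree (nerve (faces {..n} \<otimes> II)) (pull (disk_in n) \<phi>) h"
    unfolding agree_def pull_def
  proof (intro allI ballI)
    fix m \<alpha> assume a: "\<alpha> \<in> simplices (nerve (faces {..n} \<otimes> II)) m"
    have "(\<lambda>i \<in> {..m}. (vmap fst m \<alpha> i, vmap snd m \<alpha> i)) = \<alpha>"
      using a by (auto simp: vmap_def compose_def fun_eq_iff extensional_def)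
    then show "\<phi> m (disk_in n m \<alpha>) = h m \<alpha>" unfolding disk_in_def val by (simp add: F_def)
  qed
  have a2: "agree (nerve (bd {..n})) (pull (disk_bd n) \<phi>) b"
    unfolding agree_def pull_def disk_bd_def val by (simp add: F_def)
  have "smap (disk n) T X \<phi>"
    unfolding smap_def
  proof (intro conjI allI ballI)
    fix m c assume "c \<in> simplices (disk n) m"
    from disk_surj[OF this] show "\<phi> m c \<in> hom C T (level X m)"
    proof
      assume "c \<in> disk_in n m ` simplices (nerve (faces {..n} \<otimes> II)) m"
      then obtain \<alpha> where "\<alpha> \<in> simplices (nerve (faces {..n} \<otimes> II)) m" "c = disk_in n m \<alpha>" by blast
      then show ?thesis using a1 smapD(1)[OF h1] unfolding agree_def pull_def by metis
    next
      assume "c \<in> disk_bd n m ` simplices (nerve (bd {..n})) m"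
      then obtain \<alpha> where "\<alpha> \<in> simplices (nerve (bd {..n})) m" "c = disk_bd n m \<alpha>" by blast
      then show ?thesis using a2 smapD(1)[OF h2] unfolding agree_def pull_def by metis
    qed
  next
    fix l m \<theta> c assume t: "\<theta> \<in> delta_hom l m" and "c \<in> simplices (disk n) m"
    from disk_surj[OF this(2)] show "\<phi> l (sset_op (disk n) l m \<theta> c) = sobj_op X l m \<theta> \<cdot> \<phi> m c"
    proof
      let ?Z = "nerve (faces {..n} \<otimes> II)"
      assume "c \<in> disk_in n m ` simplices ?Z m"
      then obtain \<alpha> where a: "\<alpha> \<in> simplices ?Z m" "c = disk_in n m \<alpha>" by blast
      have ok: "sset_ok ?Z" by (rule nerve_ok[OF complexD(2)[OF complex_cprod]]) (auto intro: faces_complex)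
      have "sset_op (disk n) l m \<theta> c = disk_in n l (sset_op ?Z l m \<theta> \<alpha>)"
        using sset_mor_disk_in[of n] a t unfolding sset_mor_def by metis
      moreover have "sset_op ?Z l m \<theta> \<alpha> \<in> simplices ?Z l" using ok a(1) t unfolding sset_ok_def by blast
      ultimately have "\<phi> l (sset_op (disk n) l m \<theta> c) = h l (sset_op ?Z l m \<theta> \<alpha>)" using a1 unfolding agree_def pull_def by metis
      also have "\<dots> = sobj_op X l m \<theta> \<cdot> h m \<alpha>" by (rule smapD(2)[OF h1 t a(1)])
      also have "h m \<alpha> = \<phi> m c" using a1 a unfolding agree_def pull_def by metis
      finally show ?thesis .
    next
      let ?Z = "nerve (bd {..n})"
      assume "c \<in> disk_bd n m ` simplices ?Z m"
      then obtain \<alpha> where a: "\<alpha> \<in> simplices ?Z m" "c = disk_bd n m \<alpha>" by blast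
      have ok: "sset_ok ?Z" by (rule nerve_ok[OF complexD(2)[OF bd_complex]]) auto
      have "sset_op (disk n) l m \<theta> c = disk_bd n l (sset_op ?Z l m \<theta> \<alpha>)"
        using sset_mor_disk_bd[of n] a t unfolding sset_mor_def by metis
      moreover have "sset_op ?Z l m \<theta> \<alpha> \<in> simplices ?Z l" using ok a(1) t unfolding sset_ok_def by blast
      ultimately have "\<phi> l (sset_op (disk n) l m \<theta> c) = b l (sset_op ?Z l m \<theta> \<alpha>)" using a2 unfolding agree_def pull_def by metis
      also have "\<dots> = sobj_op X l m \<theta> \<cdot> b m \<alpha>" by (rule smapD(2)[OF h2 t a(1)])
      also have "b m \<alpha> = \<phi> m c" using a2 a unfolding agree_def pull_def by metis
      finally show ?thesis .
    qed
  qed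
  then show ?thesis using a1 a2 by blast
qed

text \<open>A homotopy relative to \<open>K\<close>, directed from \<open>y0\<close> at the end
  \<open>0\<close> to \<open>y1\<close> at the end \<open>1\<close>. Stationarity is expressed
  through \<open>y0\<close>; \<open>homotopy_rel\<close> recovers the agreement of \<open>y0\<close>
  and \<open>y1\<close> on \<open>K\<close>.\<close>

definition homotopy :: "'p::order set set \<Rightarrow> 'p set set \<Rightarrow> 'o \<Rightarrow> ('o, 'm) sobj \<Rightarrow> (nat \<Rightarrow> (nat \<Rightarrow> 'p) \<Rightarrow> 'm) \<Rightarrow>
    (nat \<Rightarrow> (nat \<Rightarrow> 'p) \<Rightarrow> 'm) \<Rightarrow> (nat \<Rightarrow> (nat \<Rightarrow> 'p \<times> nat) \<Rightarrow> 'm) \<Rightarrow> bool" where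
  "homotopy K L T Y y0 y1 h \<longleftrightarrow> smap (nerve (L \<otimes> II)) T Y h \<and> agree (nerve L) (pull (vmap (at 0)) h) y0 \<and>
     agree (nerve L) (pull (vmap (at 1)) h) y1 \<and> agree (nerve (K \<otimes> II)) h (pull (vmap fst) y0)"

lemma disk_end_eq:
  assumes "\<alpha> \<in> simplices (std_simplex n) m" "e \<le> 1"
  shows "disk_end n e m \<alpha> = disk_in n m (vmap (at e) m \<alpha>)"
proof -
  have "(\<lambda>i \<in> {..m}. e) \<in> simplices (std_simplex 1) m"
    using assms(2) unfolding std_simplex_nerve by (auto simp: mono_on_def faces_def)
  moreover have "vmap fst m (vmap (at e) m \<alpha>) = \<alpha>" "vmap snd m (vmap (at e) m \<alpha>) = (\<lambda>i \<in> {..m}. e)"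
    using assms(1) unfolding std_simplex_nerve by (auto simp: vmap_def compose_def fun_eq_iff extensional_def)
  ultimately show ?thesis
    using assms unfolding disk_end_def disk_quot_def pushout_rel_disk disk_in_def by (simp add: sset_prod_def)
qed

lemma sset_mor_cong:
  assumes "sset_mor Z W i" "\<And>m z. z \<in> simplices Z m \<Longrightarrow> j m z = i m z" "sset_ok Z" shows "sset_mor Z W j"
  using assms unfolding sset_mor_def sset_ok_def by metis

lemma sset_mor_disk_end:
  assumes "e \<le> 1" shows "sset_mor (std_simplex n) (disk n) (disk_end n e)"
proof (rule sset_mor_cong)
  have c: "complex (faces {..n})" by (rule faces_complex) auto
  have "{e} \<in> II" using assms by (auto simp: faces_def)
  then have m: "sset_mor (nerve (faces {..n})) (nerve (faces {..n} \<otimes> II)) (vmap (at e))" using cmap_at[OF c] by (intro sset_mor_vmap)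
  show "sset_mor (std_simplex n) (disk n) (\<lambda>m \<alpha>. disk_in n m (vmap (at e) m \<alpha>))"
    using m sset_mor_disk_in[of n] unfolding sset_mor_def std_simplex_nerve by metis
  show "sset_ok (std_simplex n)" unfolding std_simplex_nerve by (rule nerve_ok[OF complexD(2)[OF c]])
qed (rule disk_end_eq[OF _ assms])

text \<open>Composition with the quotient map from the cylinder produces a homotopy, stationary on
  the boundary because the quotient collapses the interval there.\<close>

lemma disk_smap_homotopy:
  assumes "smap (disk n) T Y \<phi>"
  shows "\<exists>h. homotopy (bd {..n}) (faces {..n}) T Y (pull (disk_end n 0) \<phi>) (pull (disk_end n 1) \<phi>) h"
proof -
  define h where "h = pull (disk_in n) \<phi>"
  have e: "agree (nerve (faces {..n})) (pull (vmap (at e)) h) (pull (disk_end n e) \<phi>)" if "e \<le> 1" for e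
    unfolding agree_def h_def pull_def using disk_end_eq[OF _ that] unfolding std_simplex_nerve by metis
  have cb: "complex (bd {..n})" by (rule bd_complex) auto
  have b: "agree (nerve (bd {..n} \<otimes> II)) h (pull (vmap fst) (pull (disk_bd n) \<phi>))"
    unfolding agree_def h_def pull_def using disk_in_boundary by metis
  \<comment> \<open>The disk provides stationarity at the value of \<open>disk_bd\<close>, whereas
    \<open>homotopy\<close> asks for the value of the end \<open>0\<close>; on the boundary the two
    agree.\<close>
  have "agree (nerve (bd {..n})) (pull (vmap (at 0)) h) (pull (vmap (fst \<circ> at 0)) (pull (disk_bd n) \<phi>))"
    using agree_pull_vmap[OF b cmap_at[OF cb II_simps(1)]] by simp
  also have "agree (nerve (bd {..n})) (pull (vmap (fst \<circ> at 0)) (pull (disk_bd n) \<phi>)) (pull (disk_bd n) \<phi>)"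
    by (rule agree_pull_ident) simp
  finally have "agree (nerve (bd {..n})) (pull (disk_bd n) \<phi>) (pull (disk_end n 0) \<phi>)"
    using agree_trans[OF agree_sym agree_mono[OF e[of 0]]] by (auto simp: bd_def)
  then have "agree (nerve (bd {..n} \<otimes> II)) h (pull (vmap fst) (pull (disk_end n 0) \<phi>))"
    using agree_trans[OF b agree_pull_vmap[OF _ cmap_fst]] by blast
  moreover have "smap (nerve (faces {..n} \<otimes> II)) T Y h" unfolding h_def by (rule smap_pull[OF assms sset_mor_disk_in])
  ultimately show ?thesis unfolding homotopy_def using e[of 0] e[of 1] by auto
qed

text \<open>The homotopy and the restriction of \<open>y0\<close> to the boundary are a compatible
  pair for the pushout that defines the disk.\<close>

lemma homotopy_disk_smap:
  assumes h: "homotopy (bd {..n}) (faces {..n}) T Y y0 y1 h" and y: "smap (nerve (faces {..n})) T Y y0"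
  shows "\<exists>\<phi>. smap (disk n) T Y \<phi> \<and> agree (std_simplex n) (pull (disk_end n 0) \<phi>) y0 \<and>
    agree (std_simplex n) (pull (disk_end n 1) \<phi>) y1"
proof -
  have h': "smap (nerve (faces {..n} \<otimes> II)) T Y h" "agree (nerve (faces {..n})) (pull (vmap (at 0)) h) y0"
    "agree (nerve (faces {..n})) (pull (vmap (at 1)) h) y1" "agree (nerve (bd {..n} \<otimes> II)) h (pull (vmap fst) y0)"
    using h by (auto simp: homotopy_def)
  have "smap (nerve (bd {..n})) T Y y0" by (rule smap_mono[OF y]) (auto simp: bd_def)
  then obtain \<phi> where p: "smap (disk n) T Y \<phi>" "agree (nerve (faces {..n} \<otimes> II)) (pull (disk_in n) \<phi>) h"
    using disk_lift[OF h'(1) _ h'(4)] by blast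
  have cf: "complex (faces {..n})" by (rule faces_complex) auto
  have "agree (std_simplex n) (pull (disk_end n e) \<phi>) (pull (vmap (at e)) h)" if "e \<le> 1" for e
  proof -
    have "{e} \<in> II" using that by (auto simp: faces_def)
    then have "agree (std_simplex n) (pull (vmap (at e)) (pull (disk_in n) \<phi>)) (pull (vmap (at e)) h)"
      using agree_pull_vmap[OF p(2) cmap_at[OF cf]] unfolding std_simplex_nerve by blast
    moreover have "agree (std_simplex n) (pull (disk_end n e) \<phi>) (pull (vmap (at e)) (pull (disk_in n) \<phi>))"
      unfolding agree_def pull_def using disk_end_eq[OF _ that] by metis
    ultimately show ?thesis using agree_trans by blast
  qed
  from this[of 0] this[of 1] show ?thesis
    using p(1) h'(2,3) agree_trans unfolding std_simplex_nerve by auto blast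
qed

end

context regular_category
begin

text \<open>The disk is not given as a complex of chains, so its limit is obtained from three
  nerves: cylinder, cylinder on the boundary, and boundary.\<close>

lemma has_wlim_disk:
  assumes X: "simplicial_object C X" shows "has_wlim (disk n) X"
proof -
  have cf: "complex (faces {..n})" and cb: "complex (bd {..n})" by (auto intro: faces_complex bd_complex)
  obtain L0 v0 L1 v1 L2 v2 where c: "wlim_cone (nerve (bd {..n} \<otimes> II)) X L0 v0"
    "wlim_cone (nerve (faces {..n} \<otimes> II)) X L1 v1" "wlim_cone (nerve (bd {..n})) X L2 v2"
    using wlim_cone_nerve[OF X complex_cprod[OF cb II_simps(3)]] wlim_cone_nerve[OF X complex_cprod[OF cf II_simps(3)]]
      wlim_cone_nerve[OF X cb] by blast
  have "\<exists>L \<upsilon>. wlim_cone (disk n) X L \<upsilon>"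
  proof (rule wlim_cone_pushout[OF X c])
    show "sset_mor (nerve (bd {..n} \<otimes> II)) (nerve (faces {..n} \<otimes> II)) (\<lambda>m \<alpha>. \<alpha>)"
      by (rule sset_mor_incl[OF cprod_mono]) (auto simp: bd_def)
    show "sset_mor (nerve (bd {..n} \<otimes> II)) (nerve (bd {..n})) (vmap fst)" by (rule sset_mor_vmap[OF cmap_fst])
    show "sset_mor (nerve (faces {..n} \<otimes> II)) (disk n) (disk_in n)" by (rule sset_mor_disk_in)
    show "sset_mor (nerve (bd {..n})) (disk n) (disk_bd n)" by (rule sset_mor_disk_bd)
    show "agree (nerve (bd {..n} \<otimes> II)) (pull (\<lambda>m \<alpha>. \<alpha>) (pull (disk_in n) \<phi>)) (pull (vmap fst) (pull (disk_bd n) \<phi>))"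
      for \<phi> :: "nat \<Rightarrow> disk_simplex \<Rightarrow> 'm"
      unfolding agree_def pull_def using disk_in_boundary by metis
    show "z \<in> disk_in n m ` simplices (nerve (faces {..n} \<otimes> II)) m \<or> z \<in> disk_bd n m ` simplices (nerve (bd {..n})) m"
      if "z \<in> simplices (disk n) m" for m z by (rule disk_surj[OF that])
    show "\<exists>\<phi>. smap (disk n) T X \<phi> \<and> agree (nerve (faces {..n} \<otimes> II)) (pull (disk_in n) \<phi>) h \<and> agree (nerve (bd {..n})) (pull (disk_bd n) \<phi>) b"
      if "smap (nerve (faces {..n} \<otimes> II)) T X h" "smap (nerve (bd {..n})) T X b"
        "agree (nerve (bd {..n} \<otimes> II)) (pull (\<lambda>m \<alpha>. \<alpha>) h) (pull (vmap fst) b)" for T h b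
      using disk_lift that by simp
  qed
  then show ?thesis using X disk_ok by (simp add: has_wlim_def)
qed

end

section \<open>Local lifting properties\<close>

lemma agree_transs: "agree Z \<phi> \<psi> \<Longrightarrow> agree Z \<phi> \<chi> \<Longrightarrow> agree Z \<psi> \<chi>"
  by (simp add: agree_def)

context category
begin

section \<open>Functoriality of weighted limits on generalized elements\<close>

lemma wlim_restrict_ev:
  assumes "has_wlim Z X" "has_wlim W X" "sset_mor Z W i" "t \<in> hom C T (wlim C W X)"
  shows "agree Z (wlim_univ C Z X \<star> (wlim_restrict C Z W i X \<cdot> t)) (pull i (wlim_univ C W X \<star> t))"
proof -
  note r = wlim_restrict[OF assms(1-3)]
  have "agree Z (wlim_univ C Z X \<star> wlim_restrict C Z W i X \<star> t) (wlim_univ C Z X \<star> (wlim_restrict C Z W i X \<cdot> t))"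
    by (rule stage_stage[OF wlim_coneD(2)[OF has_wlimD(3)[OF assms(1)]] r(1) assms(4)])
  moreover have "agree Z (wlim_univ C Z X \<star> wlim_restrict C Z W i X \<star> t) (pull i (wlim_univ C W X) \<star> t)"
    by (rule agree_stage[OF r(2)])
  ultimately show ?thesis using agree_transs by fastforce
qed

lemma wlim_map_ev:
  assumes f: "simplicial_morphism C f" and "has_wlim Z (sdom f)" "has_wlim Z (scod f)" "t \<in> hom C T (wlim C Z (sdom f))"
  shows "agree Z (wlim_univ C Z (scod f) \<star> (wlim_map C Z f \<cdot> t)) (f \<odot> (wlim_univ C Z (sdom f) \<star> t))"
proof -
  note r = wlim_map[OF assms(1-3)]
  have "agree Z (wlim_univ C Z (scod f) \<star> wlim_map C Z f \<star> t) (wlim_univ C Z (scod f) \<star> (wlim_map C Z f \<cdot> t))"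
    by (rule stage_stage[OF wlim_coneD(2)[OF has_wlimD(3)[OF assms(3)]] r(1) assms(4)])
  moreover have "agree Z (wlim_univ C Z (scod f) \<star> wlim_map C Z f \<star> t) ((f \<odot> wlim_univ C Z (sdom f)) \<star> t)"
    by (rule agree_stage[OF r(2)])
  moreover have "agree Z ((f \<odot> wlim_univ C Z (sdom f)) \<star> t) (f \<odot> (wlim_univ C Z (sdom f) \<star> t))"
    by (rule push_stage[OF f wlim_coneD(2)[OF has_wlimD(3)[OF assms(2)]] assms(4)])
  ultimately show ?thesis using agree_transs agree_trans by blast
qed

lemma wlim_unique:
  assumes "has_wlim Z X" "t \<in> hom C T (wlim C Z X)" "t' \<in> hom C T (wlim C Z X)"
    "agree Z (wlim_univ C Z X \<star> t) \<phi>" "agree Z (wlim_univ C Z X \<star> t') \<phi>"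
  shows "t = t'"
  by (rule wlim_cone_unique[OF has_wlimD(3,2)[OF assms(1)] assms(2,3)]) (use assms(4,5) agree_trans agree_sym in blast)

lemma wlim_map_restrict:
  assumes f: "simplicial_morphism C f" and w: "has_wlim Z (sdom f)" "has_wlim Z (scod f)" "has_wlim W (sdom f)" "has_wlim W (scod f)"
    and i: "sset_mor Z W i"
  shows "wlim_map C Z f \<cdot> wlim_restrict C Z W i (sdom f) = wlim_restrict C Z W i (scod f) \<cdot> wlim_map C W f"
proof -
  note rX = wlim_restrict[OF w(1,3) i] and rY = wlim_restrict[OF w(2,4) i] and mZ = wlim_map[OF f w(1,2)] and mW = wlim_map[OF f w(3,4)]
  show ?thesis
  proof (rule wlim_unique[OF w(2) Comp_in[OF rX(1) mZ(1)] Comp_in[OF mW(1) rY(1)]])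
    show "agree Z (wlim_univ C Z (scod f) \<star> (wlim_map C Z f \<cdot> wlim_restrict C Z W i (sdom f))) (f \<odot> pull i (wlim_univ C W (sdom f)))"
      using agree_trans[OF wlim_map_ev[OF f w(1,2) rX(1)] agree_push[OF rX(2)]] .
    show "agree Z (wlim_univ C Z (scod f) \<star> (wlim_restrict C Z W i (scod f) \<cdot> wlim_map C W f)) (f \<odot> pull i (wlim_univ C W (sdom f)))"
      using agree_trans[OF wlim_restrict_ev[OF w(2,4) i mW(1)] agree_pull[OF mW(2) i]] by simp
  qed
qed

end

context regular_category
begin

text \<open>A generalized element of the chosen pullback is a compatible pair, so local surjectivity
  of the induced morphism can be read off from its two projections.\<close>

lemma pb_pair_regular_epi_iff:
  assumes a: "a \<in> hom C A D" and b: "b \<in> hom C B D" and u: "u \<in> hom C E A" and v: "v \<in> hom C E B" and eq: "a \<cdot> u = b \<cdot> v"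
  shows "regular_epi C (pb_pair C a b u v) \<longleftrightarrow>
    (\<forall>T t1 t2. t1 \<in> hom C T A \<longrightarrow> t2 \<in> hom C T B \<longrightarrow> a \<cdot> t1 = b \<cdot> t2 \<longrightarrow>
      (\<exists>T' c s. cover c T' T \<and> s \<in> hom C T' E \<and> u \<cdot> s = t1 \<cdot> c \<and> v \<cdot> s = t2 \<cdot> c))"
proof -
  have ex: "\<exists>p q. is_pullback C a b p q" using pullback_exists[of a b] a b by (auto simp: hom_def)
  let ?p = "pb_fst C a b" and ?q = "pb_snd C a b" and ?w = "pb_pair C a b u v"
  define P where "P = Dom C ?p"
  note pb = pb_ex[OF ex]
  have p: "?p \<in> hom C P A" and q: "?q \<in> hom C P B" using pullbackD[OF pb] a b by (auto simp: P_def hom_def)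
  have w: "?w \<in> hom C E P" "?p \<cdot> ?w = u" "?q \<cdot> ?w = v"
    using pb_pair[OF ex, of u v] a b u v eq by (auto simp: P_def hom_def)
  have key: "?w \<cdot> s = t \<cdot> c \<longleftrightarrow> u \<cdot> s = (?p \<cdot> t) \<cdot> c \<and> v \<cdot> s = (?q \<cdot> t) \<cdot> c"
    if s: "s \<in> hom C T' E" and c: "c \<in> hom C T' T" and t: "t \<in> hom C T P" for s c t T T'
  proof -
    have e: "u \<cdot> s = ?p \<cdot> (?w \<cdot> s)" "v \<cdot> s = ?q \<cdot> (?w \<cdot> s)" "(?p \<cdot> t) \<cdot> c = ?p \<cdot> (t \<cdot> c)" "(?q \<cdot> t) \<cdot> c = ?q \<cdot> (t \<cdot> c)"
      using assoc[OF s w(1) p] assoc[OF s w(1) q] assoc[OF c t p] assoc[OF c t q] w(2,3) by simp_all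
    show ?thesis
    proof
      assume "u \<cdot> s = (?p \<cdot> t) \<cdot> c \<and> v \<cdot> s = (?q \<cdot> t) \<cdot> c"
      then have 1: "?p \<cdot> (?w \<cdot> s) = ?p \<cdot> (t \<cdot> c)" and 2: "?q \<cdot> (?w \<cdot> s) = ?q \<cdot> (t \<cdot> c)" using e by metis+
      show "?w \<cdot> s = t \<cdot> c"
        by (rule pullback_unique[OF pb _ _ _ _ _ 1 2])
          (use homD[OF Comp_in[OF s w(1)]] homD[OF Comp_in[OF c t]] in \<open>auto simp: P_def\<close>)
    qed (simp only: e)
  qed
  show ?thesis
    unfolding regular_epi_iff_local[OF w(1)]
  proof (intro iffI allI impI)
    fix T t1 t2 assume *: "\<forall>T b. b \<in> hom C T P \<longrightarrow> (\<exists>T' c a. cover c T' T \<and> a \<in> hom C T' E \<and> ?w \<cdot> a = b \<cdot> c)"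
      and t: "t1 \<in> hom C T A" "t2 \<in> hom C T B" "a \<cdot> t1 = b \<cdot> t2"
    obtain t where t': "t \<in> hom C T P" "?p \<cdot> t = t1" "?q \<cdot> t = t2"
      using pullback_lift[OF pb, of t1 t2] t a b by (auto simp: hom_def P_def)
    obtain T' c s where "cover c T' T" "s \<in> hom C T' E" "?w \<cdot> s = t \<cdot> c" using * t'(1) by blast
    then show "\<exists>T' c s. cover c T' T \<and> s \<in> hom C T' E \<and> u \<cdot> s = t1 \<cdot> c \<and> v \<cdot> s = t2 \<cdot> c"
      using key[OF _ coverD(1) t'(1)] t'(2,3) by blast
  next
    fix T t assume *: "\<forall>T t1 t2. t1 \<in> hom C T A \<longrightarrow> t2 \<in> hom C T B \<longrightarrow> a \<cdot> t1 = b \<cdot> t2 \<longrightarrow>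
      (\<exists>T' c s. cover c T' T \<and> s \<in> hom C T' E \<and> u \<cdot> s = t1 \<cdot> c \<and> v \<cdot> s = t2 \<cdot> c)"
      and t: "t \<in> hom C T P"
    have "a \<cdot> ?p \<cdot> t = b \<cdot> ?q \<cdot> t"
      by (rule comp_square[OF pullbackD(9)[OF pb]]) (use a b p q t in \<open>auto simp: hom_def\<close>)
    then obtain T' c s where "cover c T' T" "s \<in> hom C T' E" "u \<cdot> s = (?p \<cdot> t) \<cdot> c" "v \<cdot> s = (?q \<cdot> t) \<cdot> c"
      using * Comp_in[OF t p] Comp_in[OF t q] by blast
    then show "\<exists>T' c a. cover c T' T \<and> a \<in> hom C T' E \<and> ?w \<cdot> a = t \<cdot> c"
      using key[OF _ coverD(1) t] by blast
  qed
qed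

text \<open>The right lifting property of \<open>p\<close>, its absolute version, and the relative homotopy lifting
  property of Dugger and Isaksen; all solutions exist locally, that is, on a cover of the stage.\<close>

definition llift :: "('o, 'm) smor \<Rightarrow> 'p::order set set \<Rightarrow> 'p set set \<Rightarrow> bool" where
  "llift p K L \<longleftrightarrow> (\<forall>T \<phi> \<psi>. T \<in> Obj C \<longrightarrow> smap (nerve K) T (sdom p) \<phi> \<longrightarrow> smap (nerve L) T (scod p) \<psi> \<longrightarrow>
     agree (nerve K) (p \<odot> \<phi>) \<psi> \<longrightarrow>
     (\<exists>T' c \<chi>. cover c T' T \<and> smap (nerve L) T' (sdom p) \<chi> \<and> agree (nerve K) \<chi> (\<phi> \<star> c) \<and>
       agree (nerve L) (p \<odot> \<chi>) (\<psi> \<star> c)))"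

definition lext :: "('o, 'm) sobj \<Rightarrow> 'p::order set set \<Rightarrow> 'p set set \<Rightarrow> bool" where
  "lext X K L \<longleftrightarrow> (\<forall>T \<phi>. T \<in> Obj C \<longrightarrow> smap (nerve K) T X \<phi> \<longrightarrow>
     (\<exists>T' c \<chi>. cover c T' T \<and> smap (nerve L) T' X \<chi> \<and> agree (nerve K) \<chi> (\<phi> \<star> c)))"

definition rhl :: "('o, 'm) smor \<Rightarrow> 'p::order set set \<Rightarrow> 'p set set \<Rightarrow> bool" where
  "rhl f K L \<longleftrightarrow> (\<forall>T \<phi> \<psi>. T \<in> Obj C \<longrightarrow> smap (nerve K) T (sdom f) \<phi> \<longrightarrow> smap (nerve L) T (scod f) \<psi> \<longrightarrow>
     agree (nerve K) (f \<odot> \<phi>) \<psi> \<longrightarrow>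
     (\<exists>T' c \<chi> h. cover c T' T \<and> smap (nerve L) T' (sdom f) \<chi> \<and> agree (nerve K) \<chi> (\<phi> \<star> c) \<and>
       homotopy K L T' (scod f) (\<psi> \<star> c) (f \<odot> \<chi>) h))"

text \<open>At the stage \<open>T\<close> elements of the weighted limits are simplicial maps. A
  compatible pair is then a lifting problem, and a preimage of it on a cover is a local
  solution.\<close>

lemma regular_epi_comparison_iff:
  fixes K L :: "'p::order set set"
  assumes p: "simplicial_morphism C p" and K: "complex K" "complex L" "K \<subseteq> L"
  shows "regular_epi C (comparison C (nerve K) (nerve L) (sset_incl (nerve K)) p) \<longleftrightarrow> llift p K L"
proof -
  let ?Z = "nerve K" and ?W = "nerve L" and ?i = "sset_incl (nerve K)" and ?X = "sdom p" and ?Y = "scod p"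
  note XY = smorD(1,2)[OF p]
  note ZX = has_wlim_nerve[OF K(1) XY(1)] and ZY = has_wlim_nerve[OF K(1) XY(2)]
    and WX = has_wlim_nerve[OF K(2) XY(1)] and WY = has_wlim_nerve[OF K(2) XY(2)]
  have ok: "sset_ok ?Z" by (rule nerve_ok[OF complexD(2)[OF K(1)]])
  have i: "sset_mor ?Z ?W ?i"
    by (rule sset_mor_cong[OF sset_mor_incl[OF K(3)] _ ok]) (simp add: sset_incl_def)
  have pi: "agree ?Z (pull ?i \<phi>) \<phi>" for \<phi> :: "nat \<Rightarrow> (nat \<Rightarrow> 'p) \<Rightarrow> 'm"
    by (simp add: agree_def pull_def sset_incl_def)
  let ?a = "wlim_map C ?Z p" and ?b = "wlim_restrict C ?Z ?W ?i ?Y" and ?u = "wlim_restrict C ?Z ?W ?i ?X" and ?v = "wlim_map C ?W p"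
  note a = wlim_map[OF p ZX ZY] and b = wlim_restrict[OF ZY WY i] and u = wlim_restrict[OF ZX WX i] and v = wlim_map[OF p WX WY]
  let ?uZX = "wlim_univ C ?Z ?X" and ?uZY = "wlim_univ C ?Z ?Y" and ?uWX = "wlim_univ C ?W ?X" and ?uWY = "wlim_univ C ?W ?Y"
  note sZX = wlim_coneD(2)[OF has_wlimD(3)[OF ZX]] and sWX = wlim_coneD(2)[OF has_wlimD(3)[OF WX]] and sWY = wlim_coneD(2)[OF has_wlimD(3)[OF WY]]
  note iff = pb_pair_regular_epi_iff[OF a(1) b(1) u(1) v(1) wlim_map_restrict[OF p ZX ZY WX WY i]]
  show ?thesis
    unfolding comparison_def iff
  proof
    assume *: "\<forall>T t1 t2. t1 \<in> hom C T (wlim C ?Z ?X) \<longrightarrow> t2 \<in> hom C T (wlim C ?W ?Y) \<longrightarrow> ?a \<cdot> t1 = ?b \<cdot> t2 \<longrightarrow>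
      (\<exists>T' c s. cover c T' T \<and> s \<in> hom C T' (wlim C ?W ?X) \<and> ?u \<cdot> s = t1 \<cdot> c \<and> ?v \<cdot> s = t2 \<cdot> c)"
    show "llift p K L"
      unfolding llift_def
    proof (intro allI impI)
      fix T \<phi> \<psi> assume T: "T \<in> Obj C" and h: "smap ?Z T ?X \<phi>" "smap ?W T ?Y \<psi>" "agree ?Z (p \<odot> \<phi>) \<psi>"
      define t1 where "t1 = wmor ?Z ?X T \<phi>"
      define t2 where "t2 = wmor ?W ?Y T \<psi>"
      have t1: "t1 \<in> hom C T (wlim C ?Z ?X)" "agree ?Z (?uZX \<star> t1) \<phi>" using has_wlimD(4,5)[OF ZX h(1) T] by (auto simp: t1_def)
      have t2: "t2 \<in> hom C T (wlim C ?W ?Y)" "agree ?W (?uWY \<star> t2) \<psi>" using has_wlimD(4,5)[OF WY h(2) T] by (auto simp: t2_def)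
      have "?a \<cdot> t1 = ?b \<cdot> t2"
      proof (rule wlim_unique[OF ZY Comp_in[OF t1(1) a(1)] Comp_in[OF t2(1) b(1)]])
        show "agree ?Z (?uZY \<star> (?a \<cdot> t1)) \<psi>"
          using agree_trans[OF wlim_map_ev[OF p ZX ZY t1(1)] agree_trans[OF agree_push[OF t1(2)] h(3)]] .
        show "agree ?Z (?uZY \<star> (?b \<cdot> t2)) \<psi>"
          using agree_trans[OF wlim_restrict_ev[OF ZY WY i t2(1)] agree_trans[OF pi agree_mono[OF t2(2) K(3)]]] .
      qed
      then obtain T' c s where c: "cover c T' T" "s \<in> hom C T' (wlim C ?W ?X)" "?u \<cdot> s = t1 \<cdot> c" "?v \<cdot> s = t2 \<cdot> c"
        using * t1(1) t2(1) by blast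
      note ch = coverD(1)[OF c(1)]
      show "\<exists>T' c \<chi>. cover c T' T \<and> smap ?W T' ?X \<chi> \<and> agree ?Z \<chi> (\<phi> \<star> c) \<and> agree ?W (p \<odot> \<chi>) (\<psi> \<star> c)"
      proof (intro exI conjI)
        show "cover c T' T" by fact
        show "smap ?W T' ?X (?uWX \<star> s)" by (rule smap_stage[OF XY(1) sWX c(2)])
        have "agree ?Z (?uZX \<star> (t1 \<cdot> c)) (?uWX \<star> s)"
          using agree_trans[OF wlim_restrict_ev[OF ZX WX i c(2)] pi] unfolding c(3) .
        moreover have "agree ?Z (?uZX \<star> (t1 \<cdot> c)) (\<phi> \<star> c)"
          using agree_trans[OF agree_sym[OF stage_stage[OF sZX t1(1) ch]] agree_stage[OF t1(2)]] .
        ultimately show "agree ?Z (?uWX \<star> s) (\<phi> \<star> c)" by (rule agree_transs)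
        have "agree ?W (?uWY \<star> (t2 \<cdot> c)) (p \<odot> (?uWX \<star> s))"
          using wlim_map_ev[OF p WX WY c(2)] unfolding c(4) .
        moreover have "agree ?W (?uWY \<star> (t2 \<cdot> c)) (\<psi> \<star> c)"
          using agree_trans[OF agree_sym[OF stage_stage[OF sWY t2(1) ch]] agree_stage[OF t2(2)]] .
        ultimately show "agree ?W (p \<odot> (?uWX \<star> s)) (\<psi> \<star> c)" by (rule agree_transs)
      qed
    qed
  next
    assume l: "llift p K L"
    show "\<forall>T t1 t2. t1 \<in> hom C T (wlim C ?Z ?X) \<longrightarrow> t2 \<in> hom C T (wlim C ?W ?Y) \<longrightarrow> ?a \<cdot> t1 = ?b \<cdot> t2 \<longrightarrow>
      (\<exists>T' c s. cover c T' T \<and> s \<in> hom C T' (wlim C ?W ?X) \<and> ?u \<cdot> s = t1 \<cdot> c \<and> ?v \<cdot> s = t2 \<cdot> c)"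
    proof (intro allI impI)
      fix T t1 t2 assume t: "t1 \<in> hom C T (wlim C ?Z ?X)" "t2 \<in> hom C T (wlim C ?W ?Y)" "?a \<cdot> t1 = ?b \<cdot> t2"
      have T: "T \<in> Obj C" using homD t by blast
      have "agree ?Z (?uZY \<star> (?a \<cdot> t1)) (?uWY \<star> t2)"
        using agree_trans[OF wlim_restrict_ev[OF ZY WY i t(2)] pi] unfolding t(3) .
      then have "agree ?Z (p \<odot> (?uZX \<star> t1)) (?uWY \<star> t2)"
        by (rule agree_transs[OF wlim_map_ev[OF p ZX ZY t(1)]])
      then obtain T' c \<chi> where c: "cover c T' T" "smap ?W T' ?X \<chi>" "agree ?Z \<chi> (?uZX \<star> t1 \<star> c)" "agree ?W (p \<odot> \<chi>) (?uWY \<star> t2 \<star> c)"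
        using l[unfolded llift_def] T smap_stage[OF XY(1) sZX t(1)] smap_stage[OF XY(2) sWY t(2)] by blast
      note ch = coverD(1,5)[OF c(1)]
      define s where "s = wmor ?W ?X T' \<chi>"
      have s: "s \<in> hom C T' (wlim C ?W ?X)" "agree ?W (?uWX \<star> s) \<chi>" using has_wlimD(4,5)[OF WX c(2) ch(2)] by (auto simp: s_def)
      have "?u \<cdot> s = t1 \<cdot> c"
      proof (rule wlim_unique[OF ZX Comp_in[OF s(1) u(1)] Comp_in[OF ch(1) t(1)]])
        show "agree ?Z (?uZX \<star> (?u \<cdot> s)) \<chi>"
          using agree_trans[OF wlim_restrict_ev[OF ZX WX i s(1)] agree_trans[OF pi agree_mono[OF s(2) K(3)]]] .
        show "agree ?Z (?uZX \<star> (t1 \<cdot> c)) \<chi>"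
          using agree_trans[OF agree_sym[OF stage_stage[OF sZX t(1) ch(1)]] agree_sym[OF c(3)]] .
      qed
      moreover have "?v \<cdot> s = t2 \<cdot> c"
      proof (rule wlim_unique[OF WY Comp_in[OF s(1) v(1)] Comp_in[OF ch(1) t(2)]])
        show "agree ?W (?uWY \<star> (?v \<cdot> s)) (p \<odot> \<chi>)"
          using agree_trans[OF wlim_map_ev[OF p WX WY s(1)] agree_push[OF s(2)]] .
        show "agree ?W (?uWY \<star> (t2 \<cdot> c)) (p \<odot> \<chi>)"
          using agree_trans[OF agree_sym[OF stage_stage[OF sWY t(2) ch(1)]] agree_sym[OF c(4)]] .
      qed
      ultimately show "\<exists>T' c s. cover c T' T \<and> s \<in> hom C T' (wlim C ?W ?X) \<and> ?u \<cdot> s = t1 \<cdot> c \<and> ?v \<cdot> s = t2 \<cdot> c"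
        using c(1) s(1) by blast
    qed
  qed
qed

lemma homotopy_cong:
  assumes "homotopy K L T Y y0 y1 h" "agree (nerve L) y0 y0'" "agree (nerve L) y1 y1'" "K \<subseteq> L"
  shows "homotopy K L T Y y0' y1' h"
proof -
  have *: "agree (nerve (K \<otimes> II)) (pull (vmap fst) y0) (pull (vmap fst) y0')"
    by (rule agree_pull_vmap[OF agree_mono[OF assms(2,4)] cmap_fst])
  note h = assms(1)[unfolded homotopy_def]
  show ?thesis unfolding homotopy_def
    using h agree_trans[OF _ assms(2)] agree_trans[OF _ assms(3)] agree_trans[OF _ *] by blast
qed

text \<open>An element of the domain is a map \<open>\<chi>\<close> on the simplex with a disk whose
  end \<open>1\<close> is \<open>f \<odot> \<chi>\<close>. Being a preimage means that
  \<open>\<chi>\<close> extends \<open>\<phi>\<close> and that the end \<open>0\<close> is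
  \<open>\<psi>\<close>, so the disk is a homotopy from \<open>\<psi>\<close> to
  \<open>f \<odot> \<chi>\<close> relative to the boundary.\<close>

lemma regular_epi_DI_comparison_iff:
  assumes f: "simplicial_morphism C f"
  shows "regular_epi C (DI_comparison C n f) \<longleftrightarrow> rhl f (bd {..n}) (faces {..n})"
proof -
  let ?Z = "nerve (bd {..n})" and ?W = "nerve (faces {..n})" and ?D = "disk n" and ?i = "sset_incl (nerve (bd {..n}))" and ?X = "sdom f" and ?Y = "scod f"
  have K: "complex (bd {..n})" "complex (faces {..n})" "bd {..n} \<subseteq> faces {..n}"
    using bd_complex[of "{..n}"] faces_complex[of "{..n}"] by (simp_all, auto simp: bd_def)
  note XY = smorD(1,2)[OF f]
  note ZX = has_wlim_nerve[OF K(1) XY(1)] and ZY = has_wlim_nerve[OF K(1) XY(2)]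
    and WX = has_wlim_nerve[OF K(2) XY(1)] and WY = has_wlim_nerve[OF K(2) XY(2)] and DY = has_wlim_disk[OF XY(2), of n]
  have ok: "sset_ok ?Z" by (rule nerve_ok[OF complexD(2)[OF K(1)]])
  have i: "sset_mor ?Z ?W ?i"
    by (rule sset_mor_cong[OF sset_mor_incl[OF K(3)] _ ok]) (simp add: sset_incl_def)
  have pi: "agree ?Z (pull ?i \<phi>) \<phi>" for \<phi> :: "nat \<Rightarrow> (nat \<Rightarrow> nat) \<Rightarrow> 'm"
    by (simp add: agree_def pull_def sset_incl_def)
  have j: "sset_mor ?W ?D (disk_end n 0)" "sset_mor ?W ?D (disk_end n 1)"
    using sset_mor_disk_end[of 0 n] sset_mor_disk_end[of 1 n] unfolding std_simplex_nerve by auto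
  let ?a = "wlim_map C ?Z f" and ?b = "wlim_restrict C ?Z ?W ?i ?Y" and ?r = "wlim_restrict C ?Z ?W ?i ?X" and ?v = "wlim_map C ?W f"
    and ?j = "\<lambda>e. wlim_restrict C ?W ?D (disk_end n e) ?Y"
  note a = wlim_map[OF f ZX ZY] and b = wlim_restrict[OF ZY WY i] and r = wlim_restrict[OF ZX WX i] and v = wlim_map[OF f WX WY]
    and j0 = wlim_restrict[OF WY DY j(1)] and j1 = wlim_restrict[OF WY DY j(2)]
  let ?uZX = "wlim_univ C ?Z ?X" and ?uZY = "wlim_univ C ?Z ?Y" and ?uWX = "wlim_univ C ?W ?X" and ?uWY = "wlim_univ C ?W ?Y" and ?uDY = "wlim_univ C ?D ?Y"
  note sZX = wlim_coneD(2)[OF has_wlimD(3)[OF ZX]] and sWX = wlim_coneD(2)[OF has_wlimD(3)[OF WX]] and sWY = wlim_coneD(2)[OF has_wlimD(3)[OF WY]]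
    and sDY = wlim_coneD(2)[OF has_wlimD(3)[OF DY]]
  let ?e1 = "pb_fst C ?v (?j 1)" and ?e2 = "pb_snd C ?v (?j 1)"
  define E where "E = Dom C ?e1"
  have ex: "\<exists>p q. is_pullback C ?v (?j 1) p q" using pullback_exists[of ?v "?j 1"] v(1) j1(1) by (auto simp: hom_def)
  note pb = pb_ex[OF ex]
  have e1: "?e1 \<in> hom C E (wlim C ?W ?X)" and e2: "?e2 \<in> hom C E (wlim C ?D ?Y)"
    using pullbackD[OF pb] v(1) j1(1) by (auto simp: hom_def E_def)
  have e12: "?v \<cdot> ?e1 = ?j 1 \<cdot> ?e2" by (rule pullbackD(9)[OF pb])
  \<comment> \<open>Both ends of a disk have the same boundary; this makes the square
    \<open>sq\<close> commute, on which the comparison morphism depends.\<close>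
  have ends: "agree ?Z (pull (disk_end n 1) \<delta>) (pull (disk_end n 0) \<delta>)" if d: "smap ?D T ?Y \<delta>" for T \<delta>
  proof -
    obtain h where "homotopy (bd {..n}) (faces {..n}) T ?Y (pull (disk_end n 0) \<delta>) (pull (disk_end n 1) \<delta>) h"
      using disk_smap_homotopy[OF d] by blast
    then have h: "agree ?W (pull (vmap (at 1)) h) (pull (disk_end n 1) \<delta>)"
      "agree (nerve (bd {..n} \<otimes> II)) h (pull (vmap fst) (pull (disk_end n 0) \<delta>))" by (auto simp: homotopy_def)
    have "agree ?Z (pull (vmap (at 1)) h) (pull (vmap (at 1)) (pull (vmap fst) (pull (disk_end n 0) \<delta>)))"
      by (rule agree_pull_vmap[OF h(2) cmap_at[OF K(1)]]) (auto simp: faces_def)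
    also have "agree ?Z \<dots> (pull (disk_end n 0) \<delta>)" by simp (rule agree_pull_ident, simp)
    finally show ?thesis using agree_transs[OF agree_mono[OF h(1) K(3)]] by blast
  qed
  let ?u' = "?r \<cdot> ?e1" and ?v' = "?j 0 \<cdot> ?e2"
  note u' = Comp_in[OF e1 r(1)] and v' = Comp_in[OF e2 j0(1)]
  have sq: "?a \<cdot> ?u' = ?b \<cdot> ?v'"
  proof (rule wlim_unique[OF ZY Comp_in[OF u' a(1)] Comp_in[OF v' b(1)]])
    let ?d = "?uDY \<star> ?e2"
    have "agree ?Z (?uZX \<star> ?u') (?uWX \<star> ?e1)" using agree_trans[OF wlim_restrict_ev[OF ZX WX i e1] pi] .
    then have "agree ?Z (?uZY \<star> (?a \<cdot> ?u')) (f \<odot> (?uWX \<star> ?e1))" using agree_trans[OF wlim_map_ev[OF f ZX ZY u'] agree_push] by blast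
    also have "agree ?Z (f \<odot> (?uWX \<star> ?e1)) (?uWY \<star> (?v \<cdot> ?e1))"
      using agree_mono[OF agree_sym[OF wlim_map_ev[OF f WX WY e1]] K(3)] .
    also have "agree ?Z (?uWY \<star> (?v \<cdot> ?e1)) (pull (disk_end n 1) ?d)"
      unfolding e12 using agree_mono[OF wlim_restrict_ev[OF WY DY j(2) e2] K(3)] .
    also have "agree ?Z (pull (disk_end n 1) ?d) (pull (disk_end n 0) ?d)"
      by (rule ends[OF smap_stage[OF XY(2) sDY e2]])
    finally show "agree ?Z (?uZY \<star> (?a \<cdot> ?u')) (pull (disk_end n 0) ?d)" .
    show "agree ?Z (?uZY \<star> (?b \<cdot> ?v')) (pull (disk_end n 0) ?d)"
      using agree_trans[OF agree_trans[OF wlim_restrict_ev[OF ZY WY i v'] pi] agree_mono[OF wlim_restrict_ev[OF WY DY j(1) e2] K(3)]] .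
  qed
  have DI: "DI_comparison C n f = pb_pair C ?a ?b ?u' ?v'"
    by (simp add: DI_comparison_def Let_def std_simplex_nerve boundary_nerve)
  note iff = pb_pair_regular_epi_iff[OF a(1) b(1) u' v' sq]
  show ?thesis
    unfolding DI iff
  proof
    assume *: "\<forall>T t1 t2. t1 \<in> hom C T (wlim C ?Z ?X) \<longrightarrow> t2 \<in> hom C T (wlim C ?W ?Y) \<longrightarrow> ?a \<cdot> t1 = ?b \<cdot> t2 \<longrightarrow>
      (\<exists>T' c s. cover c T' T \<and> s \<in> hom C T' E \<and> ?u' \<cdot> s = t1 \<cdot> c \<and> ?v' \<cdot> s = t2 \<cdot> c)"
    show "rhl f (bd {..n}) (faces {..n})"
      unfolding rhl_def
    proof (intro allI impI)
      fix T \<phi> \<psi> assume T: "T \<in> Obj C" and h: "smap ?Z T ?X \<phi>" "smap ?W T ?Y \<psi>" "agree ?Z (f \<odot> \<phi>) \<psi>"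
      define t1 where "t1 = wmor ?Z ?X T \<phi>"
      define t2 where "t2 = wmor ?W ?Y T \<psi>"
      have t1: "t1 \<in> hom C T (wlim C ?Z ?X)" "agree ?Z (?uZX \<star> t1) \<phi>" using has_wlimD(4,5)[OF ZX h(1) T] by (auto simp: t1_def)
      have t2: "t2 \<in> hom C T (wlim C ?W ?Y)" "agree ?W (?uWY \<star> t2) \<psi>" using has_wlimD(4,5)[OF WY h(2) T] by (auto simp: t2_def)
      have "?a \<cdot> t1 = ?b \<cdot> t2"
      proof (rule wlim_unique[OF ZY Comp_in[OF t1(1) a(1)] Comp_in[OF t2(1) b(1)]])
        show "agree ?Z (?uZY \<star> (?a \<cdot> t1)) \<psi>"
          using agree_trans[OF wlim_map_ev[OF f ZX ZY t1(1)] agree_trans[OF agree_push[OF t1(2)] h(3)]] .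
        show "agree ?Z (?uZY \<star> (?b \<cdot> t2)) \<psi>"
          using agree_trans[OF wlim_restrict_ev[OF ZY WY i t2(1)] agree_trans[OF pi agree_mono[OF t2(2) K(3)]]] .
      qed
      then obtain T' c s where c: "cover c T' T" "s \<in> hom C T' E" "?u' \<cdot> s = t1 \<cdot> c" "?v' \<cdot> s = t2 \<cdot> c"
        using * t1(1) t2(1) by blast
      note ch = coverD(1)[OF c(1)]
      let ?x = "?e1 \<cdot> s" and ?y = "?e2 \<cdot> s"
      note x = Comp_in[OF c(2) e1] and y = Comp_in[OF c(2) e2]
      have xy: "?r \<cdot> ?x = t1 \<cdot> c" "?j 0 \<cdot> ?y = t2 \<cdot> c" "?v \<cdot> ?x = ?j 1 \<cdot> ?y"
        using c(3,4) assoc[OF c(2) e1 r(1)] assoc[OF c(2) e2 j0(1)] assoc[OF c(2) e1 v(1)] assoc[OF c(2) e2 j1(1)] e12 by simp_all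
      obtain hh where hh: "homotopy (bd {..n}) (faces {..n}) T' ?Y (pull (disk_end n 0) (?uDY \<star> ?y)) (pull (disk_end n 1) (?uDY \<star> ?y)) hh"
        using disk_smap_homotopy[OF smap_stage[OF XY(2) sDY y]] by blast
      have end0: "agree ?W (pull (disk_end n 0) (?uDY \<star> ?y)) (\<psi> \<star> c)"
      proof -
        have "agree ?W (?uWY \<star> (t2 \<cdot> c)) (pull (disk_end n 0) (?uDY \<star> ?y))"
          using wlim_restrict_ev[OF WY DY j(1) y] unfolding xy(2) .
        moreover have "agree ?W (?uWY \<star> (t2 \<cdot> c)) (\<psi> \<star> c)"
          using agree_trans[OF agree_sym[OF stage_stage[OF sWY t2(1) ch]] agree_stage[OF t2(2)]] .
        ultimately show ?thesis by (rule agree_transs)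
      qed
      have end1: "agree ?W (pull (disk_end n 1) (?uDY \<star> ?y)) (f \<odot> (?uWX \<star> ?x))"
      proof -
        have "agree ?W (?uWY \<star> (?v \<cdot> ?x)) (pull (disk_end n 1) (?uDY \<star> ?y))"
          using wlim_restrict_ev[OF WY DY j(2) y] unfolding xy(3) .
        then show ?thesis by (rule agree_transs) (rule wlim_map_ev[OF f WX WY x])
      qed
      show "\<exists>T' c \<chi> h. cover c T' T \<and> smap ?W T' ?X \<chi> \<and> agree ?Z \<chi> (\<phi> \<star> c) \<and>
          homotopy (bd {..n}) (faces {..n}) T' ?Y (\<psi> \<star> c) (f \<odot> \<chi>) h"
      proof (intro exI conjI)
        show "cover c T' T" by fact
        show "smap ?W T' ?X (?uWX \<star> ?x)" by (rule smap_stage[OF XY(1) sWX x])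
        have "agree ?Z (?uZX \<star> (t1 \<cdot> c)) (?uWX \<star> ?x)"
          using agree_trans[OF wlim_restrict_ev[OF ZX WX i x] pi] unfolding xy(1) .
        moreover have "agree ?Z (?uZX \<star> (t1 \<cdot> c)) (\<phi> \<star> c)"
          using agree_trans[OF agree_sym[OF stage_stage[OF sZX t1(1) ch]] agree_stage[OF t1(2)]] .
        ultimately show "agree ?Z (?uWX \<star> ?x) (\<phi> \<star> c)" by (rule agree_transs)
        show "homotopy (bd {..n}) (faces {..n}) T' ?Y (\<psi> \<star> c) (f \<odot> (?uWX \<star> ?x)) hh"
          by (rule homotopy_cong[OF hh end0 end1 K(3)])
      qed
    qed
  next
    assume l: "rhl f (bd {..n}) (faces {..n})"
    show "\<forall>T t1 t2. t1 \<in> hom C T (wlim C ?Z ?X) \<longrightarrow> t2 \<in> hom C T (wlim C ?W ?Y) \<longrightarrow> ?a \<cdot> t1 = ?b \<cdot> t2 \<longrightarrow>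
      (\<exists>T' c s. cover c T' T \<and> s \<in> hom C T' E \<and> ?u' \<cdot> s = t1 \<cdot> c \<and> ?v' \<cdot> s = t2 \<cdot> c)"
    proof (intro allI impI)
      fix T t1 t2 assume t: "t1 \<in> hom C T (wlim C ?Z ?X)" "t2 \<in> hom C T (wlim C ?W ?Y)" "?a \<cdot> t1 = ?b \<cdot> t2"
      have T: "T \<in> Obj C" using homD t by blast
      have "agree ?Z (?uZY \<star> (?a \<cdot> t1)) (?uWY \<star> t2)"
        using agree_trans[OF wlim_restrict_ev[OF ZY WY i t(2)] pi] unfolding t(3) .
      then have "agree ?Z (f \<odot> (?uZX \<star> t1)) (?uWY \<star> t2)"
        by (rule agree_transs[OF wlim_map_ev[OF f ZX ZY t(1)]])
      then obtain T' c \<chi> h where c: "cover c T' T" "smap ?W T' ?X \<chi>" "agree ?Z \<chi> (?uZX \<star> t1 \<star> c)"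
          "homotopy (bd {..n}) (faces {..n}) T' ?Y (?uWY \<star> t2 \<star> c) (f \<odot> \<chi>) h"
        using l[unfolded rhl_def] T smap_stage[OF XY(1) sZX t(1)] smap_stage[OF XY(2) sWY t(2)] by blast
      note ch = coverD(1,5)[OF c(1)]
      obtain \<delta> where d: "smap ?D T' ?Y \<delta>" "agree ?W (pull (disk_end n 0) \<delta>) (?uWY \<star> t2 \<star> c)" "agree ?W (pull (disk_end n 1) \<delta>) (f \<odot> \<chi>)"
        using homotopy_disk_smap[OF c(4) smap_stage[OF XY(2) smap_stage[OF XY(2) sWY t(2)] ch(1)]] unfolding std_simplex_nerve by blast
      define x where "x = wmor ?W ?X T' \<chi>"
      define y where "y = wmor ?D ?Y T' \<delta>"
      have x: "x \<in> hom C T' (wlim C ?W ?X)" "agree ?W (?uWX \<star> x) \<chi>" using has_wlimD(4,5)[OF WX c(2) ch(2)] by (auto simp: x_def)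
      have y: "y \<in> hom C T' (wlim C ?D ?Y)" "agree ?D (?uDY \<star> y) \<delta>" using has_wlimD(4,5)[OF DY d(1) ch(2)] by (auto simp: y_def)
      have "?v \<cdot> x = ?j 1 \<cdot> y"
      proof (rule wlim_unique[OF WY Comp_in[OF x(1) v(1)] Comp_in[OF y(1) j1(1)]])
        show "agree ?W (?uWY \<star> (?v \<cdot> x)) (f \<odot> \<chi>)" using agree_trans[OF wlim_map_ev[OF f WX WY x(1)] agree_push[OF x(2)]] .
        show "agree ?W (?uWY \<star> (?j 1 \<cdot> y)) (f \<odot> \<chi>)"
          using agree_trans[OF wlim_restrict_ev[OF WY DY j(2) y(1)] agree_trans[OF agree_pull[OF y(2) j(2)] d(3)]] .
      qed
      then obtain s where s: "s \<in> hom C T' E" "?e1 \<cdot> s = x" "?e2 \<cdot> s = y"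
        using pullback_lift[OF pb, of x y] x(1) y(1) v(1) j1(1) by (auto simp: hom_def E_def)
      have us: "?u' \<cdot> s = ?r \<cdot> x" and vs: "?v' \<cdot> s = ?j 0 \<cdot> y"
        using assoc[OF s(1) e1 r(1)] assoc[OF s(1) e2 j0(1)] s(2,3) by simp_all
      have "?r \<cdot> x = t1 \<cdot> c"
      proof (rule wlim_unique[OF ZX Comp_in[OF x(1) r(1)] Comp_in[OF ch(1) t(1)]])
        show "agree ?Z (?uZX \<star> (?r \<cdot> x)) \<chi>"
          using agree_trans[OF wlim_restrict_ev[OF ZX WX i x(1)] agree_trans[OF pi agree_mono[OF x(2) K(3)]]] .
        show "agree ?Z (?uZX \<star> (t1 \<cdot> c)) \<chi>"
          using agree_trans[OF agree_sym[OF stage_stage[OF sZX t(1) ch(1)]] agree_sym[OF c(3)]] .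
      qed
      moreover have "?j 0 \<cdot> y = t2 \<cdot> c"
      proof (rule wlim_unique[OF WY Comp_in[OF y(1) j0(1)] Comp_in[OF ch(1) t(2)]])
        show "agree ?W (?uWY \<star> (?j 0 \<cdot> y)) (?uWY \<star> t2 \<star> c)"
          using agree_trans[OF wlim_restrict_ev[OF WY DY j(1) y(1)] agree_trans[OF agree_pull[OF y(2) j(1)] d(2)]] .
        show "agree ?W (?uWY \<star> (t2 \<cdot> c)) (?uWY \<star> t2 \<star> c)"
          using agree_sym[OF stage_stage[OF sWY t(2) ch(1)]] .
      qed
      ultimately show "\<exists>T' c s. cover c T' T \<and> s \<in> hom C T' E \<and> ?u' \<cdot> s = t1 \<cdot> c \<and> ?v' \<cdot> s = t2 \<cdot> c"
        using c(1) s(1) us vs by auto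
    qed
  qed
qed

end

section \<open>Anodyne inclusions\<close>

lemma cprod_Int: "(K \<otimes> M) \<inter> (K' \<otimes> M') = (K \<inter> K') \<otimes> (M \<inter> M')"
  by (auto simp: cprod_def)

lemma cprod_Un_left: "(K \<union> K') \<otimes> M = K \<otimes> M \<union> K' \<otimes> M"
  by (auto simp: cprod_def)

lemma cmap_cprod:
  assumes u: "cmap (fst \<circ> u) N K" "cmap (snd \<circ> u) N M" and N: "\<And>\<sigma>. \<sigma> \<in> N \<Longrightarrow> is_chain \<sigma>"
  shows "cmap u N (K \<otimes> M)"
  unfolding cmap_def
proof (intro ballI conjI)
  fix \<sigma> assume s: "\<sigma> \<in> N"
  show m: "mono_on \<sigma> u"
    using u s by (auto simp: cmap_def mono_on_def less_eq_prod_def)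
  have "is_chain (u ` \<sigma>)"
    unfolding is_chain_def
  proof (intro ballI)
    fix a b assume "a \<in> u ` \<sigma>" "b \<in> u ` \<sigma>"
    then obtain x y where xy: "x \<in> \<sigma>" "y \<in> \<sigma>" "a = u x" "b = u y" by blast
    then have "x \<le> y \<or> y \<le> x" using N[OF s] by (auto simp: is_chain_def)
    then show "a \<le> b \<or> b \<le> a" using m xy by (auto simp: mono_on_def)
  qed
  moreover have "fst ` u ` \<sigma> \<in> K" "snd ` u ` \<sigma> \<in> M" using u s by (auto simp: cmap_def image_image)
  ultimately show "u ` \<sigma> \<in> K \<otimes> M" by (simp add: cprod_def)
qed

lemma cmap_comp: "cmap u K L \<Longrightarrow> cmap v L M \<Longrightarrow> cmap (v \<circ> u) K M"
  unfolding cmap_def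
proof (intro ballI conjI)
  fix \<sigma> assume h: "\<forall>\<sigma> \<in> K. mono_on \<sigma> u \<and> u ` \<sigma> \<in> L" "\<forall>\<sigma> \<in> L. mono_on \<sigma> v \<and> v ` \<sigma> \<in> M" "\<sigma> \<in> K"
  then have m: "mono_on \<sigma> u" "u ` \<sigma> \<in> L" "mono_on (u ` \<sigma>) v" "v ` u ` \<sigma> \<in> M" by auto
  then show "mono_on \<sigma> (v \<circ> u)" by (auto simp: mono_on_def)
  show "(v \<circ> u) ` \<sigma> \<in> M" using m(4) by (simp only: image_comp)
qed

lemma cmap_ident: "cmap (\<lambda>x. x) K K"
  by (auto simp: cmap_def mono_on_def)

lemma cmap_Un: "cmap u K L \<Longrightarrow> cmap u K' L' \<Longrightarrow> cmap u (K \<union> K') (L \<union> L')"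
  by (auto simp: cmap_def)

lemma cprod_chain: "\<sigma> \<in> K \<otimes> M \<Longrightarrow> is_chain \<sigma>"
  by (simp add: cprod_def)

lemma cmap_map_prod:
  assumes "cmap u K K'" "cmap v M M'" shows "cmap (map_prod u v) (K \<otimes> M) (K' \<otimes> M')"
proof (rule cmap_cprod)
  have "fst \<circ> map_prod u v = u \<circ> fst" "snd \<circ> map_prod u v = v \<circ> snd" by auto
  then show "cmap (fst \<circ> map_prod u v) (K \<otimes> M) K'" "cmap (snd \<circ> map_prod u v) (K \<otimes> M) M'"
    using cmap_comp[OF cmap_fst assms(1)] cmap_comp[OF cmap_snd assms(2)] by simp_all
qed (rule cprod_chain)

text \<open>Invertibility matters for the boundary and for the horn: a set that is not the whole
  chain, or not the facet opposite \<open>v\<close>, must not become so under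
  \<open>r\<close>.\<close>

lemma iso_cmaps:
  assumes "mono_on A r" "r ` A = B" "s ` B = A" "\<forall>x \<in> A. s (r x) = x" "\<forall>y \<in> B. r (s y) = y"
  shows "cmap r (faces A) (faces B)" "cmap r (bd A) (bd B)" "v \<in> A \<Longrightarrow> cmap r (horn_faces A v) (horn_faces B (r v))"
proof -
  have m: "mono_on \<tau> r" if "\<tau> \<subseteq> A" for \<tau> using assms(1) that mono_on_subset by blast
  have sub: "r ` \<tau> \<subseteq> B" if "\<tau> \<subseteq> A" for \<tau> using assms(2) that by blast
  have inv: "\<tau> = s ` r ` \<tau>" if "\<tau> \<subseteq> A" for \<tau> using assms(4) that by force
  show f: "cmap r (faces A) (faces B)" using m sub by (auto simp: cmap_def faces_def)
  have n1: "r ` \<tau> \<noteq> B" if "\<tau> \<subseteq> A" "\<tau> \<noteq> A" for \<tau> using inv[OF that(1)] that(2) assms(3) by metis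
  then show "cmap r (bd A) (bd B)" using f by (auto simp: cmap_def bd_def faces_def)
  have n2: "r ` \<tau> \<noteq> B - {r v}" if "\<tau> \<subseteq> A" "\<tau> \<noteq> A - {v}" "v \<in> A" for \<tau> v
  proof
    assume "r ` \<tau> = B - {r v}"
    moreover have "s ` (B - {r v}) = A - {v}"
    proof
      show "s ` (B - {r v}) \<subseteq> A - {v}" using assms(3,5) by auto
      show "A - {v} \<subseteq> s ` (B - {r v})"
      proof
        fix x assume x: "x \<in> A - {v}"
        then have "r x \<in> B - {r v}" using assms(2,4) that(3) by (metis DiffD1 DiffD2 DiffI imageI singletonD singletonI)
        then show "x \<in> s ` (B - {r v})" using assms(4) x by (metis DiffD1 imageI)
      qed
    qed
    ultimately show False using inv[OF that(1)] that(2) by metis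
  qed
  then show "v \<in> A \<Longrightarrow> cmap r (horn_faces A v) (horn_faces B (r v))"
    using f n1 by (auto simp: cmap_def horn_faces_def faces_def)
qed

lemma horn_faces_iff: "\<tau> \<in> horn_faces A v \<longleftrightarrow> \<tau> \<noteq> {} \<and> \<tau> \<subseteq> A \<and> (\<exists>x \<in> A. x \<noteq> v \<and> x \<notin> \<tau>)"
proof -
  have "\<tau> = A \<or> \<tau> = A - {v}" if "\<tau> \<subseteq> A" "\<forall>x \<in> A. x \<noteq> v \<longrightarrow> x \<in> \<tau>"
    using that by (cases "v \<in> \<tau>") auto
  then show ?thesis by (auto simp: horn_faces_def faces_def)
qed

context regular_category
begin

section \<open>Closure of local lifting under composition, pushout and retract\<close>

lemma llift_refl: "llift p K K"
  unfolding llift_def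
proof (intro allI impI)
  fix T \<phi> \<psi> assume h: "T \<in> Obj C" "smap (nerve K) T (sdom p) \<phi>" "smap (nerve K) T (scod p) \<psi>" "agree (nerve K) (p \<odot> \<phi>) \<psi>"
  have "agree (nerve K) \<phi> (\<phi> \<star> Ident C T)" "agree (nerve K) (p \<odot> \<phi>) (\<psi> \<star> Ident C T)"
    using stage_ident[OF h(2)] agree_trans[OF h(4) agree_sym[OF stage_ident[OF h(3)]]] agree_sym by blast+
  then show "\<exists>T' c \<chi>. cover c T' T \<and> smap (nerve K) T' (sdom p) \<chi> \<and> agree (nerve K) \<chi> (\<phi> \<star> c) \<and> agree (nerve K) (p \<odot> \<chi>) (\<psi> \<star> c)"
    using cover_ident[OF h(1)] h(2) by blast
qed

lemma lliftD:
  assumes "llift p K L" "T \<in> Obj C" "smap (nerve K) T (sdom p) \<phi>" "smap (nerve L) T (scod p) \<psi>" "agree (nerve K) (p \<odot> \<phi>) \<psi>"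
  obtains T' c \<chi> where "cover c T' T" "smap (nerve L) T' (sdom p) \<chi>" "agree (nerve K) \<chi> (\<phi> \<star> c)" "agree (nerve L) (p \<odot> \<chi>) (\<psi> \<star> c)"
  using assms unfolding llift_def by blast

lemma llift_trans:
  assumes p: "simplicial_morphism C p" and l: "llift p K L" "llift p L M" "K \<subseteq> L" "L \<subseteq> M"
  shows "llift p K M"
  unfolding llift_def
proof (intro allI impI)
  note XY = smorD(1,2)[OF p]
  fix T \<phi> \<psi> assume h: "T \<in> Obj C" "smap (nerve K) T (sdom p) \<phi>" "smap (nerve M) T (scod p) \<psi>" "agree (nerve K) (p \<odot> \<phi>) \<psi>"
  obtain T1 c1 \<chi>1 where 1: "cover c1 T1 T" "smap (nerve L) T1 (sdom p) \<chi>1" "agree (nerve K) \<chi>1 (\<phi> \<star> c1)" "agree (nerve L) (p \<odot> \<chi>1) (\<psi> \<star> c1)"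
    using lliftD[OF l(1) h(1,2) smap_mono[OF h(3) l(4)] h(4)] .
  note c1 = coverD[OF 1(1)]
  obtain T2 c2 \<chi>2 where 2: "cover c2 T2 T1" "smap (nerve M) T2 (sdom p) \<chi>2" "agree (nerve L) \<chi>2 (\<chi>1 \<star> c2)" "agree (nerve M) (p \<odot> \<chi>2) (\<psi> \<star> c1 \<star> c2)"
    using lliftD[OF l(2) c1(5) 1(2) smap_stage[OF XY(2) h(3) c1(1)] 1(4)] .
  note c2 = coverD[OF 2(1)]
  have "agree (nerve K) \<chi>2 (\<phi> \<star> (c1 \<cdot> c2))"
    using agree_trans[OF agree_mono[OF 2(3) l(3)] agree_trans[OF agree_stage[OF 1(3)] stage_stage[OF h(2) c1(1) c2(1)]]] .
  moreover have "agree (nerve M) (p \<odot> \<chi>2) (\<psi> \<star> (c1 \<cdot> c2))"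
    using agree_trans[OF 2(4) stage_stage[OF h(3) c1(1) c2(1)]] .
  ultimately show "\<exists>T' c \<chi>. cover c T' T \<and> smap (nerve M) T' (sdom p) \<chi> \<and> agree (nerve K) \<chi> (\<phi> \<star> c) \<and> agree (nerve M) (p \<odot> \<chi>) (\<psi> \<star> c)"
    using cover_comp[OF 1(1) 2(1)] 2(2) by blast
qed

text \<open>Solve over \<open>L\<close> the problem restricted to \<open>K \<inter> L\<close>, then
  glue the solution to the given map on \<open>K\<close>, transported to the new stage.\<close>

lemma llift_pushout:
  assumes p: "simplicial_morphism C p" and l: "llift p (K \<inter> L) L" and dc: "down_closed K" "down_closed L"
  shows "llift p K (K \<union> L)"
  unfolding llift_def
proof (intro allI impI)
  note XY = smorD(1,2)[OF p]
  fix T \<phi> \<psi> assume h: "T \<in> Obj C" "smap (nerve K) T (sdom p) \<phi>" "smap (nerve (K \<union> L)) T (scod p) \<psi>" "agree (nerve K) (p \<odot> \<phi>) \<psi>"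
  obtain T1 c \<chi> where 1: "cover c T1 T" "smap (nerve L) T1 (sdom p) \<chi>" "agree (nerve (K \<inter> L)) \<chi> (\<phi> \<star> c)" "agree (nerve L) (p \<odot> \<chi>) (\<psi> \<star> c)"
    by (rule lliftD[OF l h(1) smap_mono[OF h(2)] smap_mono[OF h(3)] agree_mono[OF h(4)]]) auto
  note c = coverD[OF 1(1)]
  have "smap (nerve (K \<union> L)) T1 (sdom p) (glue K (\<phi> \<star> c) \<chi>)"
    by (rule smap_glue[OF dc smap_stage[OF XY(1) h(2) c(1)] 1(2) agree_sym[OF 1(3)]])
  moreover have a: "agree (nerve K) (glue K (\<phi> \<star> c) \<chi>) (\<phi> \<star> c)" by (rule glue_agree(1))
  moreover have b: "agree (nerve L) (glue K (\<phi> \<star> c) \<chi>) \<chi>" by (rule glue_agree(2)[OF agree_sym[OF 1(3)]])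
  moreover have "agree (nerve K) (p \<odot> glue K (\<phi> \<star> c) \<chi>) (\<psi> \<star> c)"
    using agree_trans[OF agree_push[OF a] agree_trans[OF agree_sym[OF push_stage[OF p h(2) c(1)]] agree_stage[OF h(4)]]] .
  moreover have "agree (nerve L) (p \<odot> glue K (\<phi> \<star> c) \<chi>) (\<psi> \<star> c)"
    using agree_trans[OF agree_push[OF b] 1(4)] .
  ultimately show "\<exists>T' c \<chi>. cover c T' T \<and> smap (nerve (K \<union> L)) T' (sdom p) \<chi> \<and> agree (nerve K) \<chi> (\<phi> \<star> c) \<and> agree (nerve (K \<union> L)) (p \<odot> \<chi>) (\<psi> \<star> c)"
    using 1(1) agree_Un by blast
qed

text \<open>Pull the data back along the retraction \<open>r\<close>, solve for the pair
  \<open>K'\<close>, \<open>L'\<close>, and restrict the solution along \<open>s\<close>.\<close>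

lemma llift_retract:
  assumes p: "simplicial_morphism C p" and l: "llift p K' L'"
    and s: "cmap s K K'" "cmap s L L'" and r: "cmap r K' K" "cmap r L' L"
    and rs: "\<And>\<sigma> x. \<sigma> \<in> L \<Longrightarrow> x \<in> \<sigma> \<Longrightarrow> r (s x) = x" and KL: "K \<subseteq> L"
  shows "llift p K L"
  unfolding llift_def
proof (intro allI impI)
  fix T \<phi> \<psi> assume h: "T \<in> Obj C" "smap (nerve K) T (sdom p) \<phi>" "smap (nerve L) T (scod p) \<psi>" "agree (nerve K) (p \<odot> \<phi>) \<psi>"
  have "agree (nerve K') (p \<odot> pull (vmap r) \<phi>) (pull (vmap r) \<psi>)"
    using agree_pull_vmap[OF h(4) r(1)] by simp
  then obtain T1 c \<chi> where 1: "cover c T1 T" "smap (nerve L') T1 (sdom p) \<chi>" "agree (nerve K') \<chi> (pull (vmap r) \<phi> \<star> c)"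
      "agree (nerve L') (p \<odot> \<chi>) (pull (vmap r) \<psi> \<star> c)"
    by (rule lliftD[OF l h(1) smap_pull_vmap[OF h(2) r(1)] smap_pull_vmap[OF h(3) r(2)]])
  have id: "agree (nerve L) (pull (vmap (r \<circ> s)) \<xi> \<star> c) (\<xi> \<star> c)" for \<xi> :: "nat \<Rightarrow> (nat \<Rightarrow> _) \<Rightarrow> 'm"
    by (rule agree_stage[OF agree_pull_ident]) (simp add: rs)
  have "agree (nerve K) (pull (vmap s) \<chi>) (\<phi> \<star> c)"
    using agree_pull_vmap[OF 1(3) s(1)] agree_mono[OF id KL] agree_trans by fastforce
  moreover have "agree (nerve L) (p \<odot> pull (vmap s) \<chi>) (\<psi> \<star> c)"
    using agree_pull_vmap[OF 1(4) s(2)] id agree_trans by fastforce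
  ultimately show "\<exists>T' c \<chi>. cover c T' T \<and> smap (nerve L) T' (sdom p) \<chi> \<and> agree (nerve K) \<chi> (\<phi> \<star> c) \<and> agree (nerve L) (p \<odot> \<chi>) (\<psi> \<star> c)"
    using 1(1) smap_pull_vmap[OF 1(2) s(2)] by blast
qed

text \<open>The form in which internal Kan fibrations are used;
  \<open>internal_Kan_fibration_iff\<close> identifies the two.\<close>

definition horn_lifting :: "('o, 'm) smor \<Rightarrow> bool" where
  "horn_lifting p \<longleftrightarrow> simplicial_morphism C p \<and> (\<forall>n k :: nat. 1 \<le> n \<longrightarrow> k \<le> n \<longrightarrow> llift p (horn_faces {..n} k) (faces {..n}))"

text \<open>The enumeration of the chain transports the standard horn;
  \<open>\<sigma> \<noteq> {v}\<close> corresponds to the condition \<open>1 \<le> n\<close>, since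
  a horn needs a simplex of positive dimension.\<close>

lemma llift_horn:
  assumes p: "horn_lifting p" and s: "finite \<sigma>" "is_chain \<sigma>" "v \<in> \<sigma>" "\<sigma> \<noteq> {v}"
  shows "llift p (horn_faces \<sigma> v) (faces \<sigma>)"
proof -
  have ne: "\<sigma> \<noteq> {}" using s by auto
  obtain n r e where n: "card \<sigma> = Suc n" "mono_on \<sigma> r" "r ` \<sigma> = {..n}" "mono_on {..n} e" "e ` {..n} = \<sigma>"
    "\<And>x. x \<in> \<sigma> \<Longrightarrow> e (r x) = x" "\<And>i. i \<le> n \<Longrightarrow> r (e i) = (i::nat)"
    using chain_enum[OF s(1,2) ne] by metis
  have n': "\<forall>x \<in> \<sigma>. e (r x) = x" "\<forall>i \<in> {..n}. r (e i) = i" using n(6,7) by auto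
  note 1 = iso_cmaps[OF n(2,3,5) n'] and 2 = iso_cmaps[OF n(4,5,3) n'(2,1)]
  have rv: "r v \<le> n" "e (r v) = v" using n(3,6) s(3) by auto
  have "n \<ge> 1"
  proof (rule ccontr)
    assume "\<not> n \<ge> 1"
    then have "card \<sigma> = 1" using n(1) by simp
    then show False using s(3,4) card_1_singletonE by blast
  qed
  then have "llift p (horn_faces {..n} (r v)) (faces {..n})" using p rv(1) by (simp add: horn_lifting_def)
  moreover have "cmap e (horn_faces {..n} (r v)) (horn_faces \<sigma> v)" using 2(3)[of "r v"] rv by simp
  ultimately show ?thesis
    by (rule llift_retract[OF _ _ 1(3)[OF s(3)] 1(1) _ 2(1), rotated])
      (use p n(6) in \<open>auto simp: horn_lifting_def horn_faces_def faces_def\<close>)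
qed

end

text \<open>The maximal chain \<open>(0,0), ..., (i,0), (i,1), ..., (n,1)\<close>: the nondegenerate
  top simplex with index \<open>i\<close> of the prism.\<close>

definition prism_cell :: "nat \<Rightarrow> nat \<Rightarrow> (nat \<times> nat) set" where
  "prism_cell n i = {..i} \<times> {0} \<union> {i..n} \<times> {1}"

lemma prism_cell_props:
  assumes "i \<le> n"
  shows "finite (prism_cell n i)" "is_chain (prism_cell n i)" "fst ` prism_cell n i = {..n}"
    "(i, 0) \<in> prism_cell n i" "(i, 1) \<in> prism_cell n i"
    "(j, 0) \<in> prism_cell n i \<longleftrightarrow> j \<le> i" "(j, 1) \<in> prism_cell n i \<longleftrightarrow> i \<le> j \<and> j \<le> n" "snd ` prism_cell n i \<subseteq> {..1}"
proof -
  show "is_chain (prism_cell n i)" using assms by (auto simp: prism_cell_def is_chain_def)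
  show "fst ` prism_cell n i = {..n}" using assms by (auto simp: prism_cell_def image_Un)
qed (use assms in \<open>auto simp: prism_cell_def\<close>)

text \<open>The cylinder on the boundary with the end \<open>e\<close>, together with the prism
  cells attached so far.\<close>

definition prism_stage :: "nat \<Rightarrow> nat \<Rightarrow> nat set \<Rightarrow> (nat \<times> nat) set set" where
  "prism_stage n e U = bd {..n} \<otimes> II \<union> faces {..n} \<otimes> {{e}} \<union> (\<Union>j \<in> U. faces (prism_cell n j))"

lemma prism_stage_insert: "prism_stage n e (insert i U) = prism_stage n e U \<union> faces (prism_cell n i)"
  by (auto simp: prism_stage_def)

lemma complex_sing [simp]: "complex {{e}}"
  by (auto simp: complex_def down_closed_def is_chain_def subset_singleton_iff)

lemma faces_bd_complex [simp]: "complex (faces {..n::nat})" "complex (bd {..n::nat})" "complex (horn_faces {..n::nat} k)"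
  by (auto intro: faces_complex bd_complex horn_faces_complex)

lemma complex_prism_stage:
  assumes "finite U" "U \<subseteq> {..n}" shows "complex (prism_stage n e U)"
  using assms
proof (induction U rule: finite_induct)
  case empty
  have "prism_stage n e {} = bd {..n} \<otimes> II \<union> faces {..n} \<otimes> {{e}}" by (simp add: prism_stage_def)
  then show ?case by (simp add: complex_Un complex_cprod)
next
  case (insert i U)
  then have c: "complex (prism_stage n e U)" and i: "i \<le> n" by simp_all
  show ?case unfolding prism_stage_insert
    by (rule complex_Un[OF c faces_complex[OF prism_cell_props(1,2)[OF i]]])
qed

text \<open>A face of the cell that omits a first coordinate lies in the cylinder on the boundary.
  Two facets keep all first coordinates. The one omitting \<open>(i, 1 - e)\<close> is present by
  \<open>old\<close>. The one omitting \<open>(i, e)\<close>, like the whole cell, contains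
  \<open>(i, 1 - e)\<close>, which is neither at the end \<open>e\<close> nor in an earlier cell,
  and so it is absent.\<close>

lemma prism_stage_horn:
  assumes i: "i \<le> n" "U \<subseteq> {..n}" "e \<le> 1"
    and new: "\<And>j. j \<in> U \<Longrightarrow> (i, 1 - e) \<notin> prism_cell n j"
    and old: "(\<exists>j \<in> U. prism_cell n i - {(i, 1 - e)} \<subseteq> prism_cell n j) \<or> snd ` (prism_cell n i - {(i, 1 - e)}) \<subseteq> {e}"
  shows "prism_stage n e U \<inter> faces (prism_cell n i) = horn_faces (prism_cell n i) (i, e)"
proof (intro subset_antisym subsetI)
  let ?t = "prism_cell n i" and ?w = "(i, 1 - e)"
  note pc = prism_cell_props[OF i(1)]
  have "e = 0 \<or> e = 1" using i(3) by linarith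
  then have w: "?w \<in> ?t" "?w \<noteq> (i, e)" "(i, e) \<in> ?t" using pc(4,5) by (elim disjE; simp)+
  have proper: "\<rho> \<notin> prism_stage n e U" if r: "?w \<in> \<rho>" "fst ` \<rho> = {..n}" for \<rho>
  proof
    assume "\<rho> \<in> prism_stage n e U"
    moreover have "\<rho> \<notin> bd {..n} \<otimes> II" using r(2) by (auto simp: cprod_def bd_def)
    moreover have "\<rho> \<notin> faces {..n} \<otimes> {{e}}"
    proof
      assume "\<rho> \<in> faces {..n} \<otimes> {{e}}"
      then have "snd ` \<rho> = {e}" by (simp add: cprod_def)
      then have "snd ?w \<in> {e}" using r(1) by blast
      then have "1 - e = e" by simp
      then show False using i(3) by arith
    qed
    moreover have "\<rho> \<notin> faces (prism_cell n j)" if "j \<in> U" for j using new[OF that] r(1) by (auto simp: faces_def)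
    ultimately show False by (auto simp: prism_stage_def)
  qed
  fix \<rho>
  { assume r: "\<rho> \<in> prism_stage n e U \<inter> faces ?t"
    have "\<rho> \<noteq> ?t" using proper[of ?t] w(1) pc(3) r by auto
    moreover have "fst ` (?t - {(i, e)}) = {..n}"
    proof -
      have "fst ` ?t \<subseteq> insert (fst ?w) (fst ` (?t - {(i, e)}))" by force
      moreover have "fst ?w \<in> fst ` (?t - {(i, e)})" using w by blast
      ultimately have "fst ` ?t \<subseteq> fst ` (?t - {(i, e)})" by auto
      then show ?thesis using pc(3) by blast
    qed
    then have "\<rho> \<noteq> ?t - {(i, e)}" using proper[of "?t - {(i, e)}"] w r by auto
    ultimately show "\<rho> \<in> horn_faces ?t (i, e)" using r by (simp add: horn_faces_def) }
  { assume "\<rho> \<in> horn_faces ?t (i, e)"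
    then obtain x where r: "\<rho> \<noteq> {}" "\<rho> \<subseteq> ?t" and x: "x \<in> ?t" "x \<noteq> (i, e)" "x \<notin> \<rho>" using horn_faces_iff by metis
    have ch: "is_chain \<rho>" using pc(2) r(2) by (rule is_chain_subset)
    have sub: "fst ` \<rho> \<subseteq> {..n}" "snd ` \<rho> \<subseteq> {..1}" using r(2) pc(3,8) by blast+
    have "\<rho> \<in> prism_stage n e U"
    proof (cases "x = ?w")
      case True
      then have r': "\<rho> \<subseteq> ?t - {?w}" using r x by blast
      from old show ?thesis
      proof
        assume "\<exists>j \<in> U. ?t - {?w} \<subseteq> prism_cell n j"
        then obtain j where "j \<in> U" "\<rho> \<subseteq> prism_cell n j" using r' by blast
        then have "\<exists>j \<in> U. \<rho> \<in> faces (prism_cell n j)" using r(1) by (auto simp: faces_def)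
        then show ?thesis unfolding prism_stage_def by blast
      next
        assume "snd ` (?t - {?w}) \<subseteq> {e}"
        then have "snd ` \<rho> = {e}" using r' r(1) by blast
        then have "\<rho> \<in> faces {..n} \<otimes> {{e}}" using sub ch r(1) by (simp add: cprod_def faces_def)
        then show ?thesis by (simp add: prism_stage_def)
      qed
    next
      case False
      obtain j d where jd: "x = (j, d)" by force
      have "d \<le> 1" using x(1) jd by (auto simp: prism_cell_def)
      then have "d = e \<or> d = 1 - e" using i(3) by arith
      then have ji: "j \<noteq> i" using False x(2) jd by auto
      \<comment> \<open>Over a first coordinate other than \<open>i\<close> the cell has a single
        vertex, so omitting that vertex omits the coordinate.\<close>
      have "j \<notin> fst ` \<rho>"
      proof
        assume "j \<in> fst ` \<rho>"
        then obtain d' where d': "(j, d') \<in> \<rho>" by force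
        then have "(j, d') \<in> ?t" using r(2) by blast
        then have "d' = d" using x(1) jd ji by (auto simp: prism_cell_def)
        then show False using x(3) jd d' by simp
      qed
      moreover have "j \<le> n" using x(1) jd i(1) by (auto simp: prism_cell_def)
      ultimately have "fst ` \<rho> \<noteq> {..n}" by blast
      then have "\<rho> \<in> bd {..n} \<otimes> II" using sub ch r(1) by (simp add: cprod_def faces_def bd_def)
      then show ?thesis by (simp add: prism_stage_def)
    qed
    then show "\<rho> \<in> prism_stage n e U \<inter> faces ?t" using r by (simp add: faces_def) }
qed

lemma prism_stage_full:
  assumes e: "e \<le> 1" shows "prism_stage n e {..n} = faces {..n} \<otimes> II"
proof (intro subset_antisym subsetI)
  fix \<rho>
  assume r: "\<rho> \<in> prism_stage n e {..n}"
  have "bd {..n} \<otimes> II \<subseteq> faces {..n} \<otimes> II" by (rule cprod_mono) (auto simp: bd_def)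
  moreover have "faces {..n} \<otimes> {{e}} \<subseteq> faces {..n} \<otimes> II" by (rule cprod_mono) (use e in \<open>auto simp: faces_def\<close>)
  moreover have "faces (prism_cell n j) \<subseteq> faces {..n} \<otimes> II" if "j \<le> n" for j
  proof
    fix \<tau> assume t: "\<tau> \<in> faces (prism_cell n j)"
    then have s: "\<tau> \<subseteq> prism_cell n j" by (simp add: faces_def)
    have "fst ` \<tau> \<subseteq> {..n}" using image_mono[OF s, of fst] prism_cell_props(3)[OF that] by simp
    moreover have "snd ` \<tau> \<subseteq> {..1}" using image_mono[OF s, of snd] prism_cell_props(8)[OF that] by (rule order_trans)
    moreover have "is_chain \<tau>" using is_chain_subset[OF prism_cell_props(2)[OF that]] t by (auto simp: faces_def)
    ultimately show "\<tau> \<in> faces {..n} \<otimes> II" using t by (simp add: cprod_def faces_def)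
  qed
  ultimately show "\<rho> \<in> faces {..n} \<otimes> II" using r by (auto simp: prism_stage_def)
next
  fix \<rho> assume r: "\<rho> \<in> faces {..n} \<otimes> II"
  then have ch: "is_chain \<rho>" and sub: "fst ` \<rho> \<subseteq> {..n}" "snd ` \<rho> \<subseteq> {..1}" and ne: "\<rho> \<noteq> {}" by (auto simp: cprod_def faces_def)
  have pt: "j \<le> n \<and> (d = 0 \<or> d = 1)" if "(j, d) \<in> \<rho>" for j d
    using sub that by (force simp: le_Suc_eq)
  show "\<rho> \<in> prism_stage n e {..n}"
  proof (cases "snd ` \<rho> = {e}")
    case True
    then have "\<rho> \<in> faces {..n} \<otimes> {{e}}" using sub ch ne by (simp add: cprod_def faces_def)
    then show ?thesis by (simp add: prism_stage_def)
  next
    case False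
    then obtain x where x: "x \<in> \<rho>" "snd x \<noteq> e" using ne by auto
    \<comment> \<open>The first coordinates of the points of \<open>\<rho>\<close> that lie at the
      end opposite to \<open>e\<close>; nonempty because \<open>\<rho>\<close> is not contained in
      the end \<open>e\<close>.\<close>
    define J where "J = {j. (j, 1 - e) \<in> \<rho>}"
    have "fst x \<in> J" using x pt[of "fst x" "snd x"] e by (cases x) (auto simp: J_def le_Suc_eq)
    moreover have fin: "finite J" by (rule finite_subset[of _ "{..n}"]) (use pt in \<open>auto simp: J_def\<close>)
    ultimately have J: "Min J \<in> J" "Max J \<in> J" "\<And>j. j \<in> J \<Longrightarrow> Min J \<le> j \<and> j \<le> Max J" using Min_in Max_in by auto
    have cmp: "a \<le> b" if "(a, 0) \<in> \<rho>" "(b, 1) \<in> \<rho>" for a b :: nat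
    proof -
      have "(a, 0::nat) \<le> (b, 1::nat) \<or> (b, 1::nat) \<le> (a, 0::nat)" using ch that unfolding is_chain_def by blast
      then show ?thesis by auto
    qed
    \<comment> \<open>A chain passes from level \<open>0\<close> to level \<open>1\<close> only
      once. The prism cell containing it is indexed by the point of level \<open>1 - e\<close>
      nearest to the passage: the first one if this level is \<open>1\<close>, the last one if it is
      \<open>0\<close>.\<close>
    define i where "i = (if e = 0 then Min J else Max J)"
    have i: "i \<le> n" using J(1,2) pt by (auto simp: i_def J_def)
    have "\<rho> \<subseteq> prism_cell n i"
    proof
      fix y assume y: "y \<in> \<rho>"
      obtain j d where jd: "y = (j, d)" by force
      have d: "j \<le> n" "d = 0 \<or> d = 1" using pt y jd by auto
      show "y \<in> prism_cell n i"
      proof (cases "e = 0")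
        case True
        show ?thesis
        proof (cases "d = 0")
          case d0: True
          then show ?thesis using cmp[of j "Min J"] J(1) y jd True by (auto simp: i_def J_def prism_cell_def)
        next
          case False
          then have "j \<in> J" using y jd d True by (auto simp: J_def)
          then show ?thesis using J(3) jd d False True by (auto simp: i_def prism_cell_def)
        qed
      next
        case False
        then have e1: "e = 1" using e by simp
        show ?thesis
        proof (cases "d = 0")
          case True
          then have "j \<in> J" using y jd e1 by (auto simp: J_def)
          then show ?thesis using J(3) jd True e1 by (auto simp: i_def prism_cell_def)
        next
          case False
          then show ?thesis using cmp[of "Max J" j] J(2) y jd d e1 by (auto simp: i_def J_def prism_cell_def)
        qed
      qed
    qed
    then have "\<rho> \<in> faces (prism_cell n i)" using ne by (simp add: faces_def)
    then show ?thesis using i by (auto simp: prism_stage_def)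
  qed
qed

context regular_category
begin

text \<open>Attaching one prism cell is a pushout of a horn inclusion, since
  \<open>prism_stage_horn\<close> identifies the intersection with the previous stage.\<close>

lemma llift_prism_stage:
  assumes p: "horn_lifting p" and i: "i \<le> n" "U \<subseteq> {..n}" "e \<le> 1"
    and new: "\<And>j. j \<in> U \<Longrightarrow> (i, 1 - e) \<notin> prism_cell n j"
    and old: "(\<exists>j \<in> U. prism_cell n i - {(i, 1 - e)} \<subseteq> prism_cell n j) \<or> snd ` (prism_cell n i - {(i, 1 - e)}) \<subseteq> {e}"
  shows "llift p (prism_stage n e U) (prism_stage n e (insert i U))"
  unfolding prism_stage_insert
proof (rule llift_pushout)
  note pc = prism_cell_props[OF i(1)]
  have "e = 0 \<or> e = 1" using i(3) by linarith
  then have v: "(i, e) \<in> prism_cell n i" "prism_cell n i \<noteq> {(i, e)}" using pc(4,5) by (elim disjE; auto)+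
  show "llift p (prism_stage n e U \<inter> faces (prism_cell n i)) (faces (prism_cell n i))"
  proof -
    have "prism_stage n e U \<inter> faces (prism_cell n i) = horn_faces (prism_cell n i) (i, e)"
      by (rule prism_stage_horn[OF i _ old]) (rule new)
    then show ?thesis using llift_horn[OF p pc(1,2) v] by simp
  qed
  have "finite U" using i(2) finite_subset by blast
  then show "down_closed (prism_stage n e U)" by (rule complexD(2)[OF complex_prism_stage[OF _ i(2)]])
  show "down_closed (faces (prism_cell n i))" by (rule complexD(2)[OF faces_complex[OF pc(1,2)]])
qed (use p in \<open>simp add: horn_lifting_def\<close>)

text \<open>The cells of the prism are attached from the end \<open>e\<close>: in decreasing order for \<open>e = 0\<close> and in
  increasing order for \<open>e = 1\<close>.\<close>

lemma llift_prism:
  fixes n :: nat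
  assumes p: "horn_lifting p" and e: "e \<le> 1"
  shows "llift p (bd {..n} \<otimes> II \<union> faces {..n} \<otimes> {{e}}) (faces {..n} \<otimes> II)"
proof -
  have sm: "simplicial_morphism C p" using p by (simp add: horn_lifting_def)
  have mono: "prism_stage n e U \<subseteq> prism_stage n e V" if "U \<subseteq> V" for U V using that by (auto simp: prism_stage_def)
  have "llift p (prism_stage n e {}) (prism_stage n e {..n})"
  proof (cases "e = 0")
    case True
    have "llift p (prism_stage n e {}) (prism_stage n e {n - k<..n})" if "k \<le> n" for k
      using that
    proof (induction k)
      case 0 show ?case by (simp add: llift_refl)
    next
      case (Suc k)
      let ?i = "n - k" and ?U = "{n - k<..n}"
      have eq: "{n - Suc k<..n} = insert ?i ?U" using Suc.prems by auto
      have st: "llift p (prism_stage n e ?U) (prism_stage n e (insert ?i ?U))"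
      proof (rule llift_prism_stage[OF p])
        show "(?i, 1 - e) \<notin> prism_cell n j" if "j \<in> ?U" for j using that True by (auto simp: prism_cell_def)
        show "(\<exists>j \<in> ?U. prism_cell n ?i - {(?i, 1 - e)} \<subseteq> prism_cell n j) \<or> snd ` (prism_cell n ?i - {(?i, 1 - e)}) \<subseteq> {e}"
        \<comment> \<open>For \<open>k = 0\<close> the cell has index \<open>n\<close> and dropping
          \<open>(n, 1)\<close> leaves only the end \<open>0\<close>. Afterwards, dropping
          \<open>(i, 1)\<close> leaves the facet shared with the cell of index \<open>i + 1\<close>,
          which was attached just before.\<close>
        proof (cases "k = 0")
          case True then show ?thesis using \<open>e = 0\<close> by (auto simp: prism_cell_def)
        next
          case False
          then have "Suc ?i \<in> ?U" using Suc.prems by auto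
          moreover have "prism_cell n ?i - {(?i, 1 - e)} \<subseteq> prism_cell n (Suc ?i)" using \<open>e = 0\<close> by (auto simp: prism_cell_def)
          ultimately show ?thesis by blast
        qed
      qed (use e in auto)
      show ?case unfolding eq by (rule llift_trans[OF sm Suc.IH st mono mono]) (use Suc.prems in auto)
    qed
    \<comment> \<open>The sets \<open>{n - k<..n}\<close> never contain \<open>0\<close>, so the
      cell of index \<open>0\<close> is attached separately.\<close>
    from this[of n] have 1: "llift p (prism_stage n e {}) (prism_stage n e {0<..n})" by simp
    have eq: "{..n} = insert 0 {0<..n}" by auto
    have 2: "llift p (prism_stage n e {0<..n}) (prism_stage n e (insert 0 {0<..n}))"
    proof (rule llift_prism_stage[OF p])
      show "(0, 1 - e) \<notin> prism_cell n j" if "j \<in> {0<..n}" for j using that True by (auto simp: prism_cell_def)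
      show "(\<exists>j \<in> {0<..n}. prism_cell n 0 - {(0, 1 - e)} \<subseteq> prism_cell n j) \<or> snd ` (prism_cell n 0 - {(0, 1 - e)}) \<subseteq> {e}"
      proof (cases "n = 0")
        case True then show ?thesis using \<open>e = 0\<close> by (auto simp: prism_cell_def)
      next
        case False
        then have "1 \<in> {0<..n}" by auto
        moreover have "prism_cell n 0 - {(0, 1 - e)} \<subseteq> prism_cell n 1" using \<open>e = 0\<close> by (auto simp: prism_cell_def)
        ultimately show ?thesis by blast
      qed
    qed (use e in auto)
    show ?thesis unfolding eq by (rule llift_trans[OF sm 1 2 mono mono]) auto
  next
    case False
    then have e1: "e = 1" using e by simp
    have "llift p (prism_stage n e {}) (prism_stage n e {..<k})" if "k \<le> Suc n" for k
      using that
    proof (induction k)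
      case 0 show ?case by (simp add: llift_refl)
    next
      case (Suc k)
      have eq: "{..<Suc k} = insert k {..<k}" by auto
      have st: "llift p (prism_stage n e {..<k}) (prism_stage n e (insert k {..<k}))"
      proof (rule llift_prism_stage[OF p])
        show "(k, 1 - e) \<notin> prism_cell n j" if "j \<in> {..<k}" for j using that e1 by (auto simp: prism_cell_def)
        show "(\<exists>j \<in> {..<k}. prism_cell n k - {(k, 1 - e)} \<subseteq> prism_cell n j) \<or> snd ` (prism_cell n k - {(k, 1 - e)}) \<subseteq> {e}"
        proof (cases "k = 0")
          case True then show ?thesis using e1 by (auto simp: prism_cell_def)
        next
          case False
          then have "k - 1 \<in> {..<k}" by auto
          moreover have "prism_cell n k - {(k, 1 - e)} \<subseteq> prism_cell n (k - 1)" using e1 by (auto simp: prism_cell_def)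
          ultimately show ?thesis by blast
        qed
      qed (use e Suc.prems in auto)
      show ?case unfolding eq by (rule llift_trans[OF sm Suc.IH st mono mono]) (use Suc.prems in auto)
    qed
    from this[of "Suc n"] show ?thesis by (simp add: lessThan_Suc_atMost)
  qed
  then show ?thesis unfolding prism_stage_full[OF e] by (simp add: prism_stage_def)
qed

text \<open>The prism over any simplex is isomorphic to the standard prism through the enumeration
  of its vertices, with the interval left fixed.\<close>

lemma llift_cylinder_cell:
  assumes p: "horn_lifting p" and e: "e \<le> 1" and s: "finite \<sigma>" "is_chain \<sigma>" "\<sigma> \<noteq> {}"
  shows "llift p (bd \<sigma> \<otimes> II \<union> faces \<sigma> \<otimes> {{e}}) (faces \<sigma> \<otimes> II)"
proof -
  obtain n r i where n: "card \<sigma> = Suc n" "mono_on \<sigma> r" "r ` \<sigma> = {..n}" "mono_on {..n} i" "i ` {..n} = \<sigma>"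
    "\<And>x. x \<in> \<sigma> \<Longrightarrow> i (r x) = x" "\<And>j. j \<le> n \<Longrightarrow> r (i j) = (j::nat)"
    using chain_enum[OF s] by metis
  have n': "\<forall>x \<in> \<sigma>. i (r x) = x" "\<forall>j \<in> {..n}. r (i j) = j" using n(6,7) by auto
  note 1 = iso_cmaps[OF n(2,3,5) n'] and 2 = iso_cmaps[OF n(4,5,3) n'(2,1)]
  let ?s = "map_prod r (\<lambda>x. x)" and ?r = "map_prod i (\<lambda>x. x)"
  show ?thesis
  proof (rule llift_retract[OF _ llift_prism[OF p e], where s = ?s and r = ?r])
    show "simplicial_morphism C p" using p by (simp add: horn_lifting_def)
    show "cmap ?s (bd \<sigma> \<otimes> II \<union> faces \<sigma> \<otimes> {{e}}) (bd {..n} \<otimes> II \<union> faces {..n} \<otimes> {{e}})"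
      by (intro cmap_Un cmap_map_prod 1 cmap_ident)
    show "cmap ?s (faces \<sigma> \<otimes> II) (faces {..n} \<otimes> II)" by (intro cmap_map_prod 1 cmap_ident)
    show "cmap ?r (bd {..n} \<otimes> II \<union> faces {..n} \<otimes> {{e}}) (bd \<sigma> \<otimes> II \<union> faces \<sigma> \<otimes> {{e}})"
      by (intro cmap_Un cmap_map_prod 2 cmap_ident)
    show "cmap ?r (faces {..n} \<otimes> II) (faces \<sigma> \<otimes> II)" by (intro cmap_map_prod 2 cmap_ident)
    show "?r (?s x) = x" if "\<tau> \<in> faces \<sigma> \<otimes> II" "x \<in> \<tau>" for \<tau> x
    proof -
      have "fst x \<in> \<sigma>" using that by (auto simp: cprod_def faces_def)
      then show ?thesis using n(6) by (cases x) auto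
    qed
    have "{e} \<in> II" using e by (auto simp: faces_def)
    then show "bd \<sigma> \<otimes> II \<union> faces \<sigma> \<otimes> {{e}} \<subseteq> faces \<sigma> \<otimes> II"
      by (intro Un_least cprod_mono) (auto simp: bd_def)
  qed
qed

text \<open>Induction over the cells of \<open>L\<close> outside \<open>K\<close>, with
  \<open>L \<otimes> {{e}}\<close> present from the start: the cylinder on a new cell is attached
  along the cylinder on its boundary and its end \<open>e\<close>, which is
  \<open>llift_cylinder_cell\<close>.\<close>

lemma llift_cylinder:
  assumes p: "horn_lifting p" and e: "e \<le> 1" and KL: "complex K" "complex L" "K \<subseteq> L"
  shows "llift p (K \<otimes> II \<union> L \<otimes> {{e}}) (L \<otimes> II)"
proof -
  have sm: "simplicial_morphism C p" using p by (simp add: horn_lifting_def)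
  have eI: "{{e}} \<subseteq> II" using e by (auto simp: faces_def)
  have "llift p (K \<otimes> II \<union> L \<otimes> {{e}}) (L \<otimes> II \<union> L \<otimes> {{e}})"
  proof (rule cell_induct[OF KL(2,1,3), where P = "\<lambda>M. llift p (K \<otimes> II \<union> L \<otimes> {{e}}) (M \<otimes> II \<union> L \<otimes> {{e}})"])
    show "llift p (K \<otimes> II \<union> L \<otimes> {{e}}) (K \<otimes> II \<union> L \<otimes> {{e}})" by (rule llift_refl)
  next
    fix \<sigma> M
    assume M: "complex M" "K \<subseteq> M" and sL: "\<sigma> \<in> L" and i: "M \<inter> faces \<sigma> = bd \<sigma>"
      and IH: "llift p (K \<otimes> II \<union> L \<otimes> {{e}}) (M \<otimes> II \<union> L \<otimes> {{e}})"
    have s: "finite \<sigma>" "is_chain \<sigma>" "\<sigma> \<noteq> {}" "faces \<sigma> \<subseteq> L"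
      using complexD[OF KL(2)] sL complex_faces_sub[OF KL(2)] by auto
    have "(M \<otimes> II \<union> L \<otimes> {{e}}) \<inter> faces \<sigma> \<otimes> II = (M \<inter> faces \<sigma>) \<otimes> II \<union> faces \<sigma> \<otimes> {{e}}"
    proof -
      have "{{e}} \<inter> II = {{e}}" "L \<inter> faces \<sigma> = faces \<sigma>" using eI s(4) by blast+
      then show ?thesis by (simp add: Int_Un_distrib2 cprod_Int)
    qed
    then have "llift p ((M \<otimes> II \<union> L \<otimes> {{e}}) \<inter> faces \<sigma> \<otimes> II) (faces \<sigma> \<otimes> II)"
      using llift_cylinder_cell[OF p e s(1-3)] i by simp
    moreover have "complex (M \<otimes> II \<union> L \<otimes> {{e}})" "complex (faces \<sigma> \<otimes> II)"
      using M(1) KL(2) faces_complex[OF s(1,2)] by (auto intro!: complex_Un complex_cprod)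
    ultimately have "llift p (M \<otimes> II \<union> L \<otimes> {{e}}) (M \<otimes> II \<union> L \<otimes> {{e}} \<union> faces \<sigma> \<otimes> II)"
      using llift_pushout[OF sm] complexD(2) by blast
    moreover have "M \<otimes> II \<union> L \<otimes> {{e}} \<union> faces \<sigma> \<otimes> II = (M \<union> faces \<sigma>) \<otimes> II \<union> L \<otimes> {{e}}"
      by (auto simp: cprod_Un_left)
    moreover have "K \<otimes> II \<subseteq> M \<otimes> II" using M(2) by (intro cprod_mono) auto
    ultimately show "llift p (K \<otimes> II \<union> L \<otimes> {{e}}) ((M \<union> faces \<sigma>) \<otimes> II \<union> L \<otimes> {{e}})"
      using llift_trans[OF sm IH, of "(M \<union> faces \<sigma>) \<otimes> II \<union> L \<otimes> {{e}}"] by auto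
  qed
  moreover have "L \<otimes> {{e}} \<subseteq> L \<otimes> II" using eI by (intro cprod_mono) auto
  ultimately show ?thesis by (simp add: Un_absorb2)
qed

text \<open>The inclusion of a horn is a retract of a cylinder inclusion, because the simplex retracts
  onto the cylinder end \<open>1 - e\<close> by a map that sends the end \<open>e\<close> into the horn.\<close>

lemma llift_pushout_product:
  fixes A B :: "'q::order set set" and n k :: nat
  assumes p: "horn_lifting p" and n: "1 \<le> n" "k \<le> n" and AB: "complex A" "complex B" "A \<subseteq> B"
  shows "llift p (horn_faces {..n} k \<otimes> B \<union> faces {..n} \<otimes> A) (faces {..n} \<otimes> B)"
proof -
  let ?K = "horn_faces {..n} k \<otimes> B \<union> faces {..n} \<otimes> A" and ?L = "faces {..n} \<otimes> B"
  \<comment> \<open>The end \<open>e\<close> has to go into the horn. For \<open>k < n\<close> this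
    is done by \<open>min i k\<close>, which misses the vertex \<open>n\<close>; for
    \<open>k = n\<close> by \<open>max i k\<close>, which is constantly \<open>n\<close> on
    \<open>{..n}\<close> and misses \<open>0\<close>. At the end \<open>1 - e\<close> the map
    \<open>\<rho>\<close> is the identity in \<open>i\<close>.\<close>
  define e where "e = (if k < n then 0 else 1::nat)"
  define \<rho> where "\<rho> i t = (if e = 0 then (if t = 0 then min i k else i) else (if t = 0 then i else max i k))" for i t :: nat
  have e: "e \<le> 1" by (simp add: e_def)
  have sm: "simplicial_morphism C p" using p by (simp add: horn_lifting_def)
  have hf: "horn_faces {..n} k \<subseteq> faces {..n}" by (auto simp: horn_faces_def)
  have KL: "complex ?K" "complex ?L" "?K \<subseteq> ?L"
    using AB hf by (simp_all add: complex_Un complex_cprod cprod_mono)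
  have \<rho>_mono: "\<rho> i t \<le> \<rho> j u" if "i \<le> j" "t \<le> u" for i j t u using that by (auto simp: \<rho>_def)
  have \<rho>_le: "\<rho> i t \<le> n" if "i \<le> n" for i t using that n by (auto simp: \<rho>_def)
  have \<rho>_cases: "\<rho> i t = i \<or> \<rho> i t = k" for i t by (auto simp: \<rho>_def min_def max_def)
  have \<rho>_id: "\<rho> i (1 - e) = i" for i by (auto simp: \<rho>_def e_def)
  let ?s = "at (1 - e) :: nat \<times> 'q \<Rightarrow> _" and ?r = "\<lambda>x :: (nat \<times> 'q) \<times> nat. (\<rho> (fst (fst x)) (snd x), snd (fst x))"
  have r_chain: "cmap ?r N (P \<otimes> Q)"
    if "\<And>\<sigma>. \<sigma> \<in> N \<Longrightarrow> is_chain \<sigma> \<and> (\<lambda>x. \<rho> (fst (fst x)) (snd x)) ` \<sigma> \<in> P \<and> (\<lambda>x. snd (fst x)) ` \<sigma> \<in> Q" for N P Q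
  proof (rule cmap_cprod)
    show "cmap (fst \<circ> ?r) N P" "cmap (snd \<circ> ?r) N Q"
      using that \<rho>_mono by (auto simp: cmap_def mono_on_def less_eq_prod_def comp_def)
    show "is_chain \<sigma>" if "\<sigma> \<in> N" for \<sigma> using that \<open>\<And>\<sigma>. \<sigma> \<in> N \<Longrightarrow> _\<close> by blast
  qed
  have img: "(\<lambda>x. \<rho> (fst (fst x)) (snd x)) ` \<sigma> \<in> faces {..n}" if "fst ` fst ` \<sigma> \<in> faces {..n}" for \<sigma> :: "((nat \<times> 'q) \<times> nat) set"
  proof -
    have "fst (fst x) \<le> n" if "x \<in> \<sigma>" for x using \<open>fst ` fst ` \<sigma> \<in> _\<close> that by (auto simp: faces_def)
    then show ?thesis using that \<rho>_le by (auto simp: faces_def)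
  qed
  \<comment> \<open>Each value of \<open>\<rho>\<close> is either its first argument or
    \<open>k\<close>, so a vertex different from \<open>k\<close> that is omitted stays
    omitted.\<close>
  have himg: "(\<lambda>x. \<rho> (fst (fst x)) (snd x)) ` \<sigma> \<in> horn_faces {..n} k" if h: "fst ` fst ` \<sigma> \<in> horn_faces {..n} k" for \<sigma> :: "((nat \<times> 'q) \<times> nat) set"
  proof -
    obtain j where j: "j \<in> {..n}" "j \<noteq> k" "j \<notin> fst ` fst ` \<sigma>" using h horn_faces_iff by metis
    have "j \<noteq> \<rho> (fst (fst x)) (snd x)" if "x \<in> \<sigma>" for x
      using \<rho>_cases[of "fst (fst x)" "snd x"] j that by auto
    then have "j \<notin> (\<lambda>x. \<rho> (fst (fst x)) (snd x)) ` \<sigma>" by blast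
    moreover have "(\<lambda>x. \<rho> (fst (fst x)) (snd x)) ` \<sigma> \<in> faces {..n}" using img h hf by blast
    ultimately show ?thesis using j unfolding horn_faces_iff faces_def by blast
  qed
  have eimg: "(\<lambda>x. \<rho> (fst (fst x)) (snd x)) ` \<sigma> \<in> horn_faces {..n} k" if h: "fst ` fst ` \<sigma> \<in> faces {..n}" "snd ` \<sigma> = {e}" for \<sigma> :: "((nat \<times> 'q) \<times> nat) set"
  proof -
    define j where "j = (if e = 0 then n else 0)"
    have "j \<noteq> \<rho> (fst (fst x)) (snd x)" if "x \<in> \<sigma>" for x
    proof -
      have "snd x = e" using that h(2) by blast
      moreover have "fst (fst x) \<le> n" using that h(1) by (auto simp: faces_def)
      ultimately show ?thesis using n by (auto simp: \<rho>_def j_def e_def split: if_splits)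
    qed
    then have "j \<notin> (\<lambda>x. \<rho> (fst (fst x)) (snd x)) ` \<sigma>" by blast
    moreover have "j \<in> {..n}" "j \<noteq> k" using n by (auto simp: j_def e_def split: if_splits)
    moreover have "(\<lambda>x. \<rho> (fst (fst x)) (snd x)) ` \<sigma> \<in> faces {..n}" by (rule img[OF h(1)])
    ultimately show ?thesis unfolding horn_faces_iff faces_def by blast
  qed
  have eI: "{1 - e} \<in> II" by (auto simp: faces_def)
  show ?thesis
  proof (rule llift_retract[OF sm llift_cylinder[OF p e KL], where s = ?s and r = ?r])
    show "cmap ?s ?K (?K \<otimes> II \<union> ?L \<otimes> {{e}})"
      by (rule cmap_subset[OF cmap_at[OF KL(1) eI]]) auto
    show "cmap ?s ?L (?L \<otimes> II)" by (rule cmap_at[OF KL(2) eI])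
    show "cmap ?r (?L \<otimes> II) ?L"
      by (rule r_chain) (auto simp: cprod_def image_image intro: img[simplified image_image])
    have 1: "cmap ?r ((horn_faces {..n} k \<otimes> B) \<otimes> II) (horn_faces {..n} k \<otimes> B)"
      by (rule r_chain) (auto simp: cprod_def image_image intro: himg[simplified image_image])
    have 2: "cmap ?r ((faces {..n} \<otimes> A) \<otimes> II) (faces {..n} \<otimes> A)"
      by (rule r_chain) (auto simp: cprod_def image_image intro: img[simplified image_image])
    have 3: "cmap ?r (?L \<otimes> {{e}}) (horn_faces {..n} k \<otimes> B)"
      by (rule r_chain) (auto simp: cprod_def image_image intro: eimg[simplified image_image])
    show "cmap ?r (?K \<otimes> II \<union> ?L \<otimes> {{e}}) ?K"
      unfolding cprod_Un_left using cmap_Un[OF cmap_Un[OF 1 2] 3] by (rule cmap_subset) auto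
    show "?r (?s x) = x" for x using \<rho>_id by simp
  qed (fact KL(3))
qed

end

section \<open>Homotopies\<close>

lemma agree_fst_at: "agree (nerve (L \<otimes> {{e}})) \<phi> (pull (vmap fst) (pull (vmap (at e)) \<phi>))"
proof -
  have "(at e \<circ> fst) x = x" if s: "\<sigma> \<in> L \<otimes> {{e}}" "x \<in> \<sigma>" for \<sigma> x
  proof -
    have "snd ` \<sigma> = {e}" using s(1) by (simp add: cprod_def)
    then have "snd x = e" using s(2) by blast
    then show ?thesis by (cases x) simp
  qed
  then have "agree (nerve (L \<otimes> {{e}})) (pull (vmap (at e \<circ> fst)) \<phi>) \<phi>" by (rule agree_pull_ident)
  then show ?thesis unfolding pull_vmap_comp by (rule agree_sym)
qed

lemma agree_at_fst: "agree (nerve L) (pull (vmap (at e)) (pull (vmap fst) y)) y"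
  unfolding pull_vmap_comp by (rule agree_pull_ident) simp

lemma cmap_at_sing: "complex K \<Longrightarrow> cmap (at e) K (K \<otimes> {{e}})"
  by (rule cmap_at) simp_all

lemma II_sing: "e \<le> 1 \<Longrightarrow> {{e}} \<subseteq> II"
  by (auto simp: faces_def)

context category
begin

section \<open>Formal calculus of homotopies\<close>

lemma stage_comp:
  assumes "smap Z T X \<phi>" "c \<in> hom C T' T" "d \<in> hom C T'' T'" "agree Z \<xi> (\<phi> \<star> c)"
  shows "agree Z (\<xi> \<star> d) (\<phi> \<star> (c \<cdot> d))"
  using agree_trans[OF agree_stage[OF assms(4)] stage_stage[OF assms(1-3)]] .

lemma push_stage_cong:
  assumes "simplicial_morphism C f" "smap Z T (sdom f) \<phi>" "c \<in> hom C T' T" "agree Z \<xi> (\<phi> \<star> c)"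
  shows "agree Z (f \<odot> \<xi>) ((f \<odot> \<phi>) \<star> c)"
  using agree_trans[OF agree_push[OF assms(4)] agree_sym[OF push_stage[OF assms(1-3)]]] .

lemma homotopyD:
  assumes "homotopy K L T Y y0 y1 h"
  shows "smap (nerve (L \<otimes> II)) T Y h" "agree (nerve L) (pull (vmap (at 0)) h) y0"
    "agree (nerve L) (pull (vmap (at 1)) h) y1" "agree (nerve (K \<otimes> II)) h (pull (vmap fst) y0)"
  using assms by (auto simp: homotopy_def)

lemma homotopy_stage:
  assumes "simplicial_object C Y" "homotopy K L T Y y0 y1 h" "c \<in> hom C T' T"
  shows "homotopy K L T' Y (y0 \<star> c) (y1 \<star> c) (h \<star> c)"
proof -
  note h = homotopyD[OF assms(2)]
  show ?thesis unfolding homotopy_def pull_stage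
    using smap_stage[OF assms(1) h(1) assms(3)] h(2-4)[THEN agree_stage] by simp
qed

lemma homotopy_push:
  assumes "simplicial_morphism C f" "homotopy K L T (sdom f) y0 y1 h"
  shows "homotopy K L T (scod f) (f \<odot> y0) (f \<odot> y1) (f \<odot> h)"
proof -
  note h = homotopyD[OF assms(2)]
  show ?thesis unfolding homotopy_def pull_push
    using smap_push[OF assms(1) h(1)] h(2-4)[THEN agree_push] by simp
qed

lemma homotopy_const:
  assumes "smap (nerve L) T Y y" "K \<subseteq> L"
  shows "homotopy K L T Y y y (pull (vmap fst) y)"
  unfolding homotopy_def by (intro conjI smap_pull_vmap[OF assms(1) cmap_fst] agree_at_fst agree_refl)

lemma homotopy_rel:
  assumes h: "homotopy K L T Y y0 y1 h" and K: "complex K" "K \<subseteq> L" shows "agree (nerve K) y0 y1"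
proof -
  have "agree (nerve K) (pull (vmap (at 1)) h) (pull (vmap (at 1)) (pull (vmap fst) y0))"
    by (rule agree_pull_vmap[OF homotopyD(4)[OF h] cmap_at[OF K(1)]]) (auto simp: faces_def)
  then have "agree (nerve K) (pull (vmap (at 1)) h) y0" using agree_at_fst agree_trans by blast
  then show ?thesis using agree_mono[OF homotopyD(3)[OF h] K(2)] agree_transs by blast
qed

end

context regular_category
begin

text \<open>The target is terminal in each level, which is the form needed for generalized elements;
  \<open>internal_Kan_complex_iff\<close> relates this to terminal simplicial objects.\<close>

definition kan :: "('o, 'm) sobj \<Rightarrow> bool" where
  "kan X \<longleftrightarrow> (\<exists>t. horn_lifting t \<and> sdom t = X \<and> (\<forall>n. is_terminal C (level (scod t) n)))"

lemma terminal_unique: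
  assumes "is_terminal C U" "f \<in> hom C a U" "g \<in> hom C a U" shows "f = g"
proof -
  have "\<exists>!h. h \<in> hom C a U" using assms homD(4)[OF assms(2)] by (simp add: is_terminal_def)
  then show ?thesis using assms by blast
qed

lemma smap_terminal:
  assumes X: "simplicial_object C X" and t: "\<And>n. is_terminal C (level X n)" and T: "T \<in> Obj C"
  obtains \<psi> where "smap (nerve K) T X \<psi>"
proof -
  define \<psi> where "\<psi> m (\<alpha> :: nat \<Rightarrow> 'a) = (THE f. f \<in> hom C T (level X m))" for m \<alpha>
  have p: "\<psi> m \<alpha> \<in> hom C T (level X m)" for m \<alpha>
    unfolding \<psi>_def by (rule theI') (use t[of m] T in \<open>simp add: is_terminal_def\<close>)
  have "smap (nerve K) T X \<psi>"
    unfolding smap_def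
  proof (intro conjI allI ballI)
    fix l m \<theta> \<alpha> assume h: "\<theta> \<in> delta_hom l m"
    show "\<psi> l (sset_op (nerve K) l m \<theta> \<alpha>) = sobj_op X l m \<theta> \<cdot> \<psi> m \<alpha>"
      by (rule terminal_unique[OF t p Comp_in[OF p sobjD(2)[OF X h]]])
  qed (rule p)
  then show thesis using that by blast
qed

lemma smap_terminal_agree:
  assumes "\<And>n. is_terminal C (level X n)" "smap Z T X \<phi>" "smap Z T X \<psi>" shows "agree Z \<phi> \<psi>"
  unfolding agree_def using terminal_unique[OF assms(1) smapD(1)[OF assms(2)] smapD(1)[OF assms(3)]] by blast

text \<open>Over a levelwise terminal target all compatibility conditions in the target hold.
  Lifting thus depends on the source alone, which also makes the choice of the terminal object
  irrelevant.\<close>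

lemma lext_iff_llift:
  assumes t: "simplicial_morphism C t" "\<And>n. is_terminal C (level (scod t) n)" and KL: "K \<subseteq> L"
  shows "llift t K L \<longleftrightarrow> lext (sdom t) K L"
proof
  assume l: "llift t K L"
  show "lext (sdom t) K L"
    unfolding lext_def
  proof (intro allI impI)
    fix T \<phi> assume h: "T \<in> Obj C" "smap (nerve K) T (sdom t) \<phi>"
    obtain \<psi> where p: "smap (nerve L) T (scod t) \<psi>" by (rule smap_terminal[OF smorD(2)[OF t(1)] t(2) h(1)])
    have "agree (nerve K) (t \<odot> \<phi>) \<psi>"
      by (rule smap_terminal_agree[OF t(2) smap_push[OF t(1) h(2)] smap_mono[OF p KL]])
    then show "\<exists>T' c \<chi>. cover c T' T \<and> smap (nerve L) T' (sdom t) \<chi> \<and> agree (nerve K) \<chi> (\<phi> \<star> c)"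
      using lliftD[OF l h p] by metis
  qed
next
  assume l: "lext (sdom t) K L"
  show "llift t K L"
    unfolding llift_def
  proof (intro allI impI)
    fix T \<phi> \<psi> assume h: "T \<in> Obj C" "smap (nerve K) T (sdom t) \<phi>" "smap (nerve L) T (scod t) \<psi>"
    obtain T' c \<chi> where c: "cover c T' T" "smap (nerve L) T' (sdom t) \<chi>" "agree (nerve K) \<chi> (\<phi> \<star> c)"
      using l h unfolding lext_def by blast
    have "agree (nerve L) (t \<odot> \<chi>) (\<psi> \<star> c)"
      by (rule smap_terminal_agree[OF t(2) smap_push[OF t(1) c(2)] smap_stage[OF smorD(2)[OF t(1)] h(3) coverD(1)[OF c(1)]]])
    then show "\<exists>T' c \<chi>. cover c T' T \<and> smap (nerve L) T' (sdom t) \<chi> \<and> agree (nerve K) \<chi> (\<phi> \<star> c) \<and> agree (nerve L) (t \<odot> \<chi>) (\<psi> \<star> c)"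
      using c by blast
  qed
qed

lemma kan_sobj: "kan X \<Longrightarrow> simplicial_object C X"
  unfolding kan_def horn_lifting_def using smorD(1) by blast

lemma cylinder_incl: "e \<le> 1 \<Longrightarrow> K \<subseteq> L \<Longrightarrow> K \<otimes> II \<union> L \<otimes> {{e}} \<subseteq> L \<otimes> II"
  using II_sing[of e] by (intro Un_least cprod_mono) auto

lemma kan_cylinder:
  assumes X: "kan X" and KL: "complex K" "complex L" "K \<subseteq> L" and e: "e \<le> 1"
  shows "lext X (K \<otimes> II \<union> L \<otimes> {{e}}) (L \<otimes> II)"
proof -
  obtain t where t: "horn_lifting t" "sdom t = X" "\<And>n. is_terminal C (level (scod t) n)" using X unfolding kan_def by blast
  have "simplicial_morphism C t" using t(1) by (simp add: horn_lifting_def)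
  from lext_iff_llift[OF this t(3) cylinder_incl[OF e KL(3)]] show ?thesis using llift_cylinder[OF t(1) e KL] t(2) by blast
qed

text \<open>The map on the open cylinder is glued from \<open>H\<close> and from \<open>y\<close>
  placed at the end \<open>e\<close>. The pieces meet in \<open>K \<otimes> {{e}}\<close>, where
  \<open>H\<close> is determined by its value at the end \<open>e\<close>.\<close>

lemma homotopy_extension:
  assumes X: "kan X" and KL: "complex K" "complex L" "K \<subseteq> L" and e: "e \<le> 1" and T: "T \<in> Obj C"
    and H: "smap (nerve (K \<otimes> II)) T X H" and y: "smap (nerve L) T X y" and Hy: "agree (nerve K) (pull (vmap (at e)) H) y"
  obtains T' c G where "cover c T' T" "smap (nerve (L \<otimes> II)) T' X G" "agree (nerve (K \<otimes> II)) G (H \<star> c)"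
    "agree (nerve L) (pull (vmap (at e)) G) (y \<star> c)"
proof -
  let ?A = "K \<otimes> II" and ?B = "L \<otimes> {{e}}" and ?y = "pull (vmap fst) y"
  have y': "smap (nerve ?B) T X ?y" by (rule smap_pull_vmap[OF y cmap_fst])
  have "K \<inter> L = K" "II \<inter> {{e}} = {{e}}" using KL(3) II_sing[OF e] by blast+
  then have int: "?A \<inter> ?B = K \<otimes> {{e}}" by (simp only: cprod_Int)
  have "agree (nerve (K \<otimes> {{e}})) H (pull (vmap fst) (pull (vmap (at e)) H))" by (rule agree_fst_at)
  also have "agree (nerve (K \<otimes> {{e}})) \<dots> ?y" by (rule agree_pull_vmap[OF Hy cmap_fst])
  finally have ag: "agree (nerve (?A \<inter> ?B)) H ?y" unfolding int .
  have cA: "complex ?A" "complex ?B" using KL by (simp_all add: complex_cprod)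
  let ?g = "glue ?A H ?y"
  have g: "smap (nerve (?A \<union> ?B)) T X ?g" by (rule smap_glue[OF cA[THEN complexD(2)] H y' ag])
  obtain T' c G where c: "cover c T' T" "smap (nerve (L \<otimes> II)) T' X G" "agree (nerve (?A \<union> ?B)) G (?g \<star> c)"
    using kan_cylinder[OF X KL e] T g unfolding lext_def by blast
  have 1: "agree (nerve ?A) G (H \<star> c)"
    using agree_trans[OF agree_mono[OF c(3)] agree_stage[OF glue_agree(1)]] by blast
  have "agree (nerve ?B) G (?y \<star> c)"
    using agree_trans[OF agree_mono[OF c(3)] agree_stage[OF glue_agree(2)[OF ag]]] by blast
  from agree_pull_vmap[OF this cmap_at_sing[OF KL(2)]]
  have "agree (nerve L) (pull (vmap (at e)) G) (pull (vmap (at e)) ?y \<star> c)" unfolding pull_stage .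
  then have "agree (nerve L) (pull (vmap (at e)) G) (y \<star> c)"
    using agree_trans[OF _ agree_stage[OF agree_at_fst]] by blast
  then show thesis using that c(1,2) 1 by blast
qed

text \<open>Filling a square of homotopies with the side \<open>1 - e\<close> missing; the sides \<open>l\<close> and \<open>r\<close> run in the
  second direction.\<close>

lemma homotopy_square:
  assumes Y: "kan Y" and KL: "complex K" "complex L" "K \<subseteq> L" and e: "e \<le> 1" and T: "T \<in> Obj C"
    and l: "smap (nerve (L \<otimes> II)) T Y l" and r: "smap (nerve (L \<otimes> II)) T Y r" and lr: "agree (nerve (K \<otimes> II)) l r"
    and b: "homotopy K L T Y (pull (vmap (at e)) l) (pull (vmap (at e)) r) b"
  obtains T' c h where "cover c T' T" "homotopy K L T' Y (pull (vmap (at (1 - e))) l \<star> c) (pull (vmap (at (1 - e))) r \<star> c) h"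
proof -
  \<comment> \<open>A point of the square is \<open>((x, s), t)\<close>, where \<open>s\<close> is
    the direction of \<open>b\<close> and \<open>t\<close> that of \<open>l\<close> and
    \<open>r\<close>; the map \<open>u\<close> forgets \<open>s\<close>.\<close>
  define u :: "('a \<times> nat) \<times> nat \<Rightarrow> 'a \<times> nat" where "u = map_prod fst (\<lambda>x. x)"
  have u_at: "u \<circ> at d = at d \<circ> fst" for d by (auto simp: u_def)
  \<comment> \<open>The square is prescribed by \<open>l\<close> on \<open>?K1\<close>, that is, on
    the side \<open>s = 0\<close> and over \<open>K\<close>, and by \<open>r\<close> on
    \<open>?K3\<close>, the side \<open>s = 1\<close>.\<close>
  let ?K1 = "K \<otimes> II \<union> L \<otimes> {{0}}" and ?K3 = "L \<otimes> {{1}}" and ?L2 = "L \<otimes> II"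
  have s0: "{{0}} \<subseteq> II" "{{1}} \<subseteq> II" by (auto simp: faces_def)
  have sub: "?K1 \<subseteq> ?L2" "?K3 \<subseteq> ?L2" using cylinder_incl[of 0, OF _ KL(3)] cylinder_incl[of 1, OF _ KL(3)] by blast+
  have cx: "complex ?K1" "complex ?K3" "complex ?L2" "complex (?K1 \<union> ?K3)"
    using KL by (simp_all add: complex_cprod complex_Un)
  have cu: "cmap u (M \<otimes> II) (N \<otimes> II)" if "cmap fst M N" for M N
    unfolding u_def by (rule cmap_map_prod[OF that cmap_ident])
  have cu1: "cmap u (?K1 \<otimes> II) (L \<otimes> II)" "cmap u (?K3 \<otimes> II) (L \<otimes> II)"
    by (rule cu[OF cmap_subset[OF cmap_fst sub(1) subset_refl]], rule cu[OF cmap_subset[OF cmap_fst sub(2) subset_refl]])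
  have "?K1 \<inter> ?K3 = K \<otimes> {{1}}"
  proof -
    have "K \<inter> L = K" "II \<inter> {{1}} = {{1}}" "{{0::nat}} \<inter> {{1}} = {}" using KL(3) s0 by auto
    moreover have "L \<otimes> ({} :: nat set set) = {}" by (simp add: cprod_def)
    ultimately show ?thesis by (simp only: Int_Un_distrib2 cprod_Int Int_absorb Un_empty_right)
  qed
  then have int: "?K1 \<otimes> II \<inter> ?K3 \<otimes> II = (K \<otimes> {{1}}) \<otimes> II" by (simp only: cprod_Int Int_absorb)
  have ag: "agree (nerve (?K1 \<otimes> II \<inter> ?K3 \<otimes> II)) (pull (vmap u) l) (pull (vmap u) r)"
    unfolding int by (rule agree_pull_vmap[OF lr cu[OF cmap_fst]])
  let ?H = "glue (?K1 \<otimes> II) (pull (vmap u) l) (pull (vmap u) r)"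
  have dc: "down_closed (?K1 \<otimes> II)" "down_closed (?K3 \<otimes> II)"
    by (rule complexD(2)[OF complex_cprod[OF cx(1) II_simps(3)]], rule complexD(2)[OF complex_cprod[OF cx(2) II_simps(3)]])
  have H: "smap (nerve ((?K1 \<union> ?K3) \<otimes> II)) T Y ?H"
    unfolding cprod_Un_left[of ?K1]
    by (rule smap_glue[OF dc smap_pull_vmap[OF l cu1(1)] smap_pull_vmap[OF r cu1(2)] ag])
  note H1 = glue_agree(1)[of "?K1 \<otimes> II" "pull (vmap u) l" "pull (vmap u) r"] and H3 = glue_agree(2)[OF ag]
  have ends: "agree (nerve M) (pull (vmap (at d)) \<xi>) (pull (vmap fst) (pull (vmap (at d)) k) \<star> c)"
    if "agree (nerve (M \<otimes> II)) \<xi> (pull (vmap u) k \<star> c)" "complex M" "d \<le> 1" for M d \<xi> k c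
  proof -
    have "{d} \<in> II" using that(3) by (auto simp: faces_def)
    then have "agree (nerve M) (pull (vmap (at d)) \<xi>) (pull (vmap (at d)) (pull (vmap u) k \<star> c))"
      by (rule agree_pull_vmap[OF that(1) cmap_at[OF that(2)]])
    then show ?thesis unfolding pull_stage pull_vmap_comp u_at .
  qed
  have ends': "agree (nerve M) (pull (vmap (at d)) \<xi>) (pull (vmap fst) (pull (vmap (at d)) k))"
    if "agree (nerve (M \<otimes> II)) \<xi> (pull (vmap u) k)" "complex M" "d \<le> 1" for M d \<xi> k
  proof -
    have "{d} \<in> II" using that(3) by (auto simp: faces_def)
    then have "agree (nerve M) (pull (vmap (at d)) \<xi>) (pull (vmap (at d)) (pull (vmap u) k))"
      by (rule agree_pull_vmap[OF that(1) cmap_at[OF that(2)]])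
    then show ?thesis unfolding pull_vmap_comp u_at .
  qed
  note b' = homotopyD[OF b]
  have Hb: "agree (nerve (?K1 \<union> ?K3)) (pull (vmap (at e)) ?H) b"
  proof (rule agree_Un)
    have "agree (nerve (L \<otimes> {{0}})) b (pull (vmap fst) (pull (vmap (at e)) l))"
      using agree_trans[OF agree_fst_at agree_pull_vmap[OF b'(2) cmap_fst]] .
    then have "agree (nerve ?K1) b (pull (vmap fst) (pull (vmap (at e)) l))" using agree_Un[OF b'(4)] by blast
    then show "agree (nerve ?K1) (pull (vmap (at e)) ?H) b"
      using agree_trans[OF ends'[OF H1 cx(1) e] agree_sym] by blast
    have "agree (nerve ?K3) b (pull (vmap fst) (pull (vmap (at e)) r))"
      using agree_trans[OF agree_fst_at agree_pull_vmap[OF b'(3) cmap_fst]] .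
    then show "agree (nerve ?K3) (pull (vmap (at e)) ?H) b"
      using agree_trans[OF ends'[OF H3 cx(2) e] agree_sym] by blast
  qed
  have K2L: "?K1 \<union> ?K3 \<subseteq> ?L2" using sub by blast
  \<comment> \<open>Homotopy extension in the direction \<open>t\<close> for the inclusion of
    \<open>?K1 \<union> ?K3\<close> into \<open>L \<otimes> II\<close>, with \<open>b\<close> as the
    given end \<open>t = e\<close>. The end \<open>t = 1 - e\<close> of the filling is the missing
    side.\<close>
  obtain T' c G where c: "cover c T' T" "smap (nerve (?L2 \<otimes> II)) T' Y G" "agree (nerve ((?K1 \<union> ?K3) \<otimes> II)) G (?H \<star> c)"
    by (rule homotopy_extension[OF Y cx(4,3) K2L e T H b'(1) Hb])
  let ?d = "1 - e"
  let ?h = "pull (vmap (at ?d)) G"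
  have G1: "agree (nerve (?K1 \<otimes> II)) G (pull (vmap u) l \<star> c)"
    using agree_trans[OF agree_mono[OF c(3)] agree_stage[OF H1]] cprod_mono[of ?K1 "?K1 \<union> ?K3" II II] by blast
  have G3: "agree (nerve (?K3 \<otimes> II)) G (pull (vmap u) r \<star> c)"
    using agree_trans[OF agree_mono[OF c(3)] agree_stage[OF H3]] cprod_mono[of ?K3 "?K1 \<union> ?K3" II II] by blast
  have d: "?d \<le> 1" "{?d} \<in> II" by (auto simp: faces_def)
  note h1 = ends[OF G1 cx(1) d(1)] and h3 = ends[OF G3 cx(2) d(1)]
  have "homotopy K L T' Y (pull (vmap (at ?d)) l \<star> c) (pull (vmap (at ?d)) r \<star> c) ?h"
    unfolding homotopy_def
  proof (intro conjI)
    show "smap (nerve ?L2) T' Y ?h" by (rule smap_pull_vmap[OF c(2) cmap_at[OF cx(3) d(2)]])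
    have "agree (nerve (L \<otimes> {{0}})) ?h (pull (vmap fst) (pull (vmap (at ?d)) l \<star> c))"
      using agree_mono[OF h1] unfolding pull_stage by blast
    from agree_pull_vmap[OF this cmap_at_sing[OF KL(2)]]
    show "agree (nerve L) (pull (vmap (at 0)) ?h) (pull (vmap (at ?d)) l \<star> c)"
      using agree_trans[OF _ agree_at_fst] by blast
    have "agree (nerve (L \<otimes> {{1}})) ?h (pull (vmap fst) (pull (vmap (at ?d)) r \<star> c))"
      using h3 unfolding pull_stage .
    from agree_pull_vmap[OF this cmap_at_sing[OF KL(2)]]
    show "agree (nerve L) (pull (vmap (at 1)) ?h) (pull (vmap (at ?d)) r \<star> c)"
      using agree_trans[OF _ agree_at_fst] by blast
    show "agree (nerve (K \<otimes> II)) ?h (pull (vmap fst) (pull (vmap (at ?d)) l \<star> c))"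
      using agree_mono[OF h1] unfolding pull_stage by blast
  qed
  then show thesis using that c(1) by blast
qed

text \<open>A square with the constant homotopy at \<open>y0\<close> on the left, \<open>h2\<close>
  on the right and \<open>h1\<close> at the end \<open>0\<close>: its end \<open>1\<close> runs from
  \<open>y0\<close> to \<open>y2\<close>.\<close>

lemma homotopy_trans:
  assumes Y: "kan Y" and KL: "complex K" "complex L" "K \<subseteq> L" and T: "T \<in> Obj C" and y0: "smap (nerve L) T Y y0"
    and h1: "homotopy K L T Y y0 y1 h1" and h2: "homotopy K L T Y y1 y2 h2"
  obtains T' c h where "cover c T' T" "homotopy K L T' Y (y0 \<star> c) (y2 \<star> c) h"
proof -
  let ?l = "pull (vmap fst) y0"
  have l: "smap (nerve (L \<otimes> II)) T Y ?l" by (rule smap_pull_vmap[OF y0 cmap_fst])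
  have "agree (nerve (K \<otimes> II)) ?l (pull (vmap fst) y1)"
    by (rule agree_pull_vmap[OF homotopy_rel[OF h1 KL(1,3)] cmap_fst])
  then have lr: "agree (nerve (K \<otimes> II)) ?l h2" using agree_trans[OF _ agree_sym[OF homotopyD(4)[OF h2]]] by blast
  have b: "homotopy K L T Y (pull (vmap (at 0)) ?l) (pull (vmap (at 0)) h2) h1"
    by (rule homotopy_cong[OF h1 agree_sym[OF agree_at_fst] agree_sym[OF homotopyD(2)[OF h2]] KL(3)])
  have "(0::nat) \<le> 1" by simp
  then obtain T' c h where c: "cover c T' T" "homotopy K L T' Y (pull (vmap (at (1 - 0))) ?l \<star> c) (pull (vmap (at (1 - 0))) h2 \<star> c) h"
    by (rule homotopy_square[OF Y KL _ T l homotopyD(1)[OF h2] lr b])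
  have d: "1 - 0 = (1::nat)" by simp
  have "homotopy K L T' Y (y0 \<star> c) (y2 \<star> c) h"
    by (rule homotopy_cong[OF c(2)[unfolded d] agree_stage[OF agree_at_fst] agree_stage[OF homotopyD(3)[OF h2]] KL(3)])
  then show thesis using that c(1) by blast
qed

section \<open>Relative homotopy lifting\<close>

lemma rhlD:
  assumes "rhl f K L" "T \<in> Obj C" "smap (nerve K) T (sdom f) \<phi>" "smap (nerve L) T (scod f) \<psi>" "agree (nerve K) (f \<odot> \<phi>) \<psi>"
  obtains T' c \<chi> h where "cover c T' T" "smap (nerve L) T' (sdom f) \<chi>" "agree (nerve K) \<chi> (\<phi> \<star> c)"
    "homotopy K L T' (scod f) (\<psi> \<star> c) (f \<odot> \<chi>) h"
  using assms unfolding rhl_def by blast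

lemma rhl_refl:
  assumes f: "simplicial_morphism C f" shows "rhl f K K"
  unfolding rhl_def
proof (intro allI impI)
  note XY = smorD(1,2)[OF f]
  fix T \<phi> \<psi> assume h: "T \<in> Obj C" "smap (nerve K) T (sdom f) \<phi>" "smap (nerve K) T (scod f) \<psi>" "agree (nerve K) (f \<odot> \<phi>) \<psi>"
  note c = cover_ident[OF h(1)]
  have s: "smap (nerve K) T (scod f) (\<psi> \<star> Ident C T)" by (rule smap_stage[OF XY(2) h(3) coverD(1)[OF c]])
  have "agree (nerve K) (\<psi> \<star> Ident C T) (f \<odot> \<phi>)"
    using agree_trans[OF stage_ident[OF h(3)] agree_sym[OF h(4)]] .
  then have "homotopy K K T (scod f) (\<psi> \<star> Ident C T) (f \<odot> \<phi>) (pull (vmap fst) (\<psi> \<star> Ident C T))"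
    by (rule homotopy_cong[OF homotopy_const[OF s subset_refl] agree_refl _ subset_refl])
  then show "\<exists>T' c \<chi> h. cover c T' T \<and> smap (nerve K) T' (sdom f) \<chi> \<and> agree (nerve K) \<chi> (\<phi> \<star> c) \<and>
      homotopy K K T' (scod f) (\<psi> \<star> c) (f \<odot> \<chi>) h"
    using c h(2) agree_sym[OF stage_ident[OF h(2)]] by blast
qed

text \<open>The homotopy found on \<open>L\<close> is stationary on \<open>K \<inter> L\<close>, so
  it glues with the constant homotopy on \<open>K\<close>.\<close>

lemma rhl_pushout:
  assumes f: "simplicial_morphism C f" and l: "rhl f (K \<inter> L) L" and KL: "complex K" "complex L"
  shows "rhl f K (K \<union> L)"
  unfolding rhl_def
proof (intro allI impI)
  note XY = smorD(1,2)[OF f] and dc = KL[THEN complexD(2)]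
  fix T \<phi> \<psi> assume h: "T \<in> Obj C" "smap (nerve K) T (sdom f) \<phi>" "smap (nerve (K \<union> L)) T (scod f) \<psi>" "agree (nerve K) (f \<odot> \<phi>) \<psi>"
  obtain T1 c \<chi> g where 1: "cover c T1 T" "smap (nerve L) T1 (sdom f) \<chi>" "agree (nerve (K \<inter> L)) \<chi> (\<phi> \<star> c)"
      "homotopy (K \<inter> L) L T1 (scod f) (\<psi> \<star> c) (f \<odot> \<chi>) g"
    by (rule rhlD[OF l h(1) smap_mono[OF h(2)] smap_mono[OF h(3)] agree_mono[OF h(4)]]) auto
  note c = coverD(1)[OF 1(1)] and g = homotopyD[OF 1(4)]
  let ?x = "glue K (\<phi> \<star> c) \<chi>" and ?z = "pull (vmap fst) (\<psi> \<star> c)"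
  have x: "smap (nerve (K \<union> L)) T1 (sdom f) ?x"
    by (rule smap_glue[OF dc smap_stage[OF XY(1) h(2) c] 1(2) agree_sym[OF 1(3)]])
  have a: "agree (nerve K) ?x (\<phi> \<star> c)" by (rule glue_agree(1))
  have b: "agree (nerve L) ?x \<chi>" by (rule glue_agree(2)[OF agree_sym[OF 1(3)]])
  have z: "smap (nerve (K \<otimes> II)) T1 (scod f) ?z"
    by (rule smap_pull_vmap[OF smap_mono[OF smap_stage[OF XY(2) h(3) c]] cmap_fst]) auto
  have int: "K \<otimes> II \<inter> L \<otimes> II = (K \<inter> L) \<otimes> II" by (simp only: cprod_Int Int_absorb)
  have ag: "agree (nerve (K \<otimes> II \<inter> L \<otimes> II)) ?z g" unfolding int by (rule agree_sym[OF g(4)])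
  let ?h = "glue (K \<otimes> II) ?z g"
  have h1: "agree (nerve (K \<otimes> II)) ?h ?z" by (rule glue_agree(1))
  have h2: "agree (nerve (L \<otimes> II)) ?h g" by (rule glue_agree(2)[OF ag])
  have I: "{e} \<in> II" if "e \<le> 1" for e using that by (auto simp: faces_def)
  have e1: "agree (nerve K) (pull (vmap (at e)) ?h) (\<psi> \<star> c)" if "e \<le> 1" for e
    using agree_trans[OF agree_pull_vmap[OF h1 cmap_at[OF KL(1) I[OF that]]] agree_at_fst] .
  have e2: "agree (nerve L) (pull (vmap (at e)) ?h) (pull (vmap (at e)) g)" if "e \<le> 1" for e
    by (rule agree_pull_vmap[OF h2 cmap_at[OF KL(2) I[OF that]]])
  have fx1: "agree (nerve K) (\<psi> \<star> c) (f \<odot> ?x)"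
    using agree_trans[OF agree_stage[OF agree_sym[OF h(4)]] agree_sym[OF push_stage_cong[OF f h(2) c a]]] .
  have "homotopy K (K \<union> L) T1 (scod f) (\<psi> \<star> c) (f \<odot> ?x) ?h"
    unfolding homotopy_def
  proof (intro conjI)
    have "down_closed (K \<otimes> II)" "down_closed (L \<otimes> II)" using KL by (simp_all add: complex_cprod complexD(2))
    then show "smap (nerve ((K \<union> L) \<otimes> II)) T1 (scod f) ?h"
      unfolding cprod_Un_left by (rule smap_glue[OF _ _ z g(1) ag])
    show "agree (nerve (K \<union> L)) (pull (vmap (at 0)) ?h) (\<psi> \<star> c)"
      using agree_Un[OF e1 agree_trans[OF e2 g(2)]] by simp
    show "agree (nerve (K \<union> L)) (pull (vmap (at 1)) ?h) (f \<odot> ?x)"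
      by (rule agree_Un[OF agree_trans[OF e1 fx1] agree_trans[OF e2 agree_trans[OF g(3) agree_push[OF agree_sym[OF b]]]]]) simp_all
  qed (fact h1)
  then show "\<exists>T' c \<chi> h. cover c T' T \<and> smap (nerve (K \<union> L)) T' (sdom f) \<chi> \<and> agree (nerve K) \<chi> (\<phi> \<star> c) \<and>
      homotopy K (K \<union> L) T' (scod f) (\<psi> \<star> c) (f \<odot> \<chi>) h"
    using 1(1) x a by blast
qed

text \<open>After the first lifting, \<open>f \<odot> \<chi>1\<close> is only homotopic to
  \<open>\<psi>\<close> on \<open>L\<close>, while the second lifting problem needs strict
  agreement. Homotopy extension deforms \<open>\<psi>\<close> into a map \<open>?\<psi>'\<close>
  that agrees with it on \<open>L\<close>; the deformation and the second homotopy are then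
  concatenated.\<close>

lemma rhl_trans:
  assumes f: "simplicial_morphism C f" and Y: "kan (scod f)" and l: "rhl f K L" "rhl f L M"
    and cx: "complex K" "complex L" "complex M" and sub: "K \<subseteq> L" "L \<subseteq> M"
  shows "rhl f K M"
  unfolding rhl_def
proof (intro allI impI)
  note XY = smorD(1,2)[OF f]
  fix T \<phi> \<psi> assume h: "T \<in> Obj C" "smap (nerve K) T (sdom f) \<phi>" "smap (nerve M) T (scod f) \<psi>" "agree (nerve K) (f \<odot> \<phi>) \<psi>"
  have KM: "K \<subseteq> M" using sub by blast
  obtain T1 c1 \<chi>1 h1 where 1: "cover c1 T1 T" "smap (nerve L) T1 (sdom f) \<chi>1" "agree (nerve K) \<chi>1 (\<phi> \<star> c1)"
      "homotopy K L T1 (scod f) (\<psi> \<star> c1) (f \<odot> \<chi>1) h1"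
    by (rule rhlD[OF l(1) h(1,2) smap_mono[OF h(3) sub(2)] h(4)])
  note c1 = coverD[OF 1(1)] and h1 = homotopyD[OF 1(4)]
  have \<psi>1: "smap (nerve M) T1 (scod f) (\<psi> \<star> c1)" by (rule smap_stage[OF XY(2) h(3) c1(1)])
  have "(0::nat) \<le> 1" by simp
  then obtain T2 c2 G where 2: "cover c2 T2 T1" "smap (nerve (M \<otimes> II)) T2 (scod f) G" "agree (nerve (L \<otimes> II)) G (h1 \<star> c2)"
      "agree (nerve M) (pull (vmap (at 0)) G) (\<psi> \<star> c1 \<star> c2)"
    by (rule homotopy_extension[OF Y cx(2,3) sub(2) _ c1(5) h1(1) \<psi>1 h1(2)])
  note c2 = coverD[OF 2(1)]
  let ?\<psi>' = "pull (vmap (at 1)) G"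
  have \<psi>': "smap (nerve M) T2 (scod f) ?\<psi>'" by (rule smap_pull_vmap[OF 2(2) cmap_at[OF cx(3)]]) (simp add: faces_def)
  have "agree (nerve L) ?\<psi>' (pull (vmap (at 1)) (h1 \<star> c2))"
    by (rule agree_pull_vmap[OF 2(3) cmap_at[OF cx(2)]]) (simp add: faces_def)
  then have "agree (nerve L) ?\<psi>' ((f \<odot> \<chi>1) \<star> c2)" unfolding pull_stage using agree_trans[OF _ agree_stage[OF h1(3)]] by blast
  then have fx: "agree (nerve L) (f \<odot> (\<chi>1 \<star> c2)) ?\<psi>'"
    using agree_sym[OF agree_trans[OF _ push_stage[OF f 1(2) c2(1)]]] by blast
  obtain T3 c3 \<chi>3 h3 where 3: "cover c3 T3 T2" "smap (nerve M) T3 (sdom f) \<chi>3" "agree (nerve L) \<chi>3 (\<chi>1 \<star> c2 \<star> c3)"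
      "homotopy L M T3 (scod f) (?\<psi>' \<star> c3) (f \<odot> \<chi>3) h3"
    by (rule rhlD[OF l(2) c2(5) smap_stage[OF XY(1) 1(2) c2(1)] \<psi>' fx])
  note c3 = coverD[OF 3(1)]
  have Gh: "homotopy K M T2 (scod f) (\<psi> \<star> c1 \<star> c2) ?\<psi>' G"
    unfolding homotopy_def
  proof (intro conjI)
    have "agree (nerve (K \<otimes> II)) G (h1 \<star> c2)" by (rule agree_mono[OF 2(3) cprod_mono[OF sub(1) subset_refl]])
    also have "agree (nerve (K \<otimes> II)) (h1 \<star> c2) (pull (vmap fst) (\<psi> \<star> c1) \<star> c2)" by (rule agree_stage[OF h1(4)])
    finally show "agree (nerve (K \<otimes> II)) G (pull (vmap fst) (\<psi> \<star> c1 \<star> c2))" unfolding pull_stage .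
  qed (use 2 in auto)
  have Gh3: "homotopy K M T3 (scod f) (\<psi> \<star> c1 \<star> c2 \<star> c3) (?\<psi>' \<star> c3) (G \<star> c3)" by (rule homotopy_stage[OF XY(2) Gh c3(1)])
  \<comment> \<open>A homotopy relative to \<open>L\<close> is in particular relative to
    \<open>K\<close>, as concatenation requires.\<close>
  have h3: "homotopy K M T3 (scod f) (?\<psi>' \<star> c3) (f \<odot> \<chi>3) h3"
    unfolding homotopy_def using homotopyD[OF 3(4)] agree_mono[OF homotopyD(4)[OF 3(4)] cprod_mono[OF sub(1) subset_refl]] by blast
  have \<psi>3: "smap (nerve M) T3 (scod f) (\<psi> \<star> c1 \<star> c2 \<star> c3)" 
    by (rule smap_stage[OF XY(2) smap_stage[OF XY(2) \<psi>1 c2(1)] c3(1)])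
  obtain T4 c4 h4 where 4: "cover c4 T4 T3" "homotopy K M T4 (scod f) (\<psi> \<star> c1 \<star> c2 \<star> c3 \<star> c4) ((f \<odot> \<chi>3) \<star> c4) h4"
    by (rule homotopy_trans[OF Y cx(1,3) KM c3(5) \<psi>3 Gh3 h3])
  note c4 = coverD[OF 4(1)]
  let ?c = "((c1 \<cdot> c2) \<cdot> c3) \<cdot> c4"
  note c12 = cover_comp[OF 1(1) 2(1)] note c123 = cover_comp[OF c12 3(1)]
  note c = cover_comp[OF c123 4(1)]
  have "agree (nerve M) (\<psi> \<star> c1 \<star> c2 \<star> c3 \<star> c4) (\<psi> \<star> ?c)"
    by (rule stage_comp[OF h(3) coverD(1)[OF c123] c4(1) stage_comp[OF h(3) coverD(1)[OF c12] c3(1) stage_stage[OF h(3) c1(1) c2(1)]]])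
  then have "homotopy K M T4 (scod f) (\<psi> \<star> ?c) (f \<odot> (\<chi>3 \<star> c4)) h4"
    by (rule homotopy_cong[OF 4(2) _ push_stage[OF f 3(2) c4(1)] KM])
  moreover have "agree (nerve K) (\<chi>3 \<star> c4) (\<phi> \<star> ?c)"
  proof (rule stage_comp[OF h(2) coverD(1)[OF c123] c4(1)])
    show "agree (nerve K) \<chi>3 (\<phi> \<star> ((c1 \<cdot> c2) \<cdot> c3))"
      using agree_trans[OF agree_mono[OF 3(3) sub(1)] stage_comp[OF h(2) coverD(1)[OF c12] c3(1) stage_comp[OF h(2) c1(1) c2(1) 1(3)]]] .
  qed
  ultimately show "\<exists>T' c \<chi> h. cover c T' T \<and> smap (nerve M) T' (sdom f) \<chi> \<and> agree (nerve K) \<chi> (\<phi> \<star> c) \<and>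
      homotopy K M T' (scod f) (\<psi> \<star> c) (f \<odot> \<chi>) h"
    using c smap_stage[OF XY(1) 3(2) c4(1)] by blast
qed

text \<open>As for \<open>llift_retract\<close>; the homotopy is restricted along \<open>s\<close>
  in the first coordinate, with the interval left fixed.\<close>

lemma rhl_retract:
  assumes f: "simplicial_morphism C f" and l: "rhl f K' L'"
    and s: "cmap s K K'" "cmap s L L'" and r: "cmap r K' K" "cmap r L' L"
    and rs: "\<And>\<sigma> x. \<sigma> \<in> L \<Longrightarrow> x \<in> \<sigma> \<Longrightarrow> r (s x) = x" and KL: "K \<subseteq> L" and cx: "complex L"
  shows "rhl f K L"
  unfolding rhl_def
proof (intro allI impI)
  fix T \<phi> \<psi> assume h: "T \<in> Obj C" "smap (nerve K) T (sdom f) \<phi>" "smap (nerve L) T (scod f) \<psi>" "agree (nerve K) (f \<odot> \<phi>) \<psi>"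
  have "agree (nerve K') (f \<odot> pull (vmap r) \<phi>) (pull (vmap r) \<psi>)"
    using agree_pull_vmap[OF h(4) r(1)] by simp
  then obtain T1 c \<chi> g where 1: "cover c T1 T" "smap (nerve L') T1 (sdom f) \<chi>" "agree (nerve K') \<chi> (pull (vmap r) \<phi> \<star> c)"
      "homotopy K' L' T1 (scod f) (pull (vmap r) \<psi> \<star> c) (f \<odot> \<chi>) g"
    by (rule rhlD[OF l h(1) smap_pull_vmap[OF h(2) r(1)] smap_pull_vmap[OF h(3) r(2)]])
  note g = homotopyD[OF 1(4)]
  have id: "agree (nerve L) (pull (vmap (r \<circ> s)) \<xi> \<star> c) (\<xi> \<star> c)" for \<xi> :: "nat \<Rightarrow> (nat \<Rightarrow> _) \<Rightarrow> 'm"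
    by (rule agree_stage[OF agree_pull_ident]) (simp add: rs)
  have x: "agree (nerve K) (pull (vmap s) \<chi>) (\<phi> \<star> c)"
    using agree_trans[OF agree_pull_vmap[OF 1(3) s(1), unfolded pull_stage pull_vmap_comp] agree_mono[OF id KL]] .
  let ?s = "map_prod s (\<lambda>x. x) :: _ \<times> nat \<Rightarrow> _"
  have sI: "cmap ?s (L \<otimes> II) (L' \<otimes> II)" "cmap ?s (K \<otimes> II) (K' \<otimes> II)" by (intro cmap_map_prod s cmap_ident)+
  have at_s: "?s \<circ> at e = at e \<circ> s" "fst \<circ> ?s = s \<circ> fst" for e by auto
  have y: "agree (nerve L) (pull (vmap s) (pull (vmap r) \<psi> \<star> c)) (\<psi> \<star> c)"
    using id unfolding pull_stage pull_vmap_comp .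
  have e: "agree (nerve L) (pull (vmap (at d)) (pull (vmap ?s) g)) (pull (vmap s) \<xi>)"
    if "agree (nerve L') (pull (vmap (at d)) g) \<xi>" for d \<xi>
    unfolding pull_vmap_comp at_s unfolding pull_vmap_comp[symmetric] by (rule agree_pull_vmap[OF that s(2)])
  have "homotopy K L T1 (scod f) (\<psi> \<star> c) (f \<odot> pull (vmap s) \<chi>) (pull (vmap ?s) g)"
    unfolding homotopy_def
  proof (intro conjI)
    show "smap (nerve (L \<otimes> II)) T1 (scod f) (pull (vmap ?s) g)" by (rule smap_pull_vmap[OF g(1) sI(1)])
    show "agree (nerve L) (pull (vmap (at 0)) (pull (vmap ?s) g)) (\<psi> \<star> c)" by (rule agree_trans[OF e[OF g(2)] y])
    show "agree (nerve L) (pull (vmap (at 1)) (pull (vmap ?s) g)) (f \<odot> pull (vmap s) \<chi>)"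
      using e[OF g(3)] unfolding pull_push .
    have "agree (nerve (K \<otimes> II)) (pull (vmap ?s) g) (pull (vmap ?s) (pull (vmap fst) (pull (vmap r) \<psi> \<star> c)))"
      by (rule agree_pull_vmap[OF g(4) sI(2)])
    also have "pull (vmap ?s) (pull (vmap fst) (pull (vmap r) \<psi> \<star> c)) = pull (vmap fst) (pull (vmap s) (pull (vmap r) \<psi> \<star> c))"
      unfolding pull_vmap_comp at_s ..
    also have "agree (nerve (K \<otimes> II)) \<dots> (pull (vmap fst) (\<psi> \<star> c))"
      by (rule agree_pull_vmap[OF agree_mono[OF y KL] cmap_fst])
    finally show "agree (nerve (K \<otimes> II)) (pull (vmap ?s) g) (pull (vmap fst) (\<psi> \<star> c))" .
  qed
  then show "\<exists>T' c \<chi> h. cover c T' T \<and> smap (nerve L) T' (sdom f) \<chi> \<and> agree (nerve K) \<chi> (\<phi> \<star> c) \<and>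
      homotopy K L T' (scod f) (\<psi> \<star> c) (f \<odot> \<chi>) h"
    using 1(1) x smap_pull_vmap[OF 1(2) s(2)] by blast
qed

text \<open>Cell by cell: \<open>rhl_pushout\<close> attaches one cell and \<open>rhl_trans\<close>
  composes the inclusions. The target is Kan so that \<open>rhl_trans\<close> can extend and
  concatenate homotopies.\<close>

lemma rhl_complex:
  assumes f: "simplicial_morphism C f" and Y: "kan (scod f)"
    and l: "\<And>n. rhl f (bd {..n::nat}) (faces {..n})" and KL: "complex K" "complex L" "K \<subseteq> L"
  shows "rhl f K L"
proof (rule cell_induct[OF KL(2,1,3), where P = "rhl f K"])
  show "rhl f K K" by (rule rhl_refl[OF f])
  fix \<sigma> M assume M: "complex M" "K \<subseteq> M" and sL: "\<sigma> \<in> L" and i: "M \<inter> faces \<sigma> = bd \<sigma>" and cM: "complex (M \<union> faces \<sigma>)" and IH: "rhl f K M"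
  have s: "finite \<sigma>" "is_chain \<sigma>" "\<sigma> \<noteq> {}" using complexD[OF KL(2)] sL by auto
  obtain n r e where n: "card \<sigma> = Suc n" "mono_on \<sigma> r" "r ` \<sigma> = {..n}" "mono_on {..n} e" "e ` {..n} = \<sigma>"
    "\<And>x. x \<in> \<sigma> \<Longrightarrow> e (r x) = x" "\<And>i. i \<le> n \<Longrightarrow> r (e i) = (i::nat)"
    using chain_enum[OF s] by metis
  have n': "\<forall>x \<in> \<sigma>. e (r x) = x" "\<forall>i \<in> {..n}. r (e i) = i" using n(6,7) by auto
  note 1 = iso_cmaps[OF n(2,3,5) n'] and 2 = iso_cmaps[OF n(4,5,3) n'(2,1)]
  have "rhl f (bd \<sigma>) (faces \<sigma>)"
    by (rule rhl_retract[OF f l[of n] 1(2,1) 2(2,1)])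
      (use n(6) faces_complex[OF s(1,2)] in \<open>auto simp: bd_def faces_def\<close>)
  then have "rhl f M (M \<union> faces \<sigma>)"
    by (intro rhl_pushout[OF f _ M(1) faces_complex[OF s(1,2)]]) (simp add: i)
  then show "rhl f K (M \<union> faces \<sigma>)"
    by (rule rhl_trans[OF f Y IH _ KL(1) M(1) cM M(2)]) simp
qed

end

section \<open>Two out of three\<close>

lemma nerve_empty: "simplices (nerve {}) m = {}"
  by auto

context category
begin

text \<open>A relation and not an operation, so that one morphism can serve as the common value of
  both composites in a commuting square.\<close>

definition is_comp :: "('o, 'm) smor \<Rightarrow> ('o, 'm) smor \<Rightarrow> ('o, 'm) smor \<Rightarrow> bool" where
  "is_comp h g f \<longleftrightarrow> simplicial_morphism C f \<and> simplicial_morphism C g \<and> simplicial_morphism C h \<and>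
     sdom h = sdom f \<and> scod h = scod g \<and> scod f = sdom g \<and> (\<forall>n. component h n = component g n \<cdot> component f n)"

lemma is_compD:
  assumes "is_comp h g f"
  shows "simplicial_morphism C f" "simplicial_morphism C g" "simplicial_morphism C h"
    "sdom h = sdom f" "scod h = scod g" "scod f = sdom g"
    "smap Z T (sdom f) \<phi> \<Longrightarrow> agree Z (h \<odot> \<phi>) (g \<odot> f \<odot> \<phi>)"
proof -
  show a: "simplicial_morphism C f" "simplicial_morphism C g" "simplicial_morphism C h"
    "sdom h = sdom f" "scod h = scod g" "scod f = sdom g"
    using assms by (auto simp: is_comp_def)
  show "agree Z (h \<odot> \<phi>) (g \<odot> f \<odot> \<phi>)" if p: "smap Z T (sdom f) \<phi>"
    unfolding agree_def push_def
  proof (intro allI ballI)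
    fix m z assume z: "z \<in> simplices Z m"
    have "component h m = component g m \<cdot> component f m" using assms by (simp add: is_comp_def)
    then show "component h m \<cdot> \<phi> m z = component g m \<cdot> component f m \<cdot> \<phi> m z"
      using assoc[OF smapD(1)[OF p z] smorD(3)[OF a(1)] smorD(3)[OF a(2), of m, folded a(6)]] by simp
  qed
qed

end

context regular_category
begin

lemma rhlI:
  assumes "\<And>T \<phi> \<psi>. T \<in> Obj C \<Longrightarrow> smap (nerve K) T (sdom f) \<phi> \<Longrightarrow> smap (nerve L) T (scod f) \<psi> \<Longrightarrow>
    agree (nerve K) (f \<odot> \<phi>) \<psi> \<Longrightarrow>
    \<exists>T' c \<chi> h. cover c T' T \<and> smap (nerve L) T' (sdom f) \<chi> \<and> agree (nerve K) \<chi> (\<phi> \<star> c) \<and>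
      homotopy K L T' (scod f) (\<psi> \<star> c) (f \<odot> \<chi>) h"
  shows "rhl f K L"
  using assms unfolding rhl_def by blast

text \<open>Lift through \<open>g\<close> first and lift the result through \<open>f\<close>. The
  second homotopy is pushed forward along \<open>g\<close> and concatenated with the first.\<close>

lemma rhl_comp:
  assumes gf: "is_comp gf g f" and Z: "kan (scod g)" and r: "rhl f K L" "rhl g K L"
    and KL: "complex K" "complex L" "K \<subseteq> L"
  shows "rhl gf K L"
proof (rule rhlI)
  note cm = is_compD[OF gf] note f = cm(1) and g = cm(2) and s = cm(4-6)
  note X = smorD(1)[OF f] and Y = smorD(1)[OF g] and Z' = smorD(2)[OF g]
  fix T \<phi> \<psi> assume T: "T \<in> Obj C" and "smap (nerve K) T (sdom gf) \<phi>" "smap (nerve L) T (scod gf) \<psi>" and ag: "agree (nerve K) (gf \<odot> \<phi>) \<psi>"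
  then have \<phi>: "smap (nerve K) T (sdom f) \<phi>" and \<psi>: "smap (nerve L) T (scod g) \<psi>" using s by simp_all
  have f\<phi>: "smap (nerve K) T (sdom g) (f \<odot> \<phi>)" using smap_push[OF f \<phi>] s by simp
  obtain T1 c1 y h1 where 1: "cover c1 T1 T" "smap (nerve L) T1 (sdom g) y" "agree (nerve K) y ((f \<odot> \<phi>) \<star> c1)"
      "homotopy K L T1 (scod g) (\<psi> \<star> c1) (g \<odot> y) h1"
    by (rule rhlD[OF r(2) T f\<phi> \<psi> agree_transs[OF cm(7)[OF \<phi>] ag]])
  note c1 = coverD[OF 1(1)]
  have fy: "agree (nerve K) (f \<odot> (\<phi> \<star> c1)) y" using agree_trans[OF agree_sym[OF push_stage[OF f \<phi> c1(1)]] agree_sym[OF 1(3)]] .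
  obtain T2 c2 x h2 where 2: "cover c2 T2 T1" "smap (nerve L) T2 (sdom f) x" "agree (nerve K) x (\<phi> \<star> c1 \<star> c2)"
      "homotopy K L T2 (scod f) (y \<star> c2) (f \<odot> x) h2"
    by (rule rhlD[OF r(1) c1(5) smap_stage[OF X \<phi> c1(1)] 1(2)[folded s(3)] fy])
  note c2 = coverD[OF 2(1)]
  have y2: "smap (nerve L) T2 (sdom g) (y \<star> c2)" by (rule smap_stage[OF Y 1(2) c2(1)])
  have H1: "homotopy K L T2 (scod g) (\<psi> \<star> c1 \<star> c2) (g \<odot> (y \<star> c2)) (h1 \<star> c2)"
    by (rule homotopy_cong[OF homotopy_stage[OF Z' 1(4) c2(1)] agree_refl push_stage[OF g 1(2) c2(1)] KL(3)])
  have H2: "homotopy K L T2 (scod g) (g \<odot> (y \<star> c2)) (g \<odot> f \<odot> x) (g \<odot> h2)"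
    by (rule homotopy_push[OF g 2(4)[unfolded s(3)]])
  have \<psi>2: "smap (nerve L) T2 (scod g) (\<psi> \<star> c1 \<star> c2)" by (rule smap_stage[OF Z' smap_stage[OF Z' \<psi> c1(1)] c2(1)])
  obtain T3 c3 h3 where 3: "cover c3 T3 T2" "homotopy K L T3 (scod g) (\<psi> \<star> c1 \<star> c2 \<star> c3) ((g \<odot> f \<odot> x) \<star> c3) h3"
    by (rule homotopy_trans[OF Z KL c2(5) \<psi>2 H1 H2])
  note c3 = coverD[OF 3(1)]
  let ?c = "(c1 \<cdot> c2) \<cdot> c3"
  note c12 = cover_comp[OF 1(1) 2(1)] note c = cover_comp[OF c12 3(1)]
  have "agree (nerve L) (\<psi> \<star> c1 \<star> c2 \<star> c3) (\<psi> \<star> ?c)"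
    by (rule stage_comp[OF \<psi> coverD(1)[OF c12] c3(1) stage_stage[OF \<psi> c1(1) c2(1)]])
  moreover have "agree (nerve L) ((g \<odot> f \<odot> x) \<star> c3) (gf \<odot> (x \<star> c3))"
    using agree_trans[OF agree_stage[OF agree_sym[OF cm(7)[OF 2(2)]]] push_stage[OF cm(3) 2(2)[folded s(1)] c3(1)]] .
  ultimately have "homotopy K L T3 (scod g) (\<psi> \<star> ?c) (gf \<odot> (x \<star> c3)) h3" by (rule homotopy_cong[OF 3(2) _ _ KL(3)])
  moreover have "agree (nerve K) (x \<star> c3) (\<phi> \<star> ?c)"
    by (rule stage_comp[OF \<phi> coverD(1)[OF c12] c3(1) agree_trans[OF 2(3) stage_stage[OF \<phi> c1(1) c2(1)]]])
  ultimately show "\<exists>T' c \<chi> h. cover c T' T \<and> smap (nerve L) T' (sdom gf) \<chi> \<and> agree (nerve K) \<chi> (\<phi> \<star> c) \<and>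
      homotopy K L T' (scod gf) (\<psi> \<star> c) (gf \<odot> \<chi>) h"
    using c smap_stage[OF X 2(2) c3(1)] s by auto
qed

text \<open>The homotopy downstairs is lifted through \<open>g\<close>, relative to the boundary of the cylinder.\<close>

lemma rhl_cancel_left:
  assumes gf: "is_comp gf g f" and r: "rhl gf K L" "rhl g (K \<otimes> II \<union> L \<otimes> {{0}} \<union> L \<otimes> {{1}}) (L \<otimes> II)"
    and KL: "complex K" "complex L" "K \<subseteq> L"
  shows "rhl f K L"
proof (rule rhlI)
  note cm = is_compD[OF gf] note f = cm(1) and g = cm(2) and s = cm(4-6)
  note X = smorD(1)[OF f] and Y = smorD(1)[OF g] and Z' = smorD(2)[OF g]
  fix T \<phi> \<psi> assume T: "T \<in> Obj C" and \<phi>: "smap (nerve K) T (sdom f) \<phi>" and "smap (nerve L) T (scod f) \<psi>" and ag: "agree (nerve K) (f \<odot> \<phi>) \<psi>"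
  then have \<psi>: "smap (nerve L) T (sdom g) \<psi>" using s by simp
  have g\<psi>: "smap (nerve L) T (scod gf) (g \<odot> \<psi>)" using smap_push[OF g \<psi>] s by simp
  have gg: "agree (nerve K) (gf \<odot> \<phi>) (g \<odot> \<psi>)" using agree_trans[OF cm(7)[OF \<phi>] agree_push[OF ag]] .
  obtain T1 c1 x h1 where "cover c1 T1 T" "smap (nerve L) T1 (sdom gf) x" "agree (nerve K) x (\<phi> \<star> c1)"
      "homotopy K L T1 (scod gf) ((g \<odot> \<psi>) \<star> c1) (gf \<odot> x) h1"
    by (rule rhlD[OF r(1) T \<phi>[folded s(1)] g\<psi> gg])
  then have 1: "cover c1 T1 T" "smap (nerve L) T1 (sdom f) x" "agree (nerve K) x (\<phi> \<star> c1)"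
      "homotopy K L T1 (scod g) ((g \<odot> \<psi>) \<star> c1) (gf \<odot> x) h1" using s by simp_all
  note c1 = coverD[OF 1(1)] and h1 = homotopyD[OF 1(4)]
  let ?A = "K \<otimes> II \<union> L \<otimes> {{0}}" and ?B = "L \<otimes> {{1}}"
  \<comment> \<open>The problem for \<open>g\<close> prescribes the cylinder over \<open>K\<close>
    and both ends: the constant homotopy at \<open>\<psi>\<close> on \<open>?A\<close>, and
    \<open>f \<odot> x\<close> on \<open>?B\<close>. Downstairs \<open>h1\<close> fills the
    cylinder.\<close>
  let ?a = "pull (vmap fst) (\<psi> \<star> c1)" and ?b = "pull (vmap fst) (f \<odot> x)"
  have fx: "smap (nerve L) T1 (sdom g) (f \<odot> x)" using smap_push[OF f 1(2)] s by simp
  have cA: "complex ?A" "complex ?B" using KL by (simp_all add: complex_cprod complex_Un)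
  have subA: "?A \<subseteq> L \<otimes> II" by (rule cylinder_incl[OF _ KL(3)]) simp
  have a: "smap (nerve ?A) T1 (sdom g) ?a"
    by (rule smap_pull_vmap[OF smap_stage[OF Y \<psi> c1(1)] cmap_subset[OF cmap_fst subA subset_refl]])
  have b: "smap (nerve ?B) T1 (sdom g) ?b" by (rule smap_pull_vmap[OF fx cmap_fst])
  have "agree (nerve K) (f \<odot> x) (\<psi> \<star> c1)"
    using agree_trans[OF push_stage_cong[OF f \<phi> c1(1) 1(3)] agree_stage[OF ag]] .
  then have e: "agree (nerve (K \<otimes> II)) ?a ?b" by (rule agree_pull_vmap[OF agree_sym cmap_fst])
  have "?A \<inter> ?B \<subseteq> K \<otimes> II"
  proof
    fix \<rho> assume r: "\<rho> \<in> ?A \<inter> ?B"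
    then have "snd ` \<rho> = {1}" by (simp add: cprod_def)
    then have "\<rho> \<notin> L \<otimes> {{0}}" by (simp add: cprod_def)
    then show "\<rho> \<in> K \<otimes> II" using r by blast
  qed
  then have ab: "agree (nerve (?A \<inter> ?B)) ?a ?b" by (rule agree_mono[OF e])
  let ?g = "glue ?A ?a ?b"
  have gl: "smap (nerve (?A \<union> ?B)) T1 (sdom g) ?g" by (rule smap_glue[OF complexD(2)[OF cA(1)] complexD(2)[OF cA(2)] a b ab])
  have ga: "agree (nerve ?A) ?g ?a" by (rule glue_agree(1))
  have gb: "agree (nerve ?B) ?g ?b" by (rule glue_agree(2)[OF ab])
  have "agree (nerve (?A \<union> ?B)) (g \<odot> ?g) h1"
  proof (rule agree_Un)
    have "agree (nerve (L \<otimes> {{0}})) h1 (pull (vmap fst) ((g \<odot> \<psi>) \<star> c1))"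
      using agree_trans[OF agree_fst_at agree_pull_vmap[OF h1(2) cmap_fst]] .
    then have "agree (nerve ?A) h1 (pull (vmap fst) ((g \<odot> \<psi>) \<star> c1))" by (rule agree_Un[OF h1(4)])
    moreover have "agree (nerve ?A) (g \<odot> ?a) (pull (vmap fst) ((g \<odot> \<psi>) \<star> c1))"
      using agree_pull_vmap[OF push_stage[OF g \<psi> c1(1)] cmap_subset[OF cmap_fst subA subset_refl], THEN agree_sym] unfolding pull_push .
    ultimately show "agree (nerve ?A) (g \<odot> ?g) h1"
      using agree_trans[OF agree_push[OF ga]] agree_sym agree_trans by blast
    have "agree (nerve ?B) h1 (pull (vmap fst) (gf \<odot> x))"
      using agree_trans[OF agree_fst_at agree_pull_vmap[OF h1(3) cmap_fst]] .
    moreover have "agree (nerve ?B) (pull (vmap fst) (gf \<odot> x)) (g \<odot> ?b)"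
      using agree_pull_vmap[OF cm(7)[OF 1(2)] cmap_fst] unfolding pull_push .
    ultimately show "agree (nerve ?B) (g \<odot> ?g) h1"
      using agree_trans[OF agree_push[OF gb]] agree_sym agree_trans by blast
  qed
  \<comment> \<open>The lift of \<open>h1\<close>, with the prescribed values on the boundary of the
    cylinder, is the required homotopy from \<open>\<psi>\<close> to
    \<open>f \<odot> x\<close>.\<close>
  then obtain T2 c2 \<beta> k where 2: "cover c2 T2 T1" "smap (nerve (L \<otimes> II)) T2 (sdom g) \<beta>" "agree (nerve (?A \<union> ?B)) \<beta> (?g \<star> c2)"
    by (rule rhlD[OF r(2) c1(5) gl h1(1)])
  note c2 = coverD[OF 2(1)] and c = cover_comp[OF 1(1) 2(1)]
  have bA: "agree (nerve ?A) \<beta> (?a \<star> c2)" using agree_trans[OF agree_mono[OF 2(3)] agree_stage[OF ga]] by blast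
  have bB: "agree (nerve ?B) \<beta> (?b \<star> c2)" using agree_trans[OF agree_mono[OF 2(3)] agree_stage[OF gb]] by blast
  have "homotopy K L T2 (sdom g) (\<psi> \<star> c1 \<star> c2) ((f \<odot> x) \<star> c2) \<beta>"
    unfolding homotopy_def
  proof (intro conjI)
    show "smap (nerve (L \<otimes> II)) T2 (sdom g) \<beta>" by fact
    have "agree (nerve (L \<otimes> {{0}})) \<beta> (?a \<star> c2)" using agree_mono[OF bA] by blast
    from agree_pull_vmap[OF this cmap_at_sing[OF KL(2)]]
    show "agree (nerve L) (pull (vmap (at 0)) \<beta>) (\<psi> \<star> c1 \<star> c2)"
      unfolding pull_stage[symmetric] using agree_trans[OF _ agree_at_fst] by blast
    from agree_pull_vmap[OF bB cmap_at_sing[OF KL(2)]]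
    show "agree (nerve L) (pull (vmap (at 1)) \<beta>) ((f \<odot> x) \<star> c2)"
      unfolding pull_stage[symmetric] using agree_trans[OF _ agree_at_fst] by blast
    show "agree (nerve (K \<otimes> II)) \<beta> (pull (vmap fst) (\<psi> \<star> c1 \<star> c2))"
      using agree_mono[OF bA] unfolding pull_stage by blast
  qed
  then have "homotopy K L T2 (scod f) (\<psi> \<star> (c1 \<cdot> c2)) (f \<odot> (x \<star> c2)) \<beta>"
    unfolding s(3) by (rule homotopy_cong[OF _ stage_stage[OF \<psi> c1(1) c2(1)] push_stage[OF f 1(2) c2(1)] KL(3)])
  moreover have "agree (nerve K) (x \<star> c2) (\<phi> \<star> (c1 \<cdot> c2))" by (rule stage_comp[OF \<phi> c1(1) c2(1) 1(3)])
  ultimately show "\<exists>T' c \<chi> h. cover c T' T \<and> smap (nerve L) T' (sdom f) \<chi> \<and> agree (nerve K) \<chi> (\<phi> \<star> c) \<and>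
      homotopy K L T' (scod f) (\<psi> \<star> c) (f \<odot> \<chi>) h"
    using c smap_stage[OF X 1(2) c2(1)] by blast
qed

text \<open>The boundary datum in \<open>Y\<close> is first moved along a homotopy into the image of \<open>f\<close>.\<close>

lemma rhl_cancel_right:
  assumes gf: "is_comp gf g f" and YZ: "kan (scod f)" "kan (scod g)" and r: "rhl gf K L" "rhl f {} K"
    and KL: "complex K" "complex L" "K \<subseteq> L"
  shows "rhl g K L"
proof (rule rhlI)
  note cm = is_compD[OF gf] note f = cm(1) and g = cm(2) and s = cm(4-6)
  note X = smorD(1)[OF f] and Y = smorD(1)[OF g] and Z' = smorD(2)[OF g]
  have kY: "kan (sdom g)" using YZ(1) s by simp
  have I: "{0} \<in> II" "{1} \<in> II" by (auto simp: faces_def)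
  fix T b z assume T: "T \<in> Obj C" and b: "smap (nerve K) T (sdom g) b" and z: "smap (nerve L) T (scod g) z" and ag: "agree (nerve K) (g \<odot> b) z"
  \<comment> \<open>With empty boundary data the lifting property of \<open>f\<close> replaces
    \<open>b\<close>, locally, by a homotopic map in the image of \<open>f\<close>.\<close>
  have em: "smap (nerve {}) T (sdom f) (\<lambda>m \<alpha>. undefined)" "agree (nerve {}) (f \<odot> (\<lambda>m \<alpha>. undefined)) b"
    by (simp_all add: smap_def agree_def nerve_empty del: nerve_simps(1))
  obtain T1 c1 a H where 1: "cover c1 T1 T" "smap (nerve K) T1 (sdom f) a" "homotopy {} K T1 (scod f) (b \<star> c1) (f \<odot> a) H"
    by (rule rhlD[OF r(2) T em(1) b[folded s(3)] em(2)])
  note c1 = coverD[OF 1(1)] and H = homotopyD[OF 1(3)[unfolded s(3)]]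
  have gH: "smap (nerve (K \<otimes> II)) T1 (scod g) (g \<odot> H)" by (rule smap_push[OF g H(1)])
  have "agree (nerve K) (pull (vmap (at 0)) (g \<odot> H)) ((g \<odot> b) \<star> c1)"
    unfolding pull_push by (rule push_stage_cong[OF g b c1(1) H(2)])
  then have gHz: "agree (nerve K) (pull (vmap (at 0)) (g \<odot> H)) (z \<star> c1)" using agree_trans[OF _ agree_stage[OF ag]] by blast
  have "(0::nat) \<le> 1" by simp
  \<comment> \<open>Transport \<open>z\<close> along the image of \<open>H\<close>, so that the new
    boundary comes from \<open>a\<close> and a lifting problem for \<open>gf\<close> arises.\<close>
  then obtain T2 c2 G where 2: "cover c2 T2 T1" "smap (nerve (L \<otimes> II)) T2 (scod g) G" "agree (nerve (K \<otimes> II)) G ((g \<odot> H) \<star> c2)"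
      "agree (nerve L) (pull (vmap (at 0)) G) (z \<star> c1 \<star> c2)"
    by (rule homotopy_extension[OF YZ(2) KL _ c1(5) gH smap_stage[OF Z' z c1(1)] gHz])
  note c2 = coverD[OF 2(1)]
  let ?z' = "pull (vmap (at 1)) G"
  have z': "smap (nerve L) T2 (scod g) ?z'" by (rule smap_pull_vmap[OF 2(2) cmap_at[OF KL(2) I(2)]])
  have "agree (nerve K) (pull (vmap (at 1)) (g \<odot> H)) (gf \<odot> a)"
    unfolding pull_push using agree_trans[OF agree_push[OF H(3)] agree_sym[OF cm(7)[OF 1(2)]]] .
  then have "agree (nerve K) ?z' ((gf \<odot> a) \<star> c2)"
    using agree_trans[OF agree_pull_vmap[OF 2(3) cmap_at[OF KL(1) I(2)], unfolded pull_stage] agree_stage] by blast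
  then have az': "agree (nerve K) (gf \<odot> (a \<star> c2)) ?z'"
    using agree_sym[OF agree_trans[OF _ push_stage[OF cm(3) 1(2)[folded s(1)] c2(1)]]] by blast
  have a2: "smap (nerve K) T2 (sdom f) (a \<star> c2)" by (rule smap_stage[OF X 1(2) c2(1)])
  obtain T3 c3 x h where "cover c3 T3 T2" "smap (nerve L) T3 (sdom gf) x" "agree (nerve K) x (a \<star> c2 \<star> c3)"
      "homotopy K L T3 (scod gf) (?z' \<star> c3) (gf \<odot> x) h"
    by (rule rhlD[OF r(1) c2(5) a2[folded s(1)] z'[folded s(2)] az'])
  then have 3: "cover c3 T3 T2" "smap (nerve L) T3 (sdom f) x" "agree (nerve K) x (a \<star> c2 \<star> c3)"
      "homotopy K L T3 (scod g) (?z' \<star> c3) (gf \<odot> x) h" using s by simp_all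
  note c3 = coverD[OF 3(1)] and c23 = Comp_in[OF coverD(1)[OF 3(1)] c2(1)]
  let ?H3 = "H \<star> (c2 \<cdot> c3)"
  have H3: "smap (nerve (K \<otimes> II)) T3 (sdom g) ?H3" by (rule smap_stage[OF Y H(1) c23])
  have fx: "smap (nerve L) T3 (sdom g) (f \<odot> x)" using smap_push[OF f 3(2)] s by simp
  have "agree (nerve K) (f \<odot> x) ((f \<odot> a) \<star> (c2 \<cdot> c3))"
    by (rule push_stage_cong[OF f 1(2) c23 agree_trans[OF 3(3) stage_stage[OF 1(2) c2(1) c3(1)]]])
  then have Hfx: "agree (nerve K) (pull (vmap (at 1)) ?H3) (f \<odot> x)"
    unfolding pull_stage using agree_trans[OF agree_stage[OF H(3)] agree_sym] by blast
  \<comment> \<open>The solution \<open>x\<close> has boundary \<open>a\<close> and not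
    \<open>b\<close>. Transporting \<open>f \<odot> x\<close> backwards along \<open>H\<close>, from
    the end \<open>1\<close> to the end \<open>0\<close>, gives a map \<open>?y\<close> with
    boundary \<open>b\<close>.\<close>
  obtain T4 c4 M where 4: "cover c4 T4 T3" "smap (nerve (L \<otimes> II)) T4 (sdom g) M" "agree (nerve (K \<otimes> II)) M (?H3 \<star> c4)"
      "agree (nerve L) (pull (vmap (at 1)) M) ((f \<odot> x) \<star> c4)"
    by (rule homotopy_extension[OF kY KL le_refl c3(5) H3 fx Hfx])
  note c4 = coverD[OF 4(1)]
  let ?y = "pull (vmap (at 0)) M"
  let ?d = "(c2 \<cdot> c3) \<cdot> c4" and ?e = "c3 \<cdot> c4"
  note c234 = Comp_in[OF c4(1) c23] and c34 = Comp_in[OF c4(1) c3(1)]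
  have MH: "agree (nerve (K \<otimes> II)) M (H \<star> ?d)" using agree_trans[OF 4(3) stage_stage[OF H(1) c23 c4(1)]] .
  have y: "smap (nerve L) T4 (sdom g) ?y" by (rule smap_pull_vmap[OF 4(2) cmap_at[OF KL(2) I(1)]])
  \<comment> \<open>The homotopies \<open>G\<close> and \<open>g \<odot> M\<close> agree over
    \<open>K\<close> and are joined at the end \<open>1\<close> by \<open>h\<close>. The side
    missing at the end \<open>0\<close> joins \<open>z\<close> to
    \<open>g \<odot> ?y\<close>.\<close>
  let ?l = "G \<star> ?e" and ?r = "g \<odot> M"
  have l: "smap (nerve (L \<otimes> II)) T4 (scod g) ?l" by (rule smap_stage[OF Z' 2(2) c34])
  have r': "smap (nerve (L \<otimes> II)) T4 (scod g) ?r" by (rule smap_push[OF g 4(2)])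
  have dd: "c2 \<cdot> ?e = ?d" by (rule assoc[OF c4(1) c3(1) c2(1), symmetric])
  have "agree (nerve (K \<otimes> II)) ?l ((g \<odot> H) \<star> ?d)" using stage_comp[OF gH c2(1) c34 2(3)] unfolding dd .
  then have lr: "agree (nerve (K \<otimes> II)) ?l ?r"
    using agree_trans[OF _ agree_sym[OF push_stage_cong[OF g H(1) c234 MH]]] by blast
  have "homotopy K L T4 (scod g) (?z' \<star> c3 \<star> c4) ((gf \<odot> x) \<star> c4) (h \<star> c4)" by (rule homotopy_stage[OF Z' 3(4) c4(1)])
  moreover have "agree (nerve L) (?z' \<star> c3 \<star> c4) (pull (vmap (at 1)) ?l)"
    unfolding pull_stage by (rule stage_stage[OF z' c3(1) c4(1)])
  moreover have "agree (nerve L) ((gf \<odot> x) \<star> c4) (pull (vmap (at 1)) ?r)"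
  proof -
    have "agree (nerve L) (g \<odot> pull (vmap (at 1)) M) ((g \<odot> f \<odot> x) \<star> c4)" by (rule push_stage_cong[OF g fx c4(1) 4(4)])
    then show ?thesis unfolding pull_push using agree_sym[OF agree_trans[OF _ agree_stage[OF agree_sym[OF cm(7)[OF 3(2)]]]]] by blast
  qed
  ultimately have bt: "homotopy K L T4 (scod g) (pull (vmap (at 1)) ?l) (pull (vmap (at 1)) ?r) (h \<star> c4)"
    by (rule homotopy_cong[OF _ _ _ KL(3)])
  obtain T5 c5 k where 5: "cover c5 T5 T4" "homotopy K L T5 (scod g) (pull (vmap (at (1 - 1))) ?l \<star> c5) (pull (vmap (at (1 - 1))) ?r \<star> c5) k"
    by (rule homotopy_square[OF YZ(2) KL le_refl c4(5) l r' lr bt])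
  note c5 = coverD[OF 5(1)]
  let ?c = "(c1 \<cdot> ?d) \<cdot> c5"
  have cd: "cover ?d T4 T1" by (rule cover_comp[OF cover_comp[OF 2(1) 3(1)] 4(1)])
  note c1d = cover_comp[OF 1(1) cd] note c = cover_comp[OF c1d 5(1)]
  have "agree (nerve L) (pull (vmap (at 0)) ?l) (z \<star> c1 \<star> ?d)"
    unfolding pull_stage using stage_comp[OF smap_stage[OF Z' z c1(1)] c2(1) c34 2(4)] unfolding dd .
  then have zl: "agree (nerve L) (pull (vmap (at 0)) ?l \<star> c5) (z \<star> ?c)"
    by (intro stage_comp[OF z coverD(1)[OF c1d] c5(1)] agree_trans[OF _ stage_stage[OF z c1(1) coverD(1)[OF cd]]])
  have yl: "agree (nerve L) (pull (vmap (at 0)) ?r \<star> c5) (g \<odot> (?y \<star> c5))"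
    unfolding pull_push by (rule push_stage[OF g y c5(1)])
  have "(1::nat) - 1 = 0" by simp
  from 5(2)[unfolded this] have "homotopy K L T5 (scod g) (z \<star> ?c) (g \<odot> (?y \<star> c5)) k" by (rule homotopy_cong[OF _ zl yl KL(3)])
  moreover have "agree (nerve K) (?y \<star> c5) (b \<star> ?c)"
  proof (rule stage_comp[OF b coverD(1)[OF c1d] c5(1)])
    have "agree (nerve K) ?y (pull (vmap (at 0)) H \<star> ?d)" using agree_pull_vmap[OF MH cmap_at[OF KL(1) I(1)]] unfolding pull_stage .
    also have "agree (nerve K) \<dots> (b \<star> (c1 \<cdot> ?d))" by (rule stage_comp[OF b c1(1) coverD(1)[OF cd] H(2)])
    finally show "agree (nerve K) ?y (b \<star> (c1 \<cdot> ?d))" .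
  qed
  ultimately show "\<exists>T' c \<chi> h. cover c T' T \<and> smap (nerve L) T' (sdom g) \<chi> \<and> agree (nerve K) \<chi> (b \<star> c) \<and>
      homotopy K L T' (scod g) (z \<star> c) (g \<odot> \<chi>) h"
    using c smap_stage[OF Y y c5(1)] by blast
qed

text \<open>Send the problem forward by the sections \<open>s\<close> and \<open>s'\<close>, solve
  it for \<open>g\<close>, and apply the retractions \<open>r\<close> and \<open>r'\<close> to the
  solution and to its homotopy.\<close>

lemma rhl_retract_morphism:
  assumes sq: "is_comp gs g s" "is_comp gs s' f" "is_comp fr f r" "is_comp fr r' g"
    and id: "is_comp i r s" "is_comp i' r' s'"
      "\<And>n. component i n = Ident C (level (sdom f) n)" "\<And>n. component i' n = Ident C (level (scod f) n)"
    and g: "rhl g K L" and KL: "K \<subseteq> L"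
  shows "rhl f K L"
proof (rule rhlI)
  note s1 = is_compD[OF sq(1)] and s2 = is_compD[OF sq(2)] and s3 = is_compD[OF sq(3)] and s4 = is_compD[OF sq(4)] and i1 = is_compD[OF id(1)] and i2 = is_compD[OF id(2)]
  note f = s2(1) and G = s1(2) and s = s1(1) and s' = s2(2) and r = s3(1) and r' = s4(2)
  have X: "sdom s = sdom f" "sdom r = sdom g" "scod s = sdom g" "scod r = sdom f" "sdom s' = scod f" "scod s' = scod g" "sdom r' = scod g" "scod r' = scod f"
    using s1(4-6) s2(4-6) s3(4-6) s4(4-6) by simp_all
  have idp: "agree Z (i \<odot> \<phi>) \<phi>" if "smap Z T (sdom f) \<phi>" for Z :: "(nat \<Rightarrow> 'a) sset" and T \<phi>
    unfolding agree_def push_def id(3) using Ident_left[OF smapD(1)[OF that]] by blast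
  have idp': "agree Z (i' \<odot> \<phi>) \<phi>" if "smap Z T (scod f) \<phi>" for Z :: "(nat \<Rightarrow> 'a) sset" and T \<phi>
    unfolding agree_def push_def id(4) using Ident_left[OF smapD(1)[OF that]] by blast
  fix T \<phi> \<psi> assume T: "T \<in> Obj C" and \<phi>: "smap (nerve K) T (sdom f) \<phi>" and \<psi>: "smap (nerve L) T (scod f) \<psi>" and ag: "agree (nerve K) (f \<odot> \<phi>) \<psi>"
  have s\<phi>: "smap (nerve K) T (sdom g) (s \<odot> \<phi>)" using smap_push[OF s] \<phi> X by simp
  have s\<psi>: "smap (nerve L) T (scod g) (s' \<odot> \<psi>)" using smap_push[OF s'] \<psi> X by simp
  have "agree (nerve K) (g \<odot> s \<odot> \<phi>) (s' \<odot> f \<odot> \<phi>)"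
    using agree_transs[OF s1(7) s2(7)] \<phi> X by simp
  then have gs: "agree (nerve K) (g \<odot> s \<odot> \<phi>) (s' \<odot> \<psi>)" using agree_trans[OF _ agree_push[OF ag]] by blast
  obtain T1 c x h where 1: "cover c T1 T" "smap (nerve L) T1 (sdom g) x" "agree (nerve K) x ((s \<odot> \<phi>) \<star> c)"
      "homotopy K L T1 (scod g) ((s' \<odot> \<psi>) \<star> c) (g \<odot> x) h"
    by (rule rhlD[OF g T s\<phi> s\<psi> gs])
  note c = coverD[OF 1(1)]
  have rx: "smap (nerve L) T1 (sdom f) (r \<odot> x)" using smap_push[OF r] 1(2) X by simp
  have "agree (nerve K) (r \<odot> s \<odot> \<phi>) \<phi>" using agree_transs[OF i1(7) idp] \<phi> X by simp
  moreover have "agree (nerve K) (r \<odot> x) ((r \<odot> s \<odot> \<phi>) \<star> c)"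
    by (rule push_stage_cong[OF r _ c(1) 1(3)]) (use s\<phi> X in simp)
  ultimately have A: "agree (nerve K) (r \<odot> x) (\<phi> \<star> c)" using agree_trans[OF _ agree_stage] by blast
  have "homotopy K L T1 (scod f) (r' \<odot> ((s' \<odot> \<psi>) \<star> c)) (r' \<odot> g \<odot> x) (r' \<odot> h)"
    using homotopy_push[OF r'] 1(4) X by simp
  moreover have "agree (nerve L) (r' \<odot> ((s' \<odot> \<psi>) \<star> c)) (\<psi> \<star> c)"
  proof -
    have "agree (nerve L) (r' \<odot> s' \<odot> \<psi>) \<psi>" using agree_transs[OF i2(7) idp'] \<psi> X by simp
    moreover have "agree (nerve L) (r' \<odot> ((s' \<odot> \<psi>) \<star> c)) ((r' \<odot> s' \<odot> \<psi>) \<star> c)"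
      using push_stage[OF r' _ c(1)] s\<psi> X agree_sym by metis
    ultimately show ?thesis using agree_trans[OF _ agree_stage] by blast
  qed
  moreover have "agree (nerve L) (r' \<odot> g \<odot> x) (f \<odot> r \<odot> x)"
    using agree_transs[OF s4(7) s3(7)] 1(2) X by simp
  ultimately have "homotopy K L T1 (scod f) (\<psi> \<star> c) (f \<odot> r \<odot> x) (r' \<odot> h)" by (rule homotopy_cong[OF _ _ _ KL])
  then show "\<exists>T' c \<chi> h. cover c T' T \<and> smap (nerve L) T' (sdom f) \<chi> \<and> agree (nerve K) \<chi> (\<phi> \<star> c) \<and>
      homotopy K L T' (scod f) (\<psi> \<star> c) (f \<odot> \<chi>) h"
    using 1(1) rx A by blast
qed

text \<open>A strict lift is a lift up to the constant homotopy.\<close>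

lemma llift_rhl:
  assumes f: "simplicial_morphism C f" and l: "llift f K L" and KL: "K \<subseteq> L" shows "rhl f K L"
proof (rule rhlI)
  fix T \<phi> \<psi> assume h: "T \<in> Obj C" "smap (nerve K) T (sdom f) \<phi>" "smap (nerve L) T (scod f) \<psi>" "agree (nerve K) (f \<odot> \<phi>) \<psi>"
  obtain T' c \<chi> where c: "cover c T' T" "smap (nerve L) T' (sdom f) \<chi>" "agree (nerve K) \<chi> (\<phi> \<star> c)" "agree (nerve L) (f \<odot> \<chi>) (\<psi> \<star> c)"
    by (rule lliftD[OF l h])
  have "smap (nerve L) T' (scod f) (\<psi> \<star> c)" by (rule smap_stage[OF smorD(2)[OF f] h(3) coverD(1)[OF c(1)]])
  from homotopy_cong[OF homotopy_const[OF this KL] agree_refl agree_sym[OF c(4)] KL]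
  show "\<exists>T' c \<chi> h. cover c T' T \<and> smap (nerve L) T' (sdom f) \<chi> \<and> agree (nerve K) \<chi> (\<phi> \<star> c) \<and>
      homotopy K L T' (scod f) (\<psi> \<star> c) (f \<odot> \<chi>) h" using c by blast
qed

text \<open>The homotopy from \<open>\<psi>\<close> to \<open>p \<odot> x\<close> is lifted through
  \<open>p\<close>, starting from \<open>x\<close> at the end \<open>1\<close> and constant over
  \<open>K\<close>. The other end of the lifted homotopy lies strictly over
  \<open>\<psi>\<close>.\<close>

lemma llift_of_rhl:
  assumes p: "horn_lifting p" and l: "rhl p K L" and KL: "complex K" "complex L" "K \<subseteq> L"
  shows "llift p K L"
  unfolding llift_def
proof (intro allI impI)
  have sm: "simplicial_morphism C p" using p by (simp add: horn_lifting_def)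
  note X = smorD(1)[OF sm] and Y = smorD(2)[OF sm]
  have I: "{0} \<in> II" "{1} \<in> II" by (auto simp: faces_def)
  fix T \<phi> \<psi> assume T: "T \<in> Obj C" and \<phi>: "smap (nerve K) T (sdom p) \<phi>" and \<psi>: "smap (nerve L) T (scod p) \<psi>" and ag: "agree (nerve K) (p \<odot> \<phi>) \<psi>"
  obtain T1 c1 x h where 1: "cover c1 T1 T" "smap (nerve L) T1 (sdom p) x" "agree (nerve K) x (\<phi> \<star> c1)"
      "homotopy K L T1 (scod p) (\<psi> \<star> c1) (p \<odot> x) h"
    by (rule rhlD[OF l T \<phi> \<psi> ag])
  note c1 = coverD[OF 1(1)] and h = homotopyD[OF 1(4)]
  let ?A = "K \<otimes> II" and ?B = "L \<otimes> {{1}}" and ?a = "pull (vmap fst) (\<phi> \<star> c1)" and ?b = "pull (vmap fst) x"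
  have \<phi>1: "smap (nerve K) T1 (sdom p) (\<phi> \<star> c1)" by (rule smap_stage[OF X \<phi> c1(1)])
  have ab: "agree (nerve (?A \<inter> ?B)) ?a ?b"
  proof (rule agree_mono)
    show "agree (nerve (K \<otimes> II)) ?a ?b" by (rule agree_pull_vmap[OF agree_sym[OF 1(3)] cmap_fst])
  qed simp
  let ?g = "glue ?A ?a ?b"
  have dc: "down_closed ?A" "down_closed ?B" using KL by (simp_all add: complex_cprod complexD(2))
  have g: "smap (nerve (?A \<union> ?B)) T1 (sdom p) ?g"
    by (rule smap_glue[OF dc smap_pull_vmap[OF \<phi>1 cmap_fst] smap_pull_vmap[OF 1(2) cmap_fst] ab])
  have ga: "agree (nerve ?A) ?g ?a" by (rule glue_agree(1))
  have gb: "agree (nerve ?B) ?g ?b" by (rule glue_agree(2)[OF ab])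
  have "agree (nerve (?A \<union> ?B)) (p \<odot> ?g) h"
  proof (rule agree_Un)
    have "agree (nerve K) (p \<odot> (\<phi> \<star> c1)) (\<psi> \<star> c1)"
      using agree_trans[OF agree_sym[OF push_stage[OF sm \<phi> c1(1)]] agree_stage[OF ag]] .
    then have "agree (nerve ?A) (p \<odot> ?a) (pull (vmap fst) (\<psi> \<star> c1))" unfolding pull_push[symmetric] by (rule agree_pull_vmap[OF _ cmap_fst])
    then show "agree (nerve ?A) (p \<odot> ?g) h"
      using agree_trans[OF agree_push[OF ga] agree_trans[OF _ agree_sym[OF h(4)]]] by blast
    have "agree (nerve ?B) h (p \<odot> ?b)"
      using agree_trans[OF agree_fst_at agree_pull_vmap[OF h(3) cmap_fst]] unfolding pull_push .
    then show "agree (nerve ?B) (p \<odot> ?g) h" using agree_trans[OF agree_push[OF gb] agree_sym] by blast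
  qed
  then obtain T2 c2 k where 2: "cover c2 T2 T1" "smap (nerve (L \<otimes> II)) T2 (sdom p) k" "agree (nerve (?A \<union> ?B)) k (?g \<star> c2)"
      "agree (nerve (L \<otimes> II)) (p \<odot> k) (h \<star> c2)"
    by (rule lliftD[OF llift_cylinder[OF p le_refl KL] c1(5) g h(1)])
  note c2 = coverD[OF 2(1)] and c = cover_comp[OF 1(1) 2(1)]
  let ?x = "pull (vmap (at 0)) k"
  have "smap (nerve L) T2 (sdom p) ?x" by (rule smap_pull_vmap[OF 2(2) cmap_at[OF KL(2) I(1)]])
  moreover have "agree (nerve K) ?x (\<phi> \<star> (c1 \<cdot> c2))"
  proof -
    have "agree (nerve ?A) k (?a \<star> c2)" using agree_trans[OF agree_mono[OF 2(3)] agree_stage[OF ga]] by blast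
    from agree_pull_vmap[OF this cmap_at[OF KL(1) I(1)]]
    have "agree (nerve K) ?x (pull (vmap (at 0)) (?a \<star> c2))" .
    also have "agree (nerve K) (pull (vmap (at 0)) (?a \<star> c2)) (\<phi> \<star> c1 \<star> c2)"
      by (subst pull_stage) (rule agree_stage[OF agree_at_fst])
    finally show ?thesis using agree_trans[OF _ stage_stage[OF \<phi> c1(1) c2(1)]] by blast
  qed
  moreover have "agree (nerve L) (p \<odot> ?x) (\<psi> \<star> (c1 \<cdot> c2))"
  proof -
    have "agree (nerve L) (p \<odot> ?x) (pull (vmap (at 0)) h \<star> c2)"
      using agree_pull_vmap[OF 2(4) cmap_at[OF KL(2) I(1)]] unfolding pull_push pull_stage .
    then show ?thesis using agree_trans[OF _ stage_comp[OF \<psi> c1(1) c2(1) h(2)]] by blast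
  qed
  ultimately show "\<exists>T' c \<chi>. cover c T' T \<and> smap (nerve L) T' (sdom p) \<chi> \<and> agree (nerve K) \<chi> (\<phi> \<star> c) \<and> agree (nerve L) (p \<odot> \<chi>) (\<psi> \<star> c)"
    using c by blast
qed

lemma llift_comp:
  assumes gf: "is_comp gf g f" and l: "llift f K L" "llift g K L" shows "llift gf K L"
  unfolding llift_def
proof (intro allI impI)
  note cm = is_compD[OF gf] note f = cm(1) and g = cm(2) and s = cm(4-6)
  note X = smorD(1)[OF f]
  fix T \<phi> \<psi> assume T: "T \<in> Obj C" and "smap (nerve K) T (sdom gf) \<phi>" "smap (nerve L) T (scod gf) \<psi>" and ag: "agree (nerve K) (gf \<odot> \<phi>) \<psi>"
  then have \<phi>: "smap (nerve K) T (sdom f) \<phi>" and \<psi>: "smap (nerve L) T (scod g) \<psi>" using s by simp_all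
  have f\<phi>: "smap (nerve K) T (sdom g) (f \<odot> \<phi>)" using smap_push[OF f \<phi>] s by simp
  obtain T1 c1 y where 1: "cover c1 T1 T" "smap (nerve L) T1 (sdom g) y" "agree (nerve K) y ((f \<odot> \<phi>) \<star> c1)" "agree (nerve L) (g \<odot> y) (\<psi> \<star> c1)"
    by (rule lliftD[OF l(2) T f\<phi> \<psi> agree_transs[OF cm(7)[OF \<phi>] ag]])
  note c1 = coverD[OF 1(1)]
  have fy: "agree (nerve K) (f \<odot> (\<phi> \<star> c1)) y" using agree_trans[OF agree_sym[OF push_stage[OF f \<phi> c1(1)]] agree_sym[OF 1(3)]] .
  obtain T2 c2 x where 2: "cover c2 T2 T1" "smap (nerve L) T2 (sdom f) x" "agree (nerve K) x (\<phi> \<star> c1 \<star> c2)" "agree (nerve L) (f \<odot> x) (y \<star> c2)"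
    by (rule lliftD[OF l(1) c1(5) smap_stage[OF X \<phi> c1(1)] 1(2)[folded s(3)] fy])
  note c2 = coverD[OF 2(1)] and c = cover_comp[OF 1(1) 2(1)]
  have "agree (nerve L) (gf \<odot> x) ((g \<odot> y) \<star> c2)"
    using agree_trans[OF cm(7)[OF 2(2)] push_stage_cong[OF g 1(2) c2(1) 2(4)]] .
  then have "agree (nerve L) (gf \<odot> x) (\<psi> \<star> (c1 \<cdot> c2))"
    using agree_trans[OF _ stage_comp[OF \<psi> c1(1) c2(1) 1(4)]] by blast
  moreover have "agree (nerve K) x (\<phi> \<star> (c1 \<cdot> c2))" using agree_trans[OF 2(3) stage_stage[OF \<phi> c1(1) c2(1)]] .
  ultimately show "\<exists>T' c \<chi>. cover c T' T \<and> smap (nerve L) T' (sdom gf) \<chi> \<and> agree (nerve K) \<chi> (\<phi> \<star> c) \<and> agree (nerve L) (gf \<odot> \<chi>) (\<psi> \<star> c)"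
    using c 2(2) s by auto
qed

text \<open>The inverse applied to \<open>\<psi>\<close> is a strict lift, with no refinement of the
  stage.\<close>

lemma llift_iso:
  assumes gf: "is_comp i g f" "is_comp i' f g" and KL: "K \<subseteq> L"
    and id: "\<And>n. component i n = Ident C (level (sdom f) n)" "\<And>n. component i' n = Ident C (level (scod f) n)"
  shows "llift f K L"
  unfolding llift_def
proof (intro allI impI)
  note cm = is_compD[OF gf(1)] and cm' = is_compD[OF gf(2)]
  note f = cm(1) and g = cm(2)
  fix T \<phi> \<psi> assume T: "T \<in> Obj C" and \<phi>: "smap (nerve K) T (sdom f) \<phi>" and \<psi>: "smap (nerve L) T (scod f) \<psi>" and ag: "agree (nerve K) (f \<odot> \<phi>) \<psi>"
  have idp: "agree (nerve K) (i \<odot> \<phi>) \<phi>"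
    unfolding agree_def push_def id(1) using Ident_left[OF smapD(1)[OF \<phi>]] by blast
  have idp': "agree (nerve L) (i' \<odot> \<psi>) \<psi>"
    unfolding agree_def push_def id(2) using Ident_left[OF smapD(1)[OF \<psi>]] by blast
  have g\<psi>: "smap (nerve L) T (sdom f) (g \<odot> \<psi>)" using smap_push[OF g] \<psi> cm(6) cm'(6) by simp
  note c = cover_ident[OF T]
  have "agree (nerve K) (g \<odot> f \<odot> \<phi>) (g \<odot> \<psi>)" by (rule agree_push[OF ag])
  then have "agree (nerve K) (g \<odot> \<psi>) \<phi>" using agree_transs[OF cm(7)[OF \<phi>] idp] agree_transs by blast
  then have A: "agree (nerve K) (g \<odot> \<psi>) (\<phi> \<star> Ident C T)" using agree_trans[OF _ agree_sym[OF stage_ident[OF \<phi>]]] by blast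
  have "smap (nerve L) T (sdom g) \<psi>" using \<psi> cm(6) by simp
  from agree_transs[OF cm'(7)[OF this] idp'] have "agree (nerve L) (f \<odot> g \<odot> \<psi>) \<psi>" .
  then have "agree (nerve L) (f \<odot> g \<odot> \<psi>) (\<psi> \<star> Ident C T)" using agree_trans[OF _ agree_sym[OF stage_ident[OF \<psi>]]] by blast
  then show "\<exists>T' c \<chi>. cover c T' T \<and> smap (nerve L) T' (sdom f) \<chi> \<and> agree (nerve K) \<chi> (\<phi> \<star> c) \<and> agree (nerve L) (f \<odot> \<chi>) (\<psi> \<star> c)"
    using c g\<psi> A by blast
qed

end

section \<open>Categories of simplicial objects\<close>

context category
begin

section \<open>Comparison isomorphisms and finite products\<close>

lemma pullback_iso:
  assumes "is_pullback C f g p q" "is_pullback C f g p' q'"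
  obtains e where "is_iso C e" "e \<in> hom C (Dom C p) (Dom C p')" "p' \<cdot> e = p" "q' \<cdot> e = q"
proof -
  note P = pullbackD[OF assms(1)] and P' = pullbackD[OF assms(2)]
  obtain e where e: "e \<in> Arr C" "Dom C e = Dom C p" "Cod C e = Dom C p'" "p' \<cdot> e = p" "q' \<cdot> e = q"
    by (rule pullback_lift[OF assms(2) P(3,4,6,7,8,9)]) blast
  obtain e' where e': "e' \<in> Arr C" "Dom C e' = Dom C p'" "Cod C e' = Dom C p" "p \<cdot> e' = p'" "q \<cdot> e' = q'"
    by (rule pullback_lift[OF assms(1) P'(3,4,6,7,8,9)]) blast
  have O: "Dom C p \<in> Obj C" "Dom C p' \<in> Obj C" using P(3) P'(3) Dom_in by auto
  have "e' \<cdot> e = Ident C (Dom C p)"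
  proof (rule pullback_unique[OF assms(1)])
    show "p \<cdot> e' \<cdot> e = p \<cdot> Ident C (Dom C p)" using comp_assoc[of e e' p] e e' P by simp
    show "q \<cdot> e' \<cdot> e = q \<cdot> Ident C (Dom C p)" using comp_assoc[of e e' q] e e' P by simp
  qed (use e e' O in auto)
  moreover have "e \<cdot> e' = Ident C (Dom C p')"
  proof (rule pullback_unique[OF assms(2)])
    show "p' \<cdot> e \<cdot> e' = p' \<cdot> Ident C (Dom C p')" using comp_assoc[of e' e p'] e e' P' by simp
    show "q' \<cdot> e \<cdot> e' = q' \<cdot> Ident C (Dom C p')" using comp_assoc[of e' e q'] e e' P' by simp
  qed (use e e' O in auto)
  ultimately have "is_iso C e" using e e' by (auto simp: is_iso_def hom_def)
  then show thesis using that e by (simp add: hom_def)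
qed

lemma terminal_iso:
  assumes "is_terminal C T" "is_terminal C T'"
  obtains e where "is_iso C e" "e \<in> hom C T T'"
proof -
  have T: "T \<in> Obj C" "T' \<in> Obj C" using assms by (auto simp: is_terminal_def)
  obtain e e' where e: "e \<in> hom C T T'" "e' \<in> hom C T' T" using assms T unfolding is_terminal_def by blast
  have "e' \<cdot> e = Ident C T" "e \<cdot> e' = Ident C T'"
    using assms T Comp_in[OF e(1,2)] Comp_in[OF e(2,1)] Ident_in[OF T(1)] Ident_in[OF T(2)] unfolding is_terminal_def by blast+
  then have "is_iso C e" using e by (auto simp: is_iso_def hom_def)
  then show thesis using that e by blast
qed

text \<open>Factors are added one at a time by a pullback over the terminal object. Only pullbacks
  of morphisms to \<open>U\<close> are requested because in \<open>Kan C\<close> these morphisms are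
  fibrations, along which pullbacks are available.\<close>

lemma finite_productsI:
  assumes t: "is_terminal C U"
    and pb: "\<And>f g. f \<in> Arr C \<Longrightarrow> g \<in> Arr C \<Longrightarrow> Cod C f = U \<Longrightarrow> Cod C g = U \<Longrightarrow> \<exists>p q. is_pullback C f g p q"
  shows "has_finite_products C"
  unfolding has_finite_products_def
proof (intro allI impI)
  fix n :: nat and A
  assume "\<forall>i < n. A i \<in> Obj C"
  then show "\<exists>P \<pi>. is_product C {..<n} A P \<pi>"
  proof (induction n)
    case 0
    show ?case using t by (intro exI[of _ U]) (auto simp: is_product_def is_terminal_def)
  next
    case (Suc n)
    then obtain P \<pi> where P: "is_product C {..<n} A P \<pi>" by auto
    have PO: "P \<in> Obj C" "A n \<in> Obj C" and pi: "\<And>i. i < n \<Longrightarrow> \<pi> i \<in> hom C P (A i)" using P Suc.prems by (auto simp: is_product_def)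
    obtain f g where f: "f \<in> hom C P U" and g: "g \<in> hom C (A n) U" using t PO unfolding is_terminal_def by blast
    obtain p q where pq: "is_pullback C f g p q" using pb[of f g] f g by (auto simp: hom_def)
    note pqD = pullbackD[OF pq]
    define Q where "Q = Dom C p"
    have p: "p \<in> hom C Q P" and q: "q \<in> hom C Q (A n)" and QO: "Q \<in> Obj C" using pqD f g Dom_in by (auto simp: Q_def hom_def)
    define \<pi>' where "\<pi>' i = (if i < n then \<pi> i \<cdot> p else q)" for i
    have "is_product C {..<Suc n} A Q \<pi>'"
      unfolding is_product_def
    proof (intro conjI ballI allI impI)
      show "Q \<in> Obj C" by (fact QO)
      show "\<pi>' i \<in> hom C Q (A i)" if "i \<in> {..<Suc n}" for i
        using that Comp_in[OF p pi[of i]] q by (cases "i = n") (auto simp: \<pi>'_def)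
      fix T \<tau> assume T: "T \<in> Obj C" and tau: "\<forall>i \<in> {..<Suc n}. \<tau> i \<in> hom C T (A i)"
      have ex1: "\<exists>!s. s \<in> hom C T P \<and> (\<forall>i \<in> {..<n}. \<pi> i \<cdot> s = \<tau> i)"
        using P T tau by (auto simp: is_product_def)
      then obtain s where s: "s \<in> hom C T P" "\<And>i. i < n \<Longrightarrow> \<pi> i \<cdot> s = \<tau> i" by auto
      have tn: "\<tau> n \<in> hom C T (A n)" using tau by simp
      have "\<exists>!h. h \<in> hom C T U" using t T by (simp add: is_terminal_def)
      then have eq: "f \<cdot> s = g \<cdot> \<tau> n" using Comp_in[OF s(1) f] Comp_in[OF tn g] by blast
      obtain u where u: "u \<in> Arr C" "Dom C u = T" "Cod C u = Q" "p \<cdot> u = s" "q \<cdot> u = \<tau> n"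
        using pullback_lift[OF pq, of s "\<tau> n"] s(1) tn f g eq by (auto simp: hom_def Q_def)
      then have u': "u \<in> hom C T Q" by (simp add: hom_def)
      show "\<exists>!u. u \<in> hom C T Q \<and> (\<forall>i \<in> {..<Suc n}. \<pi>' i \<cdot> u = \<tau> i)"
      proof (rule ex1I[of _ u])
        have "\<pi>' i \<cdot> u = \<tau> i" if "i < Suc n" for i
          using that assoc[OF u' p pi[of i]] u(4,5) s(2)[of i] by (cases "i = n") (auto simp: \<pi>'_def)
        then show "u \<in> hom C T Q \<and> (\<forall>i \<in> {..<Suc n}. \<pi>' i \<cdot> u = \<tau> i)" using u' by simp
        fix v assume v: "v \<in> hom C T Q \<and> (\<forall>i \<in> {..<Suc n}. \<pi>' i \<cdot> v = \<tau> i)"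
        have "\<pi> i \<cdot> p \<cdot> v = \<tau> i" if "i < n" for i
        proof -
          have "\<pi>' i \<cdot> v = \<tau> i" using v that by simp
          then show ?thesis using assoc[OF conjunct1[OF v] p pi[OF that]] that by (simp add: \<pi>'_def)
        qed
        moreover have "p \<cdot> v \<in> hom C T P" using Comp_in[OF _ p] v by blast
        ultimately have "p \<cdot> v = s" using ex1 s by (metis lessThan_iff)
        moreover have "q \<cdot> v = \<tau> n" using bspec[OF conjunct2[OF v], of n] by (simp add: \<pi>'_def)
        ultimately show "v = u"
          using pullback_unique[OF pq, of v u] u v by (auto simp: hom_def Q_def)
      qed
    qed
    then show ?case by blast
  qed
qed

end

section \<open>Full subcategories and the category of simplicial objects\<close>

lemma full_subcategory_simps [simp]:
  "Obj (full_subcategory D P) = {a \<in> Obj D. P a}" "Dom (full_subcategory D P) = Dom D" "Cod (full_subcategory D P) = Cod D"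
  "Ident (full_subcategory D P) = Ident D" "Comp (full_subcategory D P) = Comp D"
  "Arr (full_subcategory D P) = {f \<in> Arr D. P (Dom D f) \<and> P (Cod D f)}"
  by (simp_all add: full_subcategory_def)

lemma full_subcategory_hom: "f \<in> hom (full_subcategory D P) a b \<longleftrightarrow> f \<in> hom D a b \<and> P a \<and> P b"
  by (auto simp: hom_def)

lemma category_full_subcategory:
  assumes "category D" shows "category (full_subcategory D P)"
proof -
  interpret D: category D by fact
  show ?thesis
    by standard (auto simp: full_subcategory_hom D.Dom_in D.Cod_in D.Ident_in D.Comp_in D.Ident_left D.Ident_right D.assoc
        intro: D.Comp_in dest: D.homD)
qed

lemma full_subcategory_pullback:
  assumes "is_pullback D f g p q" "P (Dom D f)" "P (Cod D f)" "P (Dom D g)" "P (Dom D p)"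
  shows "is_pullback (full_subcategory D P) f g p q"
proof -
  have h: "hom (full_subcategory D P) a b = hom D a b" if "P a" "P b" for a b
    using that by (auto simp: full_subcategory_hom)
  note a = assms(1)[unfolded is_pullback_def]
  have c: "P (Cod D g)" using a assms(3) by simp
  show ?thesis
    unfolding is_pullback_def full_subcategory_simps
    using a assms(2-) c by (auto simp: h)
qed

lemma delta_hom_compose:
  assumes "\<theta> \<in> delta_hom m n" "\<eta> \<in> delta_hom l m" shows "compose {..l} \<theta> \<eta> \<in> delta_hom l n"
  using mono_on_compose[OF delta_homD(2)[OF assms(1)] assms(2)] delta_homD(1)[OF assms(1)] delta_homD(1)[OF assms(2)]
  by (auto simp: delta_hom_iff compose_def)

lemma delta_hom_ident: "(\<lambda>i \<in> {..n}. i) \<in> delta_hom n n"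
  by (auto simp: delta_hom_iff mono_on_def)

context category
begin

abbreviation sO :: "(('o, 'm) sobj, ('o, 'm) smor) cat" where
  "sO \<equiv> simplicial_objects C"

lemma sO_simps [simp]:
  "Obj sO = {X. simplicial_object C X}" "Arr sO = {f. simplicial_morphism C f}" "Dom sO = sdom" "Cod sO = scod"
  by (simp_all add: simplicial_objects_def)

lemma sO_comp_simps [simp]:
  "sdom (g \<cdot>\<^bsub>sO\<^esub> f) = sdom f" "scod (g \<cdot>\<^bsub>sO\<^esub> f) = scod g" "component (g \<cdot>\<^bsub>sO\<^esub> f) n = component g n \<cdot> component f n"
  "sdom (Ident sO X) = X" "scod (Ident sO X) = X" "component (Ident sO X) n = Ident C (level X n)"
  by (simp_all add: simplicial_objects_def)

lemma smor_eqI: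
  assumes "sdom f = sdom g" "scod f = scod g" "\<And>n. component f n = component g n" shows "f = (g :: ('o, 'm) smor)"
  using assms by (intro smor.equality) auto

lemma simplicial_morphismI:
  assumes "simplicial_object C (sdom f)" "simplicial_object C (scod f)"
    "\<And>n. component f n \<in> hom C (level (sdom f) n) (level (scod f) n)"
    "\<And>m n \<theta>. \<theta> \<in> delta_hom m n \<Longrightarrow> component f m \<cdot> sobj_op (sdom f) m n \<theta> = sobj_op (scod f) m n \<theta> \<cdot> component f n"
  shows "simplicial_morphism C f"
  using assms unfolding simplicial_morphism_def by blast

lemma simplicial_morphism_ident: "simplicial_object C X \<Longrightarrow> simplicial_morphism C (Ident sO X)"
  by (rule simplicial_morphismI)
    (simp_all add: Ident_in sobjD(1) Ident_left[OF sobjD(2)] Ident_right[OF sobjD(2)])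

lemma simplicial_morphism_comp:
  assumes f: "simplicial_morphism C f" and g: "simplicial_morphism C g" and s: "scod f = sdom g"
  shows "simplicial_morphism C (g \<cdot>\<^bsub>sO\<^esub> f)"
proof (rule simplicial_morphismI)
  note fh = smorD(3)[OF f] and gh = smorD(3)[OF g, folded s]
  show "component (g \<cdot>\<^bsub>sO\<^esub> f) n \<in> hom C (level (sdom (g \<cdot>\<^bsub>sO\<^esub> f)) n) (level (scod (g \<cdot>\<^bsub>sO\<^esub> f)) n)" for n
    using Comp_in[OF fh gh] by simp
  fix m n \<theta> assume t: "\<theta> \<in> delta_hom m n"
  note X = sobjD(2)[OF smorD(1)[OF f] t] and Y = sobjD(2)[OF smorD(2)[OF f] t] and Z = sobjD(2)[OF smorD(2)[OF g] t]
  have "(component g m \<cdot> component f m) \<cdot> sobj_op (sdom f) m n \<theta> = component g m \<cdot> component f m \<cdot> sobj_op (sdom f) m n \<theta>"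
    by (rule assoc[OF X fh gh])
  also have "\<dots> = component g m \<cdot> sobj_op (scod f) m n \<theta> \<cdot> component f n" by (simp add: smorD(4)[OF f t])
  also have "\<dots> = (component g m \<cdot> sobj_op (scod f) m n \<theta>) \<cdot> component f n" by (rule assoc[OF fh Y gh, symmetric])
  also have "\<dots> = (sobj_op (scod g) m n \<theta> \<cdot> component g n) \<cdot> component f n" using smorD(4)[OF g t] s by simp
  also have "\<dots> = sobj_op (scod g) m n \<theta> \<cdot> component g n \<cdot> component f n" by (rule assoc[OF fh gh Z])
  finally show "component (g \<cdot>\<^bsub>sO\<^esub> f) m \<cdot> sobj_op (sdom (g \<cdot>\<^bsub>sO\<^esub> f)) m n \<theta> = sobj_op (scod (g \<cdot>\<^bsub>sO\<^esub> f)) m n \<theta> \<cdot> component (g \<cdot>\<^bsub>sO\<^esub> f) n"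
    by simp
qed (use f g smorD in auto)

lemma category_sO: "category sO"
proof
  show "f \<in> Arr sO \<Longrightarrow> Dom sO f \<in> Obj sO" "f \<in> Arr sO \<Longrightarrow> Cod sO f \<in> Obj sO" for f using smorD by auto
  show "a \<in> Obj sO \<Longrightarrow> Ident sO a \<in> hom sO a a" for a using simplicial_morphism_ident by (auto simp: hom_def)
  show "f \<in> hom sO a b \<Longrightarrow> g \<in> hom sO b c \<Longrightarrow> g \<cdot>\<^bsub>sO\<^esub> f \<in> hom sO a c" for f g a b c
    using simplicial_morphism_comp by (auto simp: hom_def)
  show "f \<in> hom sO a b \<Longrightarrow> f \<cdot>\<^bsub>sO\<^esub> Ident sO a = f" for f a b
    by (rule smor_eqI) (auto simp: hom_def Ident_right[OF smorD(3)])
  show "f \<in> hom sO a b \<Longrightarrow> Ident sO b \<cdot>\<^bsub>sO\<^esub> f = f" for f a b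
    by (rule smor_eqI) (auto simp: hom_def Ident_left[OF smorD(3)])
  show "(h \<cdot>\<^bsub>sO\<^esub> g) \<cdot>\<^bsub>sO\<^esub> f = h \<cdot>\<^bsub>sO\<^esub> (g \<cdot>\<^bsub>sO\<^esub> f)"
    if "f \<in> hom sO a b" "g \<in> hom sO b c" "h \<in> hom sO c d" for f g h a b c d
  proof (rule smor_eqI)
    fix n
    have "component f n \<in> hom C (level a n) (level b n)" "component g n \<in> hom C (level b n) (level c n)" "component h n \<in> hom C (level c n) (level d n)"
      using that smorD(3)[of f n] smorD(3)[of g n] smorD(3)[of h n] by (auto simp: hom_def)
    then show "component ((h \<cdot>\<^bsub>sO\<^esub> g) \<cdot>\<^bsub>sO\<^esub> f) n = component (h \<cdot>\<^bsub>sO\<^esub> (g \<cdot>\<^bsub>sO\<^esub> f)) n" using assoc by simp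
  qed simp_all
qed

lemma is_comp_sO:
  assumes "simplicial_morphism C f" "simplicial_morphism C g" "scod f = sdom g" shows "is_comp (g \<cdot>\<^bsub>sO\<^esub> f) g f"
  using assms simplicial_morphism_comp[OF assms] by (simp add: is_comp_def)

end

context regular_category
begin

section \<open>The notions of the theorem as lifting properties\<close>

lemma internal_Kan_fibration_iff: "internal_Kan_fibration C p \<longleftrightarrow> horn_lifting p"
proof -
  have "horn_faces {..n} k \<subseteq> faces {..n}" for n k :: nat by (auto simp: horn_faces_def)
  then show ?thesis
    unfolding internal_Kan_fibration_def horn_lifting_def horn_nerve std_simplex_nerve
    using regular_epi_comparison_iff[of p "horn_faces {..n} k" "faces {..n}" for n k :: nat] by auto
qed

lemma internal_trivial_Kan_fibration_iff:
  "internal_trivial_Kan_fibration C p \<longleftrightarrow> simplicial_morphism C p \<and> (\<forall>n :: nat. llift p (bd {..n}) (faces {..n}))"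
proof -
  have "bd {..n} \<subseteq> faces {..n}" for n :: nat by (auto simp: bd_def)
  then show ?thesis
    unfolding internal_trivial_Kan_fibration_def boundary_nerve std_simplex_nerve
    using regular_epi_comparison_iff[of p "bd {..n}" "faces {..n}" for n :: nat] by auto
qed

definition level_terminal :: "('o, 'm) sobj \<Rightarrow> bool" where
  "level_terminal E \<longleftrightarrow> simplicial_object C E \<and> (\<forall>n. is_terminal C (level E n))"

lemma level_terminal_ex: "\<exists>E. level_terminal E"
proof -
  obtain U where U: "is_terminal C U" using terminal_ex by blast
  then have UO: "U \<in> Obj C" by (simp add: is_terminal_def)
  define E where "E = \<lparr>level = (\<lambda>n :: nat. U), sobj_op = (\<lambda>m n \<theta>. if \<theta> \<in> delta_hom m n then Ident C U else undefined)\<rparr>"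
  have "simplicial_object C E"
    unfolding simplicial_object_def using UO Ident_in[OF UO] delta_hom_compose
    by (auto simp: E_def delta_hom_ident)
  then show ?thesis using U by (auto simp: level_terminal_def E_def)
qed

lemma level_terminal_sO:
  assumes E: "level_terminal E" shows "is_terminal sO E"
  unfolding is_terminal_def
proof (intro conjI ballI)
  have EO: "simplicial_object C E" and t: "\<And>n. is_terminal C (level E n)" using E by (auto simp: level_terminal_def)
  then show "E \<in> Obj sO" by simp
  fix X assume "X \<in> Obj sO"
  then have X: "simplicial_object C X" by simp
  define f where "f = \<lparr>sdom = X, scod = E, component = (\<lambda>n. THE f. f \<in> hom C (level X n) (level E n))\<rparr>"
  have fs: "sdom f = X" "scod f = E" by (simp_all add: f_def)
  have c: "component f n \<in> hom C (level X n) (level E n)" for n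
    unfolding f_def smor.simps by (rule theI') (use t[of n] sobjD(1)[OF X] in \<open>simp add: is_terminal_def\<close>)
  have "simplicial_morphism C f"
  proof (rule simplicial_morphismI)
    fix m n \<theta> assume h: "\<theta> \<in> delta_hom m n"
    have "component f m \<cdot> sobj_op X m n \<theta> = sobj_op E m n \<theta> \<cdot> component f n"
      by (rule terminal_unique[OF t Comp_in[OF sobjD(2)[OF X h] c] Comp_in[OF c sobjD(2)[OF EO h]]])
    then show "component f m \<cdot> sobj_op (sdom f) m n \<theta> = sobj_op (scod f) m n \<theta> \<cdot> component f n"
      by (simp only: fs)
  qed (use X EO c in \<open>simp_all only: fs\<close>)
  then have fh: "f \<in> hom sO X E" by (simp add: hom_def fs)
  have "g = f" if "g \<in> hom sO X E" for g
  proof (rule smor_eqI)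
    have g: "simplicial_morphism C g" "sdom g = X" "scod g = E" using that by (auto simp: hom_def)
    then show "sdom g = sdom f" "scod g = scod f" by (simp_all add: f_def)
    show "component g n = component f n" for n
      using terminal_unique[OF t _ c] smorD(3)[OF g(1)] g(2,3) by simp
  qed
  then show "\<exists>!f. f \<in> hom sO X E" using fh by blast
qed

text \<open>A terminal simplicial object is isomorphic to the constant one built in
  \<open>level_terminal_ex\<close>, and levelwise terminality is transported along the components of
  the isomorphism.\<close>

lemma terminal_sO_level:
  assumes T: "is_terminal sO T" shows "level_terminal T"
proof -
  interpret S: category sO by (rule category_sO)
  obtain E where E: "level_terminal E" using level_terminal_ex by blast
  then have t: "\<And>n. is_terminal C (level E n)" by (auto simp: level_terminal_def)
  obtain e where e: "is_iso sO e" "e \<in> hom sO T E" using S.terminal_iso[OF T level_terminal_sO[OF E]] .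
  obtain g where g: "simplicial_morphism C e" "simplicial_morphism C g" "sdom g = E" "scod g = T" "g \<cdot>\<^bsub>sO\<^esub> e = Ident sO T"
    using S.iso_inverse[OF e(1)] e(2) by (auto simp: hom_def)
  have se: "sdom e = T" "scod e = E" using e(2) by (auto simp: hom_def)
  have TO: "simplicial_object C T" using T by (simp add: is_terminal_def)
  have "is_terminal C (level T n)" for n
    unfolding is_terminal_def
  proof (intro conjI ballI)
    have ge: "component g n \<cdot> component e n = Ident C (level T n)" using arg_cong[OF g(5), of "\<lambda>f. component f n"] by simp
    have en: "component e n \<in> hom C (level T n) (level E n)" and gn: "component g n \<in> hom C (level E n) (level T n)"
      using smorD(3)[OF g(1), of n] smorD(3)[OF g(2), of n] se g(3,4) by simp_all
    show "level T n \<in> Obj C" by (rule sobjD(1)[OF TO])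
    fix a assume a: "a \<in> Obj C"
    obtain u where u: "u \<in> hom C a (level E n)" using t[of n] a by (auto simp: is_terminal_def)
    \<comment> \<open>The morphism \<open>component e n\<close> sends \<open>v\<close> to the unique
      \<open>u\<close>, and \<open>component g n\<close> undoes it.\<close>
    have "v = component g n \<cdot> u" if v: "v \<in> hom C a (level T n)" for v
    proof -
      have "component e n \<cdot> v = u" by (rule terminal_unique[OF t Comp_in[OF v en] u])
      then show ?thesis using assoc[OF v en gn] ge Ident_left[OF v] by simp
    qed
    then show "\<exists>!f. f \<in> hom C a (level T n)" using Comp_in[OF u gn] by blast
  qed
  then show ?thesis using TO by (simp add: level_terminal_def)
qed

text \<open>By \<open>lext_iff_llift\<close> lifting over a levelwise terminal target is a property
  of the source, so it passes from the morphism that witnesses \<open>kan\<close> to any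
  other.\<close>

lemma horn_lifting_to_terminal:
  assumes t: "simplicial_morphism C t" "level_terminal (scod t)" and X: "kan (sdom t)"
  shows "horn_lifting t"
proof -
  obtain u where u: "horn_lifting u" "sdom u = sdom t" "\<And>n. is_terminal C (level (scod u) n)" using X unfolding kan_def by metis
  have um: "simplicial_morphism C u" using u(1) by (simp add: horn_lifting_def)
  have hf: "horn_faces {..n} k \<subseteq> faces {..n}" for n k :: nat by (auto simp: horn_faces_def)
  have "llift t (horn_faces {..n} k) (faces {..n})" if "1 \<le> n" "k \<le> n" for n k :: nat
  proof -
    have "llift u (horn_faces {..n} k) (faces {..n})" using u(1) that by (simp add: horn_lifting_def)
    then show ?thesis
      using lext_iff_llift[OF um u(3) hf] lext_iff_llift[OF t(1) _ hf] t(2) u(2) by (simp add: level_terminal_def)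
  qed
  then show ?thesis using t(1) by (simp add: horn_lifting_def)
qed

lemma internal_Kan_complex_iff: "internal_Kan_complex C X \<longleftrightarrow> kan X"
proof
  assume "internal_Kan_complex C X"
  then obtain T t where t: "is_terminal sO T" "t \<in> hom sO X T" "horn_lifting t"
    unfolding internal_Kan_complex_def internal_Kan_fibration_iff by blast
  have "level_terminal T" by (rule terminal_sO_level[OF t(1)])
  then show "kan X" unfolding kan_def using t by (auto simp: hom_def level_terminal_def)
next
  assume "kan X"
  then obtain t where t: "horn_lifting t" "sdom t = X" "\<And>n. is_terminal C (level (scod t) n)" unfolding kan_def by blast
  have m: "simplicial_morphism C t" using t(1) by (simp add: horn_lifting_def)
  then have "level_terminal (scod t)" using t(3) smorD(2) by (auto simp: level_terminal_def)
  then show "internal_Kan_complex C X"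
    unfolding internal_Kan_complex_def internal_Kan_fibration_iff using level_terminal_sO t m smorD(1)[OF m] by (auto simp: hom_def)
qed

lemma Kan_eq: "Kan C = full_subcategory sO kan"
  unfolding Kan_def using internal_Kan_complex_iff by (metis (no_types, lifting) ext)

lemma Kan_simps [simp]:
  "Obj (Kan C) = {X. kan X}" "Arr (Kan C) = {f. simplicial_morphism C f \<and> kan (sdom f) \<and> kan (scod f)}"
  "Dom (Kan C) = sdom" "Cod (Kan C) = scod" "Ident (Kan C) = Ident sO" "Comp (Kan C) = Comp sO"
  unfolding Kan_eq using kan_sobj by auto

lemma category_Kan: "category (Kan C)"
  unfolding Kan_eq by (rule category_full_subcategory[OF category_sO])

lemma hom_Kan: "f \<in> hom (Kan C) X Y \<longleftrightarrow> simplicial_morphism C f \<and> sdom f = X \<and> scod f = Y \<and> kan X \<and> kan Y"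
  by (auto simp: hom_def)

lemma DI_weak_equivalence_iff:
  "DI_weak_equivalence C f \<longleftrightarrow> simplicial_morphism C f \<and> kan (sdom f) \<and> kan (scod f) \<and> (\<forall>n :: nat. rhl f (bd {..n}) (faces {..n}))"
  unfolding DI_weak_equivalence_def using regular_epi_DI_comparison_iff by auto

lemma bd_faces: "bd {..n::nat} \<subseteq> faces {..n}"
  by (auto simp: bd_def)

lemma two_out_of_three_Kan: "two_out_of_three (Kan C) {f. DI_weak_equivalence C f}"
  unfolding two_out_of_three_def
proof (intro ballI impI)
  fix f g assume "f \<in> Arr (Kan C)" "g \<in> Arr (Kan C)" "Cod (Kan C) f = Dom (Kan C) g"
  then have f: "simplicial_morphism C f" "kan (sdom f)" "kan (scod f)" and g: "simplicial_morphism C g" "kan (sdom g)" "kan (scod g)"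
    and s: "scod f = sdom g" by auto
  let ?h = "g \<cdot>\<^bsub>sO\<^esub> f"
  note c = is_comp_sO[OF f(1) g(1) s]
  note h = simplicial_morphism_comp[OF f(1) g(1) s]
  have 1: "rhl ?h (bd {..n}) (faces {..n})" if "\<And>n :: nat. rhl f (bd {..n}) (faces {..n})" "\<And>n :: nat. rhl g (bd {..n}) (faces {..n})" for n :: nat
    by (rule rhl_comp[OF c g(3) that]) (simp_all add: bd_faces)
  \<comment> \<open>\<open>rhl_cancel_left\<close> lifts through \<open>g\<close> over a cylinder
    relative to its whole boundary; \<open>rhl_complex\<close> derives this from the boundaries of
    simplices.\<close>
  have 2: "rhl f (bd {..n}) (faces {..n})" if "\<And>n :: nat. rhl ?h (bd {..n}) (faces {..n})" "\<And>n :: nat. rhl g (bd {..n}) (faces {..n})" for n :: nat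
  proof (rule rhl_cancel_left[OF c that(1) rhl_complex[OF g(1,3) that(2)]])
    show "bd {..n} \<otimes> II \<union> faces {..n} \<otimes> {{0}} \<union> faces {..n} \<otimes> {{1}} \<subseteq> faces {..n} \<otimes> II"
      using cylinder_incl[of 0, OF _ bd_faces] cylinder_incl[of 1, OF _ bd_faces] by blast
  qed (simp_all add: bd_faces complex_Un complex_cprod)
  \<comment> \<open>\<open>rhl_cancel_right\<close> uses \<open>f\<close> on the inclusion of the
    empty complex into the boundary, again an instance of \<open>rhl_complex\<close>.\<close>
  have 3: "rhl g (bd {..n}) (faces {..n})" if "\<And>n :: nat. rhl ?h (bd {..n}) (faces {..n})" "\<And>n :: nat. rhl f (bd {..n}) (faces {..n})" for n :: nat
    by (rule rhl_cancel_right[OF c f(3) g(3) that(1) rhl_complex[OF f(1,3) that(2)]]) (simp_all add: bd_faces)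
  show "(f \<in> {f. DI_weak_equivalence C f} \<and> g \<in> {f. DI_weak_equivalence C f} \<longrightarrow> g \<cdot>\<^bsub>Kan C\<^esub> f \<in> {f. DI_weak_equivalence C f}) \<and>
     (f \<in> {f. DI_weak_equivalence C f} \<and> g \<cdot>\<^bsub>Kan C\<^esub> f \<in> {f. DI_weak_equivalence C f} \<longrightarrow> g \<in> {f. DI_weak_equivalence C f}) \<and>
     (g \<in> {f. DI_weak_equivalence C f} \<and> g \<cdot>\<^bsub>Kan C\<^esub> f \<in> {f. DI_weak_equivalence C f} \<longrightarrow> f \<in> {f. DI_weak_equivalence C f})"
    unfolding Kan_simps mem_Collect_eq DI_weak_equivalence_iff using f g h 1 2 3 by auto
qed

lemma retract_closed_Kan: "retract_closed (Kan C) {f. DI_weak_equivalence C f}"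
  unfolding retract_closed_def
proof (intro allI impI)
  fix f g assume "is_retract_of (Kan C) f g \<and> g \<in> {f. DI_weak_equivalence C f}"
  then obtain s r s' r' where f: "simplicial_morphism C f" "kan (sdom f)" "kan (scod f)" and g: "DI_weak_equivalence C g"
    and s: "s \<in> hom (Kan C) (sdom f) (sdom g)" and r: "r \<in> hom (Kan C) (sdom g) (sdom f)"
    and s': "s' \<in> hom (Kan C) (scod f) (scod g)" and r': "r' \<in> hom (Kan C) (scod g) (scod f)"
    and eq: "r \<cdot>\<^bsub>sO\<^esub> s = Ident sO (sdom f)" "r' \<cdot>\<^bsub>sO\<^esub> s' = Ident sO (scod f)"
      "g \<cdot>\<^bsub>sO\<^esub> s = s' \<cdot>\<^bsub>sO\<^esub> f" "f \<cdot>\<^bsub>sO\<^esub> r = r' \<cdot>\<^bsub>sO\<^esub> g"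
    unfolding is_retract_of_def by auto
  have gm: "simplicial_morphism C g" and gr: "\<And>n :: nat. rhl g (bd {..n}) (faces {..n})" using g by (auto simp: DI_weak_equivalence_iff)
  note S = s[unfolded hom_Kan] r[unfolded hom_Kan] s'[unfolded hom_Kan] r'[unfolded hom_Kan]
  have "rhl f (bd {..n}) (faces {..n})" for n :: nat
  proof (rule rhl_retract_morphism)
    show "is_comp (g \<cdot>\<^bsub>sO\<^esub> s) g s" "is_comp (f \<cdot>\<^bsub>sO\<^esub> r) f r" using S gm f by (auto intro: is_comp_sO)
    show "is_comp (g \<cdot>\<^bsub>sO\<^esub> s) s' f" "is_comp (f \<cdot>\<^bsub>sO\<^esub> r) r' g" unfolding eq(3,4) using S gm f by (auto intro: is_comp_sO)
    show "is_comp (r \<cdot>\<^bsub>sO\<^esub> s) r s" "is_comp (r' \<cdot>\<^bsub>sO\<^esub> s') r' s'" using S gm f by (auto intro: is_comp_sO)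
    show "component (r \<cdot>\<^bsub>sO\<^esub> s) n = Ident C (level (sdom f) n)" "component (r' \<cdot>\<^bsub>sO\<^esub> s') n = Ident C (level (scod f) n)" for n
      unfolding eq by simp_all
  qed (fact gr bd_faces)+
  then show "f \<in> {f. DI_weak_equivalence C f}" using f by (simp add: DI_weak_equivalence_iff)
qed

lemma horn_lifting_morphism: "horn_lifting p \<Longrightarrow> simplicial_morphism C p"
  by (simp add: horn_lifting_def)

text \<open>Both notions are tested on the boundaries of simplices. A strict lift is one up to
  homotopy, and for a fibration the homotopy can itself be lifted and absorbed into the
  solution.\<close>

lemma trivial_iff_DI:
  assumes "p \<in> Arr (Kan C)" "internal_Kan_fibration C p"
  shows "internal_trivial_Kan_fibration C p \<longleftrightarrow> DI_weak_equivalence C p"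
proof -
  have h: "horn_lifting p" using assms(2) by (simp add: internal_Kan_fibration_iff)
  have "llift p (bd {..n}) (faces {..n}) \<longleftrightarrow> rhl p (bd {..n}) (faces {..n})" for n :: nat
    using llift_rhl[OF horn_lifting_morphism[OF h] _ bd_faces] llift_of_rhl[OF h _ _ _ bd_faces] by auto
  then show ?thesis using assms(1) unfolding internal_trivial_Kan_fibration_iff DI_weak_equivalence_iff by auto
qed

section \<open>Fibrations, isomorphisms and terminal objects among Kan complexes\<close>

lemma horn_liftingI:
  assumes "simplicial_morphism C p" "\<And>n k :: nat. 1 \<le> n \<Longrightarrow> k \<le> n \<Longrightarrow> llift p (horn_faces {..n} k) (faces {..n})"
  shows "horn_lifting p"
  using assms by (simp add: horn_lifting_def)

lemma horn_liftingD:
  "horn_lifting p \<Longrightarrow> 1 \<le> n \<Longrightarrow> k \<le> n \<Longrightarrow> llift p (horn_faces {..n::nat} k) (faces {..n})"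
  by (simp add: horn_lifting_def)

lemma horn_faces_subset: "horn_faces A v \<subseteq> faces A"
  by (auto simp: horn_faces_def)

lemma horn_lifting_comp:
  assumes "horn_lifting f" "horn_lifting g" "scod f = sdom g" shows "horn_lifting (g \<cdot>\<^bsub>sO\<^esub> f)"
proof -
  note c = is_comp_sO[OF assms(1,2)[THEN horn_lifting_morphism] assms(3)]
  show ?thesis
    by (rule horn_liftingI[OF is_compD(3)[OF c]]) (rule llift_comp[OF c horn_liftingD[OF assms(1)] horn_liftingD[OF assms(2)]])
qed

text \<open>Composing \<open>p\<close> with a fibration from its target to a levelwise terminal
  object exhibits the source as Kan. In this way pullbacks along fibrations and the path object stay
  in \<open>Kan C\<close>.\<close>

lemma kan_of_fibration:
  assumes p: "horn_lifting p" and Y: "kan (scod p)" shows "kan (sdom p)"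
proof -
  obtain t where t: "horn_lifting t" "sdom t = scod p" "\<And>n. is_terminal C (level (scod t) n)" using Y unfolding kan_def by metis
  have "horn_lifting (t \<cdot>\<^bsub>sO\<^esub> p)" by (rule horn_lifting_comp[OF p t(1)]) (simp add: t(2))
  then show ?thesis unfolding kan_def using t(3) by (metis sO_comp_simps(1,2))
qed

lemma iso_llift:
  assumes "is_iso sO e" "K \<subseteq> L" shows "llift e K L"
proof -
  interpret S: category sO by (rule category_sO)
  obtain g where g: "simplicial_morphism C e" "simplicial_morphism C g" "sdom g = scod e" "scod g = sdom e"
    "g \<cdot>\<^bsub>sO\<^esub> e = Ident sO (sdom e)" "e \<cdot>\<^bsub>sO\<^esub> g = Ident sO (scod e)" using S.iso_inverse[OF assms(1)] by auto
  show ?thesis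
    by (rule llift_iso[OF is_comp_sO[OF g(1,2)] is_comp_sO[OF g(2,1)] assms(2)]) (use g in simp_all)
qed

lemma iso_horn_lifting:
  assumes "is_iso sO e" shows "horn_lifting e"
proof -
  have "simplicial_morphism C e" using assms by (simp add: is_iso_def)
  then show ?thesis by (rule horn_liftingI) (rule iso_llift[OF assms horn_faces_subset])
qed

lemma iso_Kan: "is_iso (Kan C) e \<Longrightarrow> is_iso sO e \<and> e \<in> Arr (Kan C)"
  by (auto simp: is_iso_def hom_def)

lemma iso_DI:
  assumes "is_iso (Kan C) e" shows "DI_weak_equivalence C e"
  using iso_Kan[OF assms] llift_rhl[OF _ iso_llift[OF _ bd_faces] bd_faces] by (auto simp: DI_weak_equivalence_iff)

lemma level_terminal_Kan:
  assumes E: "level_terminal E" shows "kan E" "is_terminal (Kan C) E"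
proof -
  interpret S: category sO by (rule category_sO)
  have EO: "E \<in> Obj sO" using E by (simp add: level_terminal_def)
  have "horn_lifting (Ident sO E)" by (rule iso_horn_lifting[OF S.ident_iso[OF EO]])
  then show k: "kan E" unfolding kan_def using E by (auto simp: level_terminal_def)
  have "hom (Kan C) X E = hom sO X E" if "kan X" for X using that k by (auto simp: hom_def)
  then show "is_terminal (Kan C) E"
    using level_terminal_sO[OF E] k kan_sobj unfolding is_terminal_def by simp
qed

text \<open>\<open>T\<close> is terminal only within \<open>Kan C\<close>. It is isomorphic there to
  a levelwise terminal object; the composite of \<open>t\<close> with this isomorphism is a
  fibration, and composing with the inverse returns \<open>t\<close>.\<close>

lemma terminal_Kan_fibration:
  assumes T: "is_terminal (Kan C) T" and t: "t \<in> hom (Kan C) X T" shows "horn_lifting t"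
proof -
  interpret K: category "Kan C" by (rule category_Kan)
  interpret S: category sO by (rule category_sO)
  obtain E where E: "level_terminal E" using level_terminal_ex by blast
  obtain e where e: "is_iso (Kan C) e" "e \<in> hom (Kan C) T E" using K.terminal_iso[OF T level_terminal_Kan(2)[OF E]] .
  obtain g where g: "g \<in> Arr (Kan C)" "Dom (Kan C) g = Cod (Kan C) e" "Cod (Kan C) g = Dom (Kan C) e"
    "g \<cdot>\<^bsub>Kan C\<^esub> e = Ident (Kan C) (Dom (Kan C) e)" "e \<cdot>\<^bsub>Kan C\<^esub> g = Ident (Kan C) (Cod (Kan C) e)" using K.iso_inverse[OF e(1)] by metis
  have gi: "is_iso sO g" using g e by (auto simp: is_iso_def hom_def)
  have th: "simplicial_morphism C t" "sdom t = X" "scod t = T" "kan X" using t by (auto simp: hom_Kan)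
  have eh: "simplicial_morphism C e" "sdom e = T" "scod e = E" using e(2) by (auto simp: hom_Kan)
  have "horn_lifting (e \<cdot>\<^bsub>sO\<^esub> t)"
    by (rule horn_lifting_to_terminal) (use simplicial_morphism_comp[OF th(1) eh(1)] th eh E in simp_all)
  then have "horn_lifting (g \<cdot>\<^bsub>sO\<^esub> (e \<cdot>\<^bsub>sO\<^esub> t))"
    by (rule horn_lifting_comp[OF _ iso_horn_lifting[OF gi]]) (use g eh in simp)
  moreover have "g \<cdot>\<^bsub>sO\<^esub> (e \<cdot>\<^bsub>sO\<^esub> t) = t"
    using S.comp_assoc[of t e g] g eh th by simp
  ultimately show ?thesis by simp
qed

section \<open>Levelwise pullbacks\<close>

definition level_pullback :: "('o, 'm) smor \<Rightarrow> ('o, 'm) smor \<Rightarrow> ('o, 'm) smor \<Rightarrow> ('o, 'm) smor \<Rightarrow> bool" where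
  "level_pullback f g p q \<longleftrightarrow> simplicial_morphism C f \<and> simplicial_morphism C g \<and> simplicial_morphism C p \<and> simplicial_morphism C q \<and>
     sdom q = sdom p \<and> scod p = sdom f \<and> scod q = sdom g \<and> scod g = scod f \<and>
     (\<forall>n. is_pullback C (component f n) (component g n) (component p n) (component q n))"

lemma level_pullbackD:
  assumes "level_pullback f g p q"
  shows "simplicial_morphism C f" "simplicial_morphism C g" "simplicial_morphism C p" "simplicial_morphism C q"
    "sdom q = sdom p" "scod p = sdom f" "scod q = sdom g" "scod g = scod f"
    "\<And>n. is_pullback C (component f n) (component g n) (component p n) (component q n)"
  using assms by (auto simp: level_pullback_def)

lemma level_pullback_lift:
  assumes "level_pullback f g p q" "u \<in> hom C T (level (sdom f) n)" "v \<in> hom C T (level (sdom g) n)" "component f n \<cdot> u = component g n \<cdot> v"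
  obtains t where "t \<in> hom C T (level (sdom p) n)" "component p n \<cdot> t = u" "component q n \<cdot> t = v"
proof -
  note l = level_pullbackD[OF assms(1)]
  have d: "Dom C (component f n) = level (sdom f) n" "Dom C (component g n) = level (sdom g) n" "Dom C (component p n) = level (sdom p) n"
    using homD[OF smorD(3)[OF l(1)]] homD[OF smorD(3)[OF l(2)]] homD[OF smorD(3)[OF l(3)]] by auto
  show thesis
    by (rule pullback_lift[OF l(9)[of n], of u v]) (use assms d that in \<open>auto simp: hom_def\<close>)
qed

lemma level_pullback_unique:
  assumes "level_pullback f g p q" "s \<in> hom C T (level (sdom p) n)" "t \<in> hom C T (level (sdom p) n)"
    "component p n \<cdot> s = component p n \<cdot> t" "component q n \<cdot> s = component q n \<cdot> t"
  shows "s = t"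
proof -
  note l = level_pullbackD[OF assms(1)]
  have d: "Dom C (component p n) = level (sdom p) n" using homD[OF smorD(3)[OF l(3)]] by auto
  show ?thesis by (rule pullback_unique[OF l(9)[of n] _ _ _ _ _ assms(4,5)]) (use assms(2,3) d in \<open>auto simp: hom_def\<close>)
qed

text \<open>The operators on the chosen pullbacks are induced by those of \<open>sdom f\<close> and
  \<open>sdom g\<close>. Each is chosen separately; uniqueness of morphisms into a pullback makes
  the choices functorial.\<close>

lemma level_pullback_ex:
  assumes f: "simplicial_morphism C f" and g: "simplicial_morphism C g" and s: "scod g = scod f"
  shows "\<exists>p q. level_pullback f g p q"
proof -
  let ?X = "sdom f" and ?Y = "sdom g"
  note X = smorD(1)[OF f] and Y = smorD(1)[OF g]
  note fh = smorD(3)[OF f] and gh = smorD(3)[OF g, unfolded s]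
  have ex: "\<exists>p q. is_pullback C (component f n) (component g n) p q" for n
    using pullback_exists[of "component f n" "component g n"] fh[of n] gh[of n] by (auto simp: hom_def)
  define a where "a n = pb_fst C (component f n) (component g n)" for n
  define b where "b n = pb_snd C (component f n) (component g n)" for n
  define L where "L n = Dom C (a n)" for n
  have pb: "is_pullback C (component f n) (component g n) (a n) (b n)" for n unfolding a_def b_def by (rule pb_ex[OF ex])
  have a: "a n \<in> hom C (L n) (level ?X n)" and b: "b n \<in> hom C (L n) (level ?Y n)" and eq: "component f n \<cdot> a n = component g n \<cdot> b n" for n
    using pullbackD[OF pb[of n]] fh[of n] gh[of n] by (auto simp: hom_def L_def)
  have uniq: "u = v" if "u \<in> hom C T (L n)" "v \<in> hom C T (L n)" "a n \<cdot> u = a n \<cdot> v" "b n \<cdot> u = b n \<cdot> v" for u v T n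
    by (rule pullback_unique[OF pb _ _ _ _ _ that(3,4)]) (use that(1,2) in \<open>auto simp: hom_def L_def\<close>)
  have "\<exists>t. t \<in> hom C (L n) (L m) \<and> a m \<cdot> t = sobj_op ?X m n \<theta> \<cdot> a n \<and> b m \<cdot> t = sobj_op ?Y m n \<theta> \<cdot> b n"
    if t: "\<theta> \<in> delta_hom m n" for m n \<theta>
  proof -
    note Xt = sobjD(2)[OF X t] and Yt = sobjD(2)[OF Y t]
    have "component f m \<cdot> sobj_op ?X m n \<theta> \<cdot> a n = (component f m \<cdot> sobj_op ?X m n \<theta>) \<cdot> a n" by (rule assoc[OF a Xt fh, symmetric])
    also have "\<dots> = sobj_op (scod f) m n \<theta> \<cdot> component f n \<cdot> a n"
      unfolding smorD(4)[OF f t] by (rule assoc[OF a fh sobjD(2)[OF smorD(2)[OF f] t]])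
    also have "\<dots> = (sobj_op (scod f) m n \<theta> \<cdot> component g n) \<cdot> b n"
      unfolding eq by (rule assoc[OF b gh sobjD(2)[OF smorD(2)[OF f] t], symmetric])
    also have "\<dots> = component g m \<cdot> sobj_op ?Y m n \<theta> \<cdot> b n"
      unfolding smorD(4)[OF g t, unfolded s, symmetric] by (rule assoc[OF b Yt gh])
    finally have e: "component f m \<cdot> sobj_op ?X m n \<theta> \<cdot> a n = component g m \<cdot> sobj_op ?Y m n \<theta> \<cdot> b n" .
    obtain t where "t \<in> Arr C" "Dom C t = Dom C (sobj_op ?X m n \<theta> \<cdot> a n)" "Cod C t = Dom C (a m)"
      "a m \<cdot> t = sobj_op ?X m n \<theta> \<cdot> a n" "b m \<cdot> t = sobj_op ?Y m n \<theta> \<cdot> b n"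
      by (rule pullback_lift[OF pb[of m] _ _ _ _ _ e])
        (use homD[OF Comp_in[OF a Xt]] homD[OF Comp_in[OF b Yt]] homD[OF fh] homD[OF gh] in auto)
    then show ?thesis using homD[OF Comp_in[OF a Xt]] by (auto simp: hom_def L_def)
  qed
  note ex_op = this
  define op where "op m n \<theta> = (SOME t. t \<in> hom C (L n) (L m) \<and> a m \<cdot> t = sobj_op ?X m n \<theta> \<cdot> a n \<and> b m \<cdot> t = sobj_op ?Y m n \<theta> \<cdot> b n)" for m n \<theta>
  have op: "op m n \<theta> \<in> hom C (L n) (L m) \<and> a m \<cdot> op m n \<theta> = sobj_op ?X m n \<theta> \<cdot> a n \<and> b m \<cdot> op m n \<theta> = sobj_op ?Y m n \<theta> \<cdot> b n"
    if "\<theta> \<in> delta_hom m n" for m n \<theta>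
    unfolding op_def by (rule someI_ex[OF ex_op[OF that]])
  define P where "P = \<lparr>level = L, sobj_op = (\<lambda>m n \<theta>. if \<theta> \<in> delta_hom m n then op m n \<theta> else undefined)\<rparr>"
  have LO: "L n \<in> Obj C" for n using homD(4)[OF a] .
  have P: "simplicial_object C P"
    unfolding simplicial_object_def
  proof (intro conjI allI ballI impI)
    show "level P n \<in> Obj C" for n using LO by (simp add: P_def)
    show "sobj_op P m n \<theta> \<in> hom C (level P n) (level P m)" if "\<theta> \<in> delta_hom m n" for m n \<theta> using op[OF that] that by (simp add: P_def)
    show "sobj_op P m n \<theta> = undefined" if "\<theta> \<notin> delta_hom m n" for m n \<theta> using that by (simp add: P_def)
    have "op n n (\<lambda>i \<in> {..n}. i) = Ident C (L n)" for n
      by (rule uniq[of _ "L n" n])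
        (use op[OF delta_hom_ident] LO in \<open>simp_all add: Ident_in Ident_right[OF a] Ident_right[OF b] sobjD(4)[OF X] sobjD(4)[OF Y] Ident_left[OF a] Ident_left[OF b]\<close>)
    then show "sobj_op P n n (\<lambda>i \<in> {..n}. i) = Ident C (level P n)" for n using delta_hom_ident by (simp add: P_def)
    fix l m n \<eta> \<theta> assume e: "\<eta> \<in> delta_hom l m" and t: "\<theta> \<in> delta_hom m n"
    note et = delta_hom_compose[OF t e]
    note oe = op[OF e, THEN conjunct1] and ot = op[OF t, THEN conjunct1]
    have "op l n (compose {..l} \<theta> \<eta>) = op l m \<eta> \<cdot> op m n \<theta>"
    proof (rule uniq[OF op[OF et, THEN conjunct1] Comp_in[OF ot oe]])
      have "a l \<cdot> op l m \<eta> \<cdot> op m n \<theta> = (sobj_op ?X l m \<eta> \<cdot> a m) \<cdot> op m n \<theta>"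
        using assoc[OF ot oe a] op[OF e] by simp
      also have "\<dots> = sobj_op ?X l m \<eta> \<cdot> sobj_op ?X m n \<theta> \<cdot> a n"
        using assoc[OF ot a sobjD(2)[OF X e]] op[OF t] by simp
      also have "\<dots> = sobj_op ?X l n (compose {..l} \<theta> \<eta>) \<cdot> a n"
        unfolding sobjD(5)[OF X e t] by (rule assoc[OF a sobjD(2)[OF X t] sobjD(2)[OF X e], symmetric])
      finally show "a l \<cdot> op l n (compose {..l} \<theta> \<eta>) = a l \<cdot> op l m \<eta> \<cdot> op m n \<theta>" using op[OF et] by simp
      have "b l \<cdot> op l m \<eta> \<cdot> op m n \<theta> = (sobj_op ?Y l m \<eta> \<cdot> b m) \<cdot> op m n \<theta>"
        using assoc[OF ot oe b] op[OF e] by simp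
      also have "\<dots> = sobj_op ?Y l m \<eta> \<cdot> sobj_op ?Y m n \<theta> \<cdot> b n"
        using assoc[OF ot b sobjD(2)[OF Y e]] op[OF t] by simp
      also have "\<dots> = sobj_op ?Y l n (compose {..l} \<theta> \<eta>) \<cdot> b n"
        unfolding sobjD(5)[OF Y e t] by (rule assoc[OF b sobjD(2)[OF Y t] sobjD(2)[OF Y e], symmetric])
      finally show "b l \<cdot> op l n (compose {..l} \<theta> \<eta>) = b l \<cdot> op l m \<eta> \<cdot> op m n \<theta>" using op[OF et] by simp
    qed
    then show "sobj_op P l n (compose {..l} \<theta> \<eta>) = sobj_op P l m \<eta> \<cdot> sobj_op P m n \<theta>"
      using e t et by (simp add: P_def)
  qed
  define p where "p = \<lparr>sdom = P, scod = ?X, component = a\<rparr>"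
  define q where "q = \<lparr>sdom = P, scod = ?Y, component = b\<rparr>"
  have "simplicial_morphism C p" "simplicial_morphism C q"
    by (rule simplicial_morphismI; use P X Y a b op in \<open>simp add: p_def q_def P_def\<close>)+
  then have "level_pullback f g p q" using f g s pb by (simp add: level_pullback_def p_def q_def)
  then show ?thesis by blast
qed

lemma level_pullback_sO:
  assumes l: "level_pullback f g p q" shows "is_pullback sO f g p q"
proof -
  interpret S: category sO by (rule category_sO)
  note D = level_pullbackD[OF l]
  have fp: "component f n \<cdot> component p n = component g n \<cdot> component q n" for n using pullbackD(9)[OF D(9)] .
  show ?thesis
  proof (rule S.pullbackI)
    show "f \<cdot>\<^bsub>sO\<^esub> p = g \<cdot>\<^bsub>sO\<^esub> q" by (rule smor_eqI) (use D fp in simp_all)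
    fix u v assume "u \<in> Arr sO" "v \<in> Arr sO" "Dom sO v = Dom sO u" "Cod sO u = Dom sO f" "Cod sO v = Dom sO g" and e: "f \<cdot>\<^bsub>sO\<^esub> u = g \<cdot>\<^bsub>sO\<^esub> v"
    then have u: "simplicial_morphism C u" "scod u = sdom f" and v: "simplicial_morphism C v" "scod v = sdom g" "sdom v = sdom u" by simp_all
    let ?T = "sdom u"
    note T = smorD(1)[OF u(1)]
    have uh: "component u n \<in> hom C (level ?T n) (level (sdom f) n)" and vh: "component v n \<in> hom C (level ?T n) (level (sdom g) n)" for n
      using smorD(3)[OF u(1)] smorD(3)[OF v(1)] u v by auto
    have "\<exists>t. t \<in> hom C (level ?T n) (level (sdom p) n) \<and> component p n \<cdot> t = component u n \<and> component q n \<cdot> t = component v n" for n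
    proof -
      have "component f n \<cdot> component u n = component g n \<cdot> component v n" using arg_cong[OF e, of "\<lambda>h. component h n"] by simp
      then show ?thesis using level_pullback_lift[OF l uh vh] by blast
    qed
    then obtain t where t: "\<And>n. t n \<in> hom C (level ?T n) (level (sdom p) n)" "\<And>n. component p n \<cdot> t n = component u n" "\<And>n. component q n \<cdot> t n = component v n"
      by metis
    define h where "h = \<lparr>sdom = ?T, scod = sdom p, component = t\<rparr>"
    have "simplicial_morphism C h"
    proof (rule simplicial_morphismI)
      fix m n \<theta> assume th: "\<theta> \<in> delta_hom m n"
      note Tt = sobjD(2)[OF T th] and Pt = sobjD(2)[OF smorD(1)[OF D(3)] th]
      note ph = smorD(3)[OF D(3)] and qh = smorD(3)[OF D(4), unfolded D(5)]
      have "t m \<cdot> sobj_op ?T m n \<theta> = sobj_op (sdom p) m n \<theta> \<cdot> t n"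
      proof (rule level_pullback_unique[OF l Comp_in[OF Tt t(1)] Comp_in[OF t(1) Pt]])
        have "component p m \<cdot> t m \<cdot> sobj_op ?T m n \<theta> = component u m \<cdot> sobj_op ?T m n \<theta>"
          using assoc[OF Tt t(1) ph] t(2) by simp
        also have "\<dots> = sobj_op (sdom f) m n \<theta> \<cdot> component p n \<cdot> t n" using smorD(4)[OF u(1) th] u(2) t(2) by simp
        also have "\<dots> = (sobj_op (sdom f) m n \<theta> \<cdot> component p n) \<cdot> t n"
          by (rule assoc[OF t(1) ph, symmetric, unfolded D(6)]) (rule sobjD(2)[OF smorD(1)[OF D(1)] th])
        also have "\<dots> = component p m \<cdot> sobj_op (sdom p) m n \<theta> \<cdot> t n"
          using smorD(4)[OF D(3) th] assoc[OF t(1) Pt ph] D(6) by simp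
        finally show "component p m \<cdot> t m \<cdot> sobj_op ?T m n \<theta> = component p m \<cdot> sobj_op (sdom p) m n \<theta> \<cdot> t n" .
        have "component q m \<cdot> t m \<cdot> sobj_op ?T m n \<theta> = component v m \<cdot> sobj_op ?T m n \<theta>"
          using assoc[OF Tt t(1) qh] t(3) by simp
        also have "\<dots> = sobj_op (sdom g) m n \<theta> \<cdot> component q n \<cdot> t n" using smorD(4)[OF v(1) th] v(2,3) t(3) by simp
        also have "\<dots> = (sobj_op (sdom g) m n \<theta> \<cdot> component q n) \<cdot> t n"
          by (rule assoc[OF t(1) qh, symmetric, unfolded D(7)]) (rule sobjD(2)[OF smorD(1)[OF D(2)] th])
        also have "\<dots> = component q m \<cdot> sobj_op (sdom p) m n \<theta> \<cdot> t n"
          using smorD(4)[OF D(4) th] assoc[OF t(1) Pt qh] D(5,7) by simp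
        finally show "component q m \<cdot> t m \<cdot> sobj_op ?T m n \<theta> = component q m \<cdot> sobj_op (sdom p) m n \<theta> \<cdot> t n" .
      qed
      then show "component h m \<cdot> sobj_op (sdom h) m n \<theta> = sobj_op (scod h) m n \<theta> \<cdot> component h n" by (simp add: h_def)
    qed (use T t(1) smorD(1)[OF D(3)] in \<open>simp_all add: h_def\<close>)
    moreover have "p \<cdot>\<^bsub>sO\<^esub> h = u" "q \<cdot>\<^bsub>sO\<^esub> h = v" by (rule smor_eqI; use D u v t in \<open>simp add: h_def\<close>)+
    ultimately show "\<exists>t. t \<in> Arr sO \<and> Dom sO t = Dom sO u \<and> Cod sO t = Dom sO p \<and> p \<cdot>\<^bsub>sO\<^esub> t = u \<and> q \<cdot>\<^bsub>sO\<^esub> t = v"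
      by (intro exI[of _ h]) (simp add: h_def)
  next
    fix s t assume "s \<in> Arr sO" "t \<in> Arr sO" "Dom sO s = Dom sO t" "Cod sO s = Dom sO p" "Cod sO t = Dom sO p" and e: "p \<cdot>\<^bsub>sO\<^esub> s = p \<cdot>\<^bsub>sO\<^esub> t" "q \<cdot>\<^bsub>sO\<^esub> s = q \<cdot>\<^bsub>sO\<^esub> t"
    then have s: "simplicial_morphism C s" "scod s = sdom p" "sdom s = sdom t" and t: "simplicial_morphism C t" "scod t = sdom p" by simp_all
    show "s = t"
    proof (rule smor_eqI)
      fix n
      have "component p n \<cdot> component s n = component p n \<cdot> component t n" "component q n \<cdot> component s n = component q n \<cdot> component t n"
        using arg_cong[OF e(1), of "\<lambda>h. component h n"] arg_cong[OF e(2), of "\<lambda>h. component h n"] by simp_all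
      moreover have "component s n \<in> hom C (level (sdom t) n) (level (sdom p) n)" "component t n \<in> hom C (level (sdom t) n) (level (sdom p) n)"
        using smorD(3)[OF s(1), of n] smorD(3)[OF t(1), of n] s t by simp_all
      ultimately show "component s n = component t n" using level_pullback_unique[OF l] by blast
    qed (use s t in simp_all)
  qed (use D in simp_all)
qed

text \<open>The values are chosen simplex by simplex, and joint uniqueness in the levelwise
  pullbacks forces compatibility with the operators.\<close>

lemma level_pullback_smap:
  assumes l: "level_pullback f g p q" and ok: "sset_ok Z" and u: "smap Z T (sdom f) \<phi>" and v: "smap Z T (sdom g) \<psi>" and e: "agree Z (f \<odot> \<phi>) (g \<odot> \<psi>)"
  obtains \<chi> where "smap Z T (sdom p) \<chi>" "agree Z (p \<odot> \<chi>) \<phi>" "agree Z (q \<odot> \<chi>) \<psi>"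
proof -
  note D = level_pullbackD[OF l]
  have "\<exists>t. t \<in> hom C T (level (sdom p) n) \<and> component p n \<cdot> t = \<phi> n z \<and> component q n \<cdot> t = \<psi> n z" if z: "z \<in> simplices Z n" for n z
  proof -
    have "component f n \<cdot> \<phi> n z = component g n \<cdot> \<psi> n z" using e z by (simp add: agree_def push_def)
    then show ?thesis using level_pullback_lift[OF l smapD(1)[OF u z] smapD(1)[OF v z]] by blast
  qed
  note ex = this
  define \<chi> where "\<chi> n z = (SOME t. t \<in> hom C T (level (sdom p) n) \<and> component p n \<cdot> t = \<phi> n z \<and> component q n \<cdot> t = \<psi> n z)" for n z
  have c: "\<chi> n z \<in> hom C T (level (sdom p) n) \<and> component p n \<cdot> \<chi> n z = \<phi> n z \<and> component q n \<cdot> \<chi> n z = \<psi> n z" if "z \<in> simplices Z n" for n z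
    unfolding \<chi>_def by (rule someI_ex[OF ex[OF that]])
  have "smap Z T (sdom p) \<chi>"
    unfolding smap_def
  proof (intro conjI allI ballI)
    show "\<chi> m z \<in> hom C T (level (sdom p) m)" if "z \<in> simplices Z m" for m z using c[OF that] by blast
    fix m n \<theta> z assume th: "\<theta> \<in> delta_hom m n" and z: "z \<in> simplices Z n"
    have z': "sset_op Z m n \<theta> z \<in> simplices Z m" using ok th z by (simp add: sset_ok_def)
    note Pt = sobjD(2)[OF smorD(1)[OF D(3)] th] and cz = c[OF z, THEN conjunct1]
    note ph = smorD(3)[OF D(3)] and qh = smorD(3)[OF D(4), unfolded D(5)]
    show "\<chi> m (sset_op Z m n \<theta> z) = sobj_op (sdom p) m n \<theta> \<cdot> \<chi> n z"
    proof (rule level_pullback_unique[OF l c[OF z', THEN conjunct1] Comp_in[OF cz Pt]])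
      have "component p m \<cdot> sobj_op (sdom p) m n \<theta> \<cdot> \<chi> n z = sobj_op (sdom f) m n \<theta> \<cdot> component p n \<cdot> \<chi> n z"
        using assoc[OF cz Pt ph] smorD(4)[OF D(3) th] assoc[OF cz ph sobjD(2)[OF smorD(2)[OF D(3)] th]] D(6) by simp
      then show "component p m \<cdot> \<chi> m (sset_op Z m n \<theta> z) = component p m \<cdot> sobj_op (sdom p) m n \<theta> \<cdot> \<chi> n z"
        using c[OF z] c[OF z'] smapD(2)[OF u th z] by simp
      have "component q m \<cdot> sobj_op (sdom p) m n \<theta> \<cdot> \<chi> n z = sobj_op (sdom g) m n \<theta> \<cdot> component q n \<cdot> \<chi> n z"
        using assoc[OF cz Pt qh] smorD(4)[OF D(4) th] assoc[OF cz qh sobjD(2)[OF smorD(2)[OF D(4)] th]] D(5,7) by simp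
      then show "component q m \<cdot> \<chi> m (sset_op Z m n \<theta> z) = component q m \<cdot> sobj_op (sdom p) m n \<theta> \<cdot> \<chi> n z"
        using c[OF z] c[OF z'] smapD(2)[OF v th z] by simp
    qed
  qed
  then show thesis using that[of \<chi>] c by (simp add: agree_def push_def)
qed

lemma level_pullback_agree:
  assumes l: "level_pullback f g p q" and "smap Z T (sdom p) \<phi>" "smap Z T (sdom p) \<psi>" "agree Z (p \<odot> \<phi>) (p \<odot> \<psi>)" "agree Z (q \<odot> \<phi>) (q \<odot> \<psi>)"
  shows "agree Z \<phi> \<psi>"
  unfolding agree_def
proof (intro allI ballI)
  fix n z assume z: "z \<in> simplices Z n"
  show "\<phi> n z = \<psi> n z"
    by (rule level_pullback_unique[OF l smapD(1)[OF assms(2) z] smapD(1)[OF assms(3) z]])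
      (use assms(4,5) z in \<open>auto simp: agree_def push_def\<close>)
qed

text \<open>Lift \<open>p \<odot> \<phi>\<close> over \<open>g \<odot> \<psi>\<close> through
  \<open>f\<close>; paired with \<open>\<psi>\<close> on the same cover, this lift is a map into the
  pullback.\<close>

lemma llift_level_pullback:
  assumes l: "level_pullback f g p q" and f: "llift f K L" and KL: "complex K" "complex L" "K \<subseteq> L"
  shows "llift q K L"
  unfolding llift_def
proof (intro allI impI)
  note D = level_pullbackD[OF l]
  note P = smorD(1)[OF D(3)] and Z = smorD(1)[OF D(2)]
  have c: "agree A (f \<odot> p \<odot> \<phi>) (g \<odot> q \<odot> \<phi>)" if "smap A T (sdom p) \<phi>" for A :: "(nat \<Rightarrow> 'a) sset" and T \<phi>
    unfolding agree_def push_def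
  proof (intro allI ballI)
    fix m z assume z: "z \<in> simplices A m"
    show "component f m \<cdot> component p m \<cdot> \<phi> m z = component g m \<cdot> component q m \<cdot> \<phi> m z"
      by (rule comp_square[OF pullbackD(9)[OF D(9)]])
        (use homD[OF smapD(1)[OF that z]] homD[OF smorD(3)[OF D(1)]] homD[OF smorD(3)[OF D(2)]] homD[OF smorD(3)[OF D(3)]] homD[OF smorD(3)[OF D(4)]] D(5-7) in auto)
  qed
  fix T \<phi> \<psi> assume T: "T \<in> Obj C" and "smap (nerve K) T (sdom q) \<phi>" "smap (nerve L) T (scod q) \<psi>" and ag: "agree (nerve K) (q \<odot> \<phi>) \<psi>"
  then have \<phi>: "smap (nerve K) T (sdom p) \<phi>" and \<psi>: "smap (nerve L) T (sdom g) \<psi>" using D by simp_all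
  have p\<phi>: "smap (nerve K) T (sdom f) (p \<odot> \<phi>)" using smap_push[OF D(3) \<phi>] D(6) by simp
  have g\<psi>: "smap (nerve L) T (scod f) (g \<odot> \<psi>)" using smap_push[OF D(2) \<psi>] D(8) by simp
  have e: "agree (nerve K) (f \<odot> p \<odot> \<phi>) (g \<odot> \<psi>)" using agree_trans[OF c[OF \<phi>] agree_push[OF ag]] .
  obtain T' d x where 1: "cover d T' T" "smap (nerve L) T' (sdom f) x" "agree (nerve K) x ((p \<odot> \<phi>) \<star> d)" "agree (nerve L) (f \<odot> x) ((g \<odot> \<psi>) \<star> d)"
    by (rule lliftD[OF f T p\<phi> g\<psi> e])
  note d = coverD[OF 1(1)]
  have \<psi>d: "smap (nerve L) T' (sdom g) (\<psi> \<star> d)" by (rule smap_stage[OF Z \<psi> d(1)])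
  have ok: "sset_ok (nerve L)" by (rule nerve_ok[OF complexD(2)[OF KL(2)]])
  obtain \<chi> where x: "smap (nerve L) T' (sdom p) \<chi>" "agree (nerve L) (p \<odot> \<chi>) x" "agree (nerve L) (q \<odot> \<chi>) (\<psi> \<star> d)"
    by (rule level_pullback_smap[OF l ok 1(2) \<psi>d agree_trans[OF 1(4) push_stage[OF D(2) \<psi> d(1)]]])
  have \<phi>d: "smap (nerve K) T' (sdom p) (\<phi> \<star> d)" by (rule smap_stage[OF P \<phi> d(1)])
  have "agree (nerve K) \<chi> (\<phi> \<star> d)"
  proof (rule level_pullback_agree[OF l smap_mono[OF x(1) KL(3)] \<phi>d])
    show "agree (nerve K) (p \<odot> \<chi>) (p \<odot> (\<phi> \<star> d))"
      using agree_trans[OF agree_mono[OF x(2) KL(3)] agree_trans[OF 1(3) push_stage[OF D(3) \<phi> d(1)]]] .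
    have "agree (nerve K) (\<psi> \<star> d) ((q \<odot> \<phi>) \<star> d)" by (rule agree_stage[OF agree_sym[OF ag]])
    also have "agree (nerve K) ((q \<odot> \<phi>) \<star> d) (q \<odot> (\<phi> \<star> d))" by (rule push_stage[OF D(4) \<phi>[folded D(5)] d(1)])
    finally show "agree (nerve K) (q \<odot> \<chi>) (q \<odot> (\<phi> \<star> d))" using agree_trans[OF agree_mono[OF x(3) KL(3)]] by blast
  qed
  then show "\<exists>T' c \<chi>. cover c T' T \<and> smap (nerve L) T' (sdom q) \<chi> \<and> agree (nerve K) \<chi> (\<phi> \<star> c) \<and> agree (nerve L) (q \<odot> \<chi>) (\<psi> \<star> c)"
    using 1(1) x D(5) by auto
qed

lemma horn_lifting_level_pullback:
  assumes l: "level_pullback f g p q" and f: "horn_lifting f" shows "horn_lifting q"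
proof -
  show ?thesis
    by (rule horn_liftingI[OF level_pullbackD(4)[OF l]], rule llift_level_pullback[OF l horn_liftingD[OF f]])
      (simp_all add: horn_faces_subset)
qed

text \<open>The vertex of the pullback is Kan because \<open>q\<close> is a fibration with Kan
  target, so the pullback of simplicial objects lies in the full subcategory.\<close>

lemma level_pullback_Kan:
  assumes l: "level_pullback f g p q" and f: "horn_lifting f" "kan (sdom f)" "kan (scod f)" and g: "kan (sdom g)"
  shows "is_pullback (Kan C) f g p q"
proof -
  note D = level_pullbackD[OF l]
  have "kan (sdom q)" by (rule kan_of_fibration[OF horn_lifting_level_pullback[OF l f(1)]]) (simp add: D g)
  then show ?thesis unfolding Kan_eq
    by (intro full_subcategory_pullback[OF level_pullback_sO[OF l]]) (use f g D in simp_all)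
qed

section \<open>Pullbacks of fibrations between Kan complexes\<close>

lemma Kan_pullback_exists:
  assumes "horn_lifting f" "f \<in> Arr (Kan C)" "g \<in> Arr (Kan C)" "scod g = scod f"
  shows "\<exists>p q. is_pullback (Kan C) f g p q"
proof -
  obtain p q where l: "level_pullback f g p q" using level_pullback_ex[of f g] assms by auto
  have "is_pullback (Kan C) f g p q" by (rule level_pullback_Kan[OF l assms(1)]) (use assms in auto)
  then show ?thesis by blast
qed

text \<open>Brown's axioms speak of every pullback square in \<open>Kan C\<close>. Such a square
  differs from a levelwise one by an isomorphism, which has all lifting properties.\<close>

lemma Kan_pullback_factor:
  assumes pb: "is_pullback (Kan C) f g p q" and f: "horn_lifting f"
  obtains e p' q' where "level_pullback f g p' q'" "is_iso sO e" "scod e = sdom q'" "q = q' \<cdot>\<^bsub>sO\<^esub> e"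
proof -
  interpret K: category "Kan C" by (rule category_Kan)
  note D = K.pullbackD[OF pb]
  obtain p' q' where l: "level_pullback f g p' q'" using level_pullback_ex[of f g] D by auto
  have "is_pullback (Kan C) f g p' q'" by (rule level_pullback_Kan[OF l f]) (use D in auto)
  then obtain e where "is_iso (Kan C) e" "e \<in> hom (Kan C) (Dom (Kan C) p) (Dom (Kan C) p')" "q' \<cdot>\<^bsub>Kan C\<^esub> e = q"
    using K.pullback_iso[OF pb] by metis
  then show thesis using that[OF l] iso_Kan level_pullbackD(5)[OF l] by (auto simp: hom_def)
qed

lemma Kan_pullback_fibration:
  assumes pb: "is_pullback (Kan C) f g p q" and f: "horn_lifting f"
  shows "horn_lifting q"
proof -
  obtain e p' q' where e: "level_pullback f g p' q'" "is_iso sO e" "scod e = sdom q'" "q = q' \<cdot>\<^bsub>sO\<^esub> e" by (rule Kan_pullback_factor[OF assms])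
  show ?thesis unfolding e(4) by (rule horn_lifting_comp[OF iso_horn_lifting[OF e(2)] horn_lifting_level_pullback[OF e(1) f] e(3)])
qed

lemma Kan_pullback_llift:
  assumes pb: "is_pullback (Kan C) f g p q" and f: "horn_lifting f" "llift f K L" and KL: "complex K" "complex L" "K \<subseteq> L"
  shows "llift q K L"
proof -
  obtain e p' q' where e: "level_pullback f g p' q'" "is_iso sO e" "scod e = sdom q'" "q = q' \<cdot>\<^bsub>sO\<^esub> e" by (rule Kan_pullback_factor[OF pb f(1)])
  have "is_comp q q' e" unfolding e(4)
    by (rule is_comp_sO) (use e level_pullbackD(4)[OF e(1)] in \<open>auto simp: is_iso_def\<close>)
  then show ?thesis by (rule llift_comp[OF _ iso_llift[OF e(2) KL(3)] llift_level_pullback[OF e(1) f(2) KL]])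
qed

end

section \<open>Path objects\<close>

context category
begin

text \<open>Over a terminal object a pullback is a product. The axiom on diagonals concerns an
  arbitrary product, which is compared in this way with a levelwise pullback.\<close>

lemma product_iso_pullback:
  assumes U: "is_terminal C U" and t: "Cod C t = U" and pb: "is_pullback C t t p1 p2"
    and Q: "is_product C {0, 1 :: nat} (\<lambda>_. Dom C t) Q \<pi>"
  obtains u where "is_iso C u" "u \<in> hom C (Dom C p1) Q" "\<pi> 0 \<cdot> u = p1" "\<pi> 1 \<cdot> u = p2"
proof -
  note D = pullbackD[OF pb]
  let ?R = "Dom C p1" and ?B = "Dom C t"
  have RO: "?R \<in> Obj C" using D(3) Dom_in by blast
  have p: "p1 \<in> hom C ?R ?B" "p2 \<in> hom C ?R ?B" and th: "t \<in> hom C ?B U" using D t by (auto simp: hom_def)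
  have QO: "Q \<in> Obj C" and pi: "\<pi> 0 \<in> hom C Q ?B" "\<pi> 1 \<in> hom C Q ?B" using Q by (auto simp: is_product_def)
  have ex: "\<exists>!u. u \<in> hom C T Q \<and> (\<forall>i \<in> {0, 1 :: nat}. \<pi> i \<cdot> u = (if i = 0 then a else b))" if "a \<in> hom C T ?B" "b \<in> hom C T ?B" for T a b
  proof -
    have T: "T \<in> Obj C" using homD that by blast
    have q: "\<forall>T \<in> Obj C. \<forall>\<tau>. (\<forall>i \<in> {0, 1 :: nat}. \<tau> i \<in> hom C T ?B) \<longrightarrow>
        (\<exists>!u. u \<in> hom C T Q \<and> (\<forall>i \<in> {0, 1}. \<pi> i \<cdot> u = \<tau> i))"
      using Q unfolding is_product_def by blast
    show ?thesis using spec[OF bspec[OF q T], of "\<lambda>i. if i = 0 then a else b"] that by simp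
  qed
  have uniq: "u = v" if "u \<in> hom C T Q" "v \<in> hom C T Q" "\<pi> 0 \<cdot> u = \<pi> 0 \<cdot> v" "\<pi> 1 \<cdot> u = \<pi> 1 \<cdot> v" for u v T
    using ex[OF Comp_in[OF that(1) pi(1)] Comp_in[OF that(1) pi(2)]] that by auto
  obtain u where u: "u \<in> hom C ?R Q" "\<pi> 0 \<cdot> u = p1" "\<pi> 1 \<cdot> u = p2" using ex[OF p] by auto
  have tt: "t \<cdot> \<pi> 0 = t \<cdot> \<pi> 1"
  proof -
    have "\<exists>!h. h \<in> hom C Q U" using U QO by (simp add: is_terminal_def)
    then show ?thesis using Comp_in[OF pi(1) th] Comp_in[OF pi(2) th] by blast
  qed
  obtain v where v: "v \<in> hom C Q ?R" "p1 \<cdot> v = \<pi> 0" "p2 \<cdot> v = \<pi> 1"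
    using pullback_lift[OF pb, of "\<pi> 0" "\<pi> 1"] pi tt by (auto simp: hom_def)
  have "u \<cdot> v = Ident C Q"
    by (rule uniq[OF Comp_in[OF v(1) u(1)] Ident_in[OF QO]])
      (use assoc[OF v(1) u(1) pi(1)] assoc[OF v(1) u(1) pi(2)] u v Ident_right[OF pi(1)] Ident_right[OF pi(2)] in simp_all)
  moreover have "v \<cdot> u = Ident C ?R"
  proof (rule pullback_unique[OF pb])
    show "p1 \<cdot> v \<cdot> u = p1 \<cdot> Ident C ?R" "p2 \<cdot> v \<cdot> u = p2 \<cdot> Ident C ?R"
      using assoc[OF u(1) v(1) p(1)] assoc[OF u(1) v(1) p(2)] u v Ident_right[OF p(1)] Ident_right[OF p(2)] by simp_all
  qed (use homD[OF Comp_in[OF u(1) v(1)]] RO in auto)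
  ultimately have "is_iso C u" using u v by (auto simp: is_iso_def hom_def)
  then show thesis using that u by blast
qed

end

abbreviation cyl :: "(nat \<Rightarrow> 'p) \<Rightarrow> nat \<times> nat \<Rightarrow> 'p \<times> nat" where
  "cyl a \<equiv> map_prod a (\<lambda>x. x)"

abbreviation cylinder :: "nat \<Rightarrow> (nat \<Rightarrow> nat \<times> nat) sset" where
  "cylinder m \<equiv> nerve (faces {..m} \<otimes> II)"

text \<open>The simplex of the prism whose first component is the fundamental simplex and whose
  second component is \<open>b\<close>.\<close>

definition graph :: "nat \<Rightarrow> (nat \<Rightarrow> nat) \<Rightarrow> nat \<Rightarrow> nat \<times> nat" where
  "graph m b = (\<lambda>i \<in> {..m}. (i, b i))"

lemma delta_hom_nerve: "\<theta> \<in> delta_hom l m \<longleftrightarrow> \<theta> \<in> simplices (nerve (faces {..m})) l"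
  by (auto simp: delta_hom_iff faces_def)

lemma cmap_simplex:
  assumes "down_closed K" "a \<in> simplices (nerve K) m" shows "cmap a (faces {..m}) K"
  unfolding cmap_def
proof (intro ballI conjI)
  fix \<sigma> assume s: "\<sigma> \<in> faces {..m}"
  show "mono_on \<sigma> a" using assms(2) s by (auto simp: faces_def intro: mono_on_subset)
  show "a ` \<sigma> \<in> K" by (rule down_closedD[OF assms(1), of "a ` {..m}"]) (use assms(2) s in \<open>auto simp: faces_def\<close>)
qed

lemma cmap_cyl:
  assumes "down_closed K" "a \<in> simplices (nerve K) m" shows "cmap (cyl a) (faces {..m} \<otimes> II) (K \<otimes> II)"
  by (rule cmap_map_prod[OF cmap_simplex[OF assms] cmap_ident])

lemma down_closed_faces: "down_closed (faces A)"
  by (rule down_closedI) (auto simp: faces_def)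

lemma cmap_cyl_delta: "\<theta> \<in> delta_hom m n \<Longrightarrow> cmap (cyl \<theta>) (faces {..m} \<otimes> II) (faces {..n} \<otimes> II)"
  by (rule cmap_cyl[OF down_closed_faces]) (simp only: delta_hom_nerve)

lemma graph_simplex:
  assumes "b \<in> simplices (nerve II) m"
  shows "graph m b \<in> simplices (cylinder m) m" "vmap fst m (graph m b) = (\<lambda>i \<in> {..m}. i)" "vmap snd m (graph m b) = b"
proof -
  have "(\<lambda>i \<in> {..m}. i) \<in> simplices (nerve (faces {..m})) m" using delta_hom_ident delta_hom_nerve by blast
  note p = pair_nerve[OF this assms]
  have "(\<lambda>i \<in> {..m}. ((\<lambda>i \<in> {..m}. i) i, b i)) = graph m b" by (auto simp: graph_def fun_eq_iff)
  then show "graph m b \<in> simplices (cylinder m) m" "vmap fst m (graph m b) = (\<lambda>i \<in> {..m}. i)" "vmap snd m (graph m b) = b"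
    using p by simp_all
qed

text \<open>Each simplex of a product with the interval is the image of a graph under the map of
  prisms induced by its first component; this reduces evaluation at arbitrary simplices to
  evaluation at graphs.\<close>

lemma cyl_graph:
  assumes "\<alpha> \<in> extensional {..l}"
  shows "vmap (cyl (vmap fst l \<alpha>)) l (graph l (vmap snd l \<alpha>)) = \<alpha>"
  using assms by (auto simp: vmap_def compose_def graph_def fun_eq_iff extensional_def)

lemma const_simplex: "e \<le> 1 \<Longrightarrow> (\<lambda>i \<in> {..m}. e) \<in> simplices (nerve II) m"
  by (auto simp: faces_def mono_on_def)

lemma cyl_compose:
  "agree (cylinder l) (pull (vmap (cyl \<eta>)) (pull (vmap (cyl \<theta>)) \<phi>)) (pull (vmap (cyl (compose {..l} \<theta> \<eta>))) \<phi>)"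
  unfolding pull_vmap_comp
proof (rule agree_pull_cong)
  fix \<sigma> x assume "\<sigma> \<in> faces {..l} \<otimes> II" "x \<in> \<sigma>"
  then have "fst x \<le> l" by (auto simp: cprod_def faces_def)
  then show "(cyl \<theta> \<circ> cyl \<eta>) x = cyl (compose {..l} \<theta> \<eta>) x" by (cases x) (simp add: compose_def)
qed

context regular_category
begin

text \<open>The cotensor of \<open>X\<close> with \<open>\<Delta>\<^sup>1\<close>: level
  \<open>m\<close> represents maps on the prism over the \<open>m\<close>-simplex. The value
  \<open>undefined\<close> outside \<open>delta_hom\<close> is the one that
  \<open>simplicial_object\<close> prescribes.\<close>

definition path_object :: "('o, 'm) sobj \<Rightarrow> ('o, 'm) sobj" where
  "path_object X = \<lparr>level = (\<lambda>m. wlim C (cylinder m) X),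
     sobj_op = (\<lambda>m n \<theta>. if \<theta> \<in> delta_hom m n then wlim_restrict C (cylinder m) (cylinder n) (vmap (cyl \<theta>)) X else undefined)\<rparr>"

lemma has_wlim_cylinder: "simplicial_object C X \<Longrightarrow> has_wlim (cylinder m) X"
  by (rule has_wlim_nerve) (simp_all add: complex_cprod)

lemma path_op:
  assumes X: "simplicial_object C X" and t: "\<theta> \<in> delta_hom m n"
  shows "sobj_op (path_object X) m n \<theta> \<in> hom C (level (path_object X) n) (level (path_object X) m)"
    "agree (cylinder m) (wlim_univ C (cylinder m) X \<star> sobj_op (path_object X) m n \<theta>) (pull (vmap (cyl \<theta>)) (wlim_univ C (cylinder n) X))"
    "s \<in> hom C T (level (path_object X) n) \<Longrightarrow>
      agree (cylinder m) (wlim_univ C (cylinder m) X \<star> (sobj_op (path_object X) m n \<theta> \<cdot> s)) (pull (vmap (cyl \<theta>)) (wlim_univ C (cylinder n) X \<star> s))"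
proof -
  note W = has_wlim_cylinder[OF X]
  note i = sset_mor_vmap[OF cmap_cyl_delta[OF t]]
  have e: "sobj_op (path_object X) m n \<theta> = wlim_restrict C (cylinder m) (cylinder n) (vmap (cyl \<theta>)) X" "\<And>k. level (path_object X) k = wlim C (cylinder k) X"
    using t by (simp_all add: path_object_def)
  show "sobj_op (path_object X) m n \<theta> \<in> hom C (level (path_object X) n) (level (path_object X) m)"
    "agree (cylinder m) (wlim_univ C (cylinder m) X \<star> sobj_op (path_object X) m n \<theta>) (pull (vmap (cyl \<theta>)) (wlim_univ C (cylinder n) X))"
    "s \<in> hom C T (level (path_object X) n) \<Longrightarrow>
      agree (cylinder m) (wlim_univ C (cylinder m) X \<star> (sobj_op (path_object X) m n \<theta> \<cdot> s)) (pull (vmap (cyl \<theta>)) (wlim_univ C (cylinder n) X \<star> s))"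
    unfolding e using wlim_restrict[OF W W i] wlim_restrict_ev[OF W W i] by blast+
qed

lemma level_path: "level (path_object X) m = wlim C (cylinder m) X"
  by (simp add: path_object_def)

lemma path_univ: "simplicial_object C X \<Longrightarrow> smap (cylinder m) (level (path_object X) m) X (wlim_univ C (cylinder m) X)"
  unfolding level_path using wlim_coneD(2)[OF has_wlimD(3)[OF has_wlim_cylinder]] .

lemma path_unique:
  assumes X: "simplicial_object C X" and "t \<in> hom C T (level (path_object X) m)" "t' \<in> hom C T (level (path_object X) m)"
    "agree (cylinder m) (wlim_univ C (cylinder m) X \<star> t) \<phi>" "agree (cylinder m) (wlim_univ C (cylinder m) X \<star> t') \<phi>"
  shows "t = t'"
  using wlim_unique[OF has_wlim_cylinder[OF X]] assms(2-) unfolding level_path by blast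

lemma simplicial_object_path:
  assumes X: "simplicial_object C X" shows "simplicial_object C (path_object X)"
  unfolding simplicial_object_def
proof (intro conjI allI ballI impI)
  let ?P = "path_object X"
  note W = has_wlim_cylinder[OF X]
  have LO: "level ?P n \<in> Obj C" for n using wlim_coneD(1)[OF has_wlimD(3)[OF W]] by (simp add: level_path)
  show "level ?P n \<in> Obj C" for n by (rule LO)
  show "sobj_op ?P m n \<theta> \<in> hom C (level ?P n) (level ?P m)" if "\<theta> \<in> delta_hom m n" for m n \<theta> by (rule path_op(1)[OF X that])
  show "sobj_op ?P m n \<theta> = undefined" if "\<theta> \<notin> delta_hom m n" for m n \<theta> using that by (simp add: path_object_def)
  show "sobj_op ?P n n (\<lambda>i \<in> {..n}. i) = Ident C (level ?P n)" for n
  proof (rule path_unique[OF X path_op(1)[OF X delta_hom_ident] Ident_in[OF LO]])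
    have "agree (cylinder n) (pull (vmap (cyl (\<lambda>i \<in> {..n}. i))) (wlim_univ C (cylinder n) X)) (wlim_univ C (cylinder n) X)"
    proof (rule agree_pull_ident)
      fix \<sigma> x assume "\<sigma> \<in> faces {..n} \<otimes> II" "x \<in> \<sigma>"
      then have "fst x \<le> n" by (auto simp: cprod_def faces_def)
      then show "cyl (\<lambda>i \<in> {..n}. i) x = x" by (cases x) simp
    qed
    then show "agree (cylinder n) (wlim_univ C (cylinder n) X \<star> sobj_op ?P n n (\<lambda>i \<in> {..n}. i)) (wlim_univ C (cylinder n) X)"
      by (rule agree_trans[OF path_op(2)[OF X delta_hom_ident]])
    show "agree (cylinder n) (wlim_univ C (cylinder n) X \<star> Ident C (level ?P n)) (wlim_univ C (cylinder n) X)"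
      by (rule stage_ident[OF path_univ[OF X]])
  qed
  fix l m n \<eta> \<theta> assume e: "\<eta> \<in> delta_hom l m" and t: "\<theta> \<in> delta_hom m n"
  note et = delta_hom_compose[OF t e]
  show "sobj_op ?P l n (compose {..l} \<theta> \<eta>) = sobj_op ?P l m \<eta> \<cdot> sobj_op ?P m n \<theta>"
  proof (rule path_unique[OF X path_op(1)[OF X et] Comp_in[OF path_op(1)[OF X t] path_op(1)[OF X e]]])
    show "agree (cylinder l) (wlim_univ C (cylinder l) X \<star> sobj_op ?P l n (compose {..l} \<theta> \<eta>)) (pull (vmap (cyl (compose {..l} \<theta> \<eta>))) (wlim_univ C (cylinder n) X))"
      by (rule path_op(2)[OF X et])
    have "agree (cylinder l) (wlim_univ C (cylinder l) X \<star> (sobj_op ?P l m \<eta> \<cdot> sobj_op ?P m n \<theta>))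
        (pull (vmap (cyl \<eta>)) (pull (vmap (cyl \<theta>)) (wlim_univ C (cylinder n) X)))"
      using agree_trans[OF path_op(3)[OF X e path_op(1)[OF X t]] agree_pull_vmap[OF path_op(2)[OF X t] cmap_cyl_delta[OF e]]] .
    then show "agree (cylinder l) (wlim_univ C (cylinder l) X \<star> (sobj_op ?P l m \<eta> \<cdot> sobj_op ?P m n \<theta>)) (pull (vmap (cyl (compose {..l} \<theta> \<eta>))) (wlim_univ C (cylinder n) X))"
      by (rule agree_trans[OF _ cyl_compose])
  qed
qed

text \<open>\<open>adj\<close> and \<open>coadj\<close> are the two directions of the exponential adjunction.\<close>

definition adj :: "('o, 'm) sobj \<Rightarrow> (nat \<Rightarrow> (nat \<Rightarrow> 'p) \<Rightarrow> 'm) \<Rightarrow> nat \<Rightarrow> (nat \<Rightarrow> 'p \<times> nat) \<Rightarrow> 'm" where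
  "adj X \<phi> m \<alpha> = wlim_univ C (cylinder m) X m (graph m (vmap snd m \<alpha>)) \<cdot> \<phi> m (vmap fst m \<alpha>)"

definition coadj :: "'o \<Rightarrow> ('o, 'm) sobj \<Rightarrow> (nat \<Rightarrow> (nat \<Rightarrow> 'p \<times> nat) \<Rightarrow> 'm) \<Rightarrow> nat \<Rightarrow> (nat \<Rightarrow> 'p) \<Rightarrow> 'm" where
  "coadj T X \<psi> m a = wmor (cylinder m) X T (pull (vmap (cyl a)) \<psi>)"

text \<open>The element \<open>\<phi> m a\<close> is a map on a whole prism, while
  \<open>adj\<close> evaluates only at graphs. Naturality of \<open>\<phi>\<close> under the first
  component, together with \<open>cyl_graph\<close>, recovers all other values.\<close>

lemma adj_eval:
  assumes X: "simplicial_object C X" and \<phi>: "smap (nerve K) T (path_object X) \<phi>" and a: "a \<in> simplices (nerve K) m"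
  shows "agree (cylinder m) (wlim_univ C (cylinder m) X \<star> \<phi> m a) (pull (vmap (cyl a)) (adj X \<phi>))"
  unfolding agree_def
proof (intro allI ballI)
  fix l \<gamma> assume g: "\<gamma> \<in> simplices (cylinder m) l"
  let ?c = "vmap fst l \<gamma>" and ?b = "vmap snd l \<gamma>"
  have c: "?c \<in> delta_hom l m" and b: "?b \<in> simplices (nerve II) l" and ge: "\<gamma> \<in> extensional {..l}"
    using g unfolding nerve_cprod delta_hom_nerve by blast+
  have 1: "vmap fst l (vmap (cyl a) l \<gamma>) = compose {..l} a ?c" "vmap snd l (vmap (cyl a) l \<gamma>) = ?b"
    by (auto simp: vmap_def compose_def fun_eq_iff)
  have "pull (vmap (cyl a)) (adj X \<phi>) l \<gamma> = wlim_univ C (cylinder l) X l (graph l ?b) \<cdot> \<phi> l (compose {..l} a ?c)"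
    by (simp only: pull_def adj_def 1)
  also have "\<phi> l (compose {..l} a ?c) = sobj_op (path_object X) l m ?c \<cdot> \<phi> m a"
    using smapD(2)[OF \<phi> c a] by simp
  also have "wlim_univ C (cylinder l) X l (graph l ?b) \<cdot> sobj_op (path_object X) l m ?c \<cdot> \<phi> m a =
      pull (vmap (cyl ?c)) (wlim_univ C (cylinder m) X \<star> \<phi> m a) l (graph l ?b)"
    using path_op(3)[OF X c smapD(1)[OF \<phi> a]] graph_simplex(1)[OF b] unfolding agree_def stage_def by blast
  also have "\<dots> = (wlim_univ C (cylinder m) X \<star> \<phi> m a) l \<gamma>" by (simp only: pull_def cyl_graph[OF ge])
  finally show "(wlim_univ C (cylinder m) X \<star> \<phi> m a) l \<gamma> = pull (vmap (cyl a)) (adj X \<phi>) l \<gamma>" ..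
qed

lemma smap_adj:
  assumes X: "simplicial_object C X" and \<phi>: "smap (nerve K) T (path_object X) \<phi>"
  shows "smap (nerve (K \<otimes> II)) T X (adj X \<phi>)"
proof -
  have main: "adj X \<phi> l (compose {..l} \<alpha> \<theta>) = sobj_op X l m \<theta> \<cdot> adj X \<phi> m \<alpha> \<and> adj X \<phi> m \<alpha> \<in> hom C T (level X m)"
    if al: "\<alpha> \<in> simplices (nerve (K \<otimes> II)) m" and t: "\<theta> \<in> delta_hom l m" for l m \<theta> \<alpha>
  proof -
    let ?a = "vmap fst m \<alpha>" and ?b = "vmap snd m \<alpha>"
    have a: "?a \<in> simplices (nerve K) m" and b: "?b \<in> simplices (nerve II) m" and ae: "\<alpha> \<in> extensional {..m}"
      using al unfolding nerve_cprod by blast+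
    let ?u = "wlim_univ C (cylinder m) X \<star> \<phi> m ?a"
    have u: "smap (cylinder m) T X ?u" by (rule smap_stage[OF X path_univ[OF X] smapD(1)[OF \<phi> a]])
    note g = graph_simplex(1)[OF b]
    have ok: "sset_ok (cylinder m)" by (rule has_wlimD(1)[OF has_wlim_cylinder[OF X]])
    have g': "compose {..l} (graph m ?b) \<theta> \<in> simplices (cylinder m) l" using ok g t unfolding sset_ok_def nerve_simps(2) by blast
    have e: "adj X \<phi> m \<alpha> = ?u m (graph m ?b)" by (simp add: adj_def stage_def)
    have "vmap (cyl ?a) l (compose {..l} (graph m ?b) \<theta>) = compose {..l} (vmap (cyl ?a) m (graph m ?b)) \<theta>"
      using delta_homD(1)[OF t] by (auto simp: vmap_def compose_def fun_eq_iff)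
    then have "vmap (cyl ?a) l (compose {..l} (graph m ?b) \<theta>) = compose {..l} \<alpha> \<theta>" unfolding cyl_graph[OF ae] .
    then have "adj X \<phi> l (compose {..l} \<alpha> \<theta>) = ?u l (compose {..l} (graph m ?b) \<theta>)"
      using adj_eval[OF X \<phi> a] g' unfolding agree_def pull_def by metis
    also have "\<dots> = sobj_op X l m \<theta> \<cdot> ?u m (graph m ?b)" using smapD(2)[OF u t g] by simp
    finally show ?thesis unfolding e using smapD(1)[OF u g] by simp
  qed
  show ?thesis
    unfolding smap_def nerve_simps(2) using main delta_hom_ident by blast
qed

text \<open>An element of the path object is determined by the map on the prism that it classifies,
  and by \<open>adj_eval\<close> this map is a restriction of the transpose.\<close>

lemma adj_inject:
  assumes X: "simplicial_object C X" and K: "down_closed K"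
    and \<phi>: "smap (nerve K) T (path_object X) \<phi>" "smap (nerve K) T (path_object X) \<phi>'"
    and ag: "agree (nerve (K \<otimes> II)) (adj X \<phi>) (adj X \<phi>')"
  shows "agree (nerve K) \<phi> \<phi>'"
  unfolding agree_def
proof (intro allI ballI)
  fix m a assume a: "a \<in> simplices (nerve K) m"
  show "\<phi> m a = \<phi>' m a"
  proof (rule path_unique[OF X smapD(1)[OF \<phi>(1) a] smapD(1)[OF \<phi>(2) a]])
    show "agree (cylinder m) (wlim_univ C (cylinder m) X \<star> \<phi> m a) (pull (vmap (cyl a)) (adj X \<phi>'))"
      using agree_trans[OF adj_eval[OF X \<phi>(1) a] agree_pull_vmap[OF ag cmap_cyl[OF K a]]] .
    show "agree (cylinder m) (wlim_univ C (cylinder m) X \<star> \<phi>' m a) (pull (vmap (cyl a)) (adj X \<phi>'))"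
      by (rule adj_eval[OF X \<phi>(2) a])
  qed
qed

lemma coadj:
  assumes X: "simplicial_object C X" and K: "down_closed K" and \<psi>: "smap (nerve (K \<otimes> II)) T X \<psi>" and T: "T \<in> Obj C"
  shows "smap (nerve K) T (path_object X) (coadj T X \<psi>)" "agree (nerve (K \<otimes> II)) (adj X (coadj T X \<psi>)) \<psi>"
proof -
  note W = has_wlim_cylinder[OF X]
  have s: "smap (cylinder m) T X (pull (vmap (cyl a)) \<psi>)" if "a \<in> simplices (nerve K) m" for m a
    by (rule smap_pull_vmap[OF \<psi> cmap_cyl[OF K that]])
  have h: "coadj T X \<psi> m a \<in> hom C T (level (path_object X) m)"
    and e: "agree (cylinder m) (wlim_univ C (cylinder m) X \<star> coadj T X \<psi> m a) (pull (vmap (cyl a)) \<psi>)" if "a \<in> simplices (nerve K) m" for m a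
    using has_wlimD(4,5)[OF W s[OF that] T] by (simp_all add: coadj_def level_path)
  show "smap (nerve K) T (path_object X) (coadj T X \<psi>)"
    unfolding smap_def
  proof (intro conjI allI ballI)
    show "coadj T X \<psi> m a \<in> hom C T (level (path_object X) m)" if "a \<in> simplices (nerve K) m" for m a by (rule h[OF that])
    fix l m \<theta> a assume t: "\<theta> \<in> delta_hom l m" and a: "a \<in> simplices (nerve K) m"
    have a': "compose {..l} a \<theta> \<in> simplices (nerve K) l" using nerve_ok[OF K] a t unfolding sset_ok_def nerve_simps(2) by blast
    have "coadj T X \<psi> l (compose {..l} a \<theta>) = sobj_op (path_object X) l m \<theta> \<cdot> coadj T X \<psi> m a"
    proof (rule path_unique[OF X h[OF a'] Comp_in[OF h[OF a] path_op(1)[OF X t]] e[OF a']])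
      have "agree (cylinder l) (wlim_univ C (cylinder l) X \<star> (sobj_op (path_object X) l m \<theta> \<cdot> coadj T X \<psi> m a)) (pull (vmap (cyl \<theta>)) (pull (vmap (cyl a)) \<psi>))"
        using agree_trans[OF path_op(3)[OF X t h[OF a]] agree_pull_vmap[OF e[OF a] cmap_cyl_delta[OF t]]] .
      then show "agree (cylinder l) (wlim_univ C (cylinder l) X \<star> (sobj_op (path_object X) l m \<theta> \<cdot> coadj T X \<psi> m a)) (pull (vmap (cyl (compose {..l} a \<theta>))) \<psi>)"
        by (rule agree_trans[OF _ cyl_compose])
    qed
    then show "coadj T X \<psi> l (sset_op (nerve K) l m \<theta> a) = sobj_op (path_object X) l m \<theta> \<cdot> coadj T X \<psi> m a" by simp
  qed
  show "agree (nerve (K \<otimes> II)) (adj X (coadj T X \<psi>)) \<psi>"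
    unfolding agree_def
  proof (intro allI ballI)
    fix m \<alpha> assume al: "\<alpha> \<in> simplices (nerve (K \<otimes> II)) m"
    have a: "vmap fst m \<alpha> \<in> simplices (nerve K) m" and b: "vmap snd m \<alpha> \<in> simplices (nerve II) m" and ae: "\<alpha> \<in> extensional {..m}"
      using al unfolding nerve_cprod by blast+
    have "adj X (coadj T X \<psi>) m \<alpha> = pull (vmap (cyl (vmap fst m \<alpha>))) \<psi> m (graph m (vmap snd m \<alpha>))"
      using e[OF a] graph_simplex(1)[OF b] unfolding adj_def agree_def stage_def by blast
    then show "adj X (coadj T X \<psi>) m \<alpha> = \<psi> m \<alpha>" by (simp only: pull_def cyl_graph[OF ae])
  qed
qed

lemma adj_stage:
  assumes X: "simplicial_object C X" and \<phi>: "smap (nerve K) T (path_object X) \<phi>" and c: "c \<in> hom C T' T"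
  shows "agree (nerve (K \<otimes> II)) (adj X (\<phi> \<star> c)) (adj X \<phi> \<star> c)"
  unfolding agree_def
proof (intro allI ballI)
  fix m \<alpha> assume al: "\<alpha> \<in> simplices (nerve (K \<otimes> II)) m"
  have a: "vmap fst m \<alpha> \<in> simplices (nerve K) m" and b: "vmap snd m \<alpha> \<in> simplices (nerve II) m"
    using al unfolding nerve_cprod by blast+
  show "adj X (\<phi> \<star> c) m \<alpha> = (adj X \<phi> \<star> c) m \<alpha>"
    unfolding adj_def stage_def
    by (rule assoc[OF c smapD(1)[OF \<phi> a] smapD(1)[OF path_univ[OF X] graph_simplex(1)[OF b]], symmetric])
qed

text \<open>Evaluation at the vertex \<open>e\<close> of the interval: the universal map on
  \<open>cylinder m\<close> at the simplex \<open>i \<mapsto> (i, e)\<close>.\<close>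

definition path_ev :: "nat \<Rightarrow> ('o, 'm) sobj \<Rightarrow> ('o, 'm) smor" where
  "path_ev e X = \<lparr>sdom = path_object X, scod = X, component = (\<lambda>m. wlim_univ C (cylinder m) X m (graph m (\<lambda>i \<in> {..m}. e)))\<rparr>"

lemma path_ev_simps [simp]: "sdom (path_ev e X) = path_object X" "scod (path_ev e X) = X"
  by (simp_all add: path_ev_def)

lemma path_ev:
  assumes X: "simplicial_object C X" and e: "e \<le> 1" shows "simplicial_morphism C (path_ev e X)"
proof (rule simplicial_morphismI)
  note g = graph_simplex(1)[OF const_simplex[OF e]]
  show "component (path_ev e X) n \<in> hom C (level (sdom (path_ev e X)) n) (level (scod (path_ev e X)) n)" for n
    using smapD(1)[OF path_univ[OF X] g] by (simp add: path_ev_def)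
  fix m n \<theta> assume t: "\<theta> \<in> delta_hom m n"
  have eq: "vmap (cyl \<theta>) m (graph m (\<lambda>i \<in> {..m}. e)) = compose {..m} (graph n (\<lambda>i \<in> {..n}. e)) \<theta>"
    using delta_homD(1)[OF t] by (auto simp: vmap_def compose_def graph_def fun_eq_iff)
  have "wlim_univ C (cylinder m) X m (graph m (\<lambda>i \<in> {..m}. e)) \<cdot> sobj_op (path_object X) m n \<theta> =
      pull (vmap (cyl \<theta>)) (wlim_univ C (cylinder n) X) m (graph m (\<lambda>i \<in> {..m}. e))"
    using path_op(2)[OF X t] g unfolding agree_def stage_def by blast
  also have "\<dots> = sobj_op X m n \<theta> \<cdot> wlim_univ C (cylinder n) X n (graph n (\<lambda>i \<in> {..n}. e))"
    using smapD(2)[OF path_univ[OF X] t g] by (simp add: pull_def eq)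
  finally show "component (path_ev e X) m \<cdot> sobj_op (sdom (path_ev e X)) m n \<theta> = sobj_op (scod (path_ev e X)) m n \<theta> \<cdot> component (path_ev e X) n"
    by (simp add: path_ev_def)
qed (simp_all add: X simplicial_object_path)

lemma path_ev_adj: "agree (nerve K) (path_ev e X \<odot> \<phi>) (pull (vmap (at e)) (adj X \<phi>))"
  unfolding agree_def
proof (intro allI ballI)
  fix m \<alpha> assume "\<alpha> \<in> simplices (nerve K) m"
  then have "vmap fst m (vmap (at e) m \<alpha>) = \<alpha>" by (auto simp: vmap_def compose_def fun_eq_iff extensional_def)
  moreover have "vmap snd m (vmap (at e) m \<alpha>) = (\<lambda>i \<in> {..m}. e)" by (auto simp: vmap_def compose_def fun_eq_iff)
  ultimately show "(path_ev e X \<odot> \<phi>) m \<alpha> = pull (vmap (at e)) (adj X \<phi>) m \<alpha>"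
    by (simp add: push_def pull_def adj_def path_ev_def)
qed

text \<open>The morphism of constant paths, classified by the projection of the prism to its base.
  It becomes the weak equivalence in the factorization of the diagonal.\<close>

lemma path_const:
  assumes X: "simplicial_object C X"
  obtains s where "simplicial_morphism C s" "sdom s = X" "scod s = path_object X"
    "\<And>e. e \<le> 1 \<Longrightarrow> path_ev e X \<cdot>\<^bsub>sO\<^esub> s = Ident sO X"
proof -
  note W = has_wlim_cylinder[OF X]
  \<comment> \<open>The Yoneda map: the identity of level \<open>m\<close> of \<open>X\<close>, as a
    generalized simplex, with everything that the operators produce from it.\<close>
  define \<iota> where "\<iota> m = (\<lambda>l c. sobj_op X l m c)" for m
  have \<iota>: "smap (nerve (faces {..m})) (level X m) X (\<iota> m)" for m
    unfolding smap_def \<iota>_def nerve_simps(2) using sobjD(2,5)[OF X] delta_hom_nerve by blast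
  have f\<iota>: "smap (cylinder m) (level X m) X (pull (vmap fst) (\<iota> m))" for m by (rule smap_pull_vmap[OF \<iota> cmap_fst])
  define c where "c m = wmor (cylinder m) X (level X m) (pull (vmap fst) (\<iota> m))" for m
  have c: "c m \<in> hom C (level X m) (level (path_object X) m)" "agree (cylinder m) (wlim_univ C (cylinder m) X \<star> c m) (pull (vmap fst) (\<iota> m))" for m
    using has_wlimD(4,5)[OF W f\<iota> sobjD(1)[OF X]] by (simp_all add: c_def level_path)
  define s where "s = \<lparr>sdom = X, scod = path_object X, component = c\<rparr>"
  have "simplicial_morphism C s"
  proof (rule simplicial_morphismI)
    fix m n \<theta> assume t: "\<theta> \<in> delta_hom m n"
    note Xt = sobjD(2)[OF X t]
    have "c m \<cdot> sobj_op X m n \<theta> = sobj_op (path_object X) m n \<theta> \<cdot> c n"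
    proof (rule path_unique[OF X Comp_in[OF Xt c(1)] Comp_in[OF c(1) path_op(1)[OF X t]]])
      have "agree (cylinder m) (wlim_univ C (cylinder m) X \<star> (c m \<cdot> sobj_op X m n \<theta>)) (pull (vmap fst) (\<iota> m) \<star> sobj_op X m n \<theta>)"
        using agree_trans[OF agree_sym[OF stage_stage[OF path_univ[OF X] c(1) Xt]] agree_stage[OF c(2)]] .
      moreover have "agree (cylinder m) (pull (vmap fst) (\<iota> m) \<star> sobj_op X m n \<theta>) (pull (vmap (fst \<circ> cyl \<theta>)) (\<iota> n))"
        unfolding agree_def
      proof (intro allI ballI)
        fix l \<gamma> assume "\<gamma> \<in> simplices (cylinder m) l"
        then have d: "vmap fst l \<gamma> \<in> delta_hom l m" unfolding nerve_cprod delta_hom_nerve by blast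
        have "vmap (fst \<circ> cyl \<theta>) l \<gamma> = compose {..l} \<theta> (vmap fst l \<gamma>)" by (auto simp: vmap_def compose_def fun_eq_iff)
        then show "(pull (vmap fst) (\<iota> m) \<star> sobj_op X m n \<theta>) l \<gamma> = pull (vmap (fst \<circ> cyl \<theta>)) (\<iota> n) l \<gamma>"
          using sobjD(5)[OF X d t] by (simp add: pull_def stage_def \<iota>_def)
      qed
      ultimately show "agree (cylinder m) (wlim_univ C (cylinder m) X \<star> (c m \<cdot> sobj_op X m n \<theta>)) (pull (vmap (fst \<circ> cyl \<theta>)) (\<iota> n))"
        by (rule agree_trans)
      show "agree (cylinder m) (wlim_univ C (cylinder m) X \<star> (sobj_op (path_object X) m n \<theta> \<cdot> c n)) (pull (vmap (fst \<circ> cyl \<theta>)) (\<iota> n))"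
        using agree_trans[OF path_op(3)[OF X t c(1)] agree_pull_vmap[OF c(2) cmap_cyl_delta[OF t]]] unfolding pull_vmap_comp .
    qed
    then show "component s m \<cdot> sobj_op (sdom s) m n \<theta> = sobj_op (scod s) m n \<theta> \<cdot> component s n" by (simp add: s_def)
  qed (use X c in \<open>simp_all add: s_def simplicial_object_path\<close>)
  moreover have "path_ev e X \<cdot>\<^bsub>sO\<^esub> s = Ident sO X" if e: "e \<le> 1" for e
  proof (rule smor_eqI)
    fix m
    note b = const_simplex[OF e, of m]
    have "wlim_univ C (cylinder m) X m (graph m (\<lambda>i \<in> {..m}. e)) \<cdot> c m = pull (vmap fst) (\<iota> m) m (graph m (\<lambda>i \<in> {..m}. e))"
      using c(2)[of m] graph_simplex(1)[OF b] unfolding agree_def stage_def by blast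
    also have "\<dots> = Ident C (level X m)" by (simp only: pull_def graph_simplex(2)[OF b] \<iota>_def sobjD(4)[OF X])
    finally show "component (path_ev e X \<cdot>\<^bsub>sO\<^esub> s) m = component (Ident sO X) m" by (simp add: path_ev_def s_def)
  qed (simp_all add: s_def)
  ultimately show thesis using that[of s] by (simp add: s_def)
qed

text \<open>By transposition this is homotopy extension from the end \<open>0\<close>. Applied to
  the boundaries of simplices it makes \<open>path_ev 0 X\<close> an equivalence.\<close>

lemma path_ev_llift:
  assumes X: "kan X" and KL: "complex K" "complex L" "K \<subseteq> L"
  shows "llift (path_ev 0 X) K L"
  unfolding llift_def path_ev_simps
proof (intro allI impI)
  note XO = kan_sobj[OF X]
  note P = simplicial_object_path[OF XO]
  have e0: "(0::nat) \<le> 1" by simp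
  fix T \<phi> \<psi> assume T: "T \<in> Obj C" and \<phi>: "smap (nerve K) T (path_object X) \<phi>" and \<psi>: "smap (nerve L) T X \<psi>"
    and ag: "agree (nerve K) (path_ev 0 X \<odot> \<phi>) \<psi>"
  obtain T' c G where G: "cover c T' T" "smap (nerve (L \<otimes> II)) T' X G" "agree (nerve (K \<otimes> II)) G (adj X \<phi> \<star> c)"
    "agree (nerve L) (pull (vmap (at 0)) G) (\<psi> \<star> c)"
    by (rule homotopy_extension[OF X KL e0 T smap_adj[OF XO \<phi>] \<psi> agree_transs[OF path_ev_adj ag]])
  note c = coverD[OF G(1)]
  note dc = KL(1,2)[THEN complexD(2)]
  note \<chi> = coadj[OF XO dc(2) G(2) c(5)]
  let ?\<chi> = "coadj T' X G"
  have "agree (nerve K) ?\<chi> (\<phi> \<star> c)"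
  proof (rule adj_inject[OF XO dc(1) smap_mono[OF \<chi>(1) KL(3)] smap_stage[OF P \<phi> c(1)]])
    have "agree (nerve (K \<otimes> II)) (adj X ?\<chi>) (adj X \<phi> \<star> c)"
      using agree_trans[OF agree_mono[OF \<chi>(2) cprod_mono[OF KL(3) subset_refl]] G(3)] .
    then show "agree (nerve (K \<otimes> II)) (adj X ?\<chi>) (adj X (\<phi> \<star> c))"
      by (rule agree_trans[OF _ agree_sym[OF adj_stage[OF XO \<phi> c(1)]]])
  qed
  moreover have "agree (nerve L) (path_ev 0 X \<odot> ?\<chi>) (\<psi> \<star> c)"
    using agree_trans[OF path_ev_adj agree_trans[OF agree_pull_vmap[OF \<chi>(2) cmap_at[OF KL(2) II_simps(1)]] G(4)]] .
  ultimately show "\<exists>T' c \<chi>. cover c T' T \<and> smap (nerve L) T' (path_object X) \<chi> \<and> agree (nerve K) \<chi> (\<phi> \<star> c) \<and>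
      agree (nerve L) (path_ev 0 X \<odot> \<chi>) (\<psi> \<star> c)"
    using G(1) \<chi>(1) by blast
qed

text \<open>A lifting problem for \<open>r\<close> transposes to an extension problem along the
  pushout product of the horn with both ends of the interval; the ends are prescribed by
  \<open>p1 \<odot> \<psi>\<close> and \<open>p2 \<odot> \<psi>\<close>.\<close>

lemma path_pair_horn_lifting:
  assumes X: "kan X" and l: "level_pullback t t p1 p2" "sdom t = X"
    and r: "simplicial_morphism C r" "sdom r = path_object X" "scod r = sdom p1"
      "p1 \<cdot>\<^bsub>sO\<^esub> r = path_ev 0 X" "p2 \<cdot>\<^bsub>sO\<^esub> r = path_ev 1 X"
  shows "horn_lifting r"
proof (rule horn_liftingI[OF r(1)])
  fix n k :: nat assume n: "1 \<le> n" "k \<le> n"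
  let ?K = "horn_faces {..n} k" and ?L = "faces {..n}"
  have KL: "complex ?K" "complex ?L" "?K \<subseteq> ?L" by (simp_all add: horn_faces_subset)
  note XO = kan_sobj[OF X]
  note PO = simplicial_object_path[OF XO]
  note D = level_pullbackD[OF l(1)]
  have I: "{0} \<in> II" "{1} \<in> II" by (auto simp: faces_def)
  let ?A = "?K \<otimes> II \<union> ?L \<otimes> {{0}}" and ?B = "?L \<otimes> {{1}}"
  have ext: "lext X (?A \<union> ?B) (?L \<otimes> II)"
  proof -
    obtain v where v: "horn_lifting v" "sdom v = X" "\<And>n. is_terminal C (level (scod v) n)" using X unfolding kan_def by metis
    \<comment> \<open>The complex \<open>{{0}} \<union> {{1}}\<close> is the boundary of the
      interval, so this is \<open>llift_pushout_product\<close> for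
      \<open>\<partial>\<Delta>\<^sup>1 \<rightarrow> \<Delta>\<^sup>1\<close>.\<close>
    have "complex ({{0}} \<union> {{1::nat}})" "{{0}} \<union> {{1}} \<subseteq> II" using I by (simp_all only: complex_Un complex_sing) auto
    then have "llift v (?K \<otimes> II \<union> ?L \<otimes> ({{0}} \<union> {{1}})) (?L \<otimes> II)" by (intro llift_pushout_product[OF v(1) n]) simp_all
    moreover have "?L \<otimes> ({{0}} \<union> {{1::nat}}) = ?L \<otimes> {{0}} \<union> ?L \<otimes> {{1}}" by (auto simp: cprod_def)
    ultimately have "llift v (?A \<union> ?B) (?L \<otimes> II)" by (simp only: Un_assoc)
    moreover have "?A \<union> ?B \<subseteq> ?L \<otimes> II" using cylinder_incl[of 0, OF _ KL(3)] cylinder_incl[of 1, OF _ KL(3)] by blast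
    ultimately show ?thesis using lext_iff_llift[OF horn_lifting_morphism[OF v(1)] v(3)] v(2) by blast
  qed
  have cr: "is_comp (path_ev 0 X) p1 r" "is_comp (path_ev 1 X) p2 r"
    using is_comp_sO[OF r(1) D(3)] is_comp_sO[OF r(1) D(4)] r D(5) by simp_all
  have ev: "agree Z (path_ev 0 X \<odot> \<phi>) (p1 \<odot> r \<odot> \<phi>)" "agree Z (path_ev 1 X \<odot> \<phi>) (p2 \<odot> r \<odot> \<phi>)" if "smap Z T (path_object X) \<phi>" for Z :: "(nat \<Rightarrow> nat) sset" and T \<phi>
    using is_compD(7)[OF cr(1)] is_compD(7)[OF cr(2)] that r(2) by simp_all
  show "llift r ?K ?L"
    unfolding llift_def
  proof (intro allI impI)
    fix T \<phi> \<psi> assume T: "T \<in> Obj C" and "smap (nerve ?K) T (sdom r) \<phi>" "smap (nerve ?L) T (scod r) \<psi>" and ag: "agree (nerve ?K) (r \<odot> \<phi>) \<psi>"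
    then have \<phi>: "smap (nerve ?K) T (path_object X) \<phi>" and \<psi>: "smap (nerve ?L) T (sdom p1) \<psi>" using r by simp_all
    let ?y0 = "p1 \<odot> \<psi>" and ?y1 = "p2 \<odot> \<psi>"
    have y: "smap (nerve ?L) T X ?y0" "smap (nerve ?L) T X ?y1" using smap_push[OF D(3)] smap_push[OF D(4)] \<psi> D(5-7) l(2) by simp_all
    have ends: "agree (nerve ?K) (pull (vmap (at 0)) (adj X \<phi>)) ?y0" "agree (nerve ?K) (pull (vmap (at 1)) (adj X \<phi>)) ?y1"
      using agree_transs[OF path_ev_adj agree_trans[OF ev(1)[OF \<phi>] agree_push[OF ag]]]
        agree_transs[OF path_ev_adj agree_trans[OF ev(2)[OF \<phi>] agree_push[OF ag]]] .
    have a: "smap (nerve (?K \<otimes> II)) T X (adj X \<phi>)" by (rule smap_adj[OF XO \<phi>])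
    have b: "smap (nerve (?L \<otimes> {{0}})) T X (pull (vmap fst) ?y0)" "smap (nerve ?B) T X (pull (vmap fst) ?y1)"
      by (rule smap_pull_vmap[OF y(1) cmap_fst], rule smap_pull_vmap[OF y(2) cmap_fst])
    have kd: "agree (nerve (?K \<otimes> {{0}})) (adj X \<phi>) (pull (vmap fst) ?y0)" "agree (nerve (?K \<otimes> {{1}})) (adj X \<phi>) (pull (vmap fst) ?y1)"
      using agree_trans[OF agree_fst_at agree_pull_vmap[OF ends(1) cmap_fst]] agree_trans[OF agree_fst_at agree_pull_vmap[OF ends(2) cmap_fst]] .
    have i0: "?K \<otimes> II \<inter> ?L \<otimes> {{0}} \<subseteq> ?K \<otimes> {{0}}" by (auto simp: cprod_def)
    have i1: "?A \<inter> ?B \<subseteq> ?K \<otimes> {{1}}"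
    proof
      fix \<rho> assume r: "\<rho> \<in> ?A \<inter> ?B"
      then have s: "snd ` \<rho> = {1}" by (simp add: cprod_def)
      then have "\<rho> \<notin> ?L \<otimes> {{0}}" by (simp add: cprod_def)
      then have "\<rho> \<in> ?K \<otimes> II" using r by blast
      then show "\<rho> \<in> ?K \<otimes> {{1}}" using s by (simp add: cprod_def)
    qed
    \<comment> \<open>The data are glued in two steps: the cylinder on the horn with the end
      \<open>0\<close>, then the end \<open>1\<close>. As the ends are disjoint, the second overlap
      lies over the horn.\<close>
    let ?g = "glue (?K \<otimes> II) (adj X \<phi>) (pull (vmap fst) ?y0)"
    let ?h = "glue ?A ?g (pull (vmap fst) ?y1)"
    note agg = agree_mono[OF kd(1) i0]
    have dc: "down_closed (?K \<otimes> II)" "down_closed (?L \<otimes> {{0}})" "down_closed ?A" "down_closed ?B"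
      using KL by (simp_all add: complexD(2) complex_cprod complex_Un)
    have g: "smap (nerve ?A) T X ?g" by (rule smap_glue[OF dc(1,2) a b(1) agg])
    note ga = glue_agree(1)[of "?K \<otimes> II" "adj X \<phi>" "pull (vmap fst) ?y0"] and gb = glue_agree(2)[OF agg]
    have "agree (nerve (?K \<otimes> {{1}})) ?g (pull (vmap fst) ?y1)"
      by (rule agree_trans[OF agree_mono[OF ga cprod_mono[OF subset_refl]] kd(2)]) (use I in auto)
    then have agh: "agree (nerve (?A \<inter> ?B)) ?g (pull (vmap fst) ?y1)" by (rule agree_mono[OF _ i1])
    have h: "smap (nerve (?A \<union> ?B)) T X ?h" by (rule smap_glue[OF dc(3,4) g b(2) agh])
    note ha = glue_agree(1)[of ?A ?g "pull (vmap fst) ?y1"] and hb = glue_agree(2)[OF agh]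
    obtain T' c G where G: "cover c T' T" "smap (nerve (?L \<otimes> II)) T' X G" "agree (nerve (?A \<union> ?B)) G (?h \<star> c)"
      using ext T h unfolding lext_def by blast
    note c = coverD[OF G(1)]
    have GA: "agree (nerve ?A) G (?g \<star> c)" using agree_trans[OF agree_mono[OF G(3)] agree_stage[OF ha]] by blast
    have GK: "agree (nerve (?K \<otimes> II)) G (adj X \<phi> \<star> c)" using agree_trans[OF agree_mono[OF GA] agree_stage[OF ga]] by blast
    have G0: "agree (nerve (?L \<otimes> {{0}})) G (pull (vmap fst) ?y0 \<star> c)" using agree_trans[OF agree_mono[OF GA] agree_stage[OF gb]] by blast
    have G1: "agree (nerve ?B) G (pull (vmap fst) ?y1 \<star> c)" using agree_trans[OF agree_mono[OF G(3)] agree_stage[OF hb]] by blast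
    note \<chi> = coadj[OF XO complexD(2)[OF KL(2)] G(2) c(5)]
    let ?\<chi> = "coadj T' X G"
    have "agree (nerve ?K) ?\<chi> (\<phi> \<star> c)"
    proof (rule adj_inject[OF XO complexD(2)[OF KL(1)] smap_mono[OF \<chi>(1) KL(3)] smap_stage[OF PO \<phi> c(1)]])
      have "agree (nerve (?K \<otimes> II)) (adj X ?\<chi>) (adj X \<phi> \<star> c)"
        using agree_trans[OF agree_mono[OF \<chi>(2) cprod_mono[OF KL(3) subset_refl]] GK] .
      then show "agree (nerve (?K \<otimes> II)) (adj X ?\<chi>) (adj X (\<phi> \<star> c))"
        by (rule agree_trans[OF _ agree_sym[OF adj_stage[OF XO \<phi> c(1)]]])
    qed
    moreover have "agree (nerve ?L) (r \<odot> ?\<chi>) (\<psi> \<star> c)"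
    proof (rule level_pullback_agree[OF l(1)])
      have end': "agree (nerve ?L) (path_ev d X \<odot> ?\<chi>) (y \<star> c)"
        if "agree (nerve (?L \<otimes> {{d}})) G (pull (vmap fst) y \<star> c)" "{d} \<in> II" for d y
      proof -
        have "agree (nerve ?L) (pull (vmap (at d)) G) (pull (vmap (at d)) (pull (vmap fst) y) \<star> c)"
          using agree_pull_vmap[OF that(1) cmap_at_sing[OF KL(2)]] unfolding pull_stage .
        then have "agree (nerve ?L) (pull (vmap (at d)) G) (y \<star> c)" by (rule agree_trans[OF _ agree_stage[OF agree_at_fst]])
        then show ?thesis
          by (rule agree_trans[OF path_ev_adj agree_trans[OF agree_pull_vmap[OF \<chi>(2) cmap_at[OF KL(2) that(2)]]]])
      qed
      show "smap (nerve ?L) T' (sdom p1) (r \<odot> ?\<chi>)" using smap_push[OF r(1)] \<chi>(1) r(2,3) by simp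
      show "smap (nerve ?L) T' (sdom p1) (\<psi> \<star> c)" by (rule smap_stage[OF smorD(1)[OF D(3)] \<psi> c(1)])
      show "agree (nerve ?L) (p1 \<odot> r \<odot> ?\<chi>) (p1 \<odot> (\<psi> \<star> c))"
        using agree_transs[OF ev(1)[OF \<chi>(1)] agree_trans[OF end'[OF G0 I(1)] push_stage[OF D(3) \<psi> c(1)]]] .
      show "agree (nerve ?L) (p2 \<odot> r \<odot> ?\<chi>) (p2 \<odot> (\<psi> \<star> c))"
        using agree_transs[OF ev(2)[OF \<chi>(1)] agree_trans[OF end'[OF G1 I(2)] push_stage[OF D(4) \<psi>[folded D(5)] c(1)]]] .
    qed
    ultimately show "\<exists>T' c \<chi>. cover c T' T \<and> smap (nerve ?L) T' (sdom r) \<chi> \<and> agree (nerve ?K) \<chi> (\<phi> \<star> c) \<and> agree (nerve ?L) (r \<odot> \<chi>) (\<psi> \<star> c)"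
      using G(1) \<chi>(1) r(2) by auto
  qed
qed

lemma diagonal_factorization:
  assumes B: "kan B" and Q: "is_product (Kan C) {0, 1 :: nat} (\<lambda>_. B) Q \<pi>"
    and d: "d \<in> hom (Kan C) B Q" "\<pi> 0 \<cdot>\<^bsub>sO\<^esub> d = Ident sO B" "\<pi> 1 \<cdot>\<^bsub>sO\<^esub> d = Ident sO B"
  shows "\<exists>w p. DI_weak_equivalence C w \<and> horn_lifting p \<and> p \<in> Arr (Kan C) \<and> scod w = sdom p \<and> d = p \<cdot>\<^bsub>sO\<^esub> w"
proof -
  interpret K: category "Kan C" by (rule category_Kan)
  interpret S: category sO by (rule category_sO)
  note BO = kan_sobj[OF B]
  obtain E where E: "level_terminal E" using level_terminal_ex by blast
  note KE = level_terminal_Kan[OF E]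
  obtain t where "t \<in> hom (Kan C) B E" using KE(2) B unfolding is_terminal_def by auto
  then have t: "simplicial_morphism C t" "sdom t = B" "scod t = E" by (auto simp: hom_Kan)
  have th: "horn_lifting t" by (rule horn_lifting_to_terminal) (use t E B in simp_all)
  obtain p1 p2 where l: "level_pullback t t p1 p2" using level_pullback_ex[OF t(1) t(1)] by blast
  note D = level_pullbackD[OF l]
  have pbK: "is_pullback (Kan C) t t p1 p2" by (rule level_pullback_Kan[OF l th]) (use t B KE in simp_all)
  have kQ0: "kan (sdom p1)" using K.pullbackD(3)[OF pbK] by simp
  \<comment> \<open>The product \<open>Q\<close> is an arbitrary one, so the endpoint morphism is
    built over the levelwise pullback and moved to \<open>Q\<close> by the isomorphism
    \<open>u\<close>.\<close>
  obtain u where u: "is_iso (Kan C) u" "u \<in> hom (Kan C) (Dom (Kan C) p1) Q" "\<pi> 0 \<cdot>\<^bsub>Kan C\<^esub> u = p1" "\<pi> 1 \<cdot>\<^bsub>Kan C\<^esub> u = p2"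
    by (rule K.product_iso_pullback[OF KE(2) _ pbK]) (use t Q in simp_all)
  note ev0 = path_ev[OF BO, of 0, simplified] and ev1 = path_ev[OF BO, of 1, simplified]
  obtain s where s: "simplicial_morphism C s" "sdom s = B" "scod s = path_object B" "\<And>e. e \<le> 1 \<Longrightarrow> path_ev e B \<cdot>\<^bsub>sO\<^esub> s = Ident sO B"
    using path_const[OF BO] by metis
  have "t \<cdot>\<^bsub>sO\<^esub> path_ev 0 B = t \<cdot>\<^bsub>sO\<^esub> path_ev 1 B"
  proof -
    have "\<exists>!h. h \<in> hom sO (path_object B) E"
      using level_terminal_sO[OF E] simplicial_object_path[OF BO] by (simp add: is_terminal_def)
    moreover have "t \<cdot>\<^bsub>sO\<^esub> path_ev 0 B \<in> hom sO (path_object B) E" "t \<cdot>\<^bsub>sO\<^esub> path_ev 1 B \<in> hom sO (path_object B) E"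
      using simplicial_morphism_comp[OF path_ev[OF BO, of 0] t(1)] simplicial_morphism_comp[OF path_ev[OF BO, of 1] t(1)] t by (simp_all add: hom_def)
    ultimately show ?thesis by blast
  qed
  then obtain r where r: "simplicial_morphism C r" "sdom r = path_object B" "scod r = sdom p1" "p1 \<cdot>\<^bsub>sO\<^esub> r = path_ev 0 B" "p2 \<cdot>\<^bsub>sO\<^esub> r = path_ev 1 B"
    using S.pullback_lift[OF level_pullback_sO[OF l], of "path_ev 0 B" "path_ev 1 B"] path_ev[OF BO, of 0] path_ev[OF BO, of 1] t by auto
  have rh: "horn_lifting r" by (rule path_pair_horn_lifting[OF B l t(2) r])
  \<comment> \<open>The path object is Kan because its endpoint morphism \<open>r\<close> is a
    fibration over the Kan complex \<open>sdom p1\<close>.\<close>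
  have kP: "kan (path_object B)" using kan_of_fibration[OF rh] kQ0 r(2,3) by simp
  have ev0_DI: "DI_weak_equivalence C (path_ev 0 B)"
    unfolding DI_weak_equivalence_iff using path_ev[OF BO, of 0] kP B llift_rhl[OF _ path_ev_llift[OF B _ _ bd_faces] bd_faces] by simp
  have id_DI: "DI_weak_equivalence C (Ident sO B)"
    using iso_DI[OF K.ident_iso[of B]] B by simp
  \<comment> \<open>The morphism \<open>s\<close> is a section of the equivalence
    \<open>path_ev 0 B\<close>, and the identity is an equivalence, so two-out-of-three
    applies.\<close>
  have s_DI: "DI_weak_equivalence C s"
  proof -
    have A: "s \<in> Arr (Kan C)" "path_ev 0 B \<in> Arr (Kan C)" using s kP B path_ev[OF BO, of 0] by simp_all
    have "path_ev 0 B \<cdot>\<^bsub>Kan C\<^esub> s = Ident sO B" using s(4)[of 0] by simp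
    then show ?thesis using two_out_of_three_Kan[unfolded two_out_of_three_def, rule_format, OF A] s(3) ev0_DI id_DI by simp
  qed
  let ?p = "u \<cdot>\<^bsub>sO\<^esub> r"
  have uh: "simplicial_morphism C u" "sdom u = sdom p1" "scod u = Q" "kan Q" using u(2) by (auto simp: hom_Kan)
  have ui: "is_iso sO u" using iso_Kan[OF u(1)] by blast
  have ph: "horn_lifting ?p" by (rule horn_lifting_comp[OF rh iso_horn_lifting[OF ui]]) (use r uh in simp)
  have pA: "?p \<in> Arr (Kan C)" using horn_lifting_morphism[OF ph] r uh kP by simp
  have "d = ?p \<cdot>\<^bsub>sO\<^esub> s"
  proof -
    have dK: "?p \<cdot>\<^bsub>sO\<^esub> s \<in> hom (Kan C) B Q"
      using simplicial_morphism_comp[OF s(1) horn_lifting_morphism[OF ph]] s r uh B by (simp add: hom_Kan)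
    have pi: "\<pi> 0 \<in> hom (Kan C) Q B" "\<pi> 1 \<in> hom (Kan C) Q B" using Q by (auto simp: is_product_def)
    have assoc4: "q \<cdot>\<^bsub>sO\<^esub> (?p \<cdot>\<^bsub>sO\<^esub> s) = ((q \<cdot>\<^bsub>sO\<^esub> u) \<cdot>\<^bsub>sO\<^esub> r) \<cdot>\<^bsub>sO\<^esub> s" if "q \<in> hom (Kan C) Q B" for q
    proof -
      have q: "simplicial_morphism C q" "sdom q = Q" using that by (auto simp: hom_Kan)
      show ?thesis using S.comp_assoc[of s ?p q] S.comp_assoc[of r u q] q uh r s horn_lifting_morphism[OF ph] by simp
    qed
    have "\<pi> 0 \<cdot>\<^bsub>sO\<^esub> (?p \<cdot>\<^bsub>sO\<^esub> s) = Ident sO B" "\<pi> 1 \<cdot>\<^bsub>sO\<^esub> (?p \<cdot>\<^bsub>sO\<^esub> s) = Ident sO B"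
      unfolding assoc4[OF pi(1)] assoc4[OF pi(2)] using u(3,4) r(4,5) s(4)[of 0] s(4)[of 1] by simp_all
    moreover have "\<exists>!h. h \<in> hom (Kan C) B Q \<and> (\<forall>i \<in> {0, 1 :: nat}. \<pi> i \<cdot>\<^bsub>Kan C\<^esub> h = Ident sO B)"
    proof -
      have "Ident sO B \<in> hom (Kan C) B B" using K.Ident_in[of B] B by simp
      then show ?thesis using Q B unfolding is_product_def by (elim conjE) (erule ballE[of _ _ B], erule allE[of _ "\<lambda>_. Ident sO B"], auto)
    qed
    ultimately show ?thesis using d dK by auto
  qed
  moreover have "scod s = sdom ?p" using s(3) r(2) by simp
  ultimately show ?thesis using s_DI ph pA by blast
qed

section \<open>Brown's axioms for the category of internal Kan complexes\<close>

lemma category_of_fibrant_objects_Kan: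
  "category_of_fibrant_objects (Kan C) {f. DI_weak_equivalence C f} {p \<in> Arr (Kan C). internal_Kan_fibration C p}"
proof -
  interpret K: category "Kan C" by (rule category_Kan)
  obtain E where E: "level_terminal E" using level_terminal_ex by blast
  show ?thesis
    unfolding internal_Kan_fibration_iff
  proof
    show "has_finite_products (Kan C)"
    proof (rule K.finite_productsI[OF level_terminal_Kan(2)[OF E]])
      fix f g assume h: "f \<in> Arr (Kan C)" "g \<in> Arr (Kan C)" "Cod (Kan C) f = E" "Cod (Kan C) g = E"
      \<comment> \<open>A morphism from a Kan complex to a levelwise terminal object is a fibration,
        so the pullbacks from which finite products are built exist.\<close>
      have "horn_lifting f" by (rule horn_lifting_to_terminal) (use h E in simp_all)
      then show "\<exists>p q. is_pullback (Kan C) f g p q" using Kan_pullback_exists h by simp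
    qed
    show "{f. DI_weak_equivalence C f} \<subseteq> Arr (Kan C)" by (auto simp: DI_weak_equivalence_iff)
    show "{p \<in> Arr (Kan C). horn_lifting p} \<subseteq> Arr (Kan C)" by blast
    show "f \<in> {f. DI_weak_equivalence C f}" if "is_iso (Kan C) f" for f using iso_DI[OF that] by simp
    show "two_out_of_three (Kan C) {f. DI_weak_equivalence C f}" by (rule two_out_of_three_Kan)
    show "f \<in> {p \<in> Arr (Kan C). horn_lifting p}" if "is_iso (Kan C) f" for f
      using iso_Kan[OF that] iso_horn_lifting by blast
    show "g \<cdot>\<^bsub>Kan C\<^esub> f \<in> {p \<in> Arr (Kan C). horn_lifting p}"
      if "f \<in> {p \<in> Arr (Kan C). horn_lifting p}" "g \<in> {p \<in> Arr (Kan C). horn_lifting p}" "Cod (Kan C) f = Dom (Kan C) g" for f g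
      using that horn_lifting_comp[of f g] horn_lifting_morphism[of "g \<cdot>\<^bsub>sO\<^esub> f"] by simp
    show "\<exists>p q. is_pullback (Kan C) f g p q"
      if "f \<in> {p \<in> Arr (Kan C). horn_lifting p}" "g \<in> Arr (Kan C)" "Cod (Kan C) g = Cod (Kan C) f" for f g
      using that Kan_pullback_exists[of f g] by simp
    show F: "q \<in> {p \<in> Arr (Kan C). horn_lifting p}"
      if "f \<in> {p \<in> Arr (Kan C). horn_lifting p}" "is_pullback (Kan C) f g p q" for f g p q
      using that Kan_pullback_fibration K.pullbackD(4) by blast
    show "q \<in> {p \<in> Arr (Kan C). horn_lifting p} \<inter> {f. DI_weak_equivalence C f}"
      if f: "f \<in> {p \<in> Arr (Kan C). horn_lifting p} \<inter> {f. DI_weak_equivalence C f}" and pb: "is_pullback (Kan C) f g p q" for f g p q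
    proof -
      have q: "q \<in> Arr (Kan C)" "horn_lifting q" using F[OF _ pb] f by auto
      have fh: "horn_lifting f" "f \<in> Arr (Kan C)" using f by auto
      \<comment> \<open>The homotopy lifting property itself is not pulled back. It is first
        strictified: a fibration that is an equivalence lifts strictly against boundaries, and
        strict lifting passes to pullbacks.\<close>
      have "llift f (bd {..n}) (faces {..n})" for n :: nat
        using trivial_iff_DI[OF fh(2)] fh(1) f unfolding internal_Kan_fibration_iff internal_trivial_Kan_fibration_iff by blast
      then have "llift q (bd {..n}) (faces {..n})" for n :: nat
        by (rule Kan_pullback_llift[OF pb fh(1)]) (simp_all add: bd_faces)
      then have "DI_weak_equivalence C q"
        using trivial_iff_DI[OF q(1)] q unfolding internal_Kan_fibration_iff internal_trivial_Kan_fibration_iff by simp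
      then show ?thesis using q by simp
    qed
    show "\<exists>w \<in> {f. DI_weak_equivalence C f}. \<exists>p \<in> {p \<in> Arr (Kan C). horn_lifting p}. Cod (Kan C) w = Dom (Kan C) p \<and> d = p \<cdot>\<^bsub>Kan C\<^esub> w"
      if "B \<in> Obj (Kan C)" "is_product (Kan C) {0, 1 :: nat} (\<lambda>_. B) P \<pi>" "d \<in> hom (Kan C) B P"
        "\<pi> 0 \<cdot>\<^bsub>Kan C\<^esub> d = Ident (Kan C) B" "\<pi> 1 \<cdot>\<^bsub>Kan C\<^esub> d = Ident (Kan C) B" for B P \<pi> d
      using diagonal_factorization[of B P \<pi> d] that by simp blast
    show "t \<in> {p \<in> Arr (Kan C). horn_lifting p}"
      if "B \<in> Obj (Kan C)" "is_terminal (Kan C) T" "t \<in> hom (Kan C) B T" for B T t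
      using terminal_Kan_fibration[OF that(2,3)] K.homD(1)[OF that(3)] by blast
  qed
qed

end

theorem theorem1p17:
  fixes S :: "('o, 'm) cat"
  assumes "regular_category S"
  shows "(two_out_of_three (Kan S) {f. DI_weak_equivalence S f} \<and>
      retract_closed (Kan S) {f. DI_weak_equivalence S f}) \<and>
    (\<forall>p \<in> Arr (Kan S). internal_Kan_fibration S p \<longrightarrow>
      (internal_trivial_Kan_fibration S p \<longleftrightarrow> DI_weak_equivalence S p)) \<and>
    category_of_fibrant_objects (Kan S) {f. DI_weak_equivalence S f}
      {p \<in> Arr (Kan S). internal_Kan_fibration S p}"
proof -
  interpret regular_category S by fact
  show ?thesis
    using two_out_of_three_Kan retract_closed_Kan trivial_iff_DI category_of_fibrant_objects_Kan by blast
qed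

end
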